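(* Let $\eta_1,\eta_2\in\mathbb R^2$ and $r_1,r_2>0$. Consider the two-player game with dynamics $dX_t=\alpha_t\,dt+dW_t$ in $\mathbb R^2$, ergodic costs $$\hat J_i(\alpha)=\lim_{T\to\infty}\frac1T\mathbb E\left[\int_0^T\left(|X_t|^2+r_i|\alpha_{i,t}|^2+(\mathbb E[\eta_i^\top X_t])^2\right)dt\right],\quad i=1,2,$$ and auxiliary costs $$J_i(\mu_0,\alpha)=\lim_{T\to\infty}\mathbb E\left[\int_0^T\left(|X_t|^2+r_i|\alpha_{i,t}|^2+(\mathbb E[\eta_i^\top X_t])^2-\hat c_i\right)dt\right],\quad i=1,2.$$ Suppose the algebraic Riccati system (R), stated in the context, admits a solution $(Q_1,Q_2,R_1,R_2,q_1,q_2,c_1,c_2)\in S_2(\mathbb R)^4\times(\mathbb R^2)^2\times\mathbb R^2$ for which there exists $\varepsilon>0$ such that $$\lambda_{\min}(\overline Q)-\frac\varepsilon2>\frac{|R|^2}\varepsilon,$$ where $\overline Q=\frac{Q+Q^\top}2$ and $$Q=\frac{e_1e_1^\top Q_1}{r_1}+\frac{e_2e_2^\top Q_2}{r_2},\qquad R=\frac{e_1e_1^\top R_1}{r_1}+\frac{e_2e_2^\top R_2}{r_2}.$$ Then: (i) the feedback control $\alpha^*$ generated by $$\bar\alpha_i^*(\mu,x)=-\frac{e_i^\top}{r_i}\left(Q_ix+R_i\,m(\mu)+\frac{q_i}2\right),\qquad i=1,2,$$ is a Nash equilibrium of the ergodic game, where $m(\mu)=\int_{\mathbb R^2}x\,\mu(dx)\in\mathbb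 R^2$; (ii) the associated ergodic constants are $$\hat c_1=-\tfrac14r_1^{-1}|e_1^\top q_1|^2+\mathrm{Tr}(Q_1)-\tfrac12r_2^{-1}q_1^\top e_2e_2^\top q_2,\qquad \hat c_2=-\tfrac14r_2^{-1}|e_2^\top q_2|^2+\mathrm{Tr}(Q_2)-\tfrac12r_1^{-1}q_2^\top e_1e_1^\top q_1;$$ (iii) the value functions $V_i$ of the auxiliary game are given by $$V_i(\mu_0)=v_i(\mu_0)-v_i(\mu_\infty^* ),\qquad v_i(\mu)=\int_{\mathbb R^2}x^\top Q_ix\,\mu(dx)+q_i^\top m(\mu)+m(\mu)^\top R_i\,m(\mu),\qquad i=1,2,$$ where $\mu_\infty^*$ is the invariant measure of the controlled state process $X_t^*$ under the feedback control $\bar\alpha^*$.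
   Context: $\mathcal P_2(\mathbb R^d)$ is the space of probability measures on $\mathbb R^d$ with finite second moment, with the 2-Wasserstein distance $\mathbb W_2$; $\mathcal L(X)$ is the law of $X$; $S_2(\mathbb R)$ is the set of symmetric $2\times2$ real matrices; $|A|$ is the operator norm; $\lambda_{\min}$ is the smallest eigenvalue; $e_1,e_2$ are the standard basis (column) vectors of $\mathbb R^2$; $I_2$ the identity. For column vectors $u,w\in\mathbb R^2$, $u\otimes w:=uw^\top$ and $u^{\otimes2}:=uu^\top$; $\overline A:=\frac12(A+A^\top)$ for $A\in\mathbb R^{2\times2}$. $W$ is a standard two-dimensional Brownian motion on a filtered probability space satisfying the usual conditions; $\alpha_t=(\alpha_{1,t},\alpha_{2,t})\in\mathbb R^2$; $\mathcal L(X_0)=\mu_0\in\mathcal P_2(\mathbb R^2)$. **Riccati system (R).** $$I_2-r_1^{-1}(Q_1e_1)^{\otimes2}-2r_2^{-1}\overline{(Q_1e_2)\otimes(Q_2e_2)}=0,$$ $$I_2-r_2^{-1}(Q_2e_2)^{\otimes2}-2r_1^{-1}\overline{(Q_2e_1)\otimes(Q_1e_1)}=0,$$ $$\eta_1^{\otimes2}-2r_1^{-1}\overline{(Q_1e_1)\otimes(R_1e_1)}-r_1^{-1}(R_1e_1)^{\otimes2}-2r_2^{-1}\overline{(Q_1e_2)\otimes(R_2e_2)}-2r_2^{-1}\overline{(Q_2e_2)\otimes(R_1e_2)}-2r_2^{-1}\overline{(R_1e_2)\otimes(R_2e_2)}=0,$$ $$\eta_2^{\otimes2}-2r_2^{-1}\overline{(Q_2e_2)\otimes(R_2e_2)}-r_2^{-1}(R_2e_2)^{\otimes2}-2r_1^{-1}\overline{(Q_2e_1)\otimes(R_1e_1)}-2r_1^{-1}\overline{(Q_1e_1)\otimes(R_2e_1)}-2r_1^{-1}\overline{(R_1e_1)\otimes(R_2e_1)}=0,$$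 $$-r_1^{-1}q_1^\top e_1^{\otimes2}(Q_1+R_1)-r_2^{-1}q_2^\top e_2^{\otimes2}(Q_1+R_1)-r_2^{-1}q_1^\top e_2^{\otimes2}(Q_2+R_2)=0,$$ $$-r_2^{-1}q_2^\top e_2^{\otimes2}(Q_2+R_2)-r_1^{-1}q_1^\top e_1^{\otimes2}(Q_2+R_2)-r_1^{-1}q_2^\top e_1^{\otimes2}(Q_1+R_1)=0,$$ $$c_1=-\tfrac14r_1^{-1}|e_1^\top q_1|^2+\mathrm{Tr}(Q_1)-\tfrac12r_2^{-1}q_1^\top e_2^{\otimes2}q_2,$$ $$c_2=-\tfrac14r_2^{-1}|e_2^\top q_2|^2+\mathrm{Tr}(Q_2)-\tfrac12r_1^{-1}q_2^\top e_1^{\otimes2}q_1.$$ **Admissible controls.** A process $\alpha$ is a stationary Markov control if there is a measurable $\bar\alpha=(\bar\alpha_1,\bar\alpha_2):\mathcal P_2(\mathbb R^2)\times\mathbb R^2\to\mathbb R^2$ such that the SDE admits a unique square integrable solution $X$ under $\alpha_t=\bar\alpha(\mathcal L(X_t),X_t)$, $t\ge0$. It is admissible if, moreover, $\mathcal L(X_t,\alpha_t)$ converges in $\mathbb W_2$ as $t\to\infty$ to some element of $\mathcal P_2(\mathbb R^4)$. $\mathcal A$ is the set of admissible controls; for $\alpha\in\mathcal A$, $\mathcal A_1(\alpha)=\{\beta\in\mathcal A:\bar\beta_2=\bar\alpha_2\}$, $\mathcal A_2(\alpha)=\{\beta\in\mathcal A:\bar\beta_1=\bar\alpha_1\}$.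 **Nash equilibrium (ergodic game).** $\alpha^*\in\mathcal A$ is a Nash equilibrium if $\hat c_i:=\hat J_i(\alpha^* )\le\hat J_i(\alpha)$ for all $\alpha\in\mathcal A_i(\alpha^* )$, $i=1,2$; $\hat c_1,\hat c_2$ are the ergodic constants. **Auxiliary game.** With these $\hat c_i$, find $\alpha^*\in\mathcal A$ with $V_i(\mu_0):=J_i(\mu_0,\alpha^* )\le J_i(\mu_0,\alpha)$ for all $\alpha\in\mathcal A_i(\alpha^* )$, $i=1,2$; $V_i$ are the value functions. *)

theory Defs
  imports "HOL-Probability.Probability"
begin

section \<open>Matrices\<close>

definition e :: "2 \<Rightarrow> real^2" where
  "e i = axis i 1"

definition outer :: "real^2 \<Rightarrow> real^2 \<Rightarrow> real^2^2" (infixl "\<odot>" 72) where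
  "u \<odot> w = (\<chi> i j. u $ i * w $ j)"

definition sym_part :: "real^2^2 \<Rightarrow> real^2^2" where
  "sym_part A = (1/2) *\<^sub>R (A + transpose A)"

text \<open>Meant for symmetric \<open>A\<close>, where the set of real eigenvalues is finite and nonempty.\<close>

definition min_eigenvalue :: "real^2^2 \<Rightarrow> real" where
  "min_eigenvalue A = Min {l. \<exists>v. v \<noteq> 0 \<and> A *v v = l *\<^sub>R v}"

abbreviation op_norm :: "real^2^2 \<Rightarrow> real" where
  "op_norm A \<equiv> onorm (\<lambda>x. A *v x)"


section \<open>Square integrable laws and the 2-Wasserstein distance\<close>

definition P2 :: "'a::euclidean_space measure set" where
  "P2 = {\<mu>. prob_space \<mu> \<and> sets \<mu> = sets borel \<and> integrable \<mu> (\<lambda>x. (norm x)\<^sup>2)}"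

definition couplings :: "'a::euclidean_space measure \<Rightarrow> 'a measure \<Rightarrow> ('a \<times> 'a) measure set" where
  "couplings \<mu> \<nu> = {\<pi>. prob_space \<pi> \<and> sets \<pi> = sets borel \<and>
     distr \<pi> borel fst = \<mu> \<and> distr \<pi> borel snd = \<nu>}"

text \<open>Only meaningful on \<open>P2\<close>, where every coupling integrates the squared distance.\<close>

definition W2 :: "'a::euclidean_space measure \<Rightarrow> 'a measure \<Rightarrow> real" where
  "W2 \<mu> \<nu> = sqrt (INF \<pi>\<in>couplings \<mu> \<nu>. \<integral>p. (dist (fst p) (snd p))\<^sup>2 \<partial>\<pi>)"

definition W2_converges :: "(real \<Rightarrow> 'a::euclidean_space measure) \<Rightarrow> 'a measure \<Rightarrow> bool" where
  "W2_converges \<mu> \<nu> \<longleftrightarrow> \<nu> \<in> P2 \<and> (\<forall>\<^sub>F t in at_top. \<mu> t \<in> P2) \<and> ((\<lambda>t. W2 (\<mu> t) \<nu>) \<longlongrightarrow> 0) at_top"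

definition mean :: "(real^2) measure \<Rightarrow> real^2" where
  "mean \<mu> = (\<integral>x. x \<partial>\<mu>)"

abbreviation law :: "'a measure \<Rightarrow> ('a \<Rightarrow> 'b::euclidean_space) \<Rightarrow> 'b measure" where
  "law M X \<equiv> distr M borel X"


section \<open>Filtered probability spaces and Brownian motion\<close>

text \<open>
  Time is the half-line \<open>{0..}\<close> inside \<open>real\<close>; values at negative times are never used.
  Of the measures \<open>F t\<close> only the underlying measurable spaces matter.
\<close>

definition filtered_prob_space :: "'a measure \<Rightarrow> (real \<Rightarrow> 'a measure) \<Rightarrow> bool" where
  "filtered_prob_space M F \<longleftrightarrow>
     prob_space M \<and> filtration (space M) F \<and> (\<forall>t. sets (F t) \<subseteq> sets M)"

definition usual_conditions :: "'a measure \<Rightarrow> (real \<Rightarrow> 'a measure) \<Rightarrow> bool" where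
  "usual_conditions M F \<longleftrightarrow>
     (\<forall>N\<in>null_sets M. \<forall>A\<subseteq>N. A \<in> sets (F 0)) \<and>
     (\<forall>t\<ge>0. sets (F t) = (\<Inter>s\<in>{t<..}. sets (F s)))"

definition brownian_motion ::
  "'a measure \<Rightarrow> (real \<Rightarrow> 'a measure) \<Rightarrow> (real \<Rightarrow> 'a \<Rightarrow> real^2) \<Rightarrow> bool" where
  "brownian_motion M F W \<longleftrightarrow>
     (AE \<omega> in M. W 0 \<omega> = 0) \<and>
     (\<forall>\<omega>\<in>space M. continuous_on {0..} (\<lambda>t. W t \<omega>)) \<and>
     (\<forall>t\<ge>0. W t \<in> borel_measurable (F t)) \<and>
     (\<forall>s t. 0 \<le> s \<and> s < t \<longrightarrow>
        prob_space.indep_set M (sets (F s))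
          {(\<lambda>\<omega>. W t \<omega> - W s \<omega>) -` B \<inter> space M | B. B \<in> sets borel} \<and>
        distributed M lborel (\<lambda>\<omega>. W t \<omega> - W s \<omega>)
          (\<lambda>x. ennreal (\<Prod>i\<in>UNIV. normal_density 0 (sqrt (t - s)) (x $ i))))"


section \<open>Feedback controls and the controlled McKean--Vlasov equation\<close>

text \<open>
  A stationary Markov control is identified with its feedback map \<open>a\<close>; only its values on
  \<open>P2 \<times> \<real>\<^sup>2\<close> matter. The noise is additive, so the equation \<open>dX = a(law X, X) dt + dW\<close> is a
  pathwise integral equation.
\<close>

type_synonym feedback = "(real^2) measure \<Rightarrow> real^2 \<Rightarrow> real^2"

definition sq_int_solution ::
  "'a measure \<Rightarrow> (real \<Rightarrow> 'a measure) \<Rightarrow> (real \<Rightarrow> 'a \<Rightarrow> real^2) \<Rightarrow> ('a \<Rightarrow> real^2) \<Rightarrow> feedback \<Rightarrow>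
   (real \<Rightarrow> 'a \<Rightarrow> real^2) \<Rightarrow> bool" where
  "sq_int_solution M F W X0 a X \<longleftrightarrow>
     (\<forall>\<omega>\<in>space M. continuous_on {0..} (\<lambda>t. X t \<omega>)) \<and>
     (\<forall>t\<ge>0. X t \<in> borel_measurable (F t)) \<and>
     (\<forall>t\<ge>0. integrable M (\<lambda>\<omega>. (norm (X t \<omega>))\<^sup>2)) \<and>
     (AE \<omega> in M. \<forall>t\<ge>0.
        set_integrable lborel {0..t} (\<lambda>s. a (law M (X s)) (X s \<omega>)) \<and>
        X t \<omega> = X0 \<omega> + (LINT s:{0..t}|lborel. a (law M (X s)) (X s \<omega>)) + W t \<omega>)"

text \<open>
  The measurable structure on \<open>P2\<close> is the one generated by the evaluations \<open>\<mu> \<mapsto> \<mu> A\<close>; it is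
  the Borel \<open>\<sigma>\<close>-algebra of \<open>W2\<close>.
\<close>

definition markov_control ::
  "'a measure \<Rightarrow> (real \<Rightarrow> 'a measure) \<Rightarrow> (real \<Rightarrow> 'a \<Rightarrow> real^2) \<Rightarrow> ('a \<Rightarrow> real^2) \<Rightarrow> feedback \<Rightarrow> bool" where
  "markov_control M F W X0 a \<longleftrightarrow>
     (\<lambda>(\<mu>, x). a \<mu> x) \<in> borel_measurable (restrict_space (prob_algebra borel) P2 \<Otimes>\<^sub>M borel) \<and>
     (\<exists>X. sq_int_solution M F W X0 a X) \<and>
     (\<forall>X Y. sq_int_solution M F W X0 a X \<longrightarrow> sq_int_solution M F W X0 a Y \<longrightarrow>
        (AE \<omega> in M. \<forall>t\<ge>0. X t \<omega> = Y t \<omega>))"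

text \<open>For a Markov control, determined up to indistinguishability.\<close>

definition state ::
  "'a measure \<Rightarrow> (real \<Rightarrow> 'a measure) \<Rightarrow> (real \<Rightarrow> 'a \<Rightarrow> real^2) \<Rightarrow> ('a \<Rightarrow> real^2) \<Rightarrow> feedback \<Rightarrow>
   real \<Rightarrow> 'a \<Rightarrow> real^2" where
  "state M F W X0 a = (SOME X. sq_int_solution M F W X0 a X)"

definition control_process ::
  "'a measure \<Rightarrow> (real \<Rightarrow> 'a measure) \<Rightarrow> (real \<Rightarrow> 'a \<Rightarrow> real^2) \<Rightarrow> ('a \<Rightarrow> real^2) \<Rightarrow> feedback \<Rightarrow>
   real \<Rightarrow> 'a \<Rightarrow> real^2" where
  "control_process M F W X0 a t \<omega> =
     a (law M (state M F W X0 a t)) (state M F W X0 a t \<omega>)"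

text \<open>\<open>\<real>\<^sup>4\<close> is represented by \<open>real^2 \<times> real^2\<close>, whose norm is the Euclidean one.\<close>

definition admissible ::
  "'a measure \<Rightarrow> (real \<Rightarrow> 'a measure) \<Rightarrow> (real \<Rightarrow> 'a \<Rightarrow> real^2) \<Rightarrow> ('a \<Rightarrow> real^2) \<Rightarrow> feedback set" where
  "admissible M F W X0 = {a. markov_control M F W X0 a \<and>
     (\<exists>\<nu>. W2_converges
        (\<lambda>t. law M (\<lambda>\<omega>. (state M F W X0 a t \<omega>, control_process M F W X0 a t \<omega>))) \<nu>)}"

text \<open>The players are the elements \<open>1\<close> and \<open>2\<close> of type \<open>2\<close> (in which \<open>2 = 0\<close>).\<close>

definition deviations ::
  "'a measure \<Rightarrow> (real \<Rightarrow> 'a measure) \<Rightarrow> (real \<Rightarrow> 'a \<Rightarrow> real^2) \<Rightarrow> ('a \<Rightarrow> real^2) \<Rightarrow> 2 \<Rightarrow> feedback \<Rightarrow>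
   feedback set" where
  "deviations M F W X0 i a = {b \<in> admissible M F W X0.
     \<forall>j. j \<noteq> i \<longrightarrow> (\<forall>\<mu>\<in>P2. \<forall>x. b \<mu> x $ j = a \<mu> x $ j)}"

text \<open>
  \<open>\<mu>\<close> is invariant for the McKean--Vlasov dynamics if starting from \<open>\<mu>\<close> the law stays \<open>\<mu>\<close>.
  As \<open>F 0\<close> need not support a variable of law \<open>\<mu>\<close>, the space is enlarged by an independent
  initial position.
\<close>

definition invariant_law ::
  "'a measure \<Rightarrow> (real \<Rightarrow> 'a measure) \<Rightarrow> (real \<Rightarrow> 'a \<Rightarrow> real^2) \<Rightarrow> feedback \<Rightarrow>
   (real^2) measure \<Rightarrow> bool" where
  "invariant_law M F W a \<mu> \<longleftrightarrow> \<mu> \<in> P2 \<and>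
     (let N = \<mu> \<Otimes>\<^sub>M M;
          sol = sq_int_solution N (\<lambda>t. borel \<Otimes>\<^sub>M F t) (\<lambda>t p. W t (snd p)) fst a
      in (\<exists>X. sol X) \<and> (\<forall>X. sol X \<longrightarrow> (\<forall>t\<ge>0. law N (X t) = \<mu>)))"


section \<open>The ergodic game and the auxiliary game\<close>

text \<open>
  The running cost is nonnegative, so its expected time integral is taken in \<open>[0, \<infinity>]\<close>.
\<close>

definition expected_cost ::
  "'a measure \<Rightarrow> (real \<Rightarrow> 'a measure) \<Rightarrow> (real \<Rightarrow> 'a \<Rightarrow> real^2) \<Rightarrow> ('a \<Rightarrow> real^2) \<Rightarrow>
   (2 \<Rightarrow> real) \<Rightarrow> (2 \<Rightarrow> real^2) \<Rightarrow> 2 \<Rightarrow> feedback \<Rightarrow> real \<Rightarrow> ereal" where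
  "expected_cost M F W X0 r \<eta> i a T = enn2ereal
     (\<integral>\<^sup>+\<omega>. (\<integral>\<^sup>+t\<in>{0..T}. ennreal
         ((norm (state M F W X0 a t \<omega>))\<^sup>2
          + r i * (control_process M F W X0 a t \<omega> $ i)\<^sup>2
          + (\<integral>\<omega>'. \<eta> i \<bullet> state M F W X0 a t \<omega>' \<partial>M)\<^sup>2) \<partial>lborel) \<partial>M)"

definition average_cost ::
  "'a measure \<Rightarrow> (real \<Rightarrow> 'a measure) \<Rightarrow> (real \<Rightarrow> 'a \<Rightarrow> real^2) \<Rightarrow> ('a \<Rightarrow> real^2) \<Rightarrow>
   (2 \<Rightarrow> real) \<Rightarrow> (2 \<Rightarrow> real^2) \<Rightarrow> 2 \<Rightarrow> feedback \<Rightarrow> real \<Rightarrow> ereal" where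
  "average_cost M F W X0 r \<eta> i a T = expected_cost M F W X0 r \<eta> i a T / ereal T"

definition ergodic_cost ::
  "'a measure \<Rightarrow> (real \<Rightarrow> 'a measure) \<Rightarrow> (real \<Rightarrow> 'a \<Rightarrow> real^2) \<Rightarrow> ('a \<Rightarrow> real^2) \<Rightarrow>
   (2 \<Rightarrow> real) \<Rightarrow> (2 \<Rightarrow> real^2) \<Rightarrow> 2 \<Rightarrow> feedback \<Rightarrow> ereal" where
  "ergodic_cost M F W X0 r \<eta> i a = Lim at_top (average_cost M F W X0 r \<eta> i a)"

text \<open>
  For finite \<open>chat i\<close>, the constant can be pulled out of the expected integral over \<open>[0, T]\<close> even
  when the expected cost is infinite, because the running cost is bounded below.
\<close>

definition compensated_cost ::
  "'a measure \<Rightarrow> (real \<Rightarrow> 'a measure) \<Rightarrow> (real \<Rightarrow> 'a \<Rightarrow> real^2) \<Rightarrow> ('a \<Rightarrow> real^2) \<Rightarrow>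
   (2 \<Rightarrow> real) \<Rightarrow> (2 \<Rightarrow> real^2) \<Rightarrow> (2 \<Rightarrow> ereal) \<Rightarrow> 2 \<Rightarrow> feedback \<Rightarrow> real \<Rightarrow> ereal" where
  "compensated_cost M F W X0 r \<eta> chat i a T =
     expected_cost M F W X0 r \<eta> i a T - chat i * ereal T"

definition auxiliary_cost ::
  "'a measure \<Rightarrow> (real \<Rightarrow> 'a measure) \<Rightarrow> (real \<Rightarrow> 'a \<Rightarrow> real^2) \<Rightarrow> ('a \<Rightarrow> real^2) \<Rightarrow>
   (2 \<Rightarrow> real) \<Rightarrow> (2 \<Rightarrow> real^2) \<Rightarrow> (2 \<Rightarrow> ereal) \<Rightarrow> 2 \<Rightarrow> feedback \<Rightarrow> ereal" where
  "auxiliary_cost M F W X0 r \<eta> chat i a = Lim at_top (compensated_cost M F W X0 r \<eta> chat i a)"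

text \<open>
  Both equilibrium notions require that the limits defining the compared costs exist
  (in \<open>[-\<infinity>, \<infinity>]\<close>), so that \<open>Lim\<close> never denotes an unspecified value; this includes the limit at
  \<open>a\<close> itself, which belongs to its own deviations.
\<close>

definition ergodic_nash_equilibrium ::
  "'a measure \<Rightarrow> (real \<Rightarrow> 'a measure) \<Rightarrow> (real \<Rightarrow> 'a \<Rightarrow> real^2) \<Rightarrow> ('a \<Rightarrow> real^2) \<Rightarrow>
   (2 \<Rightarrow> real) \<Rightarrow> (2 \<Rightarrow> real^2) \<Rightarrow> feedback \<Rightarrow> bool" where
  "ergodic_nash_equilibrium M F W X0 r \<eta> a \<longleftrightarrow>
     a \<in> admissible M F W X0 \<and>
     (\<forall>i. \<forall>b\<in>deviations M F W X0 i a.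
        (\<exists>l. (average_cost M F W X0 r \<eta> i b \<longlongrightarrow> l) at_top) \<and>
        ergodic_cost M F W X0 r \<eta> i a \<le> ergodic_cost M F W X0 r \<eta> i b)"

definition auxiliary_nash_equilibrium ::
  "'a measure \<Rightarrow> (real \<Rightarrow> 'a measure) \<Rightarrow> (real \<Rightarrow> 'a \<Rightarrow> real^2) \<Rightarrow> ('a \<Rightarrow> real^2) \<Rightarrow>
   (2 \<Rightarrow> real) \<Rightarrow> (2 \<Rightarrow> real^2) \<Rightarrow> (2 \<Rightarrow> ereal) \<Rightarrow> feedback \<Rightarrow> bool" where
  "auxiliary_nash_equilibrium M F W X0 r \<eta> chat a \<longleftrightarrow>
     a \<in> admissible M F W X0 \<and>
     (\<forall>i. \<forall>b\<in>deviations M F W X0 i a.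
        (\<exists>l. (compensated_cost M F W X0 r \<eta> chat i b \<longlongrightarrow> l) at_top) \<and>
        auxiliary_cost M F W X0 r \<eta> chat i a \<le> auxiliary_cost M F W X0 r \<eta> chat i b)"


section \<open>The algebraic Riccati system\<close>

definition ergodic_const1 ::
  "(2 \<Rightarrow> real) \<Rightarrow> (2 \<Rightarrow> real^2^2) \<Rightarrow> (2 \<Rightarrow> real^2) \<Rightarrow> real" where
  "ergodic_const1 r Q q =
     - (1/4) * inverse (r 1) * \<bar>e 1 \<bullet> q 1\<bar>\<^sup>2 + trace (Q 1)
     - (1/2) * inverse (r 2) * (q 1 \<bullet> ((e 2 \<odot> e 2) *v q 2))"

definition ergodic_const2 ::
  "(2 \<Rightarrow> real) \<Rightarrow> (2 \<Rightarrow> real^2^2) \<Rightarrow> (2 \<Rightarrow> real^2) \<Rightarrow> real" where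
  "ergodic_const2 r Q q =
     - (1/4) * inverse (r 2) * \<bar>e 2 \<bullet> q 2\<bar>\<^sup>2 + trace (Q 2)
     - (1/2) * inverse (r 1) * (q 2 \<bullet> ((e 1 \<odot> e 1) *v q 1))"

definition riccati_solution ::
  "(2 \<Rightarrow> real) \<Rightarrow> (2 \<Rightarrow> real^2) \<Rightarrow> (2 \<Rightarrow> real^2^2) \<Rightarrow> (2 \<Rightarrow> real^2^2) \<Rightarrow> (2 \<Rightarrow> real^2) \<Rightarrow>
   (2 \<Rightarrow> real) \<Rightarrow> bool" where
  "riccati_solution r \<eta> Q R q c \<longleftrightarrow>
     (\<forall>i. transpose (Q i) = Q i \<and> transpose (R i) = R i) \<and>
     mat 1 - inverse (r 1) *\<^sub>R ((Q 1 *v e 1) \<odot> (Q 1 *v e 1))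
       - (2 * inverse (r 2)) *\<^sub>R sym_part ((Q 1 *v e 2) \<odot> (Q 2 *v e 2)) = 0 \<and>
     mat 1 - inverse (r 2) *\<^sub>R ((Q 2 *v e 2) \<odot> (Q 2 *v e 2))
       - (2 * inverse (r 1)) *\<^sub>R sym_part ((Q 2 *v e 1) \<odot> (Q 1 *v e 1)) = 0 \<and>
     \<eta> 1 \<odot> \<eta> 1
       - (2 * inverse (r 1)) *\<^sub>R sym_part ((Q 1 *v e 1) \<odot> (R 1 *v e 1))
       - inverse (r 1) *\<^sub>R ((R 1 *v e 1) \<odot> (R 1 *v e 1))
       - (2 * inverse (r 2)) *\<^sub>R sym_part ((Q 1 *v e 2) \<odot> (R 2 *v e 2))
       - (2 * inverse (r 2)) *\<^sub>R sym_part ((Q 2 *v e 2) \<odot> (R 1 *v e 2))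
       - (2 * inverse (r 2)) *\<^sub>R sym_part ((R 1 *v e 2) \<odot> (R 2 *v e 2)) = 0 \<and>
     \<eta> 2 \<odot> \<eta> 2
       - (2 * inverse (r 2)) *\<^sub>R sym_part ((Q 2 *v e 2) \<odot> (R 2 *v e 2))
       - inverse (r 2) *\<^sub>R ((R 2 *v e 2) \<odot> (R 2 *v e 2))
       - (2 * inverse (r 1)) *\<^sub>R sym_part ((Q 2 *v e 1) \<odot> (R 1 *v e 1))
       - (2 * inverse (r 1)) *\<^sub>R sym_part ((Q 1 *v e 1) \<odot> (R 2 *v e 1))
       - (2 * inverse (r 1)) *\<^sub>R sym_part ((R 1 *v e 1) \<odot> (R 2 *v e 1)) = 0 \<and>
     - (inverse (r 1) *\<^sub>R (q 1 v* ((e 1 \<odot> e 1) ** (Q 1 + R 1))))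
       - inverse (r 2) *\<^sub>R (q 2 v* ((e 2 \<odot> e 2) ** (Q 1 + R 1)))
       - inverse (r 2) *\<^sub>R (q 1 v* ((e 2 \<odot> e 2) ** (Q 2 + R 2))) = 0 \<and>
     - (inverse (r 2) *\<^sub>R (q 2 v* ((e 2 \<odot> e 2) ** (Q 2 + R 2))))
       - inverse (r 1) *\<^sub>R (q 1 v* ((e 1 \<odot> e 1) ** (Q 2 + R 2)))
       - inverse (r 1) *\<^sub>R (q 2 v* ((e 1 \<odot> e 1) ** (Q 1 + R 1))) = 0 \<and>
     c 1 = ergodic_const1 r Q q \<and>
     c 2 = ergodic_const2 r Q q"

text \<open>Stacks the rows \<open>(row i of A i) / r i\<close>.\<close>

definition stacked :: "(2 \<Rightarrow> real) \<Rightarrow> (2 \<Rightarrow> real^2^2) \<Rightarrow> real^2^2" where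
  "stacked r A = inverse (r 1) *\<^sub>R ((e 1 \<odot> e 1) ** A 1) + inverse (r 2) *\<^sub>R ((e 2 \<odot> e 2) ** A 2)"

definition lq_feedback ::
  "(2 \<Rightarrow> real) \<Rightarrow> (2 \<Rightarrow> real^2^2) \<Rightarrow> (2 \<Rightarrow> real^2^2) \<Rightarrow> (2 \<Rightarrow> real^2) \<Rightarrow> feedback" where
  "lq_feedback r Q R q \<mu> x =
     (\<chi> i. - (e i \<bullet> (Q i *v x + R i *v mean \<mu> + (1/2) *\<^sub>R q i)) / r i)"

definition lq_value ::
  "(2 \<Rightarrow> real^2^2) \<Rightarrow> (2 \<Rightarrow> real^2^2) \<Rightarrow> (2 \<Rightarrow> real^2) \<Rightarrow> 2 \<Rightarrow> (real^2) measure \<Rightarrow> real" where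
  "lq_value Q R q i \<mu> =
     (\<integral>x. x \<bullet> (Q i *v x) \<partial>\<mu>) + q i \<bullet> mean \<mu> + mean \<mu> \<bullet> (R i *v mean \<mu>)"

end

theory Submission
  imports Defs
begin

text \<open>
  Write the candidate feedback as \<open>A x + B m(\<mu>) + d\<close>. The Riccati system says that the quadratic function
  \<open>v = lq_value Q R q i\<close> of the law completes the square in the running cost of player \<open>i\<close>
  (\<open>completion_of_squares\<close>). Consequently, whenever only player \<open>i\<close> deviates and the cost is finite,
  the expected cost up to time \<open>T\<close> is exactly
  \<open>v(law X0) - v(law X_T) + c T + r_i \<integral> \<Delta>\<close>, where \<open>\<Delta>\<close> is the mean squared distance
  between the control played and the candidate one (\<open>cost_identity\<close>). Only first and second moments are
  involved. Their evolution is derived from the pathwise product rule and the independence of Brownian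
  increments (\<open>ito_product\<close>), without stochastic integration.

  For an admissible deviation, state and control converge jointly in law, hence their moments and \<open>\<Delta>\<close>
  converge. Dividing by \<open>T\<close> shows that the ergodic cost is \<open>c + r_i lim \<Delta> \<ge> c\<close>, with equality for the
  candidate. In the auxiliary game the term \<open>c T\<close> is subtracted. If \<open>\<integral> \<Delta>\<close> diverges, the cost is infinite. If
  not, \<open>\<Delta>\<close> tends to \<open>0\<close>, and it has to be shown that \<open>v(law X_T)\<close> tends to the same constant as for the
  candidate. The limit law satisfies two stationary balances: its mean drift vanishes, and for every
  symmetric \<open>S\<close> the drift of \<open>E[X \<bullet> S X]\<close> compensates the trace of \<open>S\<close>. Since the control is affine under the
  limit law, the first balance fixes the mean, and the second one, with \<open>S\<close> the solution of a Lyapunov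
  equation, fixes the quadratic moment that occurs in \<open>v\<close> (\<open>optimal_limit\<close>).

  It remains to study the candidate itself. The eigenvalue condition makes both \<open>A\<close>, which drives the
  fluctuations, and \<open>A + B\<close>, which drives the mean, dissipative (\<open>eigenvalue_gap_dissipative\<close>). The
  affine McKean--Vlasov equation has an explicit solution, unique by a deterministic argument on differences
  (\<open>mkv_solution\<close>, \<open>mkv_unique\<close>). The law of its noise part is, at integer times, the law of a convergent
  sum of damped independent shocks; the sum has an invariant law (\<open>ou_limit_invariant\<close>). Coupling two
  solutions through the same noise makes their difference free of noise and exponentially small, which gives
  uniqueness of the invariant law and convergence in \<open>W2\<close> (\<open>invariant_law_unique\<close>,
  \<open>mkv_W2_converges\<close>), hence admissibility.
\<close>

section \<open>Linear differential equations in the plane\<close>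

text \<open>
  The exponential of a traceless matrix \<open>B\<close> of the plane is \<open>C t + S t B\<close>, since \<open>B\<^sup>2 = \<kappa>\<close> is scalar. The
  functions \<open>C\<close> and \<open>S\<close> are hyperbolic, linear or trigonometric according to the sign of \<open>\<kappa>\<close>.
\<close>

lemma scalar_flow_exists:
  fixes \<kappa> :: real
  shows "\<exists>C S. C 0 = 1 \<and> S 0 = (0::real) \<and>
    (\<forall>t. (C has_real_derivative \<kappa> * S t) (at t) \<and> (S has_real_derivative C t) (at t))"
proof -
  consider "\<kappa> = 0" | "\<kappa> > 0" | "\<kappa> < 0" by linarith
  then show ?thesis
  proof cases
    case 1
    then show ?thesis
      by (intro exI[of _ "\<lambda>_. 1"] exI[of _ "\<lambda>t. t"]) auto
  next
    case 2
    define a where "a = sqrt \<kappa>"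
    have a: "a > 0" "a * a = \<kappa>" using 2 by (auto simp: a_def)
    have "((\<lambda>t. cosh (a * t)) has_real_derivative \<kappa> * (sinh (a * t) / a)) (at t)" for t
      using a(1) by (auto intro!: derivative_eq_intros simp: a(2)[symmetric])
    moreover have "((\<lambda>t. sinh (a * t) / a) has_real_derivative cosh (a * t)) (at t)" for t
      using a(1) by (auto intro!: derivative_eq_intros)
    ultimately show ?thesis
      by (intro exI[of _ "\<lambda>t. cosh (a * t)"] exI[of _ "\<lambda>t. sinh (a * t) / a"]) auto
  next
    case 3
    define a where "a = sqrt (- \<kappa>)"
    have a: "a > 0" "\<kappa> = - (a * a)" using 3 by (auto simp: a_def)
    have "((\<lambda>t. cos (a * t)) has_real_derivative \<kappa> * (sin (a * t) / a)) (at t)" for t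
      using a(1) by (auto intro!: derivative_eq_intros simp: a(2))
    moreover have "((\<lambda>t. sin (a * t) / a) has_real_derivative cos (a * t)) (at t)" for t
      using a(1) by (auto intro!: derivative_eq_intros)
    ultimately show ?thesis
      by (intro exI[of _ "\<lambda>t. cos (a * t)"] exI[of _ "\<lambda>t. sin (a * t) / a"]) auto
  qed
qed

lemma bounded_bilinear_matrix_vector:
  "bounded_bilinear (\<lambda>(A::real^2^2) x. A *v x)"
proof -
  have "bounded_bilinear (\<lambda>(A::real^2^2) x. A *v x)"
    unfolding bilinear_conv_bounded_bilinear[symmetric] bilinear_def
    by (auto intro!: linearI simp: matrix_vector_mult_def vec_eq_iff sum_2 algebra_simps)
  then show ?thesis .
qed

lemma bounded_bilinear_matrix_matrix:
  "bounded_bilinear (\<lambda>(A::real^2^2) (B::real^2^2). A ** B)"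
  unfolding bilinear_conv_bounded_bilinear[symmetric] bilinear_def
  by (auto intro!: linearI simp: matrix_matrix_mult_def vec_eq_iff sum_2 algebra_simps)

text \<open>
  Up to the scalar factor \<open>exp (\<tau> t)\<close>, where \<open>2 \<tau>\<close> is the trace, the matrix can be taken traceless; the
  closed form of its exponential then solves the equation.
\<close>

lemma matrix_flow_exists:
  fixes A :: "real^2^2"
  shows "\<exists>\<Phi>. \<Phi> 0 = mat 1 \<and> (\<forall>t. \<Phi> t ** A = A ** \<Phi> t) \<and>
    (\<forall>t::real. (\<Phi> has_vector_derivative A ** \<Phi> t) (at t))"
proof -
  define \<tau> where "\<tau> = (A$1$1 + A$2$2) / 2"
  define B where "B = A - \<tau> *\<^sub>R mat 1"
  \<comment> \<open>By Cayley-Hamilton, \<open>B ** B = \<kappa> *\<^sub>R mat 1\<close>, as \<open>B\<close> has trace zero.\<close>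
  define \<kappa> where "\<kappa> = (B$1$1)^2 + B$1$2 * B$2$1"
  obtain C S where CS: "C 0 = 1" "S 0 = (0::real)"
    "\<And>t. (C has_real_derivative \<kappa> * S t) (at t)" "\<And>t. (S has_real_derivative C t) (at t)"
    using scalar_flow_exists[of \<kappa>] by blast
  define \<Phi> where "\<Phi> t = exp (\<tau> * t) *\<^sub>R (C t *\<^sub>R mat 1 + S t *\<^sub>R B)" for t
  have A: "A = \<tau> *\<^sub>R mat 1 + B" by (simp add: B_def)
  have com: "\<Phi> t ** A = A ** \<Phi> t" for t
    unfolding A \<Phi>_def
    by (simp add: matrix_matrix_mult_def vec_eq_iff forall_2 sum_2 mat_def algebra_simps)
  have eq: "A ** \<Phi> t = (\<tau> * exp (\<tau> * t)) *\<^sub>R (C t *\<^sub>R mat 1 + S t *\<^sub>R B)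
      + exp (\<tau> * t) *\<^sub>R ((\<kappa> * S t) *\<^sub>R mat 1 + C t *\<^sub>R B)" for t
  proof -
    have b: "B$2$2 = - B$1$1" by (simp add: B_def \<tau>_def mat_def field_simps)
    show ?thesis
      unfolding A \<Phi>_def
      by (simp add: matrix_matrix_mult_def vec_eq_iff forall_2 sum_2 mat_def b \<kappa>_def
          power2_eq_square algebra_simps)
  qed
  have der: "(\<Phi> has_vector_derivative A ** \<Phi> t) (at t)" for t
  proof -
    have 1: "((\<lambda>t. C t *\<^sub>R (mat 1::real^2^2) + S t *\<^sub>R B) has_vector_derivative
       ((\<kappa> * S t) *\<^sub>R mat 1 + C t *\<^sub>R B)) (at t)"
      by (rule derivative_eq_intros CS(3,4) refl | simp)+
    have 2: "((\<lambda>t. exp (\<tau> * t)) has_real_derivative \<tau> * exp (\<tau> * t)) (at t)"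
      by (rule derivative_eq_intros refl | simp)+
    show ?thesis
      unfolding eq unfolding \<Phi>_def
      using has_vector_derivative_scaleR[OF 2 1] by (simp add: add.commute)
  qed
  have "\<Phi> 0 = mat 1" by (simp add: \<Phi>_def CS)
  then show ?thesis using com der by blast
qed

text \<open>
  The matrix exponential \<open>exp (t A)\<close>, chosen by its defining properties.
\<close>

definition flow :: "real^2^2 \<Rightarrow> real \<Rightarrow> real^2^2" where
  "flow A = (SOME \<Phi>. \<Phi> 0 = mat 1 \<and> (\<forall>t. \<Phi> t ** A = A ** \<Phi> t) \<and>
    (\<forall>t. (\<Phi> has_vector_derivative A ** \<Phi> t) (at t)))"

lemma flow_0: "flow A 0 = mat 1"
  and flow_commute: "flow A t ** A = A ** flow A t"
  and flow_has_derivative: "(flow A has_vector_derivative A ** flow A t) (at t)"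
  using someI_ex[OF matrix_flow_exists[of A]] unfolding flow_def by blast+

lemma flow_vector_derivative:
  "((\<lambda>t. flow A t *v x) has_vector_derivative A *v (flow A t *v x)) (at t within S)"
proof -
  interpret bounded_bilinear "\<lambda>(A::real^2^2) x. A *v x" by (rule bounded_bilinear_matrix_vector)
  have "((\<lambda>t. flow A t *v x) has_vector_derivative (A ** flow A t) *v x) (at t)"
    using has_vector_derivative[OF flow_has_derivative[of A t] has_vector_derivative_const[of x]]
    by (simp add: zero_right)
  then show ?thesis
    by (simp add: matrix_vector_mul_assoc has_vector_derivative_at_within)
qed

lemma flow_neg_derivative:
  "((\<lambda>t. flow A (- t)) has_vector_derivative - (A ** flow A (- t))) (at t within S)"
proof -
  have "((\<lambda>t::real. - t) has_vector_derivative - 1) (at t)"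
    by (intro has_vector_derivative_minus) (auto simp: has_vector_derivative_def)
  then have "((\<lambda>t. flow A (- t)) has_vector_derivative - (A ** flow A (- t))) (at t)"
    using vector_diff_chain_at[of "\<lambda>t. - t" "-1" t "flow A" "A ** flow A (- t)"]
      flow_has_derivative[of A "- t"]
    by (auto simp: o_def)
  then show ?thesis by (rule has_vector_derivative_at_within)
qed

lemma flow_inverse: "flow A t ** flow A (- t) = mat 1" "flow A (- t) ** flow A t = mat 1"
proof -
  interpret mm: bounded_bilinear "\<lambda>(A::real^2^2) (B::real^2^2). A ** B"
    by (rule bounded_bilinear_matrix_matrix)
  have "((\<lambda>t. flow A t ** flow A (- t)) has_vector_derivative 0) (at t)" for t
  proof -
    have "((\<lambda>t. flow A t ** flow A (- t)) has_vector_derivative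
       flow A t ** (- (A ** flow A (- t))) + (A ** flow A t) ** flow A (- t)) (at t)"
      by (rule mm.has_vector_derivative[OF flow_has_derivative flow_neg_derivative])
    moreover have "flow A t ** (- (A ** flow A (- t))) + (A ** flow A t) ** flow A (- t) = 0"
      by (simp add: mm.minus_right matrix_mul_assoc flow_commute)
    ultimately show ?thesis by simp
  qed
  then obtain C where C: "\<And>t. flow A t ** flow A (- t) = C"
    using has_vector_derivative_zero_constant[of UNIV "\<lambda>t. flow A t ** flow A (- t)"] by auto
  then have c: "flow A t ** flow A (- t) = flow A 0 ** flow A (- 0)" for t
    using C[of t] C[of 0] by (simp only:)
  show 1: "flow A t ** flow A (- t) = mat 1" for t
    using c[of t] by (simp add: flow_0)
  show "flow A (- t) ** flow A t = mat 1" using 1[of "- t"] by simp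
qed

lemma continuous_on_flow: "continuous_on S (flow A)"
  by (intro continuous_at_imp_continuous_on ballI
      has_vector_derivative_continuous[OF flow_has_derivative])

lemma continuous_on_flow_mult [continuous_intros]:
  assumes "continuous_on S f" "continuous_on S g"
  shows "continuous_on S (\<lambda>s. flow A (f s) *v g s)"
  using bounded_bilinear.continuous_on[OF bounded_bilinear_matrix_vector _ assms(2)]
    continuous_on_compose2[OF continuous_on_flow[of UNIV A] assms(1)] by auto

lemma set_integrable_continuous_Icc:
  fixes f :: "real \<Rightarrow> 'b::euclidean_space"
  assumes "continuous_on {a..b} f"
  shows "set_integrable lborel {a..b} f"
  using borel_integrable_compact[OF compact_Icc assms]
  by (simp add: set_integrable_def)

lemma set_integral_singleton:
  fixes f :: "real \<Rightarrow> 'b::euclidean_space"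
  shows "(LINT s:{a}|lborel. f s) = 0"
  unfolding set_lebesgue_integral_def
proof (rule integral_eq_zero_AE)
  show "AE x in lborel. indicat_real {a} x *\<^sub>R f x = 0"
    using AE_lborel_singleton[of a] by eventually_elim (simp add: indicator_def)
qed

lemma set_integral_Icc_has_derivative:
  fixes f :: "real \<Rightarrow> 'b::euclidean_space"
  assumes f: "continuous_on {0..T} f" and t: "t \<in> {0..T}"
  shows "((\<lambda>t. LINT s:{0..t}|lborel. f s) has_vector_derivative f t) (at t within {0..T})"
proof -
  have "((\<lambda>t. integral {0..t} f) has_vector_derivative f t) (at t within {0..T})"
    by (rule integral_has_vector_derivative[OF f t])
  moreover have "(LINT s:{0..u}|lborel. f s) = integral {0..u} f" if "u \<in> {0..T}" for u
    using that by (intro set_borel_integral_eq_integral set_integrable_continuous_Icc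
        continuous_on_subset[OF f]) auto
  ultimately show ?thesis
    using t by (auto intro: has_vector_derivative_transform)
qed

lemma set_integral_Icc_FTC:
  fixes x :: "real \<Rightarrow> 'b::euclidean_space"
  assumes "0 \<le> T" "\<And>t. t \<in> {0..T} \<Longrightarrow> (x has_vector_derivative x' t) (at t within {0..T})"
    and "continuous_on {0..T} x'"
  shows "(LINT s:{0..T}|lborel. x' s) = x T - x 0"
proof -
  have "(LINT s:{0..T}|lborel. x' s) = integral {0..T} x'"
    by (intro set_borel_integral_eq_integral set_integrable_continuous_Icc assms)
  also have "\<dots> = x T - x 0"
    using fundamental_theorem_of_calculus[OF assms(1,2)] by (auto intro: integral_unique)
  finally show ?thesis .
qed

text \<open>
  The function \<open>flow A (- s) *v u s\<close> has derivative zero and vanishes at time \<open>0\<close>.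
\<close>

lemma linear_volterra_unique:
  fixes u :: "real \<Rightarrow> real^2"
  assumes cont: "continuous_on {0..} u"
    and eq: "\<And>t. 0 \<le> t \<Longrightarrow> u t = (LINT s:{0..t}|lborel. A *v u s)" and t: "0 \<le> t"
  shows "u t = 0"
proof -
  interpret mv: bounded_bilinear "\<lambda>(A::real^2^2) x. A *v x" by (rule bounded_bilinear_matrix_vector)
  have c: "continuous_on {0..t} u" using cont by (rule continuous_on_subset) auto
  have c2: "continuous_on {0..t} (\<lambda>s. A *v u s)"
    by (intro mv.continuous_on continuous_on_const c)
  have du: "(u has_vector_derivative A *v u s) (at s within {0..t})" if "s \<in> {0..t}" for s
    using set_integral_Icc_has_derivative[OF c2 that]
    by (rule has_vector_derivative_transform[OF that, rotated]) (use eq in auto)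
  have "((\<lambda>s. flow A (- s) *v u s) has_vector_derivative 0) (at s within {0..t})"
    if "s \<in> {0..t}" for s
  proof -
    have "((\<lambda>s. flow A (- s) *v u s) has_vector_derivative
       flow A (- s) *v (A *v u s) + (- (A ** flow A (- s))) *v u s) (at s within {0..t})"
      by (rule mv.has_vector_derivative[OF flow_neg_derivative du[OF that]])
    moreover have "flow A (- s) *v (A *v u s) + (- (A ** flow A (- s))) *v u s = 0"
      by (simp add: mv.minus_left matrix_vector_mul_assoc flow_commute)
    ultimately show ?thesis by simp
  qed
  from has_vector_derivative_zero_constant[OF convex_real_interval(5) this]
  obtain c where c: "\<And>s. s \<in> {0..t} \<Longrightarrow> flow A (- s) *v u s = c" by blast
  have "flow A (- t) *v u t = flow A (- 0) *v u 0" using c[of t] c[of 0] t by simp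
  also have "u 0 = 0" using eq[of 0] by (simp add: set_integral_singleton)
  finally have "flow A t *v (flow A (- t) *v u t) = 0" by simp
  then show ?thesis by (simp add: matrix_vector_mul_assoc flow_inverse)
qed

text \<open>
  Variation of constants, integrated by parts so that the forcing \<open>g\<close> enters itself instead of its
  derivative. Brownian paths can then be used as forcing, one path at a time.
\<close>

definition response :: "real^2^2 \<Rightarrow> (real \<Rightarrow> real^2) \<Rightarrow> real \<Rightarrow> real^2" where
  "response A g t = g t + flow A t *v (LINT s:{0..t}|lborel. flow A (- s) *v (A *v g s))"

lemma response_solves:
  assumes g: "continuous_on {0..} g"
  shows "continuous_on {0..} (response A g)"
    and "0 \<le> t \<Longrightarrow> response A g t = g t + (LINT s:{0..t}|lborel. A *v response A g s)"
proof -
  interpret mv: bounded_bilinear "\<lambda>(A::real^2^2) x. A *v x" by (rule bounded_bilinear_matrix_vector)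
  define z where "z t = flow A t *v (LINT s:{0..t}|lborel. flow A (- s) *v (A *v g s))" for t
  have gT: "continuous_on {0..T} g" for T using g by (rule continuous_on_subset) auto
  have dz: "(z has_vector_derivative A *v response A g t) (at t within {0..T})"
    if "t \<in> {0..T}" for t T
  proof -
    have c: "continuous_on {0..T} (\<lambda>s. flow A (- s) *v (A *v g s))"
      by (intro continuous_intros mv.continuous_on gT)
    have "(z has_vector_derivative flow A t *v (flow A (- t) *v (A *v g t))
       + (A ** flow A t) *v (LINT s:{0..t}|lborel. flow A (- s) *v (A *v g s))) (at t within {0..T})"
      unfolding z_def
      by (rule mv.has_vector_derivative[OF has_vector_derivative_at_within[OF flow_has_derivative]
            set_integral_Icc_has_derivative[OF c that]])
    then show ?thesis
      by (simp add: response_def matrix_vector_mul_assoc matrix_mul_assoc flow_inverse mv.add_right)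
  qed
  have cz: "continuous_on {0..T} z" for T
    unfolding continuous_on_eq_continuous_within
    by (intro ballI has_vector_derivative_continuous[OF dz])
  have cz': "continuous_on {0..T} (response A g)" for T
    using continuous_on_add[OF gT cz] by (simp add: response_def z_def[abs_def])
  show "continuous_on {0..} (response A g)"
    unfolding continuous_on_eq_continuous_within
  proof
    fix t :: real assume t: "t \<in> {0..}"
    have "continuous (at t within {0..t+1}) (response A g)"
      using cz'[of "t+1"] t by (auto simp: continuous_on_eq_continuous_within)
    moreover have "at t within {0..t+1} = at t within {0..}"
      by (rule at_within_nhd[of _ "{..<t+1}"]) auto
    ultimately show "continuous (at t within {0..}) (response A g)" by simp
  qed
  show "response A g t = g t + (LINT s:{0..t}|lborel. A *v response A g s)" if "0 \<le> t"
  proof -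
    have "(LINT s:{0..t}|lborel. A *v response A g s) = z t - z 0"
      by (rule set_integral_Icc_FTC[OF that dz mv.continuous_on[OF continuous_on_const cz']])
    moreover have "z 0 = 0" by (simp add: z_def set_integral_singleton bounded_bilinear.zero_right[OF bounded_bilinear_matrix_vector])
    ultimately show ?thesis by (simp add: response_def z_def)
  qed
qed

text \<open>
  The squared norm along a trajectory has derivative \<open>2 (x \<bullet> A x) \<le> - 2 l |x|\<^sup>2\<close>.
\<close>

lemma flow_decay:
  assumes A: "\<And>x. x \<bullet> (A *v x) \<le> - l * (norm x)\<^sup>2" and t: "0 \<le> t"
  shows "norm (flow A t *v x) \<le> exp (- l * t) * norm x"
proof -
  define h where "h t = exp (2 * l * t) * ((flow A t *v x) \<bullet> (flow A t *v x))" for t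
  define h' where "h' t = exp (2 * l * t) * (2 * l * (norm (flow A t *v x))\<^sup>2
      + 2 * ((flow A t *v x) \<bullet> (A *v (flow A t *v x))))" for t
  have "(h has_real_derivative h' t) (at t)" for t
  proof -
    have 1: "((\<lambda>t. (flow A t *v x) \<bullet> (flow A t *v x)) has_real_derivative
       2 * ((flow A t *v x) \<bullet> (A *v (flow A t *v x)))) (at t)"
      using bounded_bilinear.has_vector_derivative[OF bounded_bilinear_inner
          flow_vector_derivative[of A x t UNIV] flow_vector_derivative[of A x t UNIV]]
      by (simp add: has_real_derivative_iff_has_vector_derivative inner_commute)
    have 2: "((\<lambda>t. exp (2 * l * t)) has_real_derivative 2 * l * exp (2 * l * t)) (at t)"
      by (rule derivative_eq_intros refl | simp)+
    show ?thesis unfolding h_def[abs_def] h'_def using DERIV_mult[OF 2 1]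
      by (simp add: power2_norm_eq_inner algebra_simps)
  qed
  moreover have "h' t \<le> 0" for t
    using A[of "flow A t *v x"] by (auto simp: h'_def mult_nonneg_nonpos)
  ultimately have "h t \<le> h 0"
    using DERIV_nonpos_imp_nonincreasing[OF t, of h] by blast
  then have "exp (2 * l * t) * (norm (flow A t *v x))\<^sup>2 \<le> (norm x)\<^sup>2"
    by (simp add: h_def flow_0 power2_norm_eq_inner)
  then have "(exp (l * t) * norm (flow A t *v x))\<^sup>2 \<le> (norm x)\<^sup>2"
    using exp_double[of "l * t"] by (simp add: power_mult_distrib mult.assoc)
  then have "exp (l * t) * norm (flow A t *v x) \<le> norm x"
    by (rule power2_le_imp_le) simp
  then show ?thesis by (simp add: exp_minus field_simps)
qed

text \<open>
  The explicit Euler scheme with step \<open>h\<close> for the linear equation with additive forcing \<open>w\<close>.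
\<close>

primrec euler :: "real^2^2 \<Rightarrow> real \<Rightarrow> (real \<Rightarrow> real^2) \<Rightarrow> real^2 \<Rightarrow> nat \<Rightarrow> real^2" where
  "euler A h w x 0 = x"
| "euler A h w x (Suc k) = euler A h w x k + h *\<^sub>R (A *v euler A h w x k)
     + (w (real (Suc k) * h) - w (real k * h))"

lemma euler_error:
  fixes x w :: "real \<Rightarrow> real^2"
  assumes cont: "continuous_on {0..} x"
    and eq: "\<And>t. 0 \<le> t \<Longrightarrow> x t = x0 + (LINT s:{0..t}|lborel. A *v x s) + w t" and w0: "w 0 = 0"
    and K: "0 \<le> K" "\<And>v. norm (A *v v) \<le> norm v * K" and h: "0 \<le> h"
    and osc: "\<And>s s'. s \<in> {0..t} \<Longrightarrow> s' \<in> {0..t} \<Longrightarrow> \<bar>s' - s\<bar> \<le> h \<Longrightarrow> norm (x s' - x s) \<le> o'"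
    and k: "real k * h \<le> t" and o: "0 \<le> o'"
  shows "norm (euler A h w x0 k - x (real k * h)) \<le> real k * h * K * o' * exp (real k * h * K)"
  using k
proof (induction k)
  case 0
  have "x 0 = x0" using eq[of 0] w0 by (simp add: set_integral_singleton)
  then show ?case by simp
next
  case (Suc k)
  define a b where "a = real k * h" and "b = real (Suc k) * h"
  have ab: "0 \<le> a" "a \<le> b" "b - a = h" "b \<le> t"
    using h Suc.prems by (auto simp: a_def b_def algebra_simps)
  have cA: "continuous_on {c..d} (\<lambda>s. A *v x s)" if "0 \<le> c" for c d
    using that by (intro bounded_bilinear.continuous_on[OF bounded_bilinear_matrix_vector continuous_on_const]
        continuous_on_subset[OF cont]) auto
  have HK: "(LINT s:{0..t}|lborel. A *v x s) = integral {0..t} (\<lambda>s. A *v x s)" for t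
    by (intro set_borel_integral_eq_integral set_integrable_continuous_Icc cA) simp
  have xba: "x b - x a = integral {a..b} (\<lambda>s. A *v x s) + (w b - w a)"
    using eq[of a] eq[of b] ab Henstock_Kurzweil_Integration.integral_combine[OF ab(1,2) integrable_continuous_real[OF cA]]
    by (simp add: HK algebra_simps)
  have "h *\<^sub>R (A *v x a) = integral {a..b} (\<lambda>s. A *v x a)"
    using ab by simp
  moreover have "integral {a..b} (\<lambda>s. A *v x a) - integral {a..b} (\<lambda>s. A *v x s)
      = integral {a..b} (\<lambda>s. A *v (x a - x s))"
    using ab by (subst Henstock_Kurzweil_Integration.integral_diff[symmetric])
      (auto intro!: integrable_continuous_real cA simp: matrix_vector_mult_diff_distrib)
  ultimately have J: "h *\<^sub>R (A *v x a) = integral {a..b} (\<lambda>s. A *v x s) + integral {a..b} (\<lambda>s. A *v (x a - x s))"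
    by (simp only: diff_eq_eq add.commute)
  define I L where "I = integral {a..b} (\<lambda>s. A *v x s)" and "L = integral {a..b} (\<lambda>s. A *v (x a - x s))"
  have "euler A h w x0 (Suc k) - x b = (euler A h w x0 k - x a)
      + h *\<^sub>R (A *v (euler A h w x0 k - x a)) + L"
    using J xba unfolding I_def[symmetric] L_def[symmetric] euler.simps a_def[symmetric] b_def[symmetric]
    by (simp add: matrix_vector_mult_diff_distrib algebra_simps del: of_nat_Suc)
  then have e: "euler A h w x0 (Suc k) - x b = (euler A h w x0 k - x a)
      + h *\<^sub>R (A *v (euler A h w x0 k - x a)) + integral {a..b} (\<lambda>s. A *v (x a - x s))"
    by (simp add: L_def)
  have i: "norm (integral {a..b} (\<lambda>s. A *v (x a - x s))) \<le> (o' * K) * (b - a)"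
  proof (rule integral_bound[OF ab(2)])
    show "continuous_on {a..b} (\<lambda>s. A *v (x a - x s))"
      using ab by (intro bounded_bilinear.continuous_on[OF bounded_bilinear_matrix_vector continuous_on_const]
        continuous_on_diff continuous_on_const continuous_on_subset[OF cont]) auto
    fix s assume "s \<in> {a..b}"
    then have "norm (x a - x s) \<le> o'" using ab by (intro osc) auto
    then show "norm (A *v (x a - x s)) \<le> o' * K"
      using K(2)[of "x a - x s"] mult_right_mono[OF _ K(1)] by (meson order_trans)
  qed
  have IH: "norm (euler A h w x0 k - x a) \<le> a * K * o' * exp (a * K)"
    using Suc ab by (simp add: a_def[symmetric] b_def[symmetric])
  have "norm (euler A h w x0 (Suc k) - x b) \<le> norm (euler A h w x0 k - x a)
      + h * (norm (euler A h w x0 k - x a) * K) + o' * K * h"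
    unfolding e using i ab h K(2)[of "euler A h w x0 k - x a"]
    by (intro norm_triangle_mono) (auto intro: mult_left_mono)
  also have "\<dots> = (1 + h * K) * norm (euler A h w x0 k - x a) + o' * K * h"
    by (simp add: algebra_simps)
  also have "\<dots> \<le> exp (h * K) * (a * K * o' * exp (a * K)) + o' * K * h * exp (b * K)"
  proof (rule add_mono)
    show "(1 + h * K) * norm (euler A h w x0 k - x a) \<le> exp (h * K) * (a * K * o' * exp (a * K))"
      using IH by (intro mult_mono exp_ge_add_one_self) auto
    have "1 \<le> exp (b * K)" using ab K(1) by simp
    then show "o' * K * h \<le> o' * K * h * exp (b * K)"
      using mult_left_mono[of 1 "exp (b * K)" "o' * K * h"] h K(1) o by simp
  qed
  also have "\<dots> = b * K * o' * exp (b * K)"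
  proof -
    have "b = a + h" using ab by simp
    then show ?thesis by (simp add: exp_add algebra_simps)
  qed
  finally show ?case by (simp add: b_def)
qed

text \<open>
  The response to a Brownian path is approximated by functions of finitely many of its increments. This
  transfers to it statements about laws that only involve independent increments.
\<close>

lemma euler_converges:
  fixes x w :: "real \<Rightarrow> real^2"
  assumes cont: "continuous_on {0..} x"
    and eq: "\<And>t. 0 \<le> t \<Longrightarrow> x t = x0 + (LINT s:{0..t}|lborel. A *v x s) + w t" and w0: "w 0 = 0"
    and t: "0 \<le> t"
  shows "(\<lambda>n. euler A (t / real (Suc n)) w x0 (Suc n)) \<longlonglongrightarrow> x t"
proof -
  obtain K where K: "0 < K" "\<And>v. norm (A *v v) \<le> norm v * K"
    using bounded_linear.pos_bounded[OF matrix_vector_mul_bounded_linear[of A]] by blast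
  have "uniformly_continuous_on {0..t} x"
    by (intro compact_uniformly_continuous continuous_on_subset[OF cont]) auto
  show ?thesis
  proof (rule LIMSEQ_I)
    fix \<epsilon> :: real assume "0 < \<epsilon>"
    define c where "c = t * K * exp (t * K)"
    define o' where "o' = (\<epsilon> / 2) / (c + 1)"
    have tK: "0 \<le> c" using t K by (simp add: c_def)
    have o: "0 < o'" using \<open>0 < \<epsilon>\<close> tK by (simp add: o'_def)
    obtain d where d: "0 < d" "\<And>s s'. s \<in> {0..t} \<Longrightarrow> s' \<in> {0..t} \<Longrightarrow> dist s' s < d \<Longrightarrow> dist (x s') (x s) < o'"
      using \<open>uniformly_continuous_on {0..t} x\<close> o unfolding uniformly_continuous_on_def by meson
    obtain N :: nat where N: "t / d < N" using reals_Archimedean2 by blast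
    have "norm (euler A (t / real (Suc n)) w x0 (Suc n) - x t) < \<epsilon>" if "n \<ge> N" for n
    proof -
      have h: "t / real (Suc n) < d"
      proof -
        have "t / d < real (Suc n)" using N that by (simp add: order_less_le_trans)
        then show ?thesis using d(1) by (simp add: field_simps)
      qed
      have "norm (euler A (t / real (Suc n)) w x0 (Suc n) - x (real (Suc n) * (t / real (Suc n))))
          \<le> real (Suc n) * (t / real (Suc n)) * K * o' * exp (real (Suc n) * (t / real (Suc n)) * K)"
        using t K o d(2) h by (intro euler_error[OF cont eq w0, where t = t])
           (auto simp: dist_norm intro!: less_imp_le simp del: of_nat_Suc)
      then have "norm (euler A (t / real (Suc n)) w x0 (Suc n) - x t) \<le> c * o'"
        by (simp add: c_def mult_ac)
      also have "\<dots> \<le> (c + 1) * o'" using o by (intro mult_right_mono) auto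
      also have "\<dots> = \<epsilon> / 2" unfolding o'_def times_divide_eq_right[of "c + 1" "\<epsilon> / 2"]
        by (rule nonzero_mult_div_cancel_left) (use tK in simp)
      also have "\<dots> < \<epsilon>" using \<open>0 < \<epsilon>\<close> by simp
      finally show ?thesis .
    qed
    then show "\<exists>N. \<forall>n\<ge>N. norm (euler A (t / real (Suc n)) w x0 (Suc n) - x t) < \<epsilon>" by blast
  qed
qed

section \<open>Coercivity from the smallest eigenvalue\<close>

text \<open>
  The smaller root \<open>l\<close> of the characteristic polynomial is an eigenvalue, and \<open>S - l\<close> has nonnegative
  diagonal and zero determinant, so its quadratic form is nonnegative.
\<close>

lemma min_eigenvalue_le_quadratic_form:
  assumes sym: "transpose S = S"
  shows "min_eigenvalue S * (norm x)\<^sup>2 \<le> x \<bullet> (S *v x)"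
proof -
  define a b d where "a = S$1$1" and "b = S$1$2" and "d = S$2$2"
  have s21: "S$2$1 = b" using sym by (simp add: transpose_def vec_eq_iff b_def) 
  define D where "D = sqrt ((a - d)\<^sup>2 + 4 * b\<^sup>2)"
  define l where "l = (a + d - D) / 2"
  have D2: "D\<^sup>2 = (a - d)\<^sup>2 + 4 * b\<^sup>2" by (simp add: D_def)
  have D0: "D \<ge> 0" by (simp add: D_def)
  have l2: "(a - l) * (d - l) = b\<^sup>2"
    using D2 by (simp add: l_def field_simps power2_eq_square)
  have Dge: "\<bar>a - d\<bar> \<le> D" unfolding D_def by (rule real_le_rsqrt) simp
  have al: "a - l \<ge> 0" "d - l \<ge> 0" using Dge by (auto simp: l_def field_simps)
  let ?E = "{l. \<exists>v. v \<noteq> 0 \<and> S *v v = l *\<^sub>R v}"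
  have mem: "l \<in> ?E"
  proof (cases "b = 0 \<and> a = l")
    case True
    then show ?thesis
      by (intro CollectI exI[of _ "axis 1 1"])
        (auto simp: vec_eq_iff forall_2 matrix_vector_mult_def sum_2 axis_def s21 a_def b_def)
  next
    case False
    then show ?thesis using l2
      by (intro CollectI exI[of _ "vector [b, l - a]"])
        (auto simp: vec_eq_iff forall_2 matrix_vector_mult_def sum_2 s21 
          a_def[symmetric] b_def[symmetric] d_def[symmetric] algebra_simps power2_eq_square)
  qed
  have "?E \<subseteq> {l, (a + d + D) / 2}"
  proof
    fix k assume "k \<in> ?E"
    then obtain v where v: "v \<noteq> 0" "S *v v = k *\<^sub>R v" by blast
    have e: "a * v$1 + b * v$2 = k * v$1" "b * v$1 + d * v$2 = k * v$2"
      using v(2) by (auto simp: vec_eq_iff forall_2 matrix_vector_mult_def sum_2 s21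
          a_def[symmetric] b_def[symmetric] d_def[symmetric])
    have "((a - k) * (d - k) - b * b) * v$1 = 0" "((a - k) * (d - k) - b * b) * v$2 = 0"
      using e by algebra+
    moreover have "v$1 \<noteq> 0 \<or> v$2 \<noteq> 0" using v(1) by (auto simp: vec_eq_iff forall_2)
    ultimately have "(a - k) * (d - k) - b * b = 0" by auto
    then have "(k - l) * (k - (a + d + D) / 2) = 0"
      using D2 by (simp add: l_def field_simps power2_eq_square)
    then show "k \<in> {l, (a + d + D) / 2}" by auto
  qed
  then have "finite ?E" by (rule finite_subset) simp
  then have le: "min_eigenvalue S \<le> l" unfolding min_eigenvalue_def using mem by (rule Min_le)
  have "l * (norm x)\<^sup>2 \<le> x \<bullet> (S *v x)"
  proof -
    have "0 \<le> (a - l) * (x$1)\<^sup>2 + 2 * b * x$1 * x$2 + (d - l) * (x$2)\<^sup>2"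
    proof -
      have "\<bar>b\<bar> = sqrt (a - l) * sqrt (d - l)"
        using arg_cong[OF l2, of sqrt] by (simp add: real_sqrt_mult)
      then have "2 * \<bar>b\<bar> * \<bar>x$1\<bar> * \<bar>x$2\<bar> \<le> (sqrt (a - l) * \<bar>x$1\<bar>)\<^sup>2 + (sqrt (d - l) * \<bar>x$2\<bar>)\<^sup>2"
        using sum_squares_bound[of "sqrt (a - l) * \<bar>x$1\<bar>" "sqrt (d - l) * \<bar>x$2\<bar>"] by (simp add: mult_ac)
      moreover have "\<bar>2 * b * x$1 * x$2\<bar> = 2 * \<bar>b\<bar> * \<bar>x$1\<bar> * \<bar>x$2\<bar>" by (simp add: abs_mult)
      moreover have "(sqrt (a - l) * \<bar>x$1\<bar>)\<^sup>2 = (a - l) * (x$1)\<^sup>2" "(sqrt (d - l) * \<bar>x$2\<bar>)\<^sup>2 = (d - l) * (x$2)\<^sup>2"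
        using al by (simp_all add: power_mult_distrib)
      ultimately show ?thesis by linarith
    qed
    also have "\<dots> = x \<bullet> (S *v x) - l * (norm x)\<^sup>2"
      unfolding power2_norm_eq_inner
      by (simp add: inner_vec_def sum_2 matrix_vector_mult_def s21
          a_def[symmetric] b_def[symmetric] d_def[symmetric] algebra_simps power2_eq_square)
    finally show ?thesis by simp
  qed
  moreover have "min_eigenvalue S * (norm x)\<^sup>2 \<le> l * (norm x)\<^sup>2" using le by (intro mult_right_mono) auto
  ultimately show ?thesis by simp
qed

lemma sym_part_quadratic_form: "x \<bullet> (sym_part A *v x) = x \<bullet> (A *v x)"
  by (simp add: sym_part_def inner_vec_def sum_2 matrix_vector_mult_def transpose_def field_simps)

text \<open>
  By \<open>2 \<epsilon> |B| \<le> \<epsilon>\<^sup>2 + |B|\<^sup>2\<close>, the spectral condition puts the operator norm of \<open>B\<close> below the smallest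
  eigenvalue of the symmetric part of \<open>A\<close>. Hence \<open>A\<close> stays coercive after a perturbation by \<open>B\<close>, which is
  how the condition enters the game.
\<close>

lemma eigenvalue_gap_dissipative:
  fixes A B :: "real^2^2"
  assumes "\<exists>\<epsilon>>0. min_eigenvalue (sym_part A) - \<epsilon> / 2 > (op_norm B)\<^sup>2 / \<epsilon>"
  obtains l \<rho> where "0 \<le> \<rho>" "\<rho> < l" "\<And>x. l * (norm x)\<^sup>2 \<le> x \<bullet> (A *v x)" "\<And>x. norm (B *v x) \<le> \<rho> * norm x"
proof -
  obtain \<epsilon> where \<epsilon>: "\<epsilon> > 0" "min_eigenvalue (sym_part A) - \<epsilon> / 2 > (op_norm B)\<^sup>2 / \<epsilon>" using assms by blast
  have "op_norm B \<ge> 0" by (rule onorm_pos_le[OF matrix_vector_mul_bounded_linear])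
  moreover have "op_norm B < min_eigenvalue (sym_part A)"
  proof -
    have "2 * \<epsilon> * op_norm B \<le> \<epsilon>\<^sup>2 + (op_norm B)\<^sup>2" by (rule sum_squares_bound)
    then have "op_norm B \<le> \<epsilon> / 2 + (op_norm B)\<^sup>2 / (2 * \<epsilon>)"
      using \<epsilon>(1) by (simp add: field_simps power2_eq_square)
    also have "(op_norm B)\<^sup>2 / (2 * \<epsilon>) \<le> (op_norm B)\<^sup>2 / \<epsilon>"
      using \<epsilon>(1) by (simp add: field_simps)
    finally show ?thesis using \<epsilon>(2) by linarith
  qed
  moreover have "min_eigenvalue (sym_part A) * (norm x)\<^sup>2 \<le> x \<bullet> (A *v x)" for x
    using min_eigenvalue_le_quadratic_form[of "sym_part A" x]
    by (simp add: sym_part_quadratic_form) (simp add: sym_part_def transpose_def vec_eq_iff add.commute)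
  moreover have "norm (B *v x) \<le> op_norm B * norm x" for x
    by (rule onorm[OF matrix_vector_mul_bounded_linear])
  ultimately show ?thesis using that by blast
qed

section \<open>Laws and couplings\<close>

lemma measurable_continuous_process:
  fixes X :: "real \<Rightarrow> 'a \<Rightarrow> 'b::{metric_space, second_countable_topology}"
  assumes meas: "\<And>t. X t \<in> borel_measurable M"
    and cont: "\<And>\<omega>. \<omega> \<in> space M \<Longrightarrow> continuous_on UNIV (\<lambda>t. X t \<omega>)"
  shows "(\<lambda>(t, \<omega>). X t \<omega>) \<in> borel_measurable ((borel :: real measure) \<Otimes>\<^sub>M M)"
proof (rule borel_measurable_LIMSEQ_metric)
  fix n :: nat
  have [measurable]: "(\<lambda>p. X (real_of_int i / real (Suc n)) (snd p)) \<in> borel_measurable ((borel :: real measure) \<Otimes>\<^sub>M M)" for i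
    using meas by measurable
  have [measurable]: "(\<lambda>p. \<lfloor>fst p * real (Suc n)\<rfloor>) \<in> measurable ((borel :: real measure) \<Otimes>\<^sub>M M) (count_space UNIV)"
    by measurable
  show "(\<lambda>p. X (real_of_int \<lfloor>fst p * real (Suc n)\<rfloor> / real (Suc n)) (snd p)) \<in> borel_measurable ((borel :: real measure) \<Otimes>\<^sub>M M)"
    by (rule measurable_compose_countable) measurable
next
  fix p assume "p \<in> space ((borel :: real measure) \<Otimes>\<^sub>M M)"
  then obtain t \<omega> where p: "p = (t, \<omega>)" "\<omega> \<in> space M" by (auto simp: space_pair_measure)
  have "(\<lambda>n. real_of_int \<lfloor>t * real (Suc n)\<rfloor> / real (Suc n)) \<longlonglongrightarrow> t"
  proof (rule real_tendsto_sandwich)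
    show "\<forall>\<^sub>F n in sequentially. t - 1 / real (Suc n) \<le> real_of_int \<lfloor>t * real (Suc n)\<rfloor> / real (Suc n)"
    proof (rule always_eventually, rule allI)
      fix n
      have "t * real (Suc n) - 1 \<le> real_of_int \<lfloor>t * real (Suc n)\<rfloor>" by linarith
      then have "(t * real (Suc n) - 1) / real (Suc n) \<le> real_of_int \<lfloor>t * real (Suc n)\<rfloor> / real (Suc n)"
        by (rule divide_right_mono) simp
      then show "t - 1 / real (Suc n) \<le> real_of_int \<lfloor>t * real (Suc n)\<rfloor> / real (Suc n)"
        by (simp add: diff_divide_distrib del: of_nat_Suc)
    qed
    show "\<forall>\<^sub>F n in sequentially. real_of_int \<lfloor>t * real (Suc n)\<rfloor> / real (Suc n) \<le> t"
      by (rule always_eventually) (simp add: divide_le_eq del: of_nat_Suc)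
    show "(\<lambda>n. t - 1 / real (Suc n)) \<longlonglongrightarrow> t"
      using tendsto_diff[OF tendsto_const LIMSEQ_inverse_real_of_nat, of t] by (simp add: inverse_eq_divide)
  qed simp
  then show "(\<lambda>n. X (real_of_int \<lfloor>fst p * real (Suc n)\<rfloor> / real (Suc n)) (snd p)) \<longlonglongrightarrow> (case p of (t, \<omega>) \<Rightarrow> X t \<omega>)"
    using continuous_on_tendsto_compose[OF cont[OF p(2)]] by (simp add: p(1))
qed

text \<open>
  Indicators of closed sets are decreasing limits of Lipschitz functions of the distance to the set.
\<close>

lemma prob_measure_eqI_Lipschitz:
  fixes \<mu> \<nu> :: "'b::metric_space measure"
  assumes \<mu>: "prob_space \<mu>" "sets \<mu> = sets borel" and \<nu>: "prob_space \<nu>" "sets \<nu> = sets borel"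
    and eq: "\<And>f::'b \<Rightarrow> real. \<And>k. (\<And>x. 0 \<le> f x \<and> f x \<le> 1) \<Longrightarrow> (\<And>x y. \<bar>f x - f y\<bar> \<le> k * dist x y) \<Longrightarrow>
        f \<in> borel_measurable borel \<Longrightarrow> (\<integral>x. f x \<partial>\<mu>) = (\<integral>x. f x \<partial>\<nu>)"
  shows "\<mu> = \<nu>"
proof -
  interpret \<mu>: prob_space \<mu> by fact
  interpret \<nu>: prob_space \<nu> by fact
  have C: "emeasure \<mu> C = emeasure \<nu> C" if "closed C" for C
  proof (cases "C = {}")
    case False
    define f where "f k x = max 0 (1 - real k * infdist x C)" for k x
    have inf: "\<bar>infdist x C - infdist y C\<bar> \<le> dist x y" for x y
      using infdist_triangle[of x C y] infdist_triangle[of y C x] by (auto simp: dist_commute abs_le_iff)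
    have f1: "0 \<le> f k x \<and> f k x \<le> 1" for k x by (auto simp: f_def infdist_nonneg)
    have f2: "\<bar>f k x - f k y\<bar> \<le> real k * dist x y" for k x y
    proof -
      have "\<bar>f k x - f k y\<bar> \<le> \<bar>real k * infdist x C - real k * infdist y C\<bar>" by (auto simp: f_def)
      also have "\<dots> = real k * \<bar>infdist x C - infdist y C\<bar>"
        by (simp add: abs_mult flip: right_diff_distrib)
      also have "\<dots> \<le> real k * dist x y" by (intro mult_left_mono inf) auto
      finally show ?thesis .
    qed
    have [measurable]: "f k \<in> borel_measurable borel" for k
      unfolding f_def by (intro borel_measurable_continuous_onI continuous_intros)
    have lim: "(\<lambda>k. f k x) \<longlonglongrightarrow> indicator C x" for x
    proof (cases "x \<in> C")
      case True then show ?thesis by (simp add: f_def)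
    next
      case F: False
      have d: "infdist x C > 0"
        using infdist_pos_not_in_closed[OF that False F] .
      obtain N :: nat where N: "1 / infdist x C < N" using reals_Archimedean2 by blast
      have "f k x = 0" if "k \<ge> N" for k
      proof -
        have "1 / infdist x C < real k" using N that by (simp add: order_less_le_trans)
        then show ?thesis using d by (simp add: f_def field_simps)
      qed
      then show ?thesis using F
        by (intro tendsto_eventually) (auto simp: eventually_sequentially)
    qed
    have l: "(\<lambda>k. \<integral>x. f k x \<partial>P) \<longlonglongrightarrow> measure P C" if "prob_space P" "sets P = sets borel" for P
    proof -
      interpret P: prob_space P by (rule that(1))
      note [measurable_cong] = that(2)
      have [measurable]: "C \<in> sets borel" using \<open>closed C\<close> by simp
      have "space P = UNIV" using that(2) sets_eq_imp_space_eq by fastforce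
      moreover have "(\<lambda>k. \<integral>x. f k x \<partial>P) \<longlonglongrightarrow> (\<integral>x. indicator C x \<partial>P)"
        by (rule integral_dominated_convergence[where w = "\<lambda>_. 1"])
          (use lim f1 \<open>closed C\<close> in auto)
      ultimately show ?thesis by simp
    qed
    have "measure \<mu> C = measure \<nu> C"
      using LIMSEQ_unique[OF l[OF \<mu>]] l[OF \<nu>] eq[OF f1 f2] by simp
    then show ?thesis by (simp add: \<mu>.emeasure_eq_measure \<nu>.emeasure_eq_measure)
  qed simp
  show ?thesis
  proof (rule measure_eqI_generator_eq[where E = "Collect closed" and \<Omega> = UNIV and A = "\<lambda>_. UNIV"])
    show "sets \<mu> = sigma_sets UNIV (Collect closed)" "sets \<nu> = sigma_sets UNIV (Collect closed)"
      using \<mu>(2) \<nu>(2) by (auto simp: borel_eq_closed)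
  qed (use C in \<open>auto simp: Int_stable_def\<close>)
qed

lemma (in prob_space) prob_space_law: "X \<in> borel_measurable M \<Longrightarrow> prob_space (law M X)"
  by (rule prob_space_distr)

text \<open>
  Two stationary sequences on one space that merge almost surely have the same law. With solutions driven
  by the same noise, this gives uniqueness of invariant laws.
\<close>

lemma law_eq_of_difference_vanishing:
  fixes U V :: "nat \<Rightarrow> 'p \<Rightarrow> 'b::euclidean_space"
  assumes P: "prob_space P"
    and [measurable]: "\<And>n. U n \<in> borel_measurable P" "\<And>n. V n \<in> borel_measurable P"
    and \<mu>: "\<And>n. law P (U n) = \<mu>" and \<nu>: "\<And>n. law P (V n) = \<nu>"
    and lim: "AE \<omega> in P. (\<lambda>n. U n \<omega> - V n \<omega>) \<longlonglongrightarrow> 0"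
  shows "\<mu> = \<nu>"
proof -
  interpret P: prob_space P by (rule P)
  show ?thesis
  proof (rule prob_measure_eqI_Lipschitz)
    show "prob_space \<mu>" using P.prob_space_law[of "U 0"] unfolding \<mu> by simp
    show "prob_space \<nu>" using P.prob_space_law[of "V 0"] unfolding \<nu> by simp
    show "sets \<mu> = sets borel" using sets_distr[of P borel "U 0"] unfolding \<mu> .
    show "sets \<nu> = sets borel" using sets_distr[of P borel "V 0"] unfolding \<nu> .
  next
    fix f :: "'b \<Rightarrow> real" and k
    assume f: "\<And>x. 0 \<le> f x \<and> f x \<le> 1" "\<And>x y. \<bar>f x - f y\<bar> \<le> k * dist x y"
      and [measurable]: "f \<in> borel_measurable borel"
    have "(\<lambda>n. \<integral>\<omega>. f (U n \<omega>) - f (V n \<omega>) \<partial>P) \<longlonglongrightarrow> (\<integral>\<omega>. 0 \<partial>P)"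
    proof (rule integral_dominated_convergence[where w = "\<lambda>_. 1"])
      show "AE \<omega> in P. (\<lambda>n. f (U n \<omega>) - f (V n \<omega>)) \<longlonglongrightarrow> 0"
        using lim
      proof eventually_elim
        case (elim \<omega>)
        then have "(\<lambda>n. k * norm (U n \<omega> - V n \<omega>)) \<longlonglongrightarrow> 0"
          by (intro tendsto_mult_right_zero tendsto_norm_zero)
        then show ?case
          by (rule Lim_null_comparison[rotated]) (use f(2) in \<open>auto simp: dist_norm\<close>)
      qed
      show "AE \<omega> in P. norm (f (U n \<omega>) - f (V n \<omega>)) \<le> 1" for n
      proof (intro always_eventually allI)
        fix \<omega> show "norm (f (U n \<omega>) - f (V n \<omega>)) \<le> 1" 
          using f(1)[of "U n \<omega>"] f(1)[of "V n \<omega>"] by (simp add: abs_le_iff)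
      qed
    qed auto
    moreover have "(\<integral>\<omega>. f (U n \<omega>) - f (V n \<omega>) \<partial>P) = (\<integral>x. f x \<partial>\<mu>) - (\<integral>x. f x \<partial>\<nu>)" for n
    proof -
      have "integrable P (\<lambda>\<omega>. f (U n \<omega>))" "integrable P (\<lambda>\<omega>. f (V n \<omega>))"
        using f(1) by (auto intro!: P.integrable_const_bound[where B = 1])
      then show ?thesis
        by (simp add: integral_distr flip: \<mu>[of n] \<nu>[of n])
    qed
    ultimately show "(\<integral>x. f x \<partial>\<mu>) = (\<integral>x. f x \<partial>\<nu>)"
      by (simp add: LIMSEQ_const_iff)
  qed
qed

lemma law_limit_unique:
  fixes S :: "nat \<Rightarrow> 'p \<Rightarrow> 'b::euclidean_space" and S' :: "nat \<Rightarrow> 'q \<Rightarrow> 'b"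
  assumes P: "prob_space P" and P': "prob_space P'"
    and [measurable]: "\<And>n. S n \<in> borel_measurable P" "\<And>n. S' n \<in> borel_measurable P'"
      "T \<in> borel_measurable P" "T' \<in> borel_measurable P'"
    and eq: "\<And>n. law P (S n) = law P' (S' n)"
    and lim: "AE \<omega> in P. (\<lambda>n. S n \<omega>) \<longlonglongrightarrow> T \<omega>" and lim': "AE \<omega> in P'. (\<lambda>n. S' n \<omega>) \<longlonglongrightarrow> T' \<omega>"
  shows "law P T = law P' T'"
proof -
  interpret P: prob_space P by (rule P)
  interpret P': prob_space P' by (rule P')
  show ?thesis
  proof (rule prob_measure_eqI_Lipschitz)
    show "prob_space (law P T)" by (rule P.prob_space_law) measurable
    show "prob_space (law P' T')" by (rule P'.prob_space_law) measurable
  next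
    fix f :: "'b \<Rightarrow> real" and k
    assume f: "\<And>x. 0 \<le> f x \<and> f x \<le> 1" "\<And>x y. \<bar>f x - f y\<bar> \<le> k * dist x y"
      and [measurable]: "f \<in> borel_measurable borel"
    have fc: "(\<lambda>n. f (s n)) \<longlonglongrightarrow> f a" if "s \<longlonglongrightarrow> a" for s :: "nat \<Rightarrow> 'b" and a
    proof (rule LIM_zero_cancel, rule Lim_null_comparison)
      show "\<forall>\<^sub>F n in sequentially. norm (f (s n) - f a) \<le> k * dist (s n) a"
        using f(2) by (intro always_eventually allI) simp
      show "(\<lambda>n. k * dist (s n) a) \<longlonglongrightarrow> 0"
        by (intro tendsto_mult_right_zero iffD1[OF tendsto_dist_iff that])
    qed
    have b: "\<bar>f x\<bar> \<le> 1" for x using f(1)[of x] by simp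
    have "AE \<omega> in P. (\<lambda>n. f (S n \<omega>)) \<longlonglongrightarrow> f (T \<omega>)"
      using lim by eventually_elim (rule fc)
    then have l: "(\<lambda>n. \<integral>\<omega>. f (S n \<omega>) \<partial>P) \<longlonglongrightarrow> (\<integral>\<omega>. f (T \<omega>) \<partial>P)"
      by (intro integral_dominated_convergence[where w = "\<lambda>_. 1"]) (simp_all add: b)
    have "AE \<omega> in P'. (\<lambda>n. f (S' n \<omega>)) \<longlonglongrightarrow> f (T' \<omega>)"
      using lim' by eventually_elim (rule fc)
    then have l': "(\<lambda>n. \<integral>\<omega>. f (S' n \<omega>) \<partial>P') \<longlonglongrightarrow> (\<integral>\<omega>. f (T' \<omega>) \<partial>P')"
      by (intro integral_dominated_convergence[where w = "\<lambda>_. 1"]) (simp_all add: b)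
    have "(\<integral>\<omega>. f (S n \<omega>) \<partial>P) = (\<integral>\<omega>. f (S' n \<omega>) \<partial>P')" for n
      using arg_cong[OF eq[of n], of "\<lambda>m. \<integral>x. f x \<partial>m"] by (simp add: integral_distr)
    then have "(\<integral>\<omega>. f (T \<omega>) \<partial>P) = (\<integral>\<omega>. f (T' \<omega>) \<partial>P')"
      using LIMSEQ_unique[OF l] l' by simp
    then show "(\<integral>x. f x \<partial>law P T) = (\<integral>x. f x \<partial>law P' T')"
      by (simp add: integral_distr)
  qed simp_all
qed

lemma law_sum_product_space:
  fixes f :: "'a \<Rightarrow> 'b::ordered_euclidean_space" and g :: "'c \<Rightarrow> 'b"
  assumes "prob_space M" "prob_space N" and [measurable]: "f \<in> borel_measurable M" "g \<in> borel_measurable N"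
  shows "law (M \<Otimes>\<^sub>M N) (\<lambda>p. f (fst p) + g (snd p)) = (law M f \<star> law N g)"
proof -
  interpret M: prob_space M by (rule assms(1))
  interpret N: prob_space N by (rule assms(2))
  interpret g: prob_space "law N g" by (rule N.prob_space_law) measurable
  have "law M f \<Otimes>\<^sub>M law N g = distr (M \<Otimes>\<^sub>M N) (borel \<Otimes>\<^sub>M borel) (\<lambda>(x, y). (f x, g y))"
    by (rule pair_measure_distr[OF _ _ g.sigma_finite_measure_axioms]) measurable
  then show ?thesis
    by (simp add: convolution_def distr_distr o_def split_beta')
qed

lemma law_convolution_linear:
  fixes f :: "'b::ordered_euclidean_space \<Rightarrow> 'b"
  assumes "prob_space \<mu>" "prob_space \<nu>" "sets \<mu> = sets borel" "sets \<nu> = sets borel" and f: "linear f"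
  shows "law (\<mu> \<star> \<nu>) f = (law \<mu> f \<star> law \<nu> f)"
proof -
  note [measurable_cong] = assms(3,4)
  have [measurable]: "f \<in> borel_measurable borel"
    using f by (intro borel_measurable_continuous_onI linear_continuous_on) (simp add: linear_conv_bounded_linear)
  interpret \<nu>: prob_space \<nu> by (rule assms(2))
  interpret g: prob_space "law \<nu> f" by (rule \<nu>.prob_space_law) measurable
  have "law \<mu> f \<Otimes>\<^sub>M law \<nu> f = distr (\<mu> \<Otimes>\<^sub>M \<nu>) (borel \<Otimes>\<^sub>M borel) (\<lambda>(x, y). (f x, f y))"
    by (rule pair_measure_distr[OF _ _ g.sigma_finite_measure_axioms]) measurable
  then show ?thesis
    by (simp add: convolution_def distr_distr o_def split_beta' linear_add[OF f])
qed

lemma integral_Cauchy_Schwarz: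
  fixes f g :: "'a \<Rightarrow> real"
  assumes [measurable]: "f \<in> borel_measurable M" "g \<in> borel_measurable M"
    and i: "integrable M (\<lambda>x. (f x)\<^sup>2)" "integrable M (\<lambda>x. (g x)\<^sup>2)"
  shows "integrable M (\<lambda>x. f x * g x)"
    and "\<bar>\<integral>x. f x * g x \<partial>M\<bar> \<le> sqrt (\<integral>x. (f x)\<^sup>2 \<partial>M) * sqrt (\<integral>x. (g x)\<^sup>2 \<partial>M)"
proof -
  show fg: "integrable M (\<lambda>x. f x * g x)"
  proof (rule Bochner_Integration.integrable_bound[OF Bochner_Integration.integrable_add[OF i]])
    show "AE x in M. norm (f x * g x) \<le> norm ((f x)\<^sup>2 + (g x)\<^sup>2)"
    proof (rule always_eventually, rule allI)
      fix x
      have "2 * (\<bar>f x\<bar> * \<bar>g x\<bar>) \<le> (f x)\<^sup>2 + (g x)\<^sup>2" using sum_squares_bound[of "\<bar>f x\<bar>" "\<bar>g x\<bar>"] by simp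
      moreover have "0 \<le> \<bar>f x\<bar> * \<bar>g x\<bar>" by simp
      ultimately have "\<bar>f x\<bar> * \<bar>g x\<bar> \<le> (f x)\<^sup>2 + (g x)\<^sup>2" by linarith
      then show "norm (f x * g x) \<le> norm ((f x)\<^sup>2 + (g x)\<^sup>2)" by (simp add: abs_mult)
    qed
  qed simp
  define F G a where "F = (\<integral>x. (f x)\<^sup>2 \<partial>M)" and "G = (\<integral>x. (g x)\<^sup>2 \<partial>M)" and "a = (\<integral>x. f x * g x \<partial>M)"
  have "0 \<le> F" "0 \<le> G" by (auto simp: F_def G_def)
  have "a\<^sup>2 \<le> F * G"
  proof (cases "F = 0")
    case True
    then have "AE x in M. (f x)\<^sup>2 = 0"
      using integral_nonneg_eq_0_iff_AE[OF i(1)] by (simp add: F_def)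
    then have "AE x in M. f x * g x = 0" by eventually_elim simp
    then have "a = 0" unfolding a_def by (rule integral_eq_zero_AE)
    then show ?thesis using True by simp
  next
    case False
    have "0 \<le> (\<integral>x. (F * g x - a * f x)\<^sup>2 \<partial>M)" by simp
    also have "\<dots> = (\<integral>x. F\<^sup>2 * (g x)\<^sup>2 - 2 * F * a * (f x * g x) + a\<^sup>2 * (f x)\<^sup>2 \<partial>M)"
      by (simp add: power2_eq_square algebra_simps)
    also have "\<dots> = F\<^sup>2 * G - 2 * F * a * a + a\<^sup>2 * F"
      using fg i by (simp add: F_def[symmetric] G_def[symmetric] a_def[symmetric])
    also have "\<dots> = F * (F * G - a\<^sup>2)" by (simp add: power2_eq_square algebra_simps)
    finally show ?thesis using False \<open>0 \<le> F\<close> by (simp add: zero_le_mult_iff)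
  qed
  then have "\<bar>a\<bar> \<le> sqrt (F * G)" by (simp add: real_le_rsqrt)
  then show "\<bar>\<integral>x. f x * g x \<partial>M\<bar> \<le> sqrt (\<integral>x. (f x)\<^sup>2 \<partial>M) * sqrt (\<integral>x. (g x)\<^sup>2 \<partial>M)"
    by (simp add: F_def G_def a_def real_sqrt_mult)
qed

text \<open>
  The joint law of \<open>U\<close> and \<open>V\<close> is a coupling of their laws.
\<close>

lemma W2_law_le:
  fixes U V :: "'a \<Rightarrow> 'b::euclidean_space"
  assumes "prob_space N" and [measurable]: "U \<in> borel_measurable N" "V \<in> borel_measurable N"
  shows "0 \<le> W2 (law N U) (law N V)"
    and "W2 (law N U) (law N V) \<le> sqrt (\<integral>\<omega>. (dist (U \<omega>) (V \<omega>))\<^sup>2 \<partial>N)"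
proof -
  interpret N: prob_space N by (rule assms(1))
  define \<pi> where "\<pi> = distr N borel (\<lambda>\<omega>. (U \<omega>, V \<omega>))"
  have m: "(\<lambda>\<omega>. (U \<omega>, V \<omega>)) \<in> borel_measurable N" by measurable
  have f: "(fst :: 'b \<times> 'b \<Rightarrow> 'b) \<in> borel_measurable borel" "(snd :: 'b \<times> 'b \<Rightarrow> 'b) \<in> borel_measurable borel"
    by (auto intro!: borel_measurable_continuous_onI continuous_intros)
  have \<pi>: "\<pi> \<in> couplings (law N U) (law N V)"
    using N.prob_space_distr[OF m] by (simp add: couplings_def \<pi>_def distr_distr[OF f(1) m] distr_distr[OF f(2) m] o_def)
  then have "0 \<le> (INF \<pi>\<in>couplings (law N U) (law N V). \<integral>p. (dist (fst p) (snd p))\<^sup>2 \<partial>\<pi>)"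
    by (intro cINF_greatest) auto
  then show "0 \<le> W2 (law N U) (law N V)" by (simp add: W2_def)
  note \<pi>
  moreover have "bdd_below ((\<lambda>\<pi>. \<integral>p. (dist (fst p) (snd p))\<^sup>2 \<partial>\<pi>) ` couplings (law N U) (law N V))"
    by (rule bdd_belowI2[of _ 0]) simp
  ultimately have "(INF \<pi>\<in>couplings (law N U) (law N V). \<integral>p. (dist (fst p) (snd p))\<^sup>2 \<partial>\<pi>)
      \<le> (\<integral>p. (dist (fst p) (snd p))\<^sup>2 \<partial>\<pi>)"
    by (intro cINF_lower)
  also have "\<dots> = (\<integral>\<omega>. (dist (U \<omega>) (V \<omega>))\<^sup>2 \<partial>N)"
    unfolding \<pi>_def by (subst integral_distr[OF m])
      (auto intro!: borel_measurable_continuous_onI continuous_intros)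
  finally show "W2 (law N U) (law N V) \<le> sqrt (\<integral>\<omega>. (dist (U \<omega>) (V \<omega>))\<^sup>2 \<partial>N)"
    unfolding W2_def by simp
qed

text \<open>
  The infimum in \<open>W2\<close> is taken over a nonempty set, because the product measure is a coupling.
\<close>

lemma near_optimal_coupling:
  fixes \<mu> \<nu> :: "'b::euclidean_space measure"
  assumes \<mu>: "prob_space \<mu>" "sets \<mu> = sets borel" and \<nu>: "prob_space \<nu>" "sets \<nu> = sets borel"
    and \<epsilon>: "0 < \<epsilon>"
  obtains \<pi> where "\<pi> \<in> couplings \<mu> \<nu>" "(\<integral>p. (dist (fst p) (snd p))\<^sup>2 \<partial>\<pi>) < (W2 \<mu> \<nu>)\<^sup>2 + \<epsilon>"
proof -
  interpret \<mu>: prob_space \<mu> by (rule \<mu>(1))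
  interpret \<nu>: prob_space \<nu> by (rule \<nu>(1))
  interpret p: pair_prob_space \<mu> \<nu> ..
  have s: "sets (\<mu> \<Otimes>\<^sub>M \<nu>) = sets borel"
    using sets_pair_measure_cong[OF \<mu>(2) \<nu>(2)] unfolding borel_prod .
  have "distr (\<mu> \<Otimes>\<^sub>M \<nu>) borel fst = \<mu>"
    using \<nu>.distr_pair_fst[of \<mu>] distr_cong[OF refl \<mu>(2)[symmetric], of "\<mu> \<Otimes>\<^sub>M \<nu>" fst fst] by simp
  moreover have "distr (\<mu> \<Otimes>\<^sub>M \<nu>) borel snd = \<nu>"
  proof (rule measure_eqI)
    show "sets (distr (\<mu> \<Otimes>\<^sub>M \<nu>) borel snd) = sets \<nu>" by (simp add: \<nu>(2))
    fix A assume "A \<in> sets (distr (\<mu> \<Otimes>\<^sub>M \<nu>) borel snd)"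
    then have A: "A \<in> sets \<nu>" "A \<in> sets borel" by (auto simp: \<nu>(2))
    have "snd \<in> measurable (\<mu> \<Otimes>\<^sub>M \<nu>) \<nu>" by measurable
    then have [measurable]: "snd \<in> borel_measurable (\<mu> \<Otimes>\<^sub>M \<nu>)" using measurable_cong_sets[OF refl \<nu>(2)] by blast
    have "snd -` A \<inter> space (\<mu> \<Otimes>\<^sub>M \<nu>) = space \<mu> \<times> A"
      using sets.sets_into_space[OF A(1)] by (auto simp: space_pair_measure)
    then show "emeasure (distr (\<mu> \<Otimes>\<^sub>M \<nu>) borel snd) A = emeasure \<nu> A"
      using A by (simp add: emeasure_distr \<nu>.emeasure_pair_measure_Times \<mu>.emeasure_space_1)
  qed
  ultimately have "\<mu> \<Otimes>\<^sub>M \<nu> \<in> couplings \<mu> \<nu>"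
    using s p.prob_space_axioms by (simp add: couplings_def)
  then have ne: "(\<lambda>\<pi>. \<integral>p. (dist (fst p) (snd p))\<^sup>2 \<partial>\<pi>) ` couplings \<mu> \<nu> \<noteq> {}" by blast
  have "0 \<le> (INF \<pi>\<in>couplings \<mu> \<nu>. \<integral>p. (dist (fst p) (snd p))\<^sup>2 \<partial>\<pi>)"
    using ne by (intro cINF_greatest) auto
  then have "(INF \<pi>\<in>couplings \<mu> \<nu>. \<integral>p. (dist (fst p) (snd p))\<^sup>2 \<partial>\<pi>) < (W2 \<mu> \<nu>)\<^sup>2 + \<epsilon>"
    using \<epsilon> by (simp add: W2_def)
  from cInf_lessD[OF ne this] show ?thesis using that by blast
qed

text \<open>
  The modulus of continuity of polynomials of degree two. Through it, convergence in \<open>W2\<close> gives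
  convergence of second moments.
\<close>

definition quadratic_variation_bound :: "real \<Rightarrow> ('b::euclidean_space \<Rightarrow> real) \<Rightarrow> bool" where
  "quadratic_variation_bound K \<phi> \<longleftrightarrow> 0 \<le> K \<and> \<phi> \<in> borel_measurable borel \<and>
     (\<forall>x y. \<bar>\<phi> x - \<phi> y\<bar> \<le> K * ((norm (x - y))\<^sup>2 + (1 + norm y) * norm (x - y)))"

lemma (in prob_space) integrable_norm_of_square:
  fixes U :: "'a \<Rightarrow> 'b::euclidean_space"
  assumes [measurable]: "U \<in> borel_measurable M" and "integrable M (\<lambda>x. (norm (U x))\<^sup>2)"
  shows "integrable M (\<lambda>x. norm (U x))" "integrable M U"
proof -
  show *: "integrable M (\<lambda>x. norm (U x))"
    using integral_Cauchy_Schwarz(1)[where f = "\<lambda>_. 1" and g = "\<lambda>x. norm (U x)" and M = M] assms by simp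
  show "integrable M U" using * integrable_norm_cancel by (metis assms(1))
qed

lemma integrable_square_diff:
  fixes U V :: "'a \<Rightarrow> 'b::euclidean_space"
  assumes [measurable]: "U \<in> borel_measurable M" "V \<in> borel_measurable M"
    and U: "integrable M (\<lambda>x. (norm (U x))\<^sup>2)" and V: "integrable M (\<lambda>x. (norm (V x))\<^sup>2)"
  shows "integrable M (\<lambda>x. (norm (U x - V x))\<^sup>2)" "integrable M (\<lambda>x. (norm (U x + V x))\<^sup>2)"
proof -
  have i: "integrable M (\<lambda>x. 2 * (norm (U x))\<^sup>2 + 2 * (norm (V x))\<^sup>2)" using U V by simp
  have b: "(norm (u + v))\<^sup>2 \<le> 2 * (norm u)\<^sup>2 + 2 * (norm v)\<^sup>2" for u v :: 'b
  proof -
    have "(norm (u + v))\<^sup>2 \<le> (norm u + norm v)\<^sup>2" by (intro power_mono norm_triangle_ineq) simp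
    also have "\<dots> \<le> 2 * (norm u)\<^sup>2 + 2 * (norm v)\<^sup>2"
      using sum_squares_bound[of "norm u" "norm v"] by (simp add: power2_sum)
    finally show ?thesis .
  qed
  show "integrable M (\<lambda>x. (norm (U x + V x))\<^sup>2)"
    by (rule Bochner_Integration.integrable_bound[OF i]) (use b in auto)
  show "integrable M (\<lambda>x. (norm (U x - V x))\<^sup>2)"
    by (rule Bochner_Integration.integrable_bound[OF i]) (use b[of _ "- _"] in auto)
qed

lemma (in prob_space) quadratic_variation_bound_expectation:
  fixes U V :: "'a \<Rightarrow> 'b::euclidean_space"
  assumes \<phi>: "quadratic_variation_bound K \<phi>"
    and [measurable]: "U \<in> borel_measurable M" "V \<in> borel_measurable M"
    and U: "integrable M (\<lambda>x. (norm (U x))\<^sup>2)" and V: "integrable M (\<lambda>x. (norm (V x))\<^sup>2)"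
  defines "u \<equiv> \<integral>x. (norm (U x - V x))\<^sup>2 \<partial>M"
  shows "integrable M (\<lambda>x. \<phi> (U x))"
    and "\<bar>(\<integral>x. \<phi> (U x) \<partial>M) - (\<integral>x. \<phi> (V x) \<partial>M)\<bar>
      \<le> K * (u + sqrt (\<integral>x. (1 + norm (V x))\<^sup>2 \<partial>M) * sqrt u)"
proof -
  have [measurable]: "\<phi> \<in> borel_measurable borel" and K: "0 \<le> K"
    and b: "\<bar>\<phi> x - \<phi> y\<bar> \<le> K * ((norm (x - y))\<^sup>2 + (1 + norm y) * norm (x - y))" for x y
    using \<phi> by (auto simp: quadratic_variation_bound_def)
  have int: "integrable M (\<lambda>x. \<phi> (Z x))" if [measurable]: "Z \<in> borel_measurable M" 
    and Z: "integrable M (\<lambda>x. (norm (Z x))\<^sup>2)" for Z :: "'a \<Rightarrow> 'b"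
  proof (rule Bochner_Integration.integrable_bound)
    show "integrable M (\<lambda>x. \<bar>\<phi> 0\<bar> + K * ((norm (Z x))\<^sup>2 + norm (Z x)))"
      using Z integrable_norm_of_square[OF that] by simp
    show "AE x in M. norm (\<phi> (Z x)) \<le> norm (\<bar>\<phi> 0\<bar> + K * ((norm (Z x))\<^sup>2 + norm (Z x)))"
    proof (intro always_eventually allI)
      fix x
      have "0 \<le> K * ((norm (Z x))\<^sup>2 + norm (Z x))" using K by simp
      then show "norm (\<phi> (Z x)) \<le> norm (\<bar>\<phi> 0\<bar> + K * ((norm (Z x))\<^sup>2 + norm (Z x)))"
        using b[of "Z x" 0] by simp
    qed
  qed simp
  show "integrable M (\<lambda>x. \<phi> (U x))" by (rule int[OF assms(2) U])
  have d: "integrable M (\<lambda>x. (norm (U x - V x))\<^sup>2)" by (rule integrable_square_diff) (use U V in simp_all)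
  have v: "integrable M (\<lambda>x. (1 + norm (V x))\<^sup>2)"
    using V integrable_norm_of_square(1)[OF assms(3) V] by (simp add: power2_sum)
  have p: "integrable M (\<lambda>x. (1 + norm (V x)) * norm (U x - V x))"
    "\<bar>\<integral>x. (1 + norm (V x)) * norm (U x - V x) \<partial>M\<bar> \<le> sqrt (\<integral>x. (1 + norm (V x))\<^sup>2 \<partial>M) * sqrt u"
    unfolding u_def using integral_Cauchy_Schwarz[OF _ _ v d] assms(2,3) by simp_all
  have "\<bar>(\<integral>x. \<phi> (U x) \<partial>M) - (\<integral>x. \<phi> (V x) \<partial>M)\<bar> = \<bar>\<integral>x. \<phi> (U x) - \<phi> (V x) \<partial>M\<bar>"
    using int[OF assms(2) U] int[OF assms(3) V] by simp
  also have "\<dots> \<le> (\<integral>x. \<bar>\<phi> (U x) - \<phi> (V x)\<bar> \<partial>M)" by (rule integral_abs_bound)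
  also have "\<dots> \<le> (\<integral>x. K * ((norm (U x - V x))\<^sup>2 + (1 + norm (V x)) * norm (U x - V x)) \<partial>M)"
    using int[OF assms(2) U] int[OF assms(3) V] d p(1) b by (intro integral_mono) simp_all
  also have "\<dots> = K * (u + (\<integral>x. (1 + norm (V x)) * norm (U x - V x) \<partial>M))"
    using d p(1) by (simp add: u_def)
  also have "\<dots> \<le> K * (u + sqrt (\<integral>x. (1 + norm (V x))\<^sup>2 \<partial>M) * sqrt u)"
    using p(2) K by (intro mult_left_mono) auto
  finally show "\<bar>(\<integral>x. \<phi> (U x) \<partial>M) - (\<integral>x. \<phi> (V x) \<partial>M)\<bar>
      \<le> K * (u + sqrt (\<integral>x. (1 + norm (V x))\<^sup>2 \<partial>M) * sqrt u)" .
qed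

text \<open>
  Applied to a nearly optimal coupling, the modulus of continuity bounds the difference of the two
  integrals by a function of \<open>W2\<close> that tends to \<open>0\<close>.
\<close>

lemma W2_converges_quadratic:
  fixes \<mu> :: "real \<Rightarrow> 'b::euclidean_space measure"
  assumes conv: "W2_converges \<mu> \<nu>" and \<phi>: "quadratic_variation_bound K \<phi>"
  shows "((\<lambda>t. \<integral>x. \<phi> x \<partial>\<mu> t) \<longlongrightarrow> (\<integral>x. \<phi> x \<partial>\<nu>)) at_top"
proof -
  have \<nu>: "prob_space \<nu>" "sets \<nu> = sets borel" "integrable \<nu> (\<lambda>x. (norm x)\<^sup>2)"
    and \<mu>: "\<forall>\<^sub>F t in at_top. \<mu> t \<in> P2" and lim: "((\<lambda>t. W2 (\<mu> t) \<nu>) \<longlongrightarrow> 0) at_top"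
    using conv by (auto simp: W2_converges_def P2_def)
  have m\<phi>: "\<phi> \<in> borel_measurable borel" and K: "0 \<le> K" using \<phi> by (auto simp: quadratic_variation_bound_def)
  define C where "C = sqrt (\<integral>x. (1 + norm x)\<^sup>2 \<partial>\<nu>)"
  \<comment> \<open>The summand \<open>exp (- t)\<close> is a positive slack for choosing a coupling; the infimum may not be attained.\<close>
  define u where "u t = (W2 (\<mu> t) \<nu>)\<^sup>2 + exp (- t)" for t :: real
  have u: "(u \<longlongrightarrow> 0) at_top"
  proof -
    have "((\<lambda>t::real. exp (- t)) \<longlongrightarrow> 0) at_top"
      by (rule filterlim_compose[OF exp_at_bot filterlim_uminus_at_bot_at_top])
    then show ?thesis unfolding u_def[abs_def]
      using tendsto_add[OF tendsto_power[OF lim, of 2]] by fastforce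
  qed
  have bound: "\<forall>\<^sub>F t in at_top. norm ((\<integral>x. \<phi> x \<partial>\<mu> t) - (\<integral>x. \<phi> x \<partial>\<nu>)) \<le> K * (u t + C * sqrt (u t))"
    using \<mu>
  proof eventually_elim
    case (elim t)
    then have mt: "prob_space (\<mu> t)" "sets (\<mu> t) = sets borel" "integrable (\<mu> t) (\<lambda>x. (norm x)\<^sup>2)"
      by (auto simp: P2_def)
    obtain \<pi> where \<pi>: "\<pi> \<in> couplings (\<mu> t) \<nu>" and less: "(\<integral>p. (dist (fst p) (snd p))\<^sup>2 \<partial>\<pi>) < u t"
      using near_optimal_coupling[OF mt(1,2) \<nu>(1,2), of "exp (- t)"] unfolding u_def by auto
    have p: "prob_space \<pi>" and s: "sets \<pi> = sets borel"
      and d: "distr \<pi> borel fst = \<mu> t" "distr \<pi> borel snd = \<nu>"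
      using \<pi> by (auto simp: couplings_def)
    interpret \<pi>: prob_space \<pi> by (rule p)
    note [measurable_cong] = s
    have m: "fst \<in> borel_measurable \<pi>" "snd \<in> borel_measurable \<pi>"
      unfolding measurable_cong_sets[OF s refl] by (auto intro!: borel_measurable_continuous_onI continuous_intros)
    have i: "integrable \<pi> (\<lambda>p. (norm (fst p))\<^sup>2)" "integrable \<pi> (\<lambda>p. (norm (snd p))\<^sup>2)"
      using mt(3) \<nu>(3) unfolding d[symmetric] by (simp_all add: integrable_distr_eq m)
    have e: "(\<integral>x. \<phi> x \<partial>\<mu> t) = (\<integral>p. \<phi> (fst p) \<partial>\<pi>)" "(\<integral>x. \<phi> x \<partial>\<nu>) = (\<integral>p. \<phi> (snd p) \<partial>\<pi>)"
      "(\<integral>x. (1 + norm x)\<^sup>2 \<partial>\<nu>) = (\<integral>p. (1 + norm (snd p))\<^sup>2 \<partial>\<pi>)"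
      unfolding d[symmetric] using m\<phi> m by (simp_all add: integral_distr)
    define c where "c = (\<integral>p. (norm (fst p - snd p))\<^sup>2 \<partial>\<pi>)"
    have c: "0 \<le> c" "c \<le> u t" using less by (auto simp: c_def dist_norm)
    have "\<bar>(\<integral>x. \<phi> x \<partial>\<mu> t) - (\<integral>x. \<phi> x \<partial>\<nu>)\<bar> \<le> K * (c + C * sqrt c)"
      unfolding C_def e c_def by (rule \<pi>.quadratic_variation_bound_expectation(2)[OF \<phi> m i])
    also have "\<dots> \<le> K * (u t + C * sqrt (u t))"
      using c K by (intro mult_left_mono add_mono real_sqrt_le_mono) (auto simp: C_def)
    finally show ?case by simp
  qed
  have "((\<lambda>t. K * (u t + C * sqrt (u t))) \<longlongrightarrow> K * (0 + C * sqrt 0)) at_top"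
    by (intro tendsto_intros u)
  then have "((\<lambda>t. K * (u t + C * sqrt (u t))) \<longlongrightarrow> 0) at_top" by simp
  from Lim_null_comparison[OF bound this] show ?thesis by (rule LIM_zero_cancel)
qed

text \<open>
  The source of all test functions: products of two affine functions.
\<close>

lemma quadratic_variation_bound_product:
  fixes f g :: "'b::euclidean_space \<Rightarrow> real"
  assumes f: "bounded_linear f" and g: "bounded_linear g"
  obtains K where "quadratic_variation_bound K (\<lambda>x. (f x + a) * (g x + b))"
proof -
  obtain F G where FG: "0 < F" "\<And>x. \<bar>f x\<bar> \<le> norm x * F" "0 < G" "\<And>x. \<bar>g x\<bar> \<le> norm x * G"
    using bounded_linear.pos_bounded[OF f] bounded_linear.pos_bounded[OF g] by auto
  define K where "K = F * G + F * \<bar>b\<bar> + G * \<bar>a\<bar> + F * G"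
  have "\<bar>(f x + a) * (g x + b) - (f y + a) * (g y + b)\<bar> \<le> (2 * K) * ((norm (x - y))\<^sup>2 + (1 + norm y) * norm (x - y))" for x y
  proof -
    define n m where "n = norm (x - y)" and "m = norm y"
    have nm: "0 \<le> n" "0 \<le> m" by (auto simp: n_def m_def)
    have e: "(f x + a) * (g x + b) - (f y + a) * (g y + b)
      = f (x - y) * g (x - y) + f (x - y) * g y + f y * g (x - y) + f (x - y) * b + g (x - y) * a"
      by (simp add: linear_diff[OF bounded_linear.linear[OF f]] linear_diff[OF bounded_linear.linear[OF g]] algebra_simps)
    have "\<bar>f (x - y) * g (x - y)\<bar> \<le> (n * F) * (n * G)" "\<bar>f (x - y) * g y\<bar> \<le> (n * F) * (m * G)"
      "\<bar>f y * g (x - y)\<bar> \<le> (m * F) * (n * G)" "\<bar>f (x - y) * b\<bar> \<le> (n * F) * \<bar>b\<bar>" "\<bar>g (x - y) * a\<bar> \<le> (n * G) * \<bar>a\<bar>"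
      unfolding abs_mult n_def m_def using FG by (auto intro!: mult_mono)
    then have "\<bar>(f x + a) * (g x + b) - (f y + a) * (g y + b)\<bar>
       \<le> (n * F) * (n * G) + (n * F) * (m * G) + (m * F) * (n * G) + (n * F) * \<bar>b\<bar> + (n * G) * \<bar>a\<bar>"
      unfolding e by linarith
    also have "\<dots> = F * G * n\<^sup>2 + 2 * (F * G) * (m * n) + (F * \<bar>b\<bar> + G * \<bar>a\<bar>) * n"
      by (simp add: power2_eq_square algebra_simps)
    also have "\<dots> \<le> (2 * K) * n\<^sup>2 + (2 * K) * (m * n) + (2 * K) * n"
      using FG nm by (intro add_mono mult_right_mono) (auto simp: K_def)
    also have "\<dots> = (2 * K) * (n\<^sup>2 + (1 + m) * n)" by (simp add: algebra_simps)
    finally show ?thesis by (simp add: n_def m_def)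
  qed
  moreover have "(\<lambda>x. (f x + a) * (g x + b)) \<in> borel_measurable borel"
    using f g by (intro borel_measurable_continuous_onI continuous_intros linear_continuous_on)
  moreover have "0 \<le> 2 * K" using FG by (simp add: K_def)
  ultimately have "quadratic_variation_bound (2 * K) (\<lambda>x. (f x + a) * (g x + b))"
    by (simp add: quadratic_variation_bound_def)
  then show ?thesis by (rule that)
qed

section \<open>Integration over time\<close>

abbreviation time :: "real \<Rightarrow> real measure" where
  "time T \<equiv> restrict_space lborel {0..T}"

lemma finite_measure_time: "finite_measure (time T)"
  by (rule finite_measureI) (simp add: emeasure_restrict_space space_restrict_space emeasure_lborel_Icc_eq)

lemma integral_time: 
  fixes f :: "real \<Rightarrow> 'b::{banach, second_countable_topology}"
  shows "integral\<^sup>L (time T) f = (LINT s:{0..T}|lborel. f s)"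
  unfolding set_lebesgue_integral_def by (rule integral_restrict_space) simp

lemma integrable_time: 
  fixes f :: "real \<Rightarrow> 'b::{banach, second_countable_topology}"
  shows "integrable (time T) f = set_integrable lborel {0..T} f"
  unfolding set_integrable_def by (rule integrable_restrict_space) simp

lemma measurable_time:
  assumes "f \<in> measurable ((borel :: real measure) \<Otimes>\<^sub>M M) N"
  shows "f \<in> measurable (time T \<Otimes>\<^sub>M M) N"
proof -
  have "(\<lambda>p. (fst p, snd p)) \<in> measurable (time T \<Otimes>\<^sub>M M) ((borel :: real measure) \<Otimes>\<^sub>M M)"
    by (intro measurable_Pair measurable_snd measurable_compose[OF measurable_fst] measurable_restrict_space1)
      simp
  from measurable_compose[OF this assms] show ?thesis by simp
qed

text \<open>
  Integration by parts for absolutely continuous functions, from Fubini's theorem on the square split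
  along its diagonal.
\<close>

lemma product_rule:
  fixes f g :: "real \<Rightarrow> real"
  assumes T: "0 \<le> T" and f: "set_integrable lborel {0..T} f" and g: "set_integrable lborel {0..T} g"
    and F: "\<And>t. t \<in> {0..T} \<Longrightarrow> F t = F0 + (LINT s:{0..t}|lborel. f s)"
    and G: "\<And>t. t \<in> {0..T} \<Longrightarrow> G t = G0 + (LINT s:{0..t}|lborel. g s)"
  shows "set_integrable lborel {0..T} (\<lambda>s. f s * G s + F s * g s)"
    and "F T * G T = F0 * G0 + (LINT s:{0..T}|lborel. f s * G s + F s * g s)"
proof -
  define f' g' where "f' s = indicator {0..T} s * f s" and "g' s = indicator {0..T} s * g s" for s :: real
  have f': "integrable lborel f'" and g': "integrable lborel g'"
    using f g unfolding set_integrable_def f'_def[abs_def] g'_def[abs_def] by simp_all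
  then have [measurable]: "f' \<in> borel_measurable borel" "g' \<in> borel_measurable borel" by auto
  define h where "h s u = f' s * g' u" for s u
  define h1 h2 where "h1 s u = (if u \<le> s then h s u else 0)" and "h2 s u = (if u \<le> s then 0 else h s u)" for s u
  have h: "integrable (lborel \<Otimes>\<^sub>M lborel) (case_prod h)"
  proof (rule lborel_pair.Fubini_integrable)
    show "case_prod h \<in> borel_measurable (lborel \<Otimes>\<^sub>M lborel)"
      unfolding h_def split_beta' by measurable
    have "integrable lborel (\<lambda>s. \<bar>f' s\<bar> * (\<integral>u. \<bar>g' u\<bar> \<partial>lborel))"
      using f' by (intro integrable_mult_left integrable_abs)
    then show "integrable lborel (\<lambda>s. \<integral>u. norm (case_prod h (s, u)) \<partial>lborel)"
      by (simp add: h_def abs_mult)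
    show "AE s in lborel. integrable lborel (\<lambda>u. case_prod h (s, u))"
      using g' by (simp add: h_def)
  qed
  have m: "case_prod h1 \<in> borel_measurable (lborel \<Otimes>\<^sub>M lborel)" "case_prod h2 \<in> borel_measurable (lborel \<Otimes>\<^sub>M lborel)"
    unfolding h1_def h2_def h_def split_beta' by measurable
  have h1: "integrable (lborel \<Otimes>\<^sub>M lborel) (case_prod h1)"
    by (rule Bochner_Integration.integrable_bound[OF h m(1)]) (simp add: h1_def split_beta')
  have h2: "integrable (lborel \<Otimes>\<^sub>M lborel) (case_prod h2)"
    by (rule Bochner_Integration.integrable_bound[OF h m(2)]) (simp add: h2_def split_beta')
  have inner1: "(\<integral>u. h1 s u \<partial>lborel) = f' s * (G s - G0)" for s
  proof (cases "s \<in> {0..T}")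
    case True
    have "(\<integral>u. h1 s u \<partial>lborel) = f' s * (\<integral>u. indicator {0..s} u * g u \<partial>lborel)"
      unfolding integral_mult_right_zero[symmetric] using True
      by (intro Bochner_Integration.integral_cong) (auto simp: h1_def h_def g'_def indicator_def)
    then show ?thesis using G[OF True] by (simp add: set_lebesgue_integral_def)
  next
    case False
    then have "f' s = 0" by (auto simp: f'_def)
    then have "h1 s u = 0" for u by (simp add: h1_def h_def)
    then show ?thesis using \<open>f' s = 0\<close> by simp
  qed
  have inner2: "(\<integral>s. h2 s u \<partial>lborel) = (F u - F0) * g' u" for u
  proof (cases "u \<in> {0..T}")
    case True
    have "(\<integral>s. h2 s u \<partial>lborel) = (\<integral>s. (indicator {0..u} s * f s) * g' u \<partial>lborel)"
    proof (rule integral_cong_AE)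
      show "AE s in lborel. h2 s u = (indicator {0..u} s * f s) * g' u"
        using AE_lborel_singleton[of u]
        by eventually_elim (use True in \<open>auto simp: h2_def h_def f'_def indicator_def\<close>)
      show "(\<lambda>s. (indicator {0..u} s * f s) * g' u) \<in> borel_measurable lborel"
      proof -
        have "(\<lambda>s. (indicator {0..u} s * f s) * g' u) = (\<lambda>s. (indicator {0..u} s * f' s) * g' u)"
          using True by (auto simp: f'_def indicator_def)
        then show ?thesis by simp
      qed
      show "(\<lambda>s. h2 s u) \<in> borel_measurable lborel" unfolding h2_def h_def by measurable
    qed
    also have "\<dots> = (\<integral>s. indicator {0..u} s * f s \<partial>lborel) * g' u" by simp
    finally show ?thesis using F[OF True] by (simp add: set_lebesgue_integral_def)
  next
    case False
    then have "g' u = 0" by (auto simp: g'_def)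
    then have "h2 s u = 0" for s by (simp add: h2_def h_def)
    then show ?thesis using \<open>g' u = 0\<close> by simp
  qed
  have i1: "integrable lborel (\<lambda>s. f' s * (G s - G0))"
    using lborel_pair.integrable_fst[OF h1] by (simp add: inner1)
  have i2: "integrable lborel (\<lambda>u. (F u - F0) * g' u)"
    using lborel_pair.integrable_snd[OF h2] by (simp add: inner2)
  have e: "(\<lambda>s. indicator {0..T} s *\<^sub>R (f s * G s + F s * g s))
      = (\<lambda>s. f' s * (G s - G0) + f' s * G0 + ((F s - F0) * g' s + F0 * g' s))"
    by (auto simp: f'_def g'_def indicator_def algebra_simps)
  show "set_integrable lborel {0..T} (\<lambda>s. f s * G s + F s * g s)"
    unfolding set_integrable_def e using i1 i2 f' g' by simp
  have fT: "(\<integral>s. f' s \<partial>lborel) = F T - F0" and gT: "(\<integral>s. g' s \<partial>lborel) = G T - G0"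
    using F[of T] G[of T] T by (auto simp: f'_def g'_def set_lebesgue_integral_def)
  have "(F T - F0) * (G T - G0) = (\<integral>s. \<integral>u. h s u \<partial>lborel \<partial>lborel)"
    by (simp add: h_def fT gT)
  also have "\<dots> = integral\<^sup>L (lborel \<Otimes>\<^sub>M lborel) (case_prod h)" by (rule lborel_pair.integral_fst[OF h])
  also have "\<dots> = (\<integral>p. case_prod h1 p + case_prod h2 p \<partial>(lborel \<Otimes>\<^sub>M lborel))"
    by (intro Bochner_Integration.integral_cong) (auto simp: h1_def h2_def)
  also have "\<dots> = integral\<^sup>L (lborel \<Otimes>\<^sub>M lborel) (case_prod h1) + integral\<^sup>L (lborel \<Otimes>\<^sub>M lborel) (case_prod h2)"
    using h1 h2 by simp
  also have "\<dots> = (\<integral>s. f' s * (G s - G0) \<partial>lborel) + (\<integral>u. (F u - F0) * g' u \<partial>lborel)"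
    using lborel_pair.integral_fst[OF h1] lborel_pair.integral_snd[OF h2] by (simp add: inner1 inner2)
  finally have "(F T - F0) * (G T - G0) = (\<integral>s. f' s * (G s - G0) \<partial>lborel) + (\<integral>u. (F u - F0) * g' u \<partial>lborel)" .
  moreover have "(LINT s:{0..T}|lborel. f s * G s + F s * g s)
     = (\<integral>s. f' s * (G s - G0) \<partial>lborel) + (F T - F0) * G0 + ((\<integral>u. (F u - F0) * g' u \<partial>lborel) + F0 * (G T - G0))"
    unfolding set_lebesgue_integral_def e using i1 i2 f' g' by (simp add: fT gT)
  ultimately show "F T * G T = F0 * G0 + (LINT s:{0..T}|lborel. f s * G s + F s * g s)"
    by (simp add: algebra_simps)
qed

section \<open>Brownian motion\<close>

lemma integral_lborel_prod:
  fixes f :: "'b::euclidean_space \<Rightarrow> real \<Rightarrow> real"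
  assumes f: "\<And>b. b \<in> Basis \<Longrightarrow> integrable lborel (f b)"
  shows "integrable lborel (\<lambda>x. \<Prod>b\<in>Basis. f b (x \<bullet> b))"
    and "(\<integral>x. (\<Prod>b\<in>Basis. f b (x \<bullet> b)) \<partial>lborel) = (\<Prod>b\<in>Basis. \<integral>x. f b x \<partial>lborel)"
proof -
  interpret p: product_sigma_finite "\<lambda>_::'b. lborel :: real measure"
    by (intro product_sigma_finite.intro sigma_finite_lborel)
  have [measurable]: "f b \<in> borel_measurable borel" if "b \<in> Basis" for b
    using borel_measurable_integrable[OF f[OF that]] by simp
  have m: "(\<lambda>f. \<Sum>b\<in>Basis. f b *\<^sub>R b) \<in> measurable (\<Pi>\<^sub>M b\<in>(Basis::'b set). (lborel::real measure)) (borel :: 'b measure)"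
    by measurable
  have m2: "(\<lambda>x. \<Prod>b\<in>Basis. f b (x \<bullet> b)) \<in> borel_measurable (borel :: 'b measure)" by measurable
  have e: "(\<Prod>b\<in>Basis. f b ((\<Sum>c\<in>Basis. x c *\<^sub>R c) \<bullet> b)) = (\<Prod>b\<in>Basis. f b (x b))" for x :: "'b \<Rightarrow> real"
    by (intro prod.cong refl) simp
  show "integrable lborel (\<lambda>x. \<Prod>b\<in>Basis. f b (x \<bullet> b))"
    unfolding lborel_eq[where 'a = 'b]
    using p.product_integrable_prod[of Basis f] f by (simp add: integrable_distr_eq[OF m m2] e)
  show "(\<integral>x. (\<Prod>b\<in>Basis. f b (x \<bullet> b)) \<partial>lborel) = (\<Prod>b\<in>Basis. \<integral>x. f b x \<partial>lborel)"
    unfolding lborel_eq[where 'a = 'b]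
    using p.product_integral_prod[of Basis f] f by (simp add: integral_distr[OF m m2] e)
qed

lemma Basis_plane: "(Basis :: (real^2) set) = {axis 1 1, axis 2 1}" "axis 1 1 \<noteq> (axis 2 1 :: real^2)"
  by (auto simp: Basis_vec_def UNIV_2 axis_eq_axis)

lemma integral_lborel_plane:
  fixes f g :: "real \<Rightarrow> real"
  assumes "integrable lborel f" "integrable lborel g"
  shows "integrable lborel (\<lambda>x::real^2. f (x $ 1) * g (x $ 2))"
    and "(\<integral>x. f (x $ 1) * g (x $ 2) \<partial>(lborel :: (real^2) measure)) = (\<integral>x. f x \<partial>lborel) * (\<integral>x. g x \<partial>lborel)"
  using integral_lborel_prod[of "\<lambda>b::real^2. if b = axis 1 1 then f else g"] assms Basis_plane(2)
  by (simp_all add: Basis_plane(1) inner_axis split: if_splits)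

lemma normal_density_second_moment:
  assumes "0 < h"
  shows "integrable lborel (\<lambda>x. normal_density 0 (sqrt h) x * x\<^sup>2)"
    and "(\<integral>x. normal_density 0 (sqrt h) x * x\<^sup>2 \<partial>lborel) = h"
  using integrable_normal_moment[of "sqrt h" 0 2] integral_normal_moment_even[of "sqrt h" 0 1] assms
  by (simp_all add: fact_2)

locale brownian =
  fixes M :: "'a measure" and F :: "real \<Rightarrow> 'a measure" and W :: "real \<Rightarrow> 'a \<Rightarrow> real^2"
  assumes filtered: "filtered_prob_space M F" and bm: "brownian_motion M F W"
begin

sublocale prob_space M using filtered by (simp add: filtered_prob_space_def)

lemma filtration: "filtration (space M) F" and sets_F: "sets (F t) \<subseteq> sets M"
  using filtered by (auto simp: filtered_prob_space_def)

lemma space_F: "space (F t) = space M" using filtration.space_F[OF filtration] .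

lemma measurable_F: "f \<in> measurable (F t) N \<Longrightarrow> f \<in> measurable M N"
  using measurable_mono[of N N "F t" M] sets_F space_F by auto

lemma measurable_F_mono: "s \<le> t \<Longrightarrow> f \<in> measurable (F s) N \<Longrightarrow> f \<in> measurable (F t) N"
  using measurable_mono[of N N "F s" "F t"] filtration.sets_F_mono[OF filtration] space_F by auto

lemma W_adapted: "0 \<le> s \<Longrightarrow> s \<le> t \<Longrightarrow> W s \<in> borel_measurable (F t)"
  using bm measurable_F_mono[of s t "W s"] by (simp add: brownian_motion_def)

lemma W_measurable: "0 \<le> s \<Longrightarrow> W s \<in> borel_measurable M"
  using measurable_F[OF W_adapted[of s s]] by simp

lemma W_continuous: "\<omega> \<in> space M \<Longrightarrow> continuous_on {0..} (\<lambda>t. W t \<omega>)"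
  using bm by (auto simp: brownian_motion_def)

lemma W_0: "AE \<omega> in M. W 0 \<omega> = 0"
  using bm by (auto simp: brownian_motion_def)

text \<open>
  The hypothesis on Brownian motion speaks of sets; this is its form for random variables.
\<close>

lemma increment_indep:
  assumes st: "0 \<le> s" "s < t" and Y: "Y \<in> borel_measurable (F s)"
  shows "indep_var borel Y borel (\<lambda>\<omega>. W t \<omega> - W s \<omega>)"
proof -
  let ?D = "\<lambda>\<omega>. W t \<omega> - W s \<omega>"
  have i: "indep_set (sets (F s)) {?D -` B \<inter> space M | B. B \<in> sets borel}"
    using bm st by (simp add: brownian_motion_def)
  have s1: "Int_stable (sets (F s))" by (auto simp: Int_stable_def)
  have s2: "Int_stable {?D -` B \<inter> space M | B. B \<in> sets borel}"
    unfolding Int_stable_def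
  proof safe
    fix A B :: "(real^2) set" assume "A \<in> sets borel" "B \<in> sets borel"
    then show "\<exists>C. ?D -` A \<inter> space M \<inter> (?D -` B \<inter> space M) = ?D -` C \<inter> space M \<and> C \<in> sets borel"
      by (intro exI[of _ "A \<inter> B"]) auto
  qed
  have j: "indep_set (sigma_sets (space M) (sets (F s))) (sigma_sets (space M) {?D -` B \<inter> space M | B. B \<in> sets borel})"
    by (rule indep_set_sigma_sets[OF i s1 s2])
  have "sigma_sets (space M) {Y -` A \<inter> space M | A. A \<in> sets borel} \<subseteq> sigma_sets (space M) (sets (F s))"
    using measurable_sets[OF Y] by (intro sigma_sets_mono') (auto simp: space_F)
  then have "indep_set (sigma_sets (space M) {Y -` A \<inter> space M | A. A \<in> sets borel})
      (sigma_sets (space M) {?D -` B \<inter> space M | B. B \<in> sets borel})"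
    using j unfolding indep_sets2_eq by (meson subset_iff)
  moreover have "Y \<in> borel_measurable M" "?D \<in> borel_measurable M"
    using measurable_F[OF Y] W_measurable st by auto
  ultimately show ?thesis by (simp add: indep_var_eq)
qed

definition gauss :: "real \<Rightarrow> real^2 \<Rightarrow> real" where
  "gauss h x = (\<Prod>i\<in>UNIV. normal_density 0 (sqrt h) (x $ i))"

lemma gauss_eq: "gauss h x = normal_density 0 (sqrt h) (x $ 1) * normal_density 0 (sqrt h) (x $ 2)"
  by (simp add: gauss_def UNIV_2)

lemma gauss_nonneg: "0 \<le> gauss h x"
  by (simp add: gauss_eq)

lemma increment_distributed:
  "0 \<le> s \<Longrightarrow> s < t \<Longrightarrow> distributed M lborel (\<lambda>\<omega>. W t \<omega> - W s \<omega>) (\<lambda>x. ennreal (gauss (t - s) x))"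
  using bm by (simp add: brownian_motion_def gauss_def)

lemma increment_moments:
  assumes st: "0 \<le> s" "s \<le> t"
  shows "integrable M (\<lambda>\<omega>. (norm (W t \<omega> - W s \<omega>))\<^sup>2)"
    and "(\<integral>\<omega>. (W t \<omega> - W s \<omega>) $ i \<partial>M) = 0"
    and "(\<integral>\<omega>. (W t \<omega> - W s \<omega>) $ i * (W t \<omega> - W s \<omega>) $ j \<partial>M) = (if i = j then t - s else 0)"
proof -
  have "integrable M (\<lambda>\<omega>. (norm (W t \<omega> - W s \<omega>))\<^sup>2) \<and>
    (\<integral>\<omega>. (W t \<omega> - W s \<omega>) $ i \<partial>M) = 0 \<and>
    (\<integral>\<omega>. (W t \<omega> - W s \<omega>) $ i * (W t \<omega> - W s \<omega>) $ j \<partial>M) = (if i = j then t - s else 0)"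
  proof (cases "s = t")
    case False
    define h n where "h = t - s" and "n = normal_density 0 (sqrt h)"
    have h: "h > 0" using False st by (simp add: h_def)
    have D: "distributed M lborel (\<lambda>\<omega>. W t \<omega> - W s \<omega>) (\<lambda>x. ennreal (gauss h x))"
      using increment_distributed[of s t] False st by (simp add: h_def)
    note E = distributed_integral[OF D _ gauss_nonneg] and I = distributed_integrable[OF D _ gauss_nonneg]
    have n: "integrable lborel n" "integral\<^sup>L lborel n = 1" "integrable lborel (\<lambda>x. n x * x)" "(\<integral>x. n x * x \<partial>lborel) = 0"
      "integrable lborel (\<lambda>x. n x * x\<^sup>2)" "(\<integral>x. n x * x\<^sup>2 \<partial>lborel) = h"
      using h integral_normal_moment_nz_1[of "sqrt h" 0] integrable_normal_moment_nz_1[of "sqrt h" 0]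
        normal_density_second_moment[OF h] by (auto simp: n_def)
    have g: "gauss h x = n (x $ 1) * n (x $ 2)" for x by (simp add: gauss_eq n_def)
    note P = integral_lborel_plane
    have m1: "(\<integral>x. gauss h x * x $ 1 \<partial>lborel) = 0" "(\<integral>x. gauss h x * x $ 2 \<partial>lborel) = 0"
      using P(2)[OF n(3,1)] P(2)[OF n(1,3)] n(2,4) by (simp_all add: g mult_ac)
    have m11: "integrable lborel (\<lambda>x. gauss h x * (x $ 1)\<^sup>2)" "integrable lborel (\<lambda>x. gauss h x * (x $ 2)\<^sup>2)"
      "(\<integral>x. gauss h x * (x $ 1)\<^sup>2 \<partial>lborel) = h" "(\<integral>x. gauss h x * (x $ 2)\<^sup>2 \<partial>lborel) = h"
      using P[OF n(5,1)] P[OF n(1,5)] n(2,6) by (simp_all add: g mult_ac)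
    have m12: "(\<integral>x. gauss h x * (x $ 1 * x $ 2) \<partial>lborel) = 0"
      using P(2)[OF n(3,3)] n(4) by (simp add: g mult_ac)
    have m: "(\<lambda>x::real^2. x $ k) \<in> borel_measurable lborel" for k
      by (auto intro!: borel_measurable_continuous_onI continuous_intros)
    have nrm: "(norm x)\<^sup>2 = (x $ 1)\<^sup>2 + (x $ 2)\<^sup>2" for x :: "real^2"
      unfolding power2_norm_eq_inner by (simp add: inner_vec_def sum_2 power2_eq_square)
    have "integrable lborel (\<lambda>x. gauss h x * (norm x)\<^sup>2)"
      using m11(1,2) by (simp add: nrm distrib_left)
    then have 1: "integrable M (\<lambda>\<omega>. (norm (W t \<omega> - W s \<omega>))\<^sup>2)"
      by (subst (asm) I) auto
    have 2: "(\<integral>\<omega>. (W t \<omega> - W s \<omega>) $ i \<partial>M) = 0" for i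
      using E[of "\<lambda>x. x $ i"] m m1 exhaust_2[of i] by auto
    have 3: "(\<integral>\<omega>. (W t \<omega> - W s \<omega>) $ i * (W t \<omega> - W s \<omega>) $ j \<partial>M) = (if i = j then h else 0)" for i j
      using E[of "\<lambda>x. x $ i * x $ j"] m m11 m12 exhaust_2[of i] exhaust_2[of j]
      by (auto simp: power2_eq_square mult.commute)
    show ?thesis using 1 2 3 by (simp add: h_def)
  qed simp
  then show "integrable M (\<lambda>\<omega>. (norm (W t \<omega> - W s \<omega>))\<^sup>2)"
    and "(\<integral>\<omega>. (W t \<omega> - W s \<omega>) $ i \<partial>M) = 0"
    and "(\<integral>\<omega>. (W t \<omega> - W s \<omega>) $ i * (W t \<omega> - W s \<omega>) $ j \<partial>M) = (if i = j then t - s else 0)"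
    by auto
qed

end

section \<open>Second moments of a process with absolutely continuous drift\<close>

lemma norm_vec2: "(norm (x::real^2))\<^sup>2 = (x $ 1)\<^sup>2 + (x $ 2)\<^sup>2"
  unfolding power2_norm_eq_inner by (simp add: inner_vec_def sum_2 power2_eq_square)

lemma borel_measurable_component [measurable (raw)]:
  fixes f :: "'a \<Rightarrow> real^2"
  assumes "f \<in> borel_measurable N"
  shows "(\<lambda>x. f x $ i) \<in> borel_measurable N"
  using assms by (rule measurable_compose) (intro borel_measurable_continuous_onI continuous_intros)

lemma integrable_square_component:
  fixes U :: "'a \<Rightarrow> real^2"
  assumes [measurable]: "U \<in> borel_measurable N" and U: "integrable N (\<lambda>x. (norm (U x))\<^sup>2)"
  shows "integrable N (\<lambda>x. (U x $ i)\<^sup>2)"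
proof (rule Bochner_Integration.integrable_bound[OF U])
  show "(\<lambda>x. (U x $ i)\<^sup>2) \<in> borel_measurable N" by measurable
  have "(u $ i)\<^sup>2 \<le> (norm u)\<^sup>2" for u :: "real^2"
    using exhaust_2[of i] by (auto simp: norm_vec2)
  then show "AE x in N. norm ((U x $ i)\<^sup>2) \<le> norm ((norm (U x))\<^sup>2)" by simp
qed

lemma integrable_component_product:
  fixes U V :: "'a \<Rightarrow> real^2"
  assumes U: "U \<in> borel_measurable N" "integrable N (\<lambda>x. (norm (U x))\<^sup>2)"
    and V: "V \<in> borel_measurable N" "integrable N (\<lambda>x. (norm (V x))\<^sup>2)"
  shows "integrable N (\<lambda>x. U x $ i * V x $ j)"
  by (rule integral_Cauchy_Schwarz(1))
    (use integrable_square_component[OF U] integrable_square_component[OF V] U(1) V(1) in simp_all)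

lemma set_integral_component:
  fixes f :: "real \<Rightarrow> real^2"
  assumes f: "set_integrable lborel A f"
  shows "set_integrable lborel A (\<lambda>s. f s $ i)"
    and "(LINT s:A|lborel. f s) $ i = (LINT s:A|lborel. f s $ i)"
proof -
  have e: "(indicator A s *\<^sub>R f s) $ i = indicator A s *\<^sub>R (f s $ i)" for s by simp
  show "set_integrable lborel A (\<lambda>s. f s $ i)"
    using integrable_bounded_linear[OF bounded_linear_vec_nth[of i] f[unfolded set_integrable_def]]
    unfolding set_integrable_def e .
  show "(LINT s:A|lborel. f s) $ i = (LINT s:A|lborel. f s $ i)"
    using integral_bounded_linear[OF bounded_linear_vec_nth[of i] f[unfolded set_integrable_def]]
    unfolding set_lebesgue_integral_def e by simp
qed

context prob_space begin

lemma pair_time: "pair_sigma_finite (time T) M"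
  using finite_measure.sigma_finite_measure[OF finite_measure_time] sigma_finite_measure_axioms
  by (simp add: pair_sigma_finite_def)

lemma integrable_time_pairI:
  fixes f :: "real \<Rightarrow> 'a \<Rightarrow> real"
  assumes m: "(\<lambda>p. f (fst p) (snd p)) \<in> borel_measurable (borel \<Otimes>\<^sub>M M)" and nn: "\<And>t \<omega>. 0 \<le> f t \<omega>"
    and i: "\<And>t. t \<in> {0..T} \<Longrightarrow> integrable M (f t)" and e: "set_integrable lborel {0..T} (\<lambda>t. \<integral>\<omega>. f t \<omega> \<partial>M)"
  shows "integrable (time T \<Otimes>\<^sub>M M) (\<lambda>p. f (fst p) (snd p))"
proof -
  interpret tp: pair_sigma_finite "time T" M by (rule pair_time)
  show ?thesis
  proof (rule tp.Fubini_integrable)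
    show "(\<lambda>p. f (fst p) (snd p)) \<in> borel_measurable (time T \<Otimes>\<^sub>M M)" by (rule measurable_time[OF m])
    show "integrable (time T) (\<lambda>x. \<integral>y. norm (f (fst (x, y)) (snd (x, y))) \<partial>M)"
      using e nn by (simp add: integrable_time)
    show "AE x in time T. integrable M (\<lambda>y. f (fst (x, y)) (snd (x, y)))"
      using i by (intro AE_I2) (simp add: space_restrict_space)
  qed
qed

lemma expectation_set_integral:
  fixes f :: "real \<Rightarrow> 'a \<Rightarrow> real"
  assumes f: "integrable (time T \<Otimes>\<^sub>M M) (\<lambda>p. f (fst p) (snd p))"
  shows "integrable M (\<lambda>\<omega>. LINT t:{0..T}|lborel. f t \<omega>)"
    and "set_integrable lborel {0..T} (\<lambda>t. \<integral>\<omega>. f t \<omega> \<partial>M)"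
    and "(\<integral>\<omega>. (LINT t:{0..T}|lborel. f t \<omega>) \<partial>M) = (LINT t:{0..T}|lborel. \<integral>\<omega>. f t \<omega> \<partial>M)"
    and "AE t in time T. integrable M (f t)"
proof -
  interpret tp: pair_sigma_finite "time T" M by (rule pair_time)
  have f': "integrable (time T \<Otimes>\<^sub>M M) (case_prod f)" using f by (simp add: split_beta')
  show "integrable M (\<lambda>\<omega>. LINT t:{0..T}|lborel. f t \<omega>)"
    using tp.integrable_snd[OF f'] by (simp add: integral_time)
  show "set_integrable lborel {0..T} (\<lambda>t. \<integral>\<omega>. f t \<omega> \<partial>M)"
    using tp.integrable_fst[OF f'] by (simp add: integrable_time)
  show "(\<integral>\<omega>. (LINT t:{0..T}|lborel. f t \<omega>) \<partial>M) = (LINT t:{0..T}|lborel. \<integral>\<omega>. f t \<omega> \<partial>M)"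
    using tp.integral_snd[OF f'] tp.integral_fst[OF f'] by (simp add: integral_time)
  show "AE t in time T. integrable M (f t)" by (rule tp.AE_integrable_fst[OF f'])
qed

end

lemma AE_time_iff: "(AE t in time T. P t) \<longleftrightarrow> (AE t in lborel. t \<in> {0..T} \<longrightarrow> P t)"
  by (rule AE_restrict_space_iff) simp

lemma set_integral_cong_AE_time:
  fixes f g :: "real \<Rightarrow> real"
  assumes f: "set_integrable lborel {0..T} f" and g: "set_integrable lborel {0..T} g" and "AE t in time T. f t = g t"
  shows "(LINT t:{0..T}|lborel. f t) = (LINT t:{0..T}|lborel. g t)"
  unfolding integral_time[symmetric]
  using f g assms(3) unfolding integrable_time[symmetric] 
  by (intro integral_cong_AE borel_measurable_integrable)

context brownian begin

lemma W_moments: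
  assumes t: "0 \<le> t"
  shows "integrable M (\<lambda>\<omega>. (norm (W t \<omega>))\<^sup>2)" "(\<integral>\<omega>. W t \<omega> $ i \<partial>M) = 0"
    "(\<integral>\<omega>. W t \<omega> $ i * W t \<omega> $ j \<partial>M) = (if i = j then t else 0)"
    "(\<integral>\<omega>. (norm (W t \<omega>))\<^sup>2 \<partial>M) = 2 * t"
proof -
  have [measurable]: "W t \<in> borel_measurable M" "W 0 \<in> borel_measurable M" using W_measurable t by auto
  have ae: "AE \<omega> in M. W t \<omega> - W 0 \<omega> = W t \<omega>" using W_0 by eventually_elim simp
  have "integrable M (\<lambda>\<omega>. (norm (W t \<omega>))\<^sup>2) \<longleftrightarrow> integrable M (\<lambda>\<omega>. (norm (W t \<omega> - W 0 \<omega>))\<^sup>2)"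
  proof (rule integrable_cong_AE)
    show "AE \<omega> in M. (norm (W t \<omega>))\<^sup>2 = (norm (W t \<omega> - W 0 \<omega>))\<^sup>2" using ae by eventually_elim simp
  qed measurable
  then show i: "integrable M (\<lambda>\<omega>. (norm (W t \<omega>))\<^sup>2)" using increment_moments(1)[of 0 t] t by simp
  have "(\<integral>\<omega>. W t \<omega> $ i \<partial>M) = (\<integral>\<omega>. (W t \<omega> - W 0 \<omega>) $ i \<partial>M)"
  proof (rule integral_cong_AE)
    show "AE \<omega> in M. W t \<omega> $ i = (W t \<omega> - W 0 \<omega>) $ i" using ae by eventually_elim simp
  qed measurable
  then show "(\<integral>\<omega>. W t \<omega> $ i \<partial>M) = 0" using increment_moments(2)[of 0 t] t by simp
  have c: "(\<integral>\<omega>. W t \<omega> $ i * W t \<omega> $ j \<partial>M) = (if i = j then t else 0)" for i j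
  proof -
    have "(\<integral>\<omega>. W t \<omega> $ i * W t \<omega> $ j \<partial>M) = (\<integral>\<omega>. (W t \<omega> - W 0 \<omega>) $ i * (W t \<omega> - W 0 \<omega>) $ j \<partial>M)"
    proof (rule integral_cong_AE)
      show "AE \<omega> in M. W t \<omega> $ i * W t \<omega> $ j = (W t \<omega> - W 0 \<omega>) $ i * (W t \<omega> - W 0 \<omega>) $ j"
        using ae by eventually_elim simp
    qed measurable
    then show ?thesis using increment_moments(3)[of 0 t] t by simp
  qed
  show "(\<integral>\<omega>. W t \<omega> $ i * W t \<omega> $ j \<partial>M) = (if i = j then t else 0)" by (rule c)
  show "(\<integral>\<omega>. (norm (W t \<omega>))\<^sup>2 \<partial>M) = 2 * t"
    unfolding norm_vec2 using c[of 1 1] c[of 2 2] integrable_square_component[OF _ i]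
    by (simp add: power2_eq_square)
qed

lemma increment_orthogonal:
  fixes Y :: "'a \<Rightarrow> real^2"
  assumes st: "0 \<le> s" "s \<le> t" and Y: "Y \<in> borel_measurable (F s)" and Y2: "integrable M (\<lambda>\<omega>. (norm (Y \<omega>))\<^sup>2)"
  shows "(\<integral>\<omega>. Y \<omega> $ i * (W t \<omega> - W s \<omega>) $ j \<partial>M) = 0"
proof (cases "s = t")
  case False
  have Ym[measurable]: "Y \<in> borel_measurable M" by (rule measurable_F[OF Y])
  have Wm[measurable]: "W t \<in> borel_measurable M" "W s \<in> borel_measurable M" using W_measurable st by auto
  have ind: "indep_var borel Y borel (\<lambda>\<omega>. W t \<omega> - W s \<omega>)" using increment_indep[OF st(1) _ Y] False st by simp
  have "indep_var borel ((\<lambda>v. v $ i) \<circ> Y) borel ((\<lambda>v. v $ j) \<circ> (\<lambda>\<omega>. W t \<omega> - W s \<omega>))"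
    by (rule indep_var_compose[OF ind]) measurable
  then have ind': "indep_var borel (\<lambda>\<omega>. Y \<omega> $ i) borel (\<lambda>\<omega>. (W t \<omega> - W s \<omega>) $ j)" by (simp add: o_def)
  have iY: "integrable M Y" by (rule integrable_norm_of_square[OF Ym Y2])
  have iW: "integrable M (\<lambda>\<omega>. W t \<omega> - W s \<omega>)"
    by (rule integrable_norm_of_square(2)) (use increment_moments(1)[OF st] in simp_all)
  have "integrable M (\<lambda>\<omega>. Y \<omega> $ i)" "integrable M (\<lambda>\<omega>. (W t \<omega> - W s \<omega>) $ j)"
    using integrable_bounded_linear[OF bounded_linear_vec_nth iY] integrable_bounded_linear[OF bounded_linear_vec_nth iW] by blast+
  from indep_var_lebesgue_integral[OF ind' this] show ?thesis
    using increment_moments(2)[OF st] by simp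
qed simp

lemma W_joint: "(\<lambda>p. W (max 0 (fst p)) (snd p)) \<in> borel_measurable (borel \<Otimes>\<^sub>M M)"
proof -
  have "(\<lambda>(t, \<omega>). W (max 0 t) \<omega>) \<in> borel_measurable ((borel :: real measure) \<Otimes>\<^sub>M M)"
  proof (rule measurable_continuous_process)
    show "W (max 0 t) \<in> borel_measurable M" for t by (rule W_measurable) simp
    fix \<omega> assume "\<omega> \<in> space M"
    then show "continuous_on UNIV (\<lambda>t. W (max 0 t) \<omega>)"
      by (intro continuous_on_compose2[OF W_continuous, of \<omega> UNIV "\<lambda>t. max 0 t"] continuous_intros) auto
  qed
  then show ?thesis by (simp add: split_beta')
qed

text \<open>
  Ito's formula in expectation for products of components, without stochastic integrals. The process
  \<open>X - W\<close> is absolutely continuous, so the pathwise product rule applies to it. What remains are the terms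
  \<open>\<alpha> t (W T - W t)\<close>, whose expectation is zero because \<open>\<alpha> t\<close> is known at time \<open>t\<close>, and the moments of \<open>W\<close>.
\<close>

lemma ito_product:
  fixes X \<alpha> :: "real \<Rightarrow> 'a \<Rightarrow> real^2"
  assumes T: "0 \<le> T"
    and \<alpha>m: "(\<lambda>p. \<alpha> (fst p) (snd p)) \<in> borel_measurable (borel \<Otimes>\<^sub>M M)"
    and Xm: "(\<lambda>p. X (fst p) (snd p)) \<in> borel_measurable (borel \<Otimes>\<^sub>M M)"
    and \<alpha>F: "\<And>t. t \<in> {0..T} \<Longrightarrow> \<alpha> t \<in> borel_measurable (F t)"
    and X0F: "X0 \<in> borel_measurable (F 0)"
    and eq: "AE \<omega> in M. \<forall>t\<in>{0..T}. set_integrable lborel {0..t} (\<lambda>s. \<alpha> s \<omega>) \<and>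
        X t \<omega> = X0 \<omega> + (LINT s:{0..t}|lborel. \<alpha> s \<omega>) + W t \<omega>"
    and \<alpha>2: "integrable (time T \<Otimes>\<^sub>M M) (\<lambda>p. (norm (\<alpha> (fst p) (snd p)))\<^sup>2)"
    and X2: "integrable (time T \<Otimes>\<^sub>M M) (\<lambda>p. (norm (X (fst p) (snd p)))\<^sup>2)"
    and XT2: "integrable M (\<lambda>\<omega>. (norm (X T \<omega>))\<^sup>2)" and X02: "integrable M (\<lambda>\<omega>. (norm (X0 \<omega>))\<^sup>2)"
  shows "set_integrable lborel {0..T} (\<lambda>t. \<integral>\<omega>. \<alpha> t \<omega> $ i * X t \<omega> $ j + X t \<omega> $ i * \<alpha> t \<omega> $ j \<partial>M)"
    and "(\<integral>\<omega>. X T \<omega> $ i * X T \<omega> $ j \<partial>M) = (\<integral>\<omega>. X0 \<omega> $ i * X0 \<omega> $ j \<partial>M)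
      + (LINT t:{0..T}|lborel. \<integral>\<omega>. \<alpha> t \<omega> $ i * X t \<omega> $ j + X t \<omega> $ i * \<alpha> t \<omega> $ j \<partial>M) + (if i = j then T else 0)"
proof -
  let ?P = "time T \<Otimes>\<^sub>M M"
  let ?w = "\<lambda>t. W (max 0 t)"
  note m\<alpha> = measurable_time[OF \<alpha>m, of T] and mX = measurable_time[OF Xm, of T] and mw = measurable_time[OF W_joint, of T]
  have WTm: "W T \<in> borel_measurable M" "W 0 \<in> borel_measurable M" using W_measurable T by auto
  have mWT: "(\<lambda>p. W T (snd p)) \<in> borel_measurable ?P" by (rule measurable_compose[OF measurable_snd WTm(1)])
  have w2: "integrable ?P (\<lambda>p. (norm (?w (fst p) (snd p)))\<^sup>2)"
  proof (rule integrable_time_pairI)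
    show "(\<lambda>p. (norm (?w (fst p) (snd p)))\<^sup>2) \<in> borel_measurable (borel \<Otimes>\<^sub>M M)"
      using W_joint by measurable
    show "integrable M (\<lambda>\<omega>. (norm (?w t \<omega>))\<^sup>2)" for t by (rule W_moments) simp
    have "set_integrable lborel {0..T} (\<lambda>t. 2 * max 0 t)"
      by (rule set_integrable_continuous_Icc) (intro continuous_intros)
    then show "set_integrable lborel {0..T} (\<lambda>t. \<integral>\<omega>. (norm (?w t \<omega>))\<^sup>2 \<partial>M)"
      using W_moments(4) by simp
  qed simp
  have WT2: "integrable ?P (\<lambda>p. (norm (W T (snd p)))\<^sup>2)"
  proof (rule integrable_time_pairI[where f = "\<lambda>t \<omega>. (norm (W T \<omega>))\<^sup>2"])
    show "(\<lambda>p. (norm (W T (snd p)))\<^sup>2) \<in> borel_measurable (borel \<Otimes>\<^sub>M M)" using WTm(1) by measurable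
    show "set_integrable lborel {0..T} (\<lambda>t. \<integral>\<omega>. (norm (W T \<omega>))\<^sup>2 \<partial>M)"
      by (rule set_integrable_continuous_Icc) (intro continuous_intros)
  qed (use W_moments(1)[OF T] in simp_all)
  note prod = integrable_component_product
  have iaX: "integrable ?P (\<lambda>p. \<alpha> (fst p) (snd p) $ i * X (fst p) (snd p) $ j)" for i j by (rule prod[OF m\<alpha> \<alpha>2 mX X2])
  have iaw: "integrable ?P (\<lambda>p. \<alpha> (fst p) (snd p) $ i * ?w (fst p) (snd p) $ j)" for i j by (rule prod[OF m\<alpha> \<alpha>2 mw w2])
  have iaW: "integrable ?P (\<lambda>p. \<alpha> (fst p) (snd p) $ i * W T (snd p) $ j)" for i j by (rule prod[OF m\<alpha> \<alpha>2 mWT WT2])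
  define g where "g t \<omega> = \<alpha> t \<omega> $ i * X t \<omega> $ j + X t \<omega> $ i * \<alpha> t \<omega> $ j" for t \<omega>
  define d where "d i j t \<omega> = \<alpha> t \<omega> $ i * W T \<omega> $ j - \<alpha> t \<omega> $ i * ?w t \<omega> $ j" for i j t \<omega>
  have ig: "integrable ?P (\<lambda>p. g (fst p) (snd p))"
    unfolding g_def using Bochner_Integration.integrable_add[OF iaX[of i j] iaX[of j i]] by (simp add: mult.commute)
  have id: "integrable ?P (\<lambda>p. d i j (fst p) (snd p))" for i j
    unfolding d_def by (rule Bochner_Integration.integrable_diff[OF iaW iaw])
  define G where "G t \<omega> = g t \<omega> + (d i j t \<omega> + d j i t \<omega>)" for t \<omega>
  have iG: "integrable ?P (\<lambda>p. G (fst p) (snd p))"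
    unfolding G_def by (intro Bochner_Integration.integrable_add ig id)
  show "set_integrable lborel {0..T} (\<lambda>t. \<integral>\<omega>. \<alpha> t \<omega> $ i * X t \<omega> $ j + X t \<omega> $ i * \<alpha> t \<omega> $ j \<partial>M)"
    using expectation_set_integral(2)[OF ig] by (simp add: g_def)
  have d0: "AE t in time T. integrable M (d i j t) \<and> (\<integral>\<omega>. d i j t \<omega> \<partial>M) = 0" for i j
    using expectation_set_integral(4)[where f = "\<lambda>t \<omega>. (norm (\<alpha> t \<omega>))\<^sup>2", OF \<alpha>2] unfolding AE_time_iff
  proof eventually_elim
    case (elim t)
    show ?case
    proof
      assume t: "t \<in> {0..T}"
      then have Wt: "W t \<in> borel_measurable M" and am: "\<alpha> t \<in> borel_measurable M"
        using W_measurable measurable_F[OF \<alpha>F] by auto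
      have a2: "integrable M (\<lambda>\<omega>. (norm (\<alpha> t \<omega>))\<^sup>2)" using elim t by simp
      have D2: "integrable M (\<lambda>\<omega>. (norm (W T \<omega> - W t \<omega>))\<^sup>2)" using increment_moments(1)[of t T] t by simp
      have e: "d i j t \<omega> = \<alpha> t \<omega> $ i * (W T \<omega> - W t \<omega>) $ j" for \<omega> using t by (simp add: d_def algebra_simps)
      show "integrable M (d i j t) \<and> (\<integral>\<omega>. d i j t \<omega> \<partial>M) = 0"
        unfolding e using increment_orthogonal[OF _ _ \<alpha>F[OF t] a2, of T i j] t
          prod[OF am a2 _ D2, of i j] WTm(1) Wt by simp
    qed
  qed
  have EG: "(LINT t:{0..T}|lborel. \<integral>\<omega>. G t \<omega> \<partial>M) = (LINT t:{0..T}|lborel. \<integral>\<omega>. g t \<omega> \<partial>M)"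
  proof (rule set_integral_cong_AE_time[OF expectation_set_integral(2)[OF iG] expectation_set_integral(2)[OF ig]])
    show "AE t in time T. (\<integral>\<omega>. G t \<omega> \<partial>M) = (\<integral>\<omega>. g t \<omega> \<partial>M)"
      using expectation_set_integral(4)[OF ig] d0[of i j] d0[of j i]
      by eventually_elim (simp add: G_def)
  qed
  have X0m: "X0 \<in> borel_measurable M" by (rule measurable_F[OF X0F])
  have x0w: "(\<integral>\<omega>. X0 \<omega> $ i * W T \<omega> $ j \<partial>M) = 0" "integrable M (\<lambda>\<omega>. X0 \<omega> $ i * W T \<omega> $ j)" for i j
  proof -
    have "(\<integral>\<omega>. X0 \<omega> $ i * W T \<omega> $ j \<partial>M) = (\<integral>\<omega>. X0 \<omega> $ i * (W T \<omega> - W 0 \<omega>) $ j \<partial>M)"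
    proof (rule integral_cong_AE)
      show "AE \<omega> in M. X0 \<omega> $ i * W T \<omega> $ j = X0 \<omega> $ i * (W T \<omega> - W 0 \<omega>) $ j"
        using W_0 by eventually_elim simp
    qed (use X0m WTm in measurable)
    then show "(\<integral>\<omega>. X0 \<omega> $ i * W T \<omega> $ j \<partial>M) = 0"
      using increment_orthogonal[OF _ T X0F X02, of i j] by simp
    show "integrable M (\<lambda>\<omega>. X0 \<omega> $ i * W T \<omega> $ j)" by (rule prod[OF X0m X02 WTm(1) W_moments(1)[OF T]])
  qed
  have path: "AE \<omega> in M. X T \<omega> $ i * X T \<omega> $ j = X0 \<omega> $ i * X0 \<omega> $ j + X0 \<omega> $ i * W T \<omega> $ j + X0 \<omega> $ j * W T \<omega> $ i
      + W T \<omega> $ i * W T \<omega> $ j + (LINT t:{0..T}|lborel. G t \<omega>)"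
    using eq
  proof eventually_elim
    case (elim \<omega>)
    let ?Y = "\<lambda>k t. X t \<omega> $ k - W t \<omega> $ k"
    have aI: "set_integrable lborel {0..t} (\<lambda>s. \<alpha> s \<omega>)" if "t \<in> {0..T}" for t using elim that by blast
    have ai: "set_integrable lborel {0..T} (\<lambda>s. \<alpha> s \<omega> $ k)" for k
      by (rule set_integral_component(1)[OF aI]) (use T in simp)
    have Y: "?Y k t = X0 \<omega> $ k + (LINT s:{0..t}|lborel. \<alpha> s \<omega> $ k)" if "t \<in> {0..T}" for k t
      using elim that set_integral_component(2)[OF aI[OF that], of k] by (simp add: bspec[OF elim that])
    have YT: "?Y k T = X0 \<omega> $ k + (LINT s:{0..T}|lborel. \<alpha> s \<omega> $ k)" for k using Y[of T] T by simp
    note pr = product_rule[OF T ai[of i] ai[of j] Y Y]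
    have "(LINT t:{0..T}|lborel. G t \<omega>) = (LINT t:{0..T}|lborel. (\<alpha> t \<omega> $ i * ?Y j t + ?Y i t * \<alpha> t \<omega> $ j)
        + (\<alpha> t \<omega> $ i * W T \<omega> $ j + \<alpha> t \<omega> $ j * W T \<omega> $ i))"
      by (intro set_lebesgue_integral_cong) (auto simp: G_def g_def d_def algebra_simps max_def)
    also have "\<dots> = (LINT t:{0..T}|lborel. \<alpha> t \<omega> $ i * ?Y j t + ?Y i t * \<alpha> t \<omega> $ j)
        + ((LINT t:{0..T}|lborel. \<alpha> t \<omega> $ i) * W T \<omega> $ j + (LINT t:{0..T}|lborel. \<alpha> t \<omega> $ j) * W T \<omega> $ i)"
      using pr(1) ai by simp
    finally have "(LINT t:{0..T}|lborel. G t \<omega>) = ?Y i T * ?Y j T - X0 \<omega> $ i * X0 \<omega> $ j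
        + ((?Y i T - X0 \<omega> $ i) * W T \<omega> $ j + (?Y j T - X0 \<omega> $ j) * W T \<omega> $ i)"
      using pr(2) YT[of i] YT[of j] by simp
    then show ?case by (simp add: algebra_simps)
  qed
  have iX0: "integrable M (\<lambda>\<omega>. X0 \<omega> $ i * X0 \<omega> $ j)" by (rule prod[OF X0m X02 X0m X02])
  have iWW: "integrable M (\<lambda>\<omega>. W T \<omega> $ i * W T \<omega> $ j)" by (rule prod[OF WTm(1) W_moments(1)[OF T] WTm(1) W_moments(1)[OF T]])
  have XTm: "X T \<in> borel_measurable M"
    using measurable_compose[OF measurable_Pair1' Xm, of T] by simp
  have "(\<integral>\<omega>. X T \<omega> $ i * X T \<omega> $ j \<partial>M) = (\<integral>\<omega>. X0 \<omega> $ i * X0 \<omega> $ j + X0 \<omega> $ i * W T \<omega> $ j + X0 \<omega> $ j * W T \<omega> $ i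
      + W T \<omega> $ i * W T \<omega> $ j + (LINT t:{0..T}|lborel. G t \<omega>) \<partial>M)"
  proof (rule integral_cong_AE[OF _ _ path])
    show "(\<lambda>\<omega>. X T \<omega> $ i * X T \<omega> $ j) \<in> borel_measurable M" using XTm by measurable
    show "(\<lambda>\<omega>. X0 \<omega> $ i * X0 \<omega> $ j + X0 \<omega> $ i * W T \<omega> $ j + X0 \<omega> $ j * W T \<omega> $ i
      + W T \<omega> $ i * W T \<omega> $ j + (LINT t:{0..T}|lborel. G t \<omega>)) \<in> borel_measurable M"
      by (intro borel_measurable_integrable Bochner_Integration.integrable_add iX0 x0w iWW expectation_set_integral(1)[OF iG])
  qed
  also have "\<dots> = (\<integral>\<omega>. X0 \<omega> $ i * X0 \<omega> $ j \<partial>M) + (if i = j then T else 0) + (LINT t:{0..T}|lborel. \<integral>\<omega>. g t \<omega> \<partial>M)"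
    using iX0 x0w iWW expectation_set_integral(1,3)[OF iG] EG W_moments(3)[OF T] by simp
  finally show "(\<integral>\<omega>. X T \<omega> $ i * X T \<omega> $ j \<partial>M) = (\<integral>\<omega>. X0 \<omega> $ i * X0 \<omega> $ j \<partial>M)
      + (LINT t:{0..T}|lborel. \<integral>\<omega>. \<alpha> t \<omega> $ i * X t \<omega> $ j + X t \<omega> $ i * \<alpha> t \<omega> $ j \<partial>M) + (if i = j then T else 0)"
    by (simp add: g_def)
qed

end

lemma inner_matrix_plane: "x \<bullet> (A *v y) = A$1$1 * (x$1 * y$1) + A$1$2 * (x$1 * y$2) + A$2$1 * (x$2 * y$1) + A$2$2 * (x$2 * y$2)"
  for A :: "real^2^2"
  by (simp add: inner_vec_def matrix_vector_mult_def sum_2 algebra_simps)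

lemma inner_plane: "x \<bullet> y = x$1 * y$1 + x$2 * y$2" for x y :: "real^2"
  by (simp add: inner_vec_def sum_2)

lemma cesaro_integral:
  fixes g :: "real \<Rightarrow> real"
  assumes g: "\<And>T. set_integrable lborel {0..T} g" and lim: "(g \<longlongrightarrow> \<kappa>) at_top"
  shows "((\<lambda>T. (LINT t:{0..T}|lborel. g t) / T) \<longlongrightarrow> \<kappa>) at_top"
proof (rule tendstoI)
  fix \<epsilon> :: real assume \<epsilon>: "0 < \<epsilon>"
  have c: "set_integrable lborel {0..T} (\<lambda>_. k)" for T k :: real
    by (rule set_integrable_continuous_Icc) (intro continuous_intros)
  have i: "set_integrable lborel {0..T} (\<lambda>t. \<bar>g t - \<kappa>\<bar>)" for T
    using set_integral_diff(1)[OF g c] by (rule set_integrable_abs)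
  obtain t0 where t0: "0 \<le> t0" "\<And>t. t \<ge> t0 \<Longrightarrow> \<bar>g t - \<kappa>\<bar> < \<epsilon> / 2"
  proof -
    have "\<forall>\<^sub>F t in at_top. dist (g t) \<kappa> < \<epsilon> / 2" using lim \<epsilon> by (intro tendstoD) auto
    then obtain t1 where "\<And>t. t \<ge> t1 \<Longrightarrow> dist (g t) \<kappa> < \<epsilon> / 2" by (auto simp: eventually_at_top_linorder)
    then show ?thesis by (intro that[of "max 0 t1"]) (auto simp: dist_real_def)
  qed
  define C where "C = (LINT t:{0..t0}|lborel. \<bar>g t - \<kappa>\<bar>)"
  have bound: "\<bar>(LINT t:{0..T}|lborel. g t) - \<kappa> * T\<bar> \<le> C + \<epsilon> / 2 * T" if T: "T \<ge> t0" for T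
  proof -
    have T0: "0 \<le> T" using T t0(1) by simp
    have "(LINT t:{0..T}|lborel. g t) - \<kappa> * T = (LINT t:{0..T}|lborel. g t - \<kappa>)"
      using g T0 by (subst set_integral_diff(2)[OF g c]) (simp add: set_integral_const)
    also have "\<bar>\<dots>\<bar> \<le> (LINT t:{0..T}|lborel. \<bar>g t - \<kappa>\<bar>)"
      unfolding set_lebesgue_integral_def
      by (rule order_trans[OF integral_abs_bound]) (simp add: abs_mult)
    also have "\<dots> \<le> (\<integral>t. indicator {0..t0} t * \<bar>g t - \<kappa>\<bar> + indicator {0..T} t * (\<epsilon> / 2) \<partial>lborel)"
      unfolding set_lebesgue_integral_def
    proof (rule integral_mono)
      show "integrable lborel (\<lambda>t. indicator {0..T} t *\<^sub>R \<bar>g t - \<kappa>\<bar>)" using i by (simp add: set_integrable_def)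
      show "integrable lborel (\<lambda>t. indicator {0..t0} t * \<bar>g t - \<kappa>\<bar> + indicator {0..T} t * (\<epsilon> / 2))"
        using i[of t0] c[of T "\<epsilon> / 2"] by (auto simp: set_integrable_def)
      show "indicator {0..T} t *\<^sub>R \<bar>g t - \<kappa>\<bar> \<le> indicator {0..t0} t * \<bar>g t - \<kappa>\<bar> + indicator {0..T} t * (\<epsilon> / 2)" for t
        using t0(2)[of t] T \<epsilon> by (auto simp: indicator_def)
    qed
    also have "\<dots> = C + \<epsilon> / 2 * T"
      using i[of t0] c[of T "\<epsilon> / 2"] T0 by (simp add: set_integrable_def set_lebesgue_integral_def C_def)
    finally show ?thesis .
  qed
  have "\<forall>\<^sub>F T in at_top. T > max t0 (2 * C / \<epsilon>) \<and> T > 0" by (intro eventually_conj eventually_gt_at_top)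
  then show "\<forall>\<^sub>F T in at_top. dist ((LINT t:{0..T}|lborel. g t) / T) \<kappa> < \<epsilon>"
  proof eventually_elim
    case (elim T)
    then have T: "T > 0" "T \<ge> t0" "2 * C < \<epsilon> * T" using \<epsilon> by (auto simp: field_simps)
    have "(LINT t:{0..T}|lborel. g t) / T - \<kappa> = ((LINT t:{0..T}|lborel. g t) - \<kappa> * T) / T"
      using T by (simp add: field_simps)
    then have "dist ((LINT t:{0..T}|lborel. g t) / T) \<kappa> = \<bar>(LINT t:{0..T}|lborel. g t) - \<kappa> * T\<bar> / T"
      using T by (simp add: dist_real_def abs_divide)
    also have "\<dots> \<le> (C + \<epsilon> / 2 * T) / T" using bound[OF T(2)] T by (intro divide_right_mono) auto
    also have "\<dots> < \<epsilon>" using T by (simp add: field_simps)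
    finally show ?case .
  qed
qed

text \<open>
  A Brownian motion plus an absolutely continuous drift, with the integrability that makes second
  moments absolutely continuous in time.
\<close>

locale drift_process = brownian M F W
  for M :: "'a measure" and F and W :: "real \<Rightarrow> 'a \<Rightarrow> real^2" +
  fixes X \<alpha> :: "real \<Rightarrow> 'a \<Rightarrow> real^2" and X0 :: "'a \<Rightarrow> real^2"
  assumes \<alpha>m: "(\<lambda>p. \<alpha> (fst p) (snd p)) \<in> borel_measurable (borel \<Otimes>\<^sub>M M)"
    and Xm: "(\<lambda>p. X (fst p) (snd p)) \<in> borel_measurable (borel \<Otimes>\<^sub>M M)"
    and \<alpha>F: "\<And>t. 0 \<le> t \<Longrightarrow> \<alpha> t \<in> borel_measurable (F t)"
    and X0F: "X0 \<in> borel_measurable (F 0)"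
    and eq: "AE \<omega> in M. \<forall>t\<ge>0. set_integrable lborel {0..t} (\<lambda>s. \<alpha> s \<omega>) \<and>
        X t \<omega> = X0 \<omega> + (LINT s:{0..t}|lborel. \<alpha> s \<omega>) + W t \<omega>"
    and \<alpha>2: "\<And>T. 0 \<le> T \<Longrightarrow> integrable (time T \<Otimes>\<^sub>M M) (\<lambda>p. (norm (\<alpha> (fst p) (snd p)))\<^sup>2)"
    and X2: "\<And>T. 0 \<le> T \<Longrightarrow> integrable (time T \<Otimes>\<^sub>M M) (\<lambda>p. (norm (X (fst p) (snd p)))\<^sup>2)"
    and Xt2: "\<And>t. 0 \<le> t \<Longrightarrow> integrable M (\<lambda>\<omega>. (norm (X t \<omega>))\<^sup>2)" and X02: "integrable M (\<lambda>\<omega>. (norm (X0 \<omega>))\<^sup>2)"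
begin

lemma X_measurable: "X t \<in> borel_measurable M" and \<alpha>_measurable: "\<alpha> t \<in> borel_measurable M"
  using measurable_compose[OF measurable_Pair1' Xm, of t] measurable_compose[OF measurable_Pair1' \<alpha>m, of t] by simp_all

lemma X0_measurable: "X0 \<in> borel_measurable M" by (rule measurable_F[OF X0F])

lemma second_moment_evolution:
  assumes T: "0 \<le> T"
  shows "set_integrable lborel {0..T} (\<lambda>t. \<integral>\<omega>. \<alpha> t \<omega> $ i * X t \<omega> $ j + X t \<omega> $ i * \<alpha> t \<omega> $ j \<partial>M)"
    and "(\<integral>\<omega>. X T \<omega> $ i * X T \<omega> $ j \<partial>M) = (\<integral>\<omega>. X0 \<omega> $ i * X0 \<omega> $ j \<partial>M)
      + (LINT t:{0..T}|lborel. \<integral>\<omega>. \<alpha> t \<omega> $ i * X t \<omega> $ j + X t \<omega> $ i * \<alpha> t \<omega> $ j \<partial>M) + (if i = j then T else 0)"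
proof -
  have "AE \<omega> in M. \<forall>t\<in>{0..T}. set_integrable lborel {0..t} (\<lambda>s. \<alpha> s \<omega>) \<and>
        X t \<omega> = X0 \<omega> + (LINT s:{0..t}|lborel. \<alpha> s \<omega>) + W t \<omega>"
    using eq by eventually_elim simp
  note I = ito_product[OF T \<alpha>m Xm \<alpha>F X0F this \<alpha>2[OF T] X2[OF T] Xt2[OF T] X02, of i j]
  show "set_integrable lborel {0..T} (\<lambda>t. \<integral>\<omega>. \<alpha> t \<omega> $ i * X t \<omega> $ j + X t \<omega> $ i * \<alpha> t \<omega> $ j \<partial>M)"
    by (rule I(1)) simp
  show "(\<integral>\<omega>. X T \<omega> $ i * X T \<omega> $ j \<partial>M) = (\<integral>\<omega>. X0 \<omega> $ i * X0 \<omega> $ j \<partial>M)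
      + (LINT t:{0..T}|lborel. \<integral>\<omega>. \<alpha> t \<omega> $ i * X t \<omega> $ j + X t \<omega> $ i * \<alpha> t \<omega> $ j \<partial>M) + (if i = j then T else 0)"
    by (rule I(2)) simp
qed

lemma X_integrable: "0 \<le> t \<Longrightarrow> integrable M (X t)"
  by (rule integrable_norm_of_square(2)[OF X_measurable Xt2])

lemma X0_integrable: "integrable M X0"
  by (rule integrable_norm_of_square(2)[OF X0_measurable X02])

lemma integrable_component: "integrable M U \<Longrightarrow> integrable M (\<lambda>\<omega>. U \<omega> $ i)" for U :: "'a \<Rightarrow> real^2"
  by (rule integrable_bounded_linear[OF bounded_linear_vec_nth])

lemma expectation_component: "integrable M U \<Longrightarrow> (\<integral>\<omega>. U \<omega> \<partial>M) $ i = (\<integral>\<omega>. U \<omega> $ i \<partial>M)" for U :: "'a \<Rightarrow> real^2"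
  using integral_bounded_linear[OF bounded_linear_vec_nth] by fastforce

lemma mean_evolution:
  assumes T: "0 \<le> T"
  shows "set_integrable lborel {0..T} (\<lambda>t. \<integral>\<omega>. \<alpha> t \<omega> $ i \<partial>M)"
    and "(\<integral>\<omega>. X T \<omega> $ i \<partial>M) = (\<integral>\<omega>. X0 \<omega> $ i \<partial>M) + (LINT t:{0..T}|lborel. \<integral>\<omega>. \<alpha> t \<omega> $ i \<partial>M)"
proof -
  have c2: "integrable (time T \<Otimes>\<^sub>M M) (\<lambda>p. 1\<^sup>2 :: real)"
    by (rule integrable_time_pairI[where f = "\<lambda>_ _. 1\<^sup>2"]) (auto intro!: set_integrable_continuous_Icc continuous_intros)
  have a: "integrable (time T \<Otimes>\<^sub>M M) (\<lambda>p. \<alpha> (fst p) (snd p) $ i)"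
    using integral_Cauchy_Schwarz(1)[OF _ _ c2 integrable_square_component[OF measurable_time[OF \<alpha>m] \<alpha>2[OF T], of i]]
      measurable_time[OF \<alpha>m, of T] by simp
  note E = expectation_set_integral[where f = "\<lambda>t \<omega>. \<alpha> t \<omega> $ i", OF a]
  show "set_integrable lborel {0..T} (\<lambda>t. \<integral>\<omega>. \<alpha> t \<omega> $ i \<partial>M)" by (rule E(2))
  have Wm: "W T \<in> borel_measurable M" by (rule W_measurable[OF T])
  have iW: "integrable M (\<lambda>\<omega>. W T \<omega> $ i)"
    by (rule integrable_component[OF integrable_norm_of_square(2)[OF Wm W_moments(1)[OF T]]])
  have "(\<integral>\<omega>. X T \<omega> $ i \<partial>M) = (\<integral>\<omega>. X0 \<omega> $ i + (LINT t:{0..T}|lborel. \<alpha> t \<omega> $ i) + W T \<omega> $ i \<partial>M)"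
  proof (rule integral_cong_AE)
    show "AE \<omega> in M. X T \<omega> $ i = X0 \<omega> $ i + (LINT t:{0..T}|lborel. \<alpha> t \<omega> $ i) + W T \<omega> $ i"
      using eq
    proof eventually_elim
      case (elim \<omega>)
      then have *: "set_integrable lborel {0..T} (\<lambda>s. \<alpha> s \<omega>)"
        and "X T \<omega> = X0 \<omega> + (LINT s:{0..T}|lborel. \<alpha> s \<omega>) + W T \<omega>" using T by blast+
      then show ?case using set_integral_component(2)[OF *] by simp
    qed
    show "(\<lambda>\<omega>. X T \<omega> $ i) \<in> borel_measurable M" using X_measurable by measurable
  qed (intro borel_measurable_integrable Bochner_Integration.integrable_add integrable_component[OF X0_integrable] E(1) iW)
  then show "(\<integral>\<omega>. X T \<omega> $ i \<partial>M) = (\<integral>\<omega>. X0 \<omega> $ i \<partial>M) + (LINT t:{0..T}|lborel. \<integral>\<omega>. \<alpha> t \<omega> $ i \<partial>M)"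
    using E(1,3) iW integrable_component[OF X0_integrable] W_moments(2)[OF T] by simp
qed

lemma AE_square_integrable:
  assumes T: "0 \<le> T"
  shows "AE t in time T. integrable M (\<lambda>\<omega>. (norm (\<alpha> t \<omega>))\<^sup>2)"
  by (rule expectation_set_integral(4)[where f = "\<lambda>t \<omega>. (norm (\<alpha> t \<omega>))\<^sup>2", OF \<alpha>2[OF T]])

lemma law_value:
  fixes U :: "'a \<Rightarrow> real^2"
  assumes U: "U \<in> borel_measurable M" "integrable M (\<lambda>\<omega>. (norm (U \<omega>))\<^sup>2)"
  shows "mean (law M U) = (\<integral>\<omega>. U \<omega> \<partial>M)"
    and "(\<integral>x. x \<bullet> (A *v x) \<partial>law M U) = A$1$1 * (\<integral>\<omega>. U \<omega> $ 1 * U \<omega> $ 1 \<partial>M) + A$1$2 * (\<integral>\<omega>. U \<omega> $ 1 * U \<omega> $ 2 \<partial>M)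
      + A$2$1 * (\<integral>\<omega>. U \<omega> $ 2 * U \<omega> $ 1 \<partial>M) + A$2$2 * (\<integral>\<omega>. U \<omega> $ 2 * U \<omega> $ 2 \<partial>M)"
proof -
  show "mean (law M U) = (\<integral>\<omega>. U \<omega> \<partial>M)" unfolding mean_def using U(1) by (subst integral_distr) auto
  have "(\<lambda>x::real^2. x \<bullet> (A *v x)) \<in> borel_measurable borel" unfolding inner_matrix_plane by measurable
  then have "(\<integral>x. x \<bullet> (A *v x) \<partial>law M U) = (\<integral>\<omega>. U \<omega> \<bullet> (A *v U \<omega>) \<partial>M)" using U(1) by (subst integral_distr) auto
  then show "(\<integral>x. x \<bullet> (A *v x) \<partial>law M U) = A$1$1 * (\<integral>\<omega>. U \<omega> $ 1 * U \<omega> $ 1 \<partial>M) + A$1$2 * (\<integral>\<omega>. U \<omega> $ 1 * U \<omega> $ 2 \<partial>M)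
      + A$2$1 * (\<integral>\<omega>. U \<omega> $ 2 * U \<omega> $ 1 \<partial>M) + A$2$2 * (\<integral>\<omega>. U \<omega> $ 2 * U \<omega> $ 2 \<partial>M)"
    unfolding inner_matrix_plane using integrable_component_product[OF U U] by simp
qed

text \<open>
  The function \<open>lq_value\<close> depends on the law only through first and second moments, so its evolution
  along a controlled process follows from theirs; the trace is the contribution of the noise.
\<close>

lemma value_evolution:
  fixes A B :: "2 \<Rightarrow> real^2^2" and b :: "2 \<Rightarrow> real^2"
  assumes T: "0 \<le> T" and symA: "transpose (A k) = A k" and symB: "transpose (B k) = B k"
  defines "g \<equiv> \<lambda>t. \<integral>\<omega>. \<alpha> t \<omega> \<bullet> (2 *\<^sub>R (A k *v X t \<omega>) + 2 *\<^sub>R (B k *v (\<integral>\<omega>. X t \<omega> \<partial>M)) + b k) \<partial>M"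
  shows "set_integrable lborel {0..T} g"
    and "lq_value A B b k (law M (X T)) = lq_value A B b k (law M X0) + (LINT t:{0..T}|lborel. g t) + T * trace (A k)"
proof -
  define a where "a i t = (\<integral>\<omega>. \<alpha> t \<omega> $ i \<partial>M)" for i t
  define m where "m i t = (\<integral>\<omega>. X t \<omega> $ i \<partial>M)" for i t
  define m0 where "m0 i = (\<integral>\<omega>. X0 \<omega> $ i \<partial>M)" for i
  define c where "c i j t = (\<integral>\<omega>. \<alpha> t \<omega> $ i * X t \<omega> $ j + X t \<omega> $ i * \<alpha> t \<omega> $ j \<partial>M)" for i j t
  define A' B' b' where "A' = A k" and "B' = B k" and "b' = b k"
  have A21: "A' $ 2 $ 1 = A' $ 1 $ 2" and B21: "B' $ 2 $ 1 = B' $ 1 $ 2"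
    using arg_cong[OF symA, of "\<lambda>M. M $ 1 $ 2"] arg_cong[OF symB, of "\<lambda>M. M $ 1 $ 2"]
    by (simp_all add: transpose_def A'_def B'_def)
  have me: "set_integrable lborel {0..t} (a i)" "m i t = m0 i + (LINT s:{0..t}|lborel. a i s)" if "0 \<le> t" for i t
    using mean_evolution[OF that, of i] by (simp_all add: a_def[abs_def] m_def m0_def)
  have mm: "set_integrable lborel {0..T} (\<lambda>s. a i s * m j s + m i s * a j s)"
    "m i T * m j T = m0 i * m0 j + (LINT s:{0..T}|lborel. a i s * m j s + m i s * a j s)" for i j
    by (rule product_rule[OF T me(1)[OF T] me(1)[OF T]]; use me(2) in simp)+
  have cc: "set_integrable lborel {0..T} (c i j)"
    "(\<integral>\<omega>. X T \<omega> $ i * X T \<omega> $ j \<partial>M) = (\<integral>\<omega>. X0 \<omega> $ i * X0 \<omega> $ j \<partial>M) + (LINT t:{0..T}|lborel. c i j t) + (if i = j then T else 0)" for i j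
    using second_moment_evolution[OF T, of i j] by (simp_all add: c_def[abs_def])
  define h where "h t = (A'$1$1 * c 1 1 t + A'$1$2 * c 1 2 t + A'$2$1 * c 2 1 t + A'$2$2 * c 2 2 t)
     + (b'$1 * a 1 t + b'$2 * a 2 t)
     + (B'$1$1 * (a 1 t * m 1 t + m 1 t * a 1 t) + B'$1$2 * (a 1 t * m 2 t + m 1 t * a 2 t)
      + B'$2$1 * (a 2 t * m 1 t + m 2 t * a 1 t) + B'$2$2 * (a 2 t * m 2 t + m 2 t * a 2 t))" for t
  have hi: "set_integrable lborel {0..T} h"
    unfolding h_def by (intro set_integral_add(1) set_integrable_mult_right cc(1) me(1)[OF T] mm(1))
  have hI: "(LINT t:{0..T}|lborel. h t) = (A'$1$1 * (LINT t:{0..T}|lborel. c 1 1 t) + A'$1$2 * (LINT t:{0..T}|lborel. c 1 2 t)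
      + A'$2$1 * (LINT t:{0..T}|lborel. c 2 1 t) + A'$2$2 * (LINT t:{0..T}|lborel. c 2 2 t))
     + (b'$1 * (LINT t:{0..T}|lborel. a 1 t) + b'$2 * (LINT t:{0..T}|lborel. a 2 t))
     + (B'$1$1 * (LINT t:{0..T}|lborel. a 1 t * m 1 t + m 1 t * a 1 t) + B'$1$2 * (LINT t:{0..T}|lborel. a 1 t * m 2 t + m 1 t * a 2 t)
      + B'$2$1 * (LINT t:{0..T}|lborel. a 2 t * m 1 t + m 2 t * a 1 t) + B'$2$2 * (LINT t:{0..T}|lborel. a 2 t * m 2 t + m 2 t * a 2 t))"
    unfolding h_def
    by (simp only: set_integral_add set_integrable_mult_right set_integral_mult_right cc(1) me(1)[OF T] mm(1))
  have gh: "AE t in time T. g t = h t"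
    using AE_square_integrable[OF T] unfolding AE_time_iff
  proof eventually_elim
    case (elim t)
    show ?case
    proof
      assume t: "t \<in> {0..T}"
      then have a2: "integrable M (\<lambda>\<omega>. (norm (\<alpha> t \<omega>))\<^sup>2)" and x2: "integrable M (\<lambda>\<omega>. (norm (X t \<omega>))\<^sup>2)"
        using elim Xt2 by auto
      have ia: "integrable M (\<lambda>\<omega>. \<alpha> t \<omega> $ i)" for i
        by (rule integrable_component[OF integrable_norm_of_square(2)[OF \<alpha>_measurable a2]])
      have iX: "integrable M (X t)" using X_integrable t by simp
      have iaX: "integrable M (\<lambda>\<omega>. \<alpha> t \<omega> $ i * X t \<omega> $ j)" for i j
        by (rule integrable_component_product[OF \<alpha>_measurable a2 X_measurable x2])
      have iXa: "integrable M (\<lambda>\<omega>. X t \<omega> $ i * \<alpha> t \<omega> $ j)" for i j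
        using iaX[of j i] by (simp add: mult.commute)
      define p where "p i j = (\<integral>\<omega>. \<alpha> t \<omega> $ i * X t \<omega> $ j \<partial>M)" for i j
      have c: "c i j t = p i j + p j i" for i j
        using iaX iXa by (simp add: c_def p_def mult.commute)
      have "g t = (\<integral>\<omega>. (2 * A'$1$1) * (\<alpha> t \<omega> $ 1 * X t \<omega> $ 1) + (2 * A'$1$2) * (\<alpha> t \<omega> $ 1 * X t \<omega> $ 2)
        + (2 * A'$2$1) * (\<alpha> t \<omega> $ 2 * X t \<omega> $ 1) + (2 * A'$2$2) * (\<alpha> t \<omega> $ 2 * X t \<omega> $ 2)
        + (2 * (B'$1$1 * m 1 t + B'$1$2 * m 2 t) + b'$1) * \<alpha> t \<omega> $ 1
        + (2 * (B'$2$1 * m 1 t + B'$2$2 * m 2 t) + b'$2) * \<alpha> t \<omega> $ 2 \<partial>M)"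
        unfolding g_def A'_def[symmetric] B'_def[symmetric] b'_def[symmetric]
        by (intro Bochner_Integration.integral_cong refl)
          (simp add: inner_plane matrix_vector_mult_def sum_2 expectation_component[OF iX] m_def[symmetric] algebra_simps)
      also have "\<dots> = (2 * A'$1$1) * p 1 1 + (2 * A'$1$2) * p 1 2 + (2 * A'$2$1) * p 2 1 + (2 * A'$2$2) * p 2 2
        + (2 * (B'$1$1 * m 1 t + B'$1$2 * m 2 t) + b'$1) * a 1 t
        + (2 * (B'$2$1 * m 1 t + B'$2$2 * m 2 t) + b'$2) * a 2 t"
        using iaX ia by (simp add: p_def a_def)
      also have "\<dots> = h t" unfolding h_def c A21 B21 by (simp add: algebra_simps)
      finally show "g t = h t" .
    qed
  qed
  have gm: "g \<in> borel_measurable (time T)"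
  proof -
    have i1: "integrable (time T \<Otimes>\<^sub>M M) (\<lambda>p. \<alpha> (fst p) (snd p) $ i * X (fst p) (snd p) $ j)" for i j
      by (rule integrable_component_product[OF measurable_time[OF \<alpha>m] \<alpha>2[OF T] measurable_time[OF Xm] X2[OF T]])
    have [measurable]: "(\<lambda>t. \<integral>\<omega>. X t \<omega> \<partial>M) \<in> borel_measurable borel"
      using borel_measurable_lebesgue_integral[of "\<lambda>t \<omega>. X t \<omega>" borel] Xm by (simp add: split_beta')
    note [measurable] = \<alpha>m Xm
    have "g \<in> borel_measurable borel"
      unfolding g_def
    proof (rule borel_measurable_lebesgue_integral)
      show "(\<lambda>(t, \<omega>). \<alpha> t \<omega> \<bullet> (2 *\<^sub>R (A k *v X t \<omega>) + 2 *\<^sub>R (B k *v (\<integral>\<omega>. X t \<omega> \<partial>M)) + b k)) \<in> borel_measurable (borel \<Otimes>\<^sub>M M)"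
        unfolding split_beta' inner_add_right inner_scaleR_right inner_matrix_plane by measurable
    qed
    then show ?thesis by (intro measurable_restrict_space1) simp
  qed
  show gi: "set_integrable lborel {0..T} g"
    unfolding integrable_time[symmetric]
  proof (rule integrable_cong_AE_imp[OF hi[unfolded integrable_time[symmetric]] gm])
    show "AE t in time T. h t = g t" using gh by eventually_elim simp
  qed
  have gI: "(LINT t:{0..T}|lborel. g t) = (LINT t:{0..T}|lborel. h t)"
    by (rule set_integral_cong_AE_time[OF gi hi gh])
  have val: "lq_value A B b k (law M U) = (A'$1$1 * (\<integral>\<omega>. U \<omega> $ 1 * U \<omega> $ 1 \<partial>M) + A'$1$2 * (\<integral>\<omega>. U \<omega> $ 1 * U \<omega> $ 2 \<partial>M)
      + A'$2$1 * (\<integral>\<omega>. U \<omega> $ 2 * U \<omega> $ 1 \<partial>M) + A'$2$2 * (\<integral>\<omega>. U \<omega> $ 2 * U \<omega> $ 2 \<partial>M))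
      + (b'$1 * n 1 + b'$2 * n 2)
      + (B'$1$1 * (n 1 * n 1) + B'$1$2 * (n 1 * n 2) + B'$2$1 * (n 2 * n 1) + B'$2$2 * (n 2 * n 2))"
    if U: "U \<in> borel_measurable M" "integrable M (\<lambda>\<omega>. (norm (U \<omega>))\<^sup>2)" and n: "\<And>i. n i = (\<integral>\<omega>. U \<omega> $ i \<partial>M)"
    for U :: "'a \<Rightarrow> real^2" and n
    unfolding lq_value_def A'_def[symmetric] B'_def[symmetric] b'_def[symmetric] law_value[OF U]
    unfolding inner_matrix_plane
    unfolding inner_plane expectation_component[OF integrable_norm_of_square(2)[OF U]] n ..
  note V1 = val[OF X_measurable Xt2[OF T], of "\<lambda>i. m i T"] and V0 = val[OF X0_measurable X02, of m0]
  have tr: "trace (A k) = A'$1$1 + A'$2$2" by (simp add: trace_def sum_2 A'_def)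
  have v1: "lq_value A B b k (law M (X T)) = (A'$1$1 * (\<integral>\<omega>. X T \<omega> $ 1 * X T \<omega> $ 1 \<partial>M) + A'$1$2 * (\<integral>\<omega>. X T \<omega> $ 1 * X T \<omega> $ 2 \<partial>M)
      + A'$2$1 * (\<integral>\<omega>. X T \<omega> $ 2 * X T \<omega> $ 1 \<partial>M) + A'$2$2 * (\<integral>\<omega>. X T \<omega> $ 2 * X T \<omega> $ 2 \<partial>M))
      + (b'$1 * m 1 T + b'$2 * m 2 T)
      + (B'$1$1 * (m 1 T * m 1 T) + B'$1$2 * (m 1 T * m 2 T) + B'$2$1 * (m 2 T * m 1 T) + B'$2$2 * (m 2 T * m 2 T))"
    by (rule V1) (simp add: m_def)
  have v0: "lq_value A B b k (law M X0) = (A'$1$1 * (\<integral>\<omega>. X0 \<omega> $ 1 * X0 \<omega> $ 1 \<partial>M) + A'$1$2 * (\<integral>\<omega>. X0 \<omega> $ 1 * X0 \<omega> $ 2 \<partial>M)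
      + A'$2$1 * (\<integral>\<omega>. X0 \<omega> $ 2 * X0 \<omega> $ 1 \<partial>M) + A'$2$2 * (\<integral>\<omega>. X0 \<omega> $ 2 * X0 \<omega> $ 2 \<partial>M))
      + (b'$1 * m0 1 + b'$2 * m0 2)
      + (B'$1$1 * (m0 1 * m0 1) + B'$1$2 * (m0 1 * m0 2) + B'$2$1 * (m0 2 * m0 1) + B'$2$2 * (m0 2 * m0 2))"
    by (rule V0) (simp add: m0_def)
  define IC IM where "IC i j = (LINT t:{0..T}|lborel. c i j t)" and
    "IM i j = (LINT t:{0..T}|lborel. a i t * m j t + m i t * a j t)" for i j
  define IA where "IA i = (LINT t:{0..T}|lborel. a i t)" for i
  define e where "e i j = (\<integral>\<omega>. X0 \<omega> $ i * X0 \<omega> $ j \<partial>M)" for i j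
  define eT mT where "eT i j = (\<integral>\<omega>. X T \<omega> $ i * X T \<omega> $ j \<partial>M)" and "mT i = m i T" for i j
  have E: "eT i j = e i j + IC i j + (if i = j then T else 0)" for i j
    using cc(2)[of i j] by (simp add: IC_def e_def eT_def)
  have MM: "mT i * mT j = m0 i * m0 j + IM i j" for i j using mm(2)[of i j] by (simp add: IM_def mT_def)
  have M: "mT i = m0 i + IA i" for i using me(2)[OF T, of i] by (simp add: IA_def mT_def)
  show "lq_value A B b k (law M (X T)) = lq_value A B b k (law M X0) + (LINT t:{0..T}|lborel. g t) + T * trace (A k)"
    unfolding gI hI v1 v0 tr IC_def[symmetric] IM_def[symmetric] IA_def[symmetric] e_def[symmetric] eT_def[symmetric]
      mT_def[symmetric] MM E unfolding M by (simp add: algebra_simps)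
qed

end

section \<open>The affine McKean--Vlasov equation\<close>

definition affine_feedback :: "real^2^2 \<Rightarrow> real^2^2 \<Rightarrow> real^2 \<Rightarrow> feedback" where
  "affine_feedback A B d \<mu> x = A *v x + B *v mean \<mu> + d"

text \<open>
  What the existence and uniqueness theory for the affine equation uses of the driving process. Brownian
  motion is an instance, and so is its extension to a product space with an independent initial position.
\<close>

locale noise = prob_space M
  for M :: "'a measure" +
  fixes F :: "real \<Rightarrow> 'a measure" and W :: "real \<Rightarrow> 'a \<Rightarrow> real^2"
  assumes space_F': "\<And>t. space (F t) = space M"
    and sets_F_mono': "\<And>s t. 0 \<le> s \<Longrightarrow> s \<le> t \<Longrightarrow> sets (F s) \<subseteq> sets (F t)"
    and sets_F': "\<And>t. sets (F t) \<subseteq> sets M"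
    and W_adapted': "\<And>t. 0 \<le> t \<Longrightarrow> W t \<in> borel_measurable (F t)"
    and W_continuous': "\<And>\<omega>. \<omega> \<in> space M \<Longrightarrow> continuous_on {0..} (\<lambda>t. W t \<omega>)"
    and W_square': "\<And>t. 0 \<le> t \<Longrightarrow> integrable M (\<lambda>\<omega>. (norm (W t \<omega>))\<^sup>2)"
    and W_variance': "\<And>t. 0 \<le> t \<Longrightarrow> (\<integral>\<omega>. (norm (W t \<omega>))\<^sup>2 \<partial>M) = 2 * t"
    and W_mean': "\<And>t i. 0 \<le> t \<Longrightarrow> (\<integral>\<omega>. W t \<omega> $ i \<partial>M) = 0"
begin

lemma adapted_measurable: "f \<in> measurable (F t) N \<Longrightarrow> f \<in> measurable M N"
  using measurable_mono[of N N "F t" M] sets_F' space_F' by auto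

lemma adapted_mono: "0 \<le> s \<Longrightarrow> s \<le> t \<Longrightarrow> f \<in> measurable (F s) N \<Longrightarrow> f \<in> measurable (F t) N"
  using measurable_mono[of N N "F s" "F t"] sets_F_mono' space_F' by auto

lemma W_measurable': "0 \<le> t \<Longrightarrow> W t \<in> borel_measurable M"
  using adapted_measurable[OF W_adapted'] .

text \<open>
  The Ornstein--Uhlenbeck process with drift matrix \<open>A\<close>, started at \<open>W 0\<close>.
\<close>

definition ou :: "real^2^2 \<Rightarrow> real \<Rightarrow> 'a \<Rightarrow> real^2" where
  "ou A t \<omega> = response A (\<lambda>s. W s \<omega>) t"

lemma ou_continuous: "\<omega> \<in> space M \<Longrightarrow> continuous_on {0..} (\<lambda>t. ou A t \<omega>)"
  using response_solves(1)[OF W_continuous'] by (simp add: ou_def[abs_def])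

lemma ou_solves: "\<omega> \<in> space M \<Longrightarrow> 0 \<le> t \<Longrightarrow> ou A t \<omega> = W t \<omega> + (LINT s:{0..t}|lborel. A *v ou A s \<omega>)"
  using response_solves(2)[OF W_continuous'] by (simp add: ou_def[abs_def])

text \<open>
  At time \<open>t\<close> the response only reads the path up to time \<open>t\<close>; freezing the path at \<open>t\<close> makes the integrand
  jointly measurable for \<open>F t\<close>.
\<close>

lemma ou_adapted:
  assumes t: "0 \<le> t"
  shows "ou A t \<in> borel_measurable (F t)"
proof -
  have "(\<lambda>(s, \<omega>). W (max 0 (min s t)) \<omega>) \<in> borel_measurable ((borel :: real measure) \<Otimes>\<^sub>M F t)"
  proof (rule measurable_continuous_process)
    show "W (max 0 (min s t)) \<in> borel_measurable (F t)" for s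
      using t by (intro adapted_mono[OF _ _ W_adapted']) auto
    fix \<omega> assume "\<omega> \<in> space (F t)"
    then have "\<omega> \<in> space M" by (simp add: space_F')
    then show "continuous_on UNIV (\<lambda>s. W (max 0 (min s t)) \<omega>)"
      by (intro continuous_on_compose2[OF W_continuous', of \<omega> UNIV "\<lambda>s. max 0 (min s t)"] continuous_intros) auto
  qed
  then have *: "(\<lambda>p. W (max 0 (min (fst p) t)) (snd p)) \<in> borel_measurable ((borel :: real measure) \<Otimes>\<^sub>M F t)"
    by (simp add: split_beta')
  have *: "(\<lambda>p. W (max 0 (min (snd p) t)) (fst p)) \<in> borel_measurable (F t \<Otimes>\<^sub>M (borel :: real measure))"
    using measurable_compose[OF measurable_pair_swap'[of "F t" borel] *] by (simp add: split_beta')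
  have L: "(\<lambda>s. flow A (- s) *v (A *v v)) \<in> borel_measurable borel" for v
    by (intro borel_measurable_continuous_onI continuous_intros)
  have mv: "(\<lambda>p. fst p *v snd p) \<in> borel_measurable (borel :: ((real^2^2) \<times> (real^2)) measure)"
    by (intro borel_measurable_continuous_onI
      bounded_bilinear.continuous_on[OF bounded_bilinear_matrix_vector] continuous_intros)
  have fl: "(\<lambda>s. flow A (- s) ** A) \<in> borel_measurable borel"
    by (intro borel_measurable_continuous_onI bounded_bilinear.continuous_on[OF bounded_bilinear_matrix_matrix]
      continuous_on_compose2[OF continuous_on_flow[of UNIV]] continuous_intros) auto
  have "(\<lambda>p. (flow A (- snd p) ** A, W (max 0 (min (snd p) t)) (fst p))) \<in> borel_measurable (F t \<Otimes>\<^sub>M (borel :: real measure))"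
    by (intro borel_measurable_Pair * measurable_compose[OF measurable_snd fl])
  from measurable_compose[OF this mv]
  have "(\<lambda>p. indicator {0..t} (snd p) *\<^sub>R ((flow A (- snd p) ** A) *v W (max 0 (min (snd p) t)) (fst p)))
      \<in> borel_measurable (F t \<Otimes>\<^sub>M (lborel :: real measure))"
    by (intro borel_measurable_scaleR) simp_all
  then have "(\<lambda>\<omega>. \<integral>s. indicator {0..t} s *\<^sub>R ((flow A (- s) ** A) *v W (max 0 (min s t)) \<omega>) \<partial>lborel) \<in> borel_measurable (F t)"
    using lborel.borel_measurable_lebesgue_integral[of "\<lambda>\<omega> s. indicator {0..t} s *\<^sub>R ((flow A (- s) ** A) *v W (max 0 (min s t)) \<omega>)" "F t"]
    by (simp add: split_beta')
  moreover have "(\<integral>s. indicator {0..t} s *\<^sub>R ((flow A (- s) ** A) *v W (max 0 (min s t)) \<omega>) \<partial>lborel)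
      = (LINT s:{0..t}|lborel. flow A (- s) *v (A *v W s \<omega>))" for \<omega>
    unfolding set_lebesgue_integral_def
    by (intro Bochner_Integration.integral_cong) (auto simp: indicator_def matrix_vector_mul_assoc)
  ultimately have "(\<lambda>\<omega>. LINT s:{0..t}|lborel. flow A (- s) *v (A *v W s \<omega>)) \<in> borel_measurable (F t)" by simp
  moreover have "(\<lambda>v. flow A t *v v) \<in> borel_measurable borel"
    by (intro borel_measurable_continuous_onI continuous_intros)
  ultimately have "(\<lambda>\<omega>. flow A t *v (LINT s:{0..t}|lborel. flow A (- s) *v (A *v W s \<omega>))) \<in> borel_measurable (F t)"
    by (rule measurable_compose)
  then show ?thesis
    unfolding ou_def[abs_def] response_def using W_adapted'[OF t] by (intro borel_measurable_add)
qed

lemma joint_of_continuous: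
  fixes Z :: "real \<Rightarrow> 'a \<Rightarrow> real^2"
  assumes "\<And>t. 0 \<le> t \<Longrightarrow> Z t \<in> borel_measurable M" "\<And>\<omega>. \<omega> \<in> space M \<Longrightarrow> continuous_on {0..} (\<lambda>t. Z t \<omega>)"
  shows "(\<lambda>p. Z (max 0 (fst p)) (snd p)) \<in> borel_measurable (borel \<Otimes>\<^sub>M M)"
proof -
  have "(\<lambda>(t, \<omega>). Z (max 0 t) \<omega>) \<in> borel_measurable ((borel :: real measure) \<Otimes>\<^sub>M M)"
  proof (rule measurable_continuous_process)
    show "Z (max 0 t) \<in> borel_measurable M" for t by (rule assms) simp
    fix \<omega> assume "\<omega> \<in> space M"
    then show "continuous_on UNIV (\<lambda>t. Z (max 0 t) \<omega>)"
      by (intro continuous_on_compose2[OF assms(2), of \<omega> UNIV "\<lambda>t. max 0 t"] continuous_intros) auto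
  qed
  then show ?thesis by (simp add: split_beta')
qed

lemma W_square_joint:
  assumes T: "0 \<le> T"
  shows "integrable (time T \<Otimes>\<^sub>M M) (\<lambda>p. (norm (W (max 0 (fst p)) (snd p)))\<^sup>2)"
proof (rule integrable_time_pairI[where f = "\<lambda>t \<omega>. (norm (W (max 0 t) \<omega>))\<^sup>2"])
  show "(\<lambda>p. (norm (W (max 0 (fst p)) (snd p)))\<^sup>2) \<in> borel_measurable (borel \<Otimes>\<^sub>M M)"
    using joint_of_continuous[OF W_measurable' W_continuous'] by measurable
  show "integrable M (\<lambda>\<omega>. (norm (W (max 0 t) \<omega>))\<^sup>2)" for t by (rule W_square') simp
  have "set_integrable lborel {0..T} (\<lambda>t. 2 * max 0 t)"
    by (rule set_integrable_continuous_Icc) (intro continuous_intros)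
  then show "set_integrable lborel {0..T} (\<lambda>t. \<integral>\<omega>. (norm (W (max 0 t) \<omega>))\<^sup>2 \<partial>M)"
    using W_variance' by simp
qed simp

lemma ou_dominated:
  assumes T: "0 \<le> T"
  obtains Z where "integrable M Z" "\<And>t \<omega>. t \<in> {0..T} \<Longrightarrow> \<omega> \<in> space M \<Longrightarrow> (norm (ou A t \<omega>))\<^sup>2 \<le> 2 * (norm (W t \<omega>))\<^sup>2 + Z \<omega>"
    "\<And>\<omega>. 0 \<le> Z \<omega>"
proof -
  have "compact ((\<lambda>(t, s). norm (flow A t) * norm (flow A (- s) ** A)) ` ({0..T} \<times> {0..T}))"
  proof (rule compact_continuous_image)
    have "continuous_on ({0..T} \<times> {0..T}) (\<lambda>p. norm (flow A (fst p)) * norm (flow A (- snd p) ** A))"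
      by (intro continuous_intros bounded_bilinear.continuous_on[OF bounded_bilinear_matrix_matrix]
        continuous_on_compose2[OF continuous_on_flow[of UNIV]]) auto
    then show "continuous_on ({0..T} \<times> {0..T}) (\<lambda>(t, s). norm (flow A t) * norm (flow A (- s) ** A))"
      by (simp add: split_beta')
    show "compact ({0..T} \<times> {0..T})" by (intro compact_Times compact_Icc)
  qed
  then have "bounded ((\<lambda>(t, s). norm (flow A t) * norm (flow A (- s) ** A)) ` ({0..T} \<times> {0..T}))"
    by (rule compact_imp_bounded)
  then obtain K1 where K1: "\<And>t s. t \<in> {0..T} \<Longrightarrow> s \<in> {0..T} \<Longrightarrow> norm (flow A t) * norm (flow A (- s) ** A) \<le> K1"
    unfolding bounded_iff by fastforce
  obtain K2 where K2: "0 < K2" "\<And>(B :: real^2^2) v. norm (B *v v) \<le> norm B * norm v * K2"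
    using bounded_bilinear.pos_bounded[OF bounded_bilinear_matrix_vector] by blast
  define K where "K = K2 * K2 * max 0 K1"
  have K: "0 \<le> K" using K2 by (simp add: K_def)
  define Z where "Z \<omega> = 2 * K\<^sup>2 * T * (LINT s:{0..T}|lborel. (norm (W (max 0 s) \<omega>))\<^sup>2)" for \<omega>
  have nn: "0 \<le> (LINT s:{0..T}|lborel. (norm (W (max 0 s) \<omega>))\<^sup>2)" for \<omega>
    unfolding set_lebesgue_integral_def by (rule Bochner_Integration.integral_nonneg) simp
  show ?thesis
  proof (rule that)
    show "integrable M Z"
      unfolding Z_def using expectation_set_integral(1)[where f = "\<lambda>t \<omega>. (norm (W (max 0 t) \<omega>))\<^sup>2", OF W_square_joint[OF T]]
      by simp
    show "0 \<le> Z \<omega>" for \<omega> using nn T by (simp add: Z_def)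
    fix t \<omega> assume t: "t \<in> {0..T}" and \<omega>: "\<omega> \<in> space M"
    have Wc: "continuous_on {0..T} (\<lambda>s. W (max 0 s) \<omega>)"
      by (intro continuous_on_compose2[OF W_continuous'[OF \<omega>], of "{0..T}" "\<lambda>s. max 0 s"] continuous_intros) auto
    define w where "w s = norm (W (max 0 s) \<omega>)" for s
    have wc: "continuous_on {0..T} w" unfolding w_def by (intro continuous_on_norm Wc)
    have wI: "set_integrable lborel {0..T} w" by (rule set_integrable_continuous_Icc[OF wc])
    have w2I: "set_integrable lborel {0..T} (\<lambda>s. (w s)\<^sup>2)"
      by (rule set_integrable_continuous_Icc) (intro continuous_on_power wc)
    define h where "h s = flow A (- s) *v (A *v W s \<omega>)" for s
    have hc: "continuous_on {0..t} h"
      unfolding h_def using t by (intro continuous_intros bounded_bilinear.continuous_on[OF bounded_bilinear_matrix_vector]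
        continuous_on_subset[OF W_continuous'[OF \<omega>]]) auto
    have "norm (flow A t *v (LINT s:{0..t}|lborel. h s)) = norm (LINT s:{0..t}|lborel. flow A t *v h s)"
      unfolding set_lebesgue_integral_def
      using integral_bounded_linear[OF matrix_vector_mul_bounded_linear[of "flow A t"]
          set_integrable_continuous_Icc[OF hc, unfolded set_integrable_def]]
      by (simp add: bounded_bilinear.scaleR_right[OF bounded_bilinear_matrix_vector])
    also have "\<dots> \<le> (\<integral>s. norm (indicator {0..t} s *\<^sub>R (flow A t *v h s)) \<partial>lborel)"
      unfolding set_lebesgue_integral_def by (rule integral_norm_bound)
    also have "\<dots> \<le> (\<integral>s. indicator {0..T} s * (K * w s) \<partial>lborel)"
    proof (rule integral_mono)
      have "continuous_on {0..t} (\<lambda>s. flow A t *v h s)" by (intro continuous_intros hc)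
      then show "integrable lborel (\<lambda>s. norm (indicator {0..t} s *\<^sub>R (flow A t *v h s)))"
        using set_integrable_continuous_Icc unfolding set_integrable_def by (intro integrable_norm) blast
      show "integrable lborel (\<lambda>s. indicator {0..T} s * (K * w s))"
        using integrable_mult_right[of K, OF wI[unfolded set_integrable_def]] by (simp add: mult_ac)
      fix s :: real
      show "norm (indicator {0..t} s *\<^sub>R (flow A t *v h s)) \<le> indicator {0..T} s * (K * w s)"
      proof (cases "s \<in> {0..t}")
        case True
        have "norm (flow A t *v h s) \<le> norm (flow A t) * norm (h s) * K2" by (rule K2(2))
        also have "norm (h s) \<le> norm (flow A (- s) ** A) * norm (W s \<omega>) * K2"
          unfolding h_def matrix_vector_mul_assoc by (rule K2(2))
        then have "norm (flow A t) * norm (h s) * K2 \<le> norm (flow A t) * (norm (flow A (- s) ** A) * norm (W s \<omega>) * K2) * K2"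
          using K2(1) by (intro mult_right_mono mult_left_mono) auto
        also have "\<dots> = (K2 * K2 * (norm (flow A t) * norm (flow A (- s) ** A))) * norm (W s \<omega>)" by (simp add: mult_ac)
        also have "\<dots> \<le> K * norm (W s \<omega>)"
          unfolding K_def using K1[of t s] True t K2(1) by (intro mult_right_mono mult_left_mono) auto
        finally show ?thesis using True t by (simp add: w_def)
      qed (use K in \<open>auto simp: w_def indicator_def\<close>)
    qed
    also have "\<dots> = K * (LINT s:{0..T}|lborel. w s)"
      unfolding set_lebesgue_integral_def by (subst integral_mult_right_zero[symmetric]) (simp add: mult_ac)
    finally have 1: "norm (flow A t *v (LINT s:{0..t}|lborel. h s)) \<le> K * (LINT s:{0..T}|lborel. w s)" .
    have 2: "\<bar>LINT s:{0..T}|lborel. w s\<bar> \<le> sqrt T * sqrt (LINT s:{0..T}|lborel. (w s)\<^sup>2)"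
    proof -
      have "integrable (time T) (\<lambda>_. 1\<^sup>2 :: real)"
        unfolding integrable_time by (rule set_integrable_continuous_Icc) (intro continuous_intros)
      from integral_Cauchy_Schwarz(2)[OF _ _ this, of w]
      have "\<bar>\<integral>s. 1 * w s \<partial>time T\<bar> \<le> sqrt (\<integral>s. 1\<^sup>2 \<partial>time T) * sqrt (\<integral>s. (w s)\<^sup>2 \<partial>time T)"
        using wI w2I unfolding integrable_time[symmetric] by simp
      moreover have "(LINT s:{0..T}|lborel. 1 :: real) = T" using T by (simp add: set_integral_const)
      ultimately show ?thesis unfolding integral_time by simp
    qed
    have "(K * (LINT s:{0..T}|lborel. w s))\<^sup>2 \<le> K\<^sup>2 * (T * (LINT s:{0..T}|lborel. (w s)\<^sup>2))"
    proof -
      have "(LINT s:{0..T}|lborel. w s)\<^sup>2 \<le> (sqrt T * sqrt (LINT s:{0..T}|lborel. (w s)\<^sup>2))\<^sup>2"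
        using 2 by (metis abs_ge_zero power2_abs power_mono)
      also have "\<dots> = T * (LINT s:{0..T}|lborel. (w s)\<^sup>2)" using T nn[of \<omega>] by (simp add: power_mult_distrib w_def)
      finally show ?thesis by (simp add: power_mult_distrib mult_left_mono)
    qed
    with 1 have 3: "(norm (flow A t *v (LINT s:{0..t}|lborel. h s)))\<^sup>2 \<le> Z \<omega> / 2"
      using power_mono[OF 1, of 2] by (simp add: Z_def w_def)
    have "(norm (ou A t \<omega>))\<^sup>2 \<le> (norm (W t \<omega>) + norm (flow A t *v (LINT s:{0..t}|lborel. h s)))\<^sup>2"
      unfolding ou_def response_def h_def by (intro power_mono norm_triangle_ineq) simp
    also have "\<dots> \<le> 2 * (norm (W t \<omega>))\<^sup>2 + 2 * (norm (flow A t *v (LINT s:{0..t}|lborel. h s)))\<^sup>2"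
      using sum_squares_bound[of "norm (W t \<omega>)" "norm (flow A t *v (LINT s:{0..t}|lborel. h s))"] by (simp add: power2_sum)
    finally show "(norm (ou A t \<omega>))\<^sup>2 \<le> 2 * (norm (W t \<omega>))\<^sup>2 + Z \<omega>" using 3 by simp
  qed
qed

lemma ou_measurable: "0 \<le> t \<Longrightarrow> ou A t \<in> borel_measurable M"
  by (rule adapted_measurable[OF ou_adapted])

lemma ou_square:
  assumes t: "0 \<le> t"
  shows "integrable M (\<lambda>\<omega>. (norm (ou A t \<omega>))\<^sup>2)"
proof -
  obtain Z where Z: "integrable M Z" "\<And>s \<omega>. s \<in> {0..t} \<Longrightarrow> \<omega> \<in> space M \<Longrightarrow> (norm (ou A s \<omega>))\<^sup>2 \<le> 2 * (norm (W s \<omega>))\<^sup>2 + Z \<omega>"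
    "\<And>\<omega>. 0 \<le> Z \<omega>" using ou_dominated[OF t] by blast
  show ?thesis
  proof (rule Bochner_Integration.integrable_bound)
    show "integrable M (\<lambda>\<omega>. 2 * (norm (W t \<omega>))\<^sup>2 + Z \<omega>)" using Z(1) W_square'[OF t] by simp
    show "(\<lambda>\<omega>. (norm (ou A t \<omega>))\<^sup>2) \<in> borel_measurable M" using ou_measurable[OF t] by measurable
    show "AE \<omega> in M. norm ((norm (ou A t \<omega>))\<^sup>2) \<le> norm (2 * (norm (W t \<omega>))\<^sup>2 + Z \<omega>)"
      using Z(2)[of t] Z(3) t by (intro AE_I2) simp
  qed
qed

lemma ou_square_joint:
  assumes T: "0 \<le> T"
  shows "integrable (time T \<Otimes>\<^sub>M M) (\<lambda>p. (norm (ou A (max 0 (fst p)) (snd p)))\<^sup>2)"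
proof -
  obtain Z where Z: "integrable M Z" "\<And>s \<omega>. s \<in> {0..T} \<Longrightarrow> \<omega> \<in> space M \<Longrightarrow> (norm (ou A s \<omega>))\<^sup>2 \<le> 2 * (norm (W s \<omega>))\<^sup>2 + Z \<omega>"
    "\<And>\<omega>. 0 \<le> Z \<omega>" using ou_dominated[OF T] by blast
  show ?thesis
  proof (rule Bochner_Integration.integrable_bound)
    have "integrable (time T \<Otimes>\<^sub>M M) (\<lambda>p. Z (snd p))"
    proof (rule integrable_time_pairI[where f = "\<lambda>_ \<omega>. Z \<omega>"])
      show "(\<lambda>p. Z (snd p)) \<in> borel_measurable (borel \<Otimes>\<^sub>M M)" using Z(1) by measurable
    qed (use Z in \<open>auto intro!: set_integrable_continuous_Icc continuous_intros\<close>)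
    then show "integrable (time T \<Otimes>\<^sub>M M) (\<lambda>p. 2 * (norm (W (max 0 (fst p)) (snd p)))\<^sup>2 + Z (snd p))"
      using W_square_joint[OF T] by simp
    have "(\<lambda>p. ou A (max 0 (fst p)) (snd p)) \<in> borel_measurable (borel \<Otimes>\<^sub>M M)"
      by (rule joint_of_continuous[OF ou_measurable ou_continuous])
    then show "(\<lambda>p. (norm (ou A (max 0 (fst p)) (snd p)))\<^sup>2) \<in> borel_measurable (time T \<Otimes>\<^sub>M M)"
      by (intro measurable_time) measurable
    show "AE p in time T \<Otimes>\<^sub>M M. norm ((norm (ou A (max 0 (fst p)) (snd p)))\<^sup>2) \<le> norm (2 * (norm (W (max 0 (fst p)) (snd p)))\<^sup>2 + Z (snd p))"
      using Z(2,3) by (intro AE_I2) (auto simp: space_pair_measure space_restrict_space)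
  qed
qed

lemma ou_integrable: "0 \<le> t \<Longrightarrow> integrable M (ou A t)"
  by (rule integrable_norm_of_square(2)[OF ou_measurable ou_square])

text \<open>
  The process is a linear function of the path of \<open>W\<close>, whose mean is zero at every time.
\<close>

lemma ou_mean:
  assumes t: "0 \<le> t"
  shows "(\<integral>\<omega>. ou A t \<omega> \<partial>M) = 0"
proof -
  let ?w = "\<lambda>s. W (max 0 s)"
  define H where "H s = flow A t ** (flow A (- s) ** A)" for s
  have Hc: "continuous_on S (\<lambda>s. H s)" for S
    unfolding H_def by (intro bounded_bilinear.continuous_on[OF bounded_bilinear_matrix_matrix]
      continuous_on_const continuous_on_compose2[OF continuous_on_flow[of UNIV]] continuous_intros) auto
  have Hij: "continuous_on S (\<lambda>s. H s $ i $ j)" for S i j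
    by (intro continuous_intros Hc)
  have i1: "integrable (time t \<Otimes>\<^sub>M M) (\<lambda>p. H (fst p) $ i $ j * ?w (fst p) (snd p) $ k)" for i j k
  proof (rule integral_Cauchy_Schwarz(1))
    have hm: "(\<lambda>s. H s $ i $ j) \<in> borel_measurable borel" by (rule borel_measurable_continuous_onI[OF Hij])
    have hm2: "(\<lambda>p. H (fst p) $ i $ j) \<in> borel_measurable (borel \<Otimes>\<^sub>M M)" by (rule measurable_compose[OF measurable_fst hm])
    show "(\<lambda>p. H (fst p) $ i $ j) \<in> borel_measurable (time t \<Otimes>\<^sub>M M)" by (rule measurable_time[OF hm2])
    have wm: "(\<lambda>p. ?w (fst p) (snd p)) \<in> borel_measurable (time t \<Otimes>\<^sub>M M)"
      by (rule measurable_time[OF joint_of_continuous[OF W_measurable' W_continuous']])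
    then show "(\<lambda>p. ?w (fst p) (snd p) $ k) \<in> borel_measurable (time t \<Otimes>\<^sub>M M)" by measurable
    show "integrable (time t \<Otimes>\<^sub>M M) (\<lambda>p. (?w (fst p) (snd p) $ k)\<^sup>2)"
      by (rule integrable_square_component[OF wm W_square_joint[OF t]])
    show "integrable (time t \<Otimes>\<^sub>M M) (\<lambda>p. (H (fst p) $ i $ j)\<^sup>2)"
    proof (rule integrable_time_pairI[where f = "\<lambda>s _. (H s $ i $ j)\<^sup>2"])
      show "(\<lambda>p. (H (fst p) $ i $ j)\<^sup>2) \<in> borel_measurable (borel \<Otimes>\<^sub>M M)" using hm2 by measurable
      have "set_integrable lborel {0..t} (\<lambda>s. (H s $ i $ j)\<^sup>2)"
        by (rule set_integrable_continuous_Icc) (intro continuous_on_power Hij)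
      then show "set_integrable lborel {0..t} (\<lambda>s. \<integral>\<omega>. (H s $ i $ j)\<^sup>2 \<partial>M)" by simp
    qed simp_all
  qed
  have c: "(\<integral>\<omega>. ou A t \<omega> $ i \<partial>M) = 0" for i
  proof -
    define f where "f s \<omega> = H s $ i $ 1 * ?w s \<omega> $ 1 + H s $ i $ 2 * ?w s \<omega> $ 2" for s \<omega>
    have fi: "integrable (time t \<Otimes>\<^sub>M M) (\<lambda>p. f (fst p) (snd p))" unfolding f_def using i1 by simp
    have iw: "integrable M (\<lambda>\<omega>. ?w s \<omega> $ k)" for s k
      by (rule integrable_bounded_linear[OF bounded_linear_vec_nth integrable_norm_of_square(2)[OF W_measurable' W_square']]) auto
    have f0: "(\<integral>\<omega>. f s \<omega> \<partial>M) = 0" for s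
      unfolding f_def using iw W_mean' by simp
    have e: "ou A t \<omega> $ i = W t \<omega> $ i + (LINT s:{0..t}|lborel. f s \<omega>)" if \<omega>: "\<omega> \<in> space M" for \<omega>
    proof -
      define h where "h s = flow A (- s) *v (A *v W s \<omega>)" for s
      have hc: "continuous_on {0..t} h"
        unfolding h_def by (intro continuous_intros bounded_bilinear.continuous_on[OF bounded_bilinear_matrix_vector]
          continuous_on_subset[OF W_continuous'[OF \<omega>]]) auto
      have "flow A t *v (LINT s:{0..t}|lborel. h s) = (LINT s:{0..t}|lborel. flow A t *v h s)"
        unfolding set_lebesgue_integral_def
        using integral_bounded_linear[OF matrix_vector_mul_bounded_linear[of "flow A t"]
            set_integrable_continuous_Icc[OF hc, unfolded set_integrable_def]]
        by (simp add: bounded_bilinear.scaleR_right[OF bounded_bilinear_matrix_vector])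
      moreover have "set_integrable lborel {0..t} (\<lambda>s. flow A t *v h s)"
        by (rule set_integrable_continuous_Icc) (intro continuous_intros hc)
      from set_integral_component(2)[OF this, of i]
      have "(LINT s:{0..t}|lborel. flow A t *v h s) $ i = (LINT s:{0..t}|lborel. f s \<omega>)"
        unfolding h_def matrix_vector_mul_assoc matrix_mul_assoc
        by (simp only: f_def H_def) (intro set_lebesgue_integral_cong, auto simp: matrix_vector_mult_def sum_2 matrix_mul_assoc)
      ultimately show ?thesis by (simp add: ou_def response_def h_def)
    qed
    have "(\<integral>\<omega>. ou A t \<omega> $ i \<partial>M) = (\<integral>\<omega>. ?w t \<omega> $ i + (LINT s:{0..t}|lborel. f s \<omega>) \<partial>M)"
      using e t by (intro Bochner_Integration.integral_cong refl) simp
    also have "\<dots> = 0"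
      using iw expectation_set_integral(1,3)[OF fi] W_mean' f0 by (simp add: set_lebesgue_integral_def)
    finally show ?thesis .
  qed
  have "(\<integral>\<omega>. ou A t \<omega> \<partial>M) $ i = 0" for i
    using integral_bounded_linear[OF bounded_linear_vec_nth[of i] ou_integrable[OF t, of A]] c[of i] by simp
  then show ?thesis by (simp add: vec_eq_iff)
qed

end

text \<open>
  Picks one path from an almost sure event. In the uniqueness proof for the affine equation, all other
  paths are compared with it.
\<close>

lemma (in prob_space) AE_witness:
  assumes "AE \<omega> in M. P \<omega>"
  obtains \<omega> where "\<omega> \<in> space M" "P \<omega>"
proof -
  have "\<exists>\<omega>. \<omega> \<in> space M \<and> P \<omega>"
  proof (rule ccontr)
    assume "\<nexists>\<omega>. \<omega> \<in> space M \<and> P \<omega>"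
    then have n: "\<And>\<omega>. \<omega> \<in> space M \<Longrightarrow> \<not> P \<omega>" by blast
    have "AE \<omega> in M. False" using assms AE_space by eventually_elim (use n in blast)
    then show False by simp
  qed
  then show ?thesis using that by blast
qed

lemma flow_integral:
  assumes t: "0 \<le> t"
  shows "set_integrable lborel {0..t} (\<lambda>s. A *v (flow A s *v x))"
    and "(LINT s:{0..t}|lborel. A *v (flow A s *v x)) = flow A t *v x - x"
proof -
  have c: "continuous_on {0..t} (\<lambda>s. A *v (flow A s *v x))"
    by (intro bounded_bilinear.continuous_on[OF bounded_bilinear_matrix_vector] continuous_on_const continuous_on_flow)
  show "set_integrable lborel {0..t} (\<lambda>s. A *v (flow A s *v x))" by (rule set_integrable_continuous_Icc[OF c])
  show "(LINT s:{0..t}|lborel. A *v (flow A s *v x)) = flow A t *v x - x"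
    using set_integral_Icc_FTC[OF t flow_vector_derivative c] by (simp add: flow_0)
qed

lemma borel_measurable_matrix_vector:
  fixes A :: "real^2^2" and f :: "'a \<Rightarrow> real^2"
  assumes "f \<in> borel_measurable N"
  shows "(\<lambda>x. A *v f x) \<in> borel_measurable N"
  using assms by (rule measurable_compose) (intro borel_measurable_continuous_onI continuous_intros)

lemma mean_law: "f \<in> borel_measurable N \<Longrightarrow> mean (law N f) = (\<integral>\<omega>. f \<omega> \<partial>N)"
  unfolding mean_def by (subst integral_distr) auto

context noise begin

text \<open>
  The explicit solution of the affine equation: the mean, the damped initial fluctuation, and the noise.
\<close>

definition mkv :: "real^2^2 \<Rightarrow> real^2^2 \<Rightarrow> real^2 \<Rightarrow> ('a \<Rightarrow> real^2) \<Rightarrow> real \<Rightarrow> 'a \<Rightarrow> real^2" where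
  "mkv A B p X0 t \<omega> = (p + flow (A + B) t *v (expectation X0 - p)) + flow A t *v (X0 \<omega> - expectation X0) + ou A t \<omega>"

lemma mkv_continuous:
  assumes "\<omega> \<in> space M"
  shows "continuous_on {0..} (\<lambda>t. mkv A B p X0 t \<omega>)"
  unfolding mkv_def
  by (intro continuous_on_add continuous_on_const ou_continuous[OF assms]
    bounded_bilinear.continuous_on[OF bounded_bilinear_matrix_vector] continuous_on_flow)

lemma mkv_adapted:
  assumes X0: "X0 \<in> borel_measurable (F 0)" and t: "0 \<le> t"
  shows "mkv A B p X0 t \<in> borel_measurable (F t)"
proof -
  have "X0 \<in> borel_measurable (F t)" by (rule adapted_mono[OF _ t X0]) simp
  then have "(\<lambda>\<omega>. flow A t *v (X0 \<omega> - expectation X0)) \<in> borel_measurable (F t)"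
    by (intro borel_measurable_matrix_vector borel_measurable_diff) simp_all
  then show ?thesis unfolding mkv_def[abs_def]
    by (intro borel_measurable_add ou_adapted[OF t]) simp_all
qed

lemma integrable_matrix_vector: "integrable M f \<Longrightarrow> integrable M (\<lambda>\<omega>. A *v f \<omega>)"
  "integrable M f \<Longrightarrow> (\<integral>\<omega>. A *v f \<omega> \<partial>M) = A *v (\<integral>\<omega>. f \<omega> \<partial>M)" for A :: "real^2^2" and f :: "'a \<Rightarrow> real^2"
  using integrable_bounded_linear[OF matrix_vector_mul_bounded_linear[of A]]
    integral_bounded_linear[OF matrix_vector_mul_bounded_linear[of A]] by blast+

lemma square_matrix_vector:
  fixes A :: "real^2^2" and f :: "'b \<Rightarrow> real^2"
  assumes f: "f \<in> borel_measurable N" "integrable N (\<lambda>\<omega>. (norm (f \<omega>))\<^sup>2)"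
  shows "integrable N (\<lambda>\<omega>. (norm (A *v f \<omega>))\<^sup>2)"
proof (rule Bochner_Integration.integrable_bound)
  have "op_norm A \<ge> 0" by (rule onorm_pos_le[OF matrix_vector_mul_bounded_linear])
  have "(norm (A *v v))\<^sup>2 \<le> (op_norm A)\<^sup>2 * (norm v)\<^sup>2" for v
    using power_mono[OF onorm[OF matrix_vector_mul_bounded_linear[of A], of v] norm_ge_zero, of 2]
    by (simp add: power_mult_distrib)
  then show "AE \<omega> in N. norm ((norm (A *v f \<omega>))\<^sup>2) \<le> norm ((op_norm A)\<^sup>2 * (norm (f \<omega>))\<^sup>2)" by simp
  show "integrable N (\<lambda>\<omega>. (op_norm A)\<^sup>2 * (norm (f \<omega>))\<^sup>2)" using f(2) by simp
  show "(\<lambda>\<omega>. (norm (A *v f \<omega>))\<^sup>2) \<in> borel_measurable N"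
    using borel_measurable_matrix_vector[OF f(1)] by measurable
qed

lemma mkv_mean:
  assumes X0: "integrable M X0" and t: "0 \<le> t"
  shows "expectation (mkv A B p X0 t) = p + flow (A + B) t *v (expectation X0 - p)"
proof -
  have i: "integrable M (\<lambda>\<omega>. X0 \<omega> - expectation X0)" using X0 by simp
  have "expectation (\<lambda>\<omega>. flow A t *v (X0 \<omega> - expectation X0)) = 0"
    unfolding integrable_matrix_vector(2)[OF i] using X0 by (simp add: prob_space)
  then show ?thesis
    unfolding mkv_def[abs_def]
    using integrable_matrix_vector(1)[OF i, of "flow A t"] ou_integrable[OF t, of A] ou_mean[OF t, of A]
    by (simp add: prob_space)
qed

lemma mkv_square:
  assumes X0: "X0 \<in> borel_measurable (F 0)" "integrable M (\<lambda>\<omega>. (norm (X0 \<omega>))\<^sup>2)" and t: "0 \<le> t"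
  shows "integrable M (\<lambda>\<omega>. (norm (mkv A B p X0 t \<omega>))\<^sup>2)"
proof -
  have m: "X0 \<in> borel_measurable M" by (rule adapted_measurable[OF X0(1)])
  have c: "integrable M (\<lambda>\<omega>. (norm (c :: real^2))\<^sup>2)" for c by simp
  have "integrable M (\<lambda>\<omega>. (norm (X0 \<omega> - expectation X0))\<^sup>2)"
    by (rule integrable_square_diff(1)[OF m _ X0(2) c]) simp
  then have f2: "integrable M (\<lambda>\<omega>. (norm (flow A t *v (X0 \<omega> - expectation X0)))\<^sup>2)"
    by (rule square_matrix_vector[rotated]) (use m in measurable)
  have fm: "(\<lambda>\<omega>. flow A t *v (X0 \<omega> - expectation X0)) \<in> borel_measurable M"
    by (rule borel_measurable_matrix_vector) (use m in measurable)
  define a where "a = p + flow (A + B) t *v (expectation X0 - p)"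
  have am: "(\<lambda>\<omega>. a + flow A t *v (X0 \<omega> - expectation X0)) \<in> borel_measurable M"
    by (rule borel_measurable_add[OF _ fm]) simp
  have a2: "integrable M (\<lambda>\<omega>. (norm (a + flow A t *v (X0 \<omega> - expectation X0)))\<^sup>2)"
    by (rule integrable_square_diff(2)[OF _ fm c f2]) simp
  show ?thesis unfolding mkv_def a_def[symmetric]
    by (rule integrable_square_diff(2)[OF am ou_measurable[OF t] a2 ou_square[OF t]])
qed

lemma mkv_square_joint:
  assumes X0: "X0 \<in> borel_measurable (F 0)" "integrable M (\<lambda>\<omega>. (norm (X0 \<omega>))\<^sup>2)" and T: "0 \<le> T"
  shows "integrable (time T \<Otimes>\<^sub>M M) (\<lambda>p'. (norm (mkv A B p X0 (max 0 (fst p')) (snd p')))\<^sup>2)"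
proof -
  have "\<exists>K. \<forall>t\<in>{0..T}. norm (flow A t) \<le> K"
    using compact_imp_bounded[OF compact_continuous_image[OF continuous_on_flow compact_Icc], of A 0 T]
    by (auto simp: bounded_iff)
  then obtain K where K: "\<forall>t\<in>{0..T}. norm (flow A t) \<le> K" by blast
  have cc: "continuous_on {0..T} (\<lambda>t. p + flow (A + B) t *v (expectation X0 - p))"
    by (intro continuous_on_add continuous_on_const bounded_bilinear.continuous_on[OF bounded_bilinear_matrix_vector] continuous_on_flow)
  have "\<exists>L. \<forall>t\<in>{0..T}. norm (p + flow (A + B) t *v (expectation X0 - p)) \<le> L"
    using compact_imp_bounded[OF compact_continuous_image[OF cc compact_Icc]]
    by (auto simp: bounded_iff)
  then obtain L where L: "\<forall>t\<in>{0..T}. norm (p + flow (A + B) t *v (expectation X0 - p)) \<le> L" by blast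
  obtain K2 where K2: "0 < K2" "\<And>(B :: real^2^2) v. norm (B *v v) \<le> norm B * norm v * K2"
    using bounded_bilinear.pos_bounded[OF bounded_bilinear_matrix_vector] by blast
  have m: "X0 \<in> borel_measurable M" by (rule adapted_measurable[OF X0(1)])
  have c: "integrable M (\<lambda>\<omega>. (norm (c :: real^2))\<^sup>2)" for c by simp
  have x2: "integrable M (\<lambda>\<omega>. (norm (X0 \<omega> - expectation X0))\<^sup>2)"
    by (rule integrable_square_diff(1)[OF m _ X0(2) c]) simp
  define Z where "Z \<omega> = 3 * L\<^sup>2 + 3 * (K * K2)\<^sup>2 * (norm (X0 \<omega> - expectation X0))\<^sup>2" for \<omega>
  have Zi: "integrable M Z" unfolding Z_def using x2 by simp
  have iZ: "integrable (time T \<Otimes>\<^sub>M M) (\<lambda>p. Z (snd p))"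
  proof (rule integrable_time_pairI[where f = "\<lambda>_ \<omega>. Z \<omega>"])
    show "(\<lambda>p. Z (snd p)) \<in> borel_measurable (borel \<Otimes>\<^sub>M M)" using Zi by measurable
    show "0 \<le> Z \<omega>" for \<omega> by (simp add: Z_def)
  qed (use Zi in \<open>auto intro!: set_integrable_continuous_Icc continuous_intros\<close>)
  show ?thesis
  proof (rule Bochner_Integration.integrable_bound)
    show "integrable (time T \<Otimes>\<^sub>M M) (\<lambda>p. Z (snd p) + 3 * (norm (ou A (max 0 (fst p)) (snd p)))\<^sup>2)"
      using iZ ou_square_joint[OF T] by simp
    have "(\<lambda>p'. mkv A B p X0 (max 0 (fst p')) (snd p')) \<in> borel_measurable (borel \<Otimes>\<^sub>M M)"
      by (rule joint_of_continuous[OF adapted_measurable[OF mkv_adapted[OF X0(1)]] mkv_continuous])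
    then show "(\<lambda>p'. (norm (mkv A B p X0 (max 0 (fst p')) (snd p')))\<^sup>2) \<in> borel_measurable (time T \<Otimes>\<^sub>M M)"
      by (intro measurable_time) measurable
    show "AE p' in time T \<Otimes>\<^sub>M M. norm ((norm (mkv A B p X0 (max 0 (fst p')) (snd p')))\<^sup>2)
        \<le> norm (Z (snd p') + 3 * (norm (ou A (max 0 (fst p')) (snd p')))\<^sup>2)"
    proof (rule AE_I2)
      fix p' assume "p' \<in> space (time T \<Otimes>\<^sub>M M)"
      then obtain t \<omega> where p': "p' = (t, \<omega>)" "t \<in> {0..T}" by (auto simp: space_pair_measure space_restrict_space)
      define a b c where "a = norm (p + flow (A + B) t *v (expectation X0 - p))"
        and "b = norm (flow A t *v (X0 \<omega> - expectation X0))" and "c = norm (ou A t \<omega>)"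
      have "norm (mkv A B p X0 t \<omega>) \<le> a + b + c"
        unfolding mkv_def a_def b_def c_def by (intro norm_triangle_le add_right_mono norm_triangle_ineq)
      then have "(norm (mkv A B p X0 t \<omega>))\<^sup>2 \<le> (a + b + c)\<^sup>2" by (intro power_mono) auto
      also have "\<dots> \<le> 3 * a\<^sup>2 + 3 * b\<^sup>2 + 3 * c\<^sup>2"
        using sum_squares_bound[of a b] sum_squares_bound[of a c] sum_squares_bound[of b c]
        by (simp add: power2_eq_square algebra_simps)
      also have "a\<^sup>2 \<le> L\<^sup>2" using bspec[OF L p'(2)] by (intro power_mono) (auto simp: a_def)
      also have "b\<^sup>2 \<le> (K * K2)\<^sup>2 * (norm (X0 \<omega> - expectation X0))\<^sup>2"
      proof -
        have "b \<le> norm (flow A t) * norm (X0 \<omega> - expectation X0) * K2" unfolding b_def by (rule K2(2))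
        also have "\<dots> \<le> K * norm (X0 \<omega> - expectation X0) * K2"
          using bspec[OF K p'(2)] K2(1) by (intro mult_right_mono) auto
        finally have "b\<^sup>2 \<le> (K * norm (X0 \<omega> - expectation X0) * K2)\<^sup>2" by (intro power_mono) (auto simp: b_def)
        then show ?thesis by (simp add: power_mult_distrib mult_ac)
      qed
      finally have "(norm (mkv A B p X0 t \<omega>))\<^sup>2 \<le> Z \<omega> + 3 * (norm (ou A t \<omega>))\<^sup>2"
        by (simp add: Z_def c_def)
      then show "norm ((norm (mkv A B p X0 (max 0 (fst p')) (snd p')))\<^sup>2)
        \<le> norm (Z (snd p') + 3 * (norm (ou A (max 0 (fst p')) (snd p')))\<^sup>2)"
        using p' by simp
    qed
  qed
qed

text \<open>
  The mean \<open>p + flow (A + B) t *v (expectation X0 - p)\<close> moves around the fixed point \<open>p\<close> with drift matrix \<open>A + B\<close>;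
  the fluctuation around the mean only sees \<open>A\<close>. Adding both equations gives the affine equation.
\<close>

lemma mkv_solution:
  assumes X0: "X0 \<in> borel_measurable (F 0)" "integrable M (\<lambda>\<omega>. (norm (X0 \<omega>))\<^sup>2)" and p: "(A + B) *v p + d = 0"
  shows "sq_int_solution M F W X0 (affine_feedback A B d) (mkv A B p X0)"
  unfolding sq_int_solution_def
proof (intro conjI ballI allI impI)
  show "continuous_on {0..} (\<lambda>t. mkv A B p X0 t \<omega>)" if "\<omega> \<in> space M" for \<omega> by (rule mkv_continuous[OF that])
  show "mkv A B p X0 t \<in> borel_measurable (F t)" if "0 \<le> t" for t by (rule mkv_adapted[OF X0(1) that])
  show "integrable M (\<lambda>\<omega>. (norm (mkv A B p X0 t \<omega>))\<^sup>2)" if "0 \<le> t" for t by (rule mkv_square[OF X0 that])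
  have iX0: "integrable M X0" by (rule integrable_norm_of_square(2)[OF adapted_measurable[OF X0(1)] X0(2)])
  define v where "v = expectation X0 - p"
  have mbar: "mean (law M (mkv A B p X0 s)) = p + flow (A + B) s *v v" if "0 \<le> s" for s
    using mean_law[OF adapted_measurable[OF mkv_adapted[OF X0(1) that]]] mkv_mean[OF iX0 that] by (simp add: v_def)
  show "AE \<omega> in M. \<forall>t\<ge>0. set_integrable lborel {0..t} (\<lambda>s. affine_feedback A B d (law M (mkv A B p X0 s)) (mkv A B p X0 s \<omega>)) \<and>
     mkv A B p X0 t \<omega> = X0 \<omega> + (LINT s:{0..t}|lborel. affine_feedback A B d (law M (mkv A B p X0 s)) (mkv A B p X0 s \<omega>)) + W t \<omega>"
  proof (intro AE_I2 allI impI)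
    fix \<omega> t assume \<omega>: "\<omega> \<in> space M" and t: "(0::real) \<le> t"
    define \<xi> where "\<xi> = X0 \<omega> - expectation X0"
    have f: "affine_feedback A B d (law M (mkv A B p X0 s)) (mkv A B p X0 s \<omega>)
       = A *v (flow A s *v \<xi>) + A *v ou A s \<omega> + (A + B) *v (flow (A + B) s *v v)" if "s \<in> {0..t}" for s
    proof -
      have "affine_feedback A B d (law M (mkv A B p X0 s)) (mkv A B p X0 s \<omega>)
        = A *v (flow A s *v \<xi>) + A *v ou A s \<omega> + (A + B) *v (flow (A + B) s *v v) + ((A + B) *v p + d)"
      proof -
        have mb: "mean (law M (mkv A B p X0 s)) = p + flow (A + B) s *v v" using that by (intro mbar) simp
        show ?thesis
          unfolding affine_feedback_def mb
          by (simp add: mkv_def \<xi>_def[symmetric] v_def[symmetric] matrix_vector_right_distrib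
            matrix_vector_mult_add_rdistrib algebra_simps)
      qed
      then show ?thesis using p by simp
    qed
    have i2: "set_integrable lborel {0..t} (\<lambda>s. A *v ou A s \<omega>)"
      by (intro set_integrable_continuous_Icc bounded_bilinear.continuous_on[OF bounded_bilinear_matrix_vector continuous_on_const]
        continuous_on_subset[OF ou_continuous[OF \<omega>]]) simp
    note i1 = flow_integral[OF t, of A \<xi>] and i3 = flow_integral[OF t, of "A + B" v]
    have I: "set_integrable lborel {0..t} (\<lambda>s. A *v (flow A s *v \<xi>) + A *v ou A s \<omega> + (A + B) *v (flow (A + B) s *v v))"
      by (intro set_integral_add(1) i1(1) i2 i3(1))
    have e: "indicator {0..t} s *\<^sub>R affine_feedback A B d (law M (mkv A B p X0 s)) (mkv A B p X0 s \<omega>)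
        = indicator {0..t} s *\<^sub>R (A *v (flow A s *v \<xi>) + A *v ou A s \<omega> + (A + B) *v (flow (A + B) s *v v))" for s
      using f[of s] by (auto simp: indicator_def)
    show "set_integrable lborel {0..t} (\<lambda>s. affine_feedback A B d (law M (mkv A B p X0 s)) (mkv A B p X0 s \<omega>)) \<and>
      mkv A B p X0 t \<omega> = X0 \<omega> + (LINT s:{0..t}|lborel. affine_feedback A B d (law M (mkv A B p X0 s)) (mkv A B p X0 s \<omega>)) + W t \<omega>"
    proof
      show "set_integrable lborel {0..t} (\<lambda>s. affine_feedback A B d (law M (mkv A B p X0 s)) (mkv A B p X0 s \<omega>))"
        using I unfolding set_integrable_def e .
      have "(LINT s:{0..t}|lborel. affine_feedback A B d (law M (mkv A B p X0 s)) (mkv A B p X0 s \<omega>))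
        = (LINT s:{0..t}|lborel. A *v (flow A s *v \<xi>) + A *v ou A s \<omega> + (A + B) *v (flow (A + B) s *v v))"
        unfolding set_lebesgue_integral_def e ..
      also have "\<dots> = (flow A t *v \<xi> - \<xi>) + (LINT s:{0..t}|lborel. A *v ou A s \<omega>) + (flow (A + B) t *v v - v)"
        by (simp only: set_integral_add i1 i2 i3)
      finally show "mkv A B p X0 t \<omega> = X0 \<omega> + (LINT s:{0..t}|lborel. affine_feedback A B d (law M (mkv A B p X0 s)) (mkv A B p X0 s \<omega>)) + W t \<omega>"
        using ou_solves[OF \<omega> t, of A] by (simp add: mkv_def \<xi>_def v_def)
    qed
  qed
qed

text \<open>
  The difference of two solutions solves a linear equation whose forcing is \<open>B\<close> times its own mean and is
  therefore deterministic. So the difference is almost surely deterministic and solves the homogeneous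
  equation with matrix \<open>A + B\<close>, started at \<open>0\<close>.
\<close>

lemma mkv_unique:
  assumes X: "sq_int_solution M F W X0 (affine_feedback A B d) X" and Y: "sq_int_solution M F W X0 (affine_feedback A B d) Y"
  shows "AE \<omega> in M. \<forall>t\<ge>0. X t \<omega> = Y t \<omega>"
proof -
  define D where "D t \<omega> = X t \<omega> - Y t \<omega>" for t \<omega>
  have Xm: "X t \<in> borel_measurable M" "Y t \<in> borel_measurable M" if "0 \<le> t" for t
    using X Y that adapted_measurable unfolding sq_int_solution_def by blast+
  have iX: "integrable M (X t)" "integrable M (Y t)" if "0 \<le> t" for t
    using X Y that integrable_norm_of_square(2)[OF Xm(1)[OF that]] integrable_norm_of_square(2)[OF Xm(2)[OF that]]
    unfolding sq_int_solution_def by blast+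
  define g where "g s = B *v (expectation (X s) - expectation (Y s))" for s
  have "AE \<omega> in M. \<omega> \<in> space M \<and> (\<forall>t\<ge>0. set_integrable lborel {0..t} (\<lambda>s. A *v D s \<omega> + g s) \<and> D t \<omega> = (LINT s:{0..t}|lborel. A *v D s \<omega> + g s))"
  proof -
    have aX: "AE \<omega> in M. \<forall>t\<ge>0. set_integrable lborel {0..t} (\<lambda>s. affine_feedback A B d (law M (X s)) (X s \<omega>)) \<and>
       X t \<omega> = X0 \<omega> + (LINT s:{0..t}|lborel. affine_feedback A B d (law M (X s)) (X s \<omega>)) + W t \<omega>"
      using X unfolding sq_int_solution_def by blast
    have aY: "AE \<omega> in M. \<forall>t\<ge>0. set_integrable lborel {0..t} (\<lambda>s. affine_feedback A B d (law M (Y s)) (Y s \<omega>)) \<and>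
       Y t \<omega> = X0 \<omega> + (LINT s:{0..t}|lborel. affine_feedback A B d (law M (Y s)) (Y s \<omega>)) + W t \<omega>"
      using Y unfolding sq_int_solution_def by blast
    from aX aY AE_space show ?thesis
    proof eventually_elim
      case (elim \<omega>)
      have step: "set_integrable lborel {0..t} (\<lambda>s. A *v D s \<omega> + g s) \<and> D t \<omega> = (LINT s:{0..t}|lborel. A *v D s \<omega> + g s)"
        if t: "0 \<le> t" for t
      proof -
        have i: "set_integrable lborel {0..t} (\<lambda>s. affine_feedback A B d (law M (X s)) (X s \<omega>))"
          "set_integrable lborel {0..t} (\<lambda>s. affine_feedback A B d (law M (Y s)) (Y s \<omega>))" using elim t by blast+
        have e: "indicator {0..t} s *\<^sub>R (affine_feedback A B d (law M (X s)) (X s \<omega>) - affine_feedback A B d (law M (Y s)) (Y s \<omega>))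
          = indicator {0..t} s *\<^sub>R (A *v D s \<omega> + g s)" for s
        proof (cases "s \<in> {0..t}")
          case True
          then have "0 \<le> s" by simp
          then show ?thesis using mean_law[OF Xm(1)] mean_law[OF Xm(2)]
            by (simp add: affine_feedback_def D_def g_def matrix_vector_mult_diff_distrib algebra_simps)
        qed simp
        have I: "set_integrable lborel {0..t} (\<lambda>s. A *v D s \<omega> + g s)"
          using set_integral_diff(1)[OF i] unfolding set_integrable_def e .
        have e1: "X t \<omega> - Y t \<omega> = (LINT s:{0..t}|lborel. affine_feedback A B d (law M (X s)) (X s \<omega>))
            - (LINT s:{0..t}|lborel. affine_feedback A B d (law M (Y s)) (Y s \<omega>))"
        proof -
          have "X t \<omega> = X0 \<omega> + (LINT s:{0..t}|lborel. affine_feedback A B d (law M (X s)) (X s \<omega>)) + W t \<omega>"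
            "Y t \<omega> = X0 \<omega> + (LINT s:{0..t}|lborel. affine_feedback A B d (law M (Y s)) (Y s \<omega>)) + W t \<omega>"
            using elim t by blast+
          moreover have "x - y = a - b" if "x = x0 + a + w" "y = x0 + b + w" for x y x0 a b w :: "real^2"
            using that by simp
          ultimately show ?thesis by blast
        qed
        also have e2: "\<dots> = (LINT s:{0..t}|lborel. A *v D s \<omega> + g s)"
          unfolding set_integral_diff(2)[OF i, symmetric] unfolding set_lebesgue_integral_def e ..
        finally have "D t \<omega> = (LINT s:{0..t}|lborel. A *v D s \<omega> + g s)" unfolding D_def[of t \<omega>] .
        with I show ?thesis by (rule conjI)
      qed
      show ?case by (intro conjI allI impI elim(3) conjunct1[OF step] conjunct2[OF step])
    qed
  qed
  note good = this
  obtain \<omega>0 where w0: "\<omega>0 \<in> space M \<and> (\<forall>t\<ge>0. set_integrable lborel {0..t} (\<lambda>s. A *v D s \<omega>0 + g s) \<and>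
      D t \<omega>0 = (LINT s:{0..t}|lborel. A *v D s \<omega>0 + g s))"
    by (rule AE_witness[OF good])
  have \<omega>0: "\<omega>0 \<in> space M" "\<And>t. 0 \<le> t \<Longrightarrow> set_integrable lborel {0..t} (\<lambda>s. A *v D s \<omega>0 + g s)"
    "\<And>t. 0 \<le> t \<Longrightarrow> D t \<omega>0 = (LINT s:{0..t}|lborel. A *v D s \<omega>0 + g s)"
    by (rule conjunct1[OF w0], rule conjunct1[OF conjunct2[OF w0, rule_format]], assumption,
      rule conjunct2[OF conjunct2[OF w0, rule_format]], assumption)
  have Dc: "continuous_on {0..} (\<lambda>t. D t \<omega>)" if "\<omega> \<in> space M" for \<omega>
    unfolding D_def using X Y that unfolding sq_int_solution_def by (intro continuous_on_diff) blast+
  have det: "AE \<omega> in M. \<forall>t\<ge>0. D t \<omega> = D t \<omega>0"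
    using good
  proof eventually_elim
    case (elim \<omega>)
    show ?case
    proof (intro allI impI)
      fix t :: real assume t: "0 \<le> t"
      have "D t \<omega> - D t \<omega>0 = 0"
      proof (rule linear_volterra_unique[where u = "\<lambda>t. D t \<omega> - D t \<omega>0" and A = A])
        show "continuous_on {0..} (\<lambda>t. D t \<omega> - D t \<omega>0)" using elim \<omega>0 by (intro continuous_on_diff Dc) auto
        fix t :: real assume t: "0 \<le> t"
        have i: "set_integrable lborel {0..t} (\<lambda>s. A *v D s \<omega> + g s)" and D: "D t \<omega> = (LINT s:{0..t}|lborel. A *v D s \<omega> + g s)"
          using elim t by blast+
        have "D t \<omega> - D t \<omega>0 = (LINT s:{0..t}|lborel. (A *v D s \<omega> + g s) - (A *v D s \<omega>0 + g s))"
          unfolding set_integral_diff(2)[OF i \<omega>0(2)[OF t]] using D \<omega>0(3)[OF t] by simp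
        then show "D t \<omega> - D t \<omega>0 = (LINT s:{0..t}|lborel. A *v (D s \<omega> - D s \<omega>0))"
          by (simp add: matrix_vector_mult_diff_distrib)
      qed (rule t)
      then show "D t \<omega> = D t \<omega>0" by simp
    qed
  qed
  have mean: "expectation (X t) - expectation (Y t) = D t \<omega>0" if t: "0 \<le> t" for t
  proof -
    have "expectation (X t) - expectation (Y t) = expectation (D t)"
      using iX[OF t] by (simp add: D_def[abs_def])
    also have "\<dots> = expectation (\<lambda>_. D t \<omega>0)"
    proof (rule integral_cong_AE)
      show "AE \<omega> in M. D t \<omega> = D t \<omega>0" using det by eventually_elim (use t in simp)
      show "D t \<in> borel_measurable M" unfolding D_def[abs_def] using Xm[OF t] by measurable
    qed simp
    finally show ?thesis by (simp add: prob_space)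
  qed
  have zero: "D t \<omega>0 = 0" if t: "0 \<le> t" for t
  proof (rule linear_volterra_unique[where A = "A + B", OF Dc[OF \<omega>0(1)] _ t])
    fix t :: real assume t: "0 \<le> t"
    have "(LINT s:{0..t}|lborel. A *v D s \<omega>0 + g s) = (LINT s:{0..t}|lborel. (A + B) *v D s \<omega>0)"
      by (intro set_lebesgue_integral_cong) (auto simp: g_def mean matrix_vector_mult_add_rdistrib)
    then show "D t \<omega>0 = (LINT s:{0..t}|lborel. (A + B) *v D s \<omega>0)" using \<omega>0(3)[OF t] by simp
  qed
  show ?thesis
    using det
  proof eventually_elim
    case (elim \<omega>)
    show ?case
    proof (intro allI impI)
      fix t :: real assume "0 \<le> t"
      then have "D t \<omega> = 0" using elim zero by simp
      then show "X t \<omega> = Y t \<omega>" by (simp add: D_def)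
    qed
  qed
qed

end

section \<open>The law of the Ornstein--Uhlenbeck process\<close>

sublocale brownian \<subseteq> noise M F W
proof unfold_locales
  show "space (F t) = space M" for t by (rule space_F)
  show "sets (F s) \<subseteq> sets (F t)" if "0 \<le> s" "s \<le> t" for s t
    by (rule filtration.sets_F_mono[OF filtration that(2)])
  show "sets (F t) \<subseteq> sets M" for t by (rule sets_F)
  show "W t \<in> borel_measurable (F t)" if "0 \<le> t" for t using W_adapted that by simp
  show "continuous_on {0..} (\<lambda>t. W t \<omega>)" if "\<omega> \<in> space M" for \<omega> by (rule W_continuous[OF that])
qed (rule W_moments; assumption)+

lemma convolution_law_zero:
  fixes Y :: "'a \<Rightarrow> real^2"
  assumes M: "prob_space M" and Y: "Y \<in> borel_measurable M"
  shows "(law M Y \<star> law M (\<lambda>_. 0)) = law M Y"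
proof -
  interpret M: prob_space M by (rule M)
  have "law (M \<Otimes>\<^sub>M M) (\<lambda>p. Y (fst p) + 0) = law (distr (M \<Otimes>\<^sub>M M) M fst) Y"
    using Y by (subst distr_distr) (auto simp: o_def)
  then show ?thesis
    using law_sum_product_space[OF M M Y, of "\<lambda>_. 0"] M.distr_pair_fst[of M] by simp
qed

lemma distr_linear:
  fixes f :: "real^2 \<Rightarrow> real^2"
  assumes "Y \<in> borel_measurable M" "linear f"
  shows "law (law M Y) f = law M (\<lambda>\<omega>. f (Y \<omega>))"
proof -
  have "f \<in> borel_measurable borel"
    using assms(2) by (intro borel_measurable_continuous_onI linear_continuous_on) (simp add: linear_conv_bounded_linear)
  then show ?thesis using assms(1) by (subst distr_distr) (auto simp: o_def)
qed

lemma linear_matrix: "linear (\<lambda>v. A *v v)" for A :: "real^2^2"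
  by (rule bounded_linear.linear[OF matrix_vector_mul_bounded_linear])

context brownian begin

lemma law_increment:
  assumes "0 \<le> s" "s < t" "0 \<le> s'" "s' < t'" "t - s = t' - s'"
  shows "law M (\<lambda>\<omega>. W t \<omega> - W s \<omega>) = law M (\<lambda>\<omega>. W t' \<omega> - W s' \<omega>)"
proof -
  have e: "law M f = distr M lborel f" for f :: "'a \<Rightarrow> real^2" by (rule distr_cong) simp_all
  show ?thesis unfolding e
    using distributed_distr_eq_density[OF increment_distributed[OF assms(1,2)]]
      distributed_distr_eq_density[OF increment_distributed[OF assms(3,4)]] assms(5) by simp
qed

lemma law_add_increment:
  assumes st: "0 \<le> s" "s < t" and Y: "Y \<in> borel_measurable (F s)"
  shows "law M (\<lambda>\<omega>. Y \<omega> + (W t \<omega> - W s \<omega>)) = (law M Y \<star> law M (\<lambda>\<omega>. W t \<omega> - W s \<omega>))"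
proof (rule sum_indep_random_variable[OF increment_indep[OF st Y]])
  show "Y \<in> borel_measurable M" by (rule measurable_F[OF Y])
  show "(\<lambda>\<omega>. W t \<omega> - W s \<omega>) \<in> borel_measurable M" using W_measurable st by (intro borel_measurable_diff) auto
qed

definition path :: "real \<Rightarrow> 'a \<Rightarrow> real \<Rightarrow> real^2" where
  "path s \<omega> u = W (s + u) \<omega> - W s \<omega>"

lemma euler_adapted:
  assumes s: "0 \<le> s" and h: "0 \<le> h" and Y: "Y \<in> borel_measurable (F s)"
  shows "(\<lambda>\<omega>. euler A h (path s \<omega>) (Y \<omega>) k) \<in> borel_measurable (F (s + real k * h))"
proof (induction k)
  case (Suc k)
  have le: "s + real k * h \<le> s + real (Suc k) * h" "0 \<le> s + real k * h" "s \<le> s + real (Suc k) * h" using s h by (auto simp: algebra_simps)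
  have E: "(\<lambda>\<omega>. euler A h (path s \<omega>) (Y \<omega>) k) \<in> borel_measurable (F (s + real (Suc k) * h))"
    by (rule measurable_F_mono[OF le(1) Suc])
  have Wm: "(\<lambda>\<omega>. path s \<omega> (real j * h)) \<in> borel_measurable (F (s + real (Suc k) * h))" if "j \<le> Suc k" for j
  proof -
    have "real j * h \<le> real (Suc k) * h" using that h by (intro mult_right_mono) auto
    then show ?thesis unfolding path_def using s h by (intro borel_measurable_diff W_adapted) (auto simp: le(3))
  qed
  show ?case unfolding euler.simps
    using E Wm[of k] Wm[of "Suc k"] borel_measurable_matrix_vector[OF E, of A]
    by (intro borel_measurable_add borel_measurable_diff borel_measurable_scaleR) auto
qed (use Y in simp)

lemma euler_step: "euler A h w x (Suc k) = (mat 1 + h *\<^sub>R A) *v euler A h w x k + (w (real (Suc k) * h) - w (real k * h))"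
  by (simp add: matrix_vector_mult_add_rdistrib scaleR_matrix_vector_assoc)

text \<open>
  One Euler step is a linear map followed by an independent increment, and laws of increments depend only
  on the time step. By induction, the law with initial value \<open>Y\<close> and path shifted by \<open>s\<close> is the convolution
  of the transported law of \<open>Y\<close> with the law started at \<open>0\<close> from time \<open>0\<close>.
\<close>

lemma euler_law:
  assumes s: "0 \<le> s" and h: "0 < h" and Y: "Y \<in> borel_measurable (F s)"
  shows "law M (\<lambda>\<omega>. euler A h (path s \<omega>) (Y \<omega>) k)
    = (law M (\<lambda>\<omega>. euler A h (\<lambda>_. 0) (Y \<omega>) k) \<star> law M (\<lambda>\<omega>. euler A h (path 0 \<omega>) 0 k))"
proof (induction k)
  case 0
  show ?case using convolution_law_zero[OF prob_space_axioms measurable_F[OF Y]] by simp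
next
  case (Suc k)
  let ?L = "\<lambda>v. (mat 1 + h *\<^sub>R A) *v v"
  define E where "E \<omega> = euler A h (path s \<omega>) (Y \<omega>) k" for \<omega>
  define E0 where "E0 \<omega> = euler A h (path 0 \<omega>) 0 k" for \<omega>
  define D where "D \<omega> = euler A h (\<lambda>_. 0) (Y \<omega>) k" for \<omega>
  have lin: "linear ?L" by (rule linear_matrix)
  have EF: "E \<in> borel_measurable (F (s + real k * h))" unfolding E_def[abs_def] using euler_adapted[OF s less_imp_le[OF h] Y] .
  have E0F: "E0 \<in> borel_measurable (F (0 + real k * h))" unfolding E0_def[abs_def] using euler_adapted[of 0 h "\<lambda>_. 0"] h by simp
  have Dm: "(\<lambda>\<omega>. euler A h (\<lambda>_. 0) (Y \<omega>) j) \<in> borel_measurable M" for j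
  proof (induction j)
    case (Suc j)
    show ?case unfolding euler_step using borel_measurable_matrix_vector[OF Suc] by simp
  qed (use measurable_F[OF Y] in simp)
  have Dm': "D \<in> borel_measurable M" unfolding D_def[abs_def] by (rule Dm)
  define \<nu> where "\<nu> = law M (\<lambda>\<omega>. W h \<omega> - W 0 \<omega>)"
  have kh: "0 \<le> s + real k * h" "s + real k * h < s + real (Suc k) * h" "0 \<le> 0 + real k * h" "0 + real k * h < 0 + real (Suc k) * h"
    using s h by (auto simp: algebra_simps)
  have \<nu>1: "law M (\<lambda>\<omega>. W (s + real (Suc k) * h) \<omega> - W (s + real k * h) \<omega>) = \<nu>"
    unfolding \<nu>_def by (rule law_increment) (use kh h in \<open>auto simp: algebra_simps\<close>)
  have \<nu>0: "law M (\<lambda>\<omega>. W (0 + real (Suc k) * h) \<omega> - W (0 + real k * h) \<omega>) = \<nu>"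
    unfolding \<nu>_def by (rule law_increment) (use kh h in \<open>auto simp: algebra_simps\<close>)
  have e: "euler A h (path s \<omega>) (Y \<omega>) (Suc k) = ?L (E \<omega>) + (W (s + real (Suc k) * h) \<omega> - W (s + real k * h) \<omega>)" for \<omega>
    unfolding euler_step E_def path_def by simp
  have e0: "euler A h (path 0 \<omega>) 0 (Suc k) = ?L (E0 \<omega>) + (W (0 + real (Suc k) * h) \<omega> - W (0 + real k * h) \<omega>)" for \<omega>
    unfolding euler_step E0_def path_def by simp
  have d: "euler A h (\<lambda>_. 0) (Y \<omega>) (Suc k) = ?L (D \<omega>)" for \<omega> unfolding euler_step D_def by simp
  have P: "prob_space (law M f)" if "f \<in> borel_measurable M" for f :: "'a \<Rightarrow> real^2" by (rule prob_space_law[OF that])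
  have Em: "E \<in> borel_measurable M" "E0 \<in> borel_measurable M" using measurable_F[OF EF] measurable_F[OF E0F] by auto
  have "law M (\<lambda>\<omega>. euler A h (path s \<omega>) (Y \<omega>) (Suc k)) = (law M (\<lambda>\<omega>. ?L (E \<omega>)) \<star> \<nu>)"
    unfolding e law_add_increment[OF kh(1,2) borel_measurable_matrix_vector[OF EF]] \<nu>1 ..
  also have "law M (\<lambda>\<omega>. ?L (E \<omega>)) = law (law M E) ?L" by (rule distr_linear[OF Em(1) lin, symmetric])
  also have "law M E = (law M D \<star> law M E0)" using Suc unfolding E_def[abs_def] E0_def[abs_def] D_def[abs_def] .
  also have "law (law M D \<star> law M E0) ?L = (law (law M D) ?L \<star> law (law M E0) ?L)"
    by (rule law_convolution_linear[OF P[OF Dm'] P[OF Em(2)] _ _ lin]) simp_all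
  also have "\<dots> = (law M (\<lambda>\<omega>. ?L (D \<omega>)) \<star> law M (\<lambda>\<omega>. ?L (E0 \<omega>)))"
    by (simp only: distr_linear[OF Dm' lin] distr_linear[OF Em(2) lin])
  also have "(\<dots> \<star> \<nu>) = (law M (\<lambda>\<omega>. ?L (D \<omega>)) \<star> (law M (\<lambda>\<omega>. ?L (E0 \<omega>)) \<star> \<nu>))"
  proof (rule convolution_associative[symmetric])
    show "finite_measure \<nu>" unfolding \<nu>_def using W_measurable h
      by (intro prob_space.finite_measure P borel_measurable_diff) auto
    show "finite_measure (law M (\<lambda>\<omega>. ?L (E0 \<omega>)))" "finite_measure (law M (\<lambda>\<omega>. ?L (D \<omega>)))"
      by (intro prob_space.finite_measure P borel_measurable_matrix_vector Em Dm')+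
  qed (simp_all add: \<nu>_def)
  also have "(law M (\<lambda>\<omega>. ?L (E0 \<omega>)) \<star> \<nu>) = law M (\<lambda>\<omega>. euler A h (path 0 \<omega>) 0 (Suc k))"
    unfolding e0 law_add_increment[OF kh(3,4) borel_measurable_matrix_vector[OF E0F]] \<nu>0 ..
  finally show ?case unfolding d .
qed

lemma path_continuous: "0 \<le> s \<Longrightarrow> \<omega> \<in> space M \<Longrightarrow> continuous_on {0..} (path s \<omega>)"
  unfolding path_def
  by (intro continuous_on_diff continuous_on_const continuous_on_compose2[OF W_continuous, of \<omega> "{0..}" "\<lambda>u. s + u"] continuous_intros) auto

lemma affine_path_solves:
  assumes g: "continuous_on {0..} g"
  shows "continuous_on {0..} (\<lambda>t. flow A t *v y + response A g t)"
    and "0 \<le> t \<Longrightarrow> flow A t *v y + response A g t = y + (LINT r:{0..t}|lborel. A *v (flow A r *v y + response A g r)) + g t"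
proof -
  show "continuous_on {0..} (\<lambda>t. flow A t *v y + response A g t)"
    by (intro continuous_on_add response_solves(1)[OF g] bounded_bilinear.continuous_on[OF bounded_bilinear_matrix_vector]
      continuous_on_const continuous_on_flow)
  assume t: "0 \<le> t"
  have i: "set_integrable lborel {0..t} (\<lambda>r. A *v response A g r)"
    by (intro set_integrable_continuous_Icc bounded_bilinear.continuous_on[OF bounded_bilinear_matrix_vector continuous_on_const]
        continuous_on_subset[OF response_solves(1)[OF g]]) simp
  show "flow A t *v y + response A g t = y + (LINT r:{0..t}|lborel. A *v (flow A r *v y + response A g r)) + g t"
    unfolding matrix_vector_right_distrib set_integral_add(2)[OF flow_integral(1)[OF t] i] flow_integral(2)[OF t]
    using response_solves(2)[OF g t, of A] by simp
qed

text \<open>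
  The Markov property of the linear equation at time \<open>s\<close>, obtained from the Euler scheme in the limit of
  small steps.
\<close>

lemma markov_law:
  assumes s: "0 \<le> s" and t: "0 < t" and Y: "Y \<in> borel_measurable (F s)"
  shows "(\<lambda>\<omega>. response A (path s \<omega>) t) \<in> borel_measurable (F (s + t))"
    and "law M (\<lambda>\<omega>. flow A t *v Y \<omega> + response A (path s \<omega>) t) = (law M (\<lambda>\<omega>. flow A t *v Y \<omega>) \<star> law M (ou A t))"
proof -
  have Ym: "Y \<in> borel_measurable M" by (rule measurable_F[OF Y])
  have h: "0 < t / real (Suc n)" for n using t by simp
  have E: "(\<lambda>n. euler A (t / real (Suc n)) (path s \<omega>) y (Suc n)) \<longlonglongrightarrow> flow A t *v y + response A (path s \<omega>) t"
    if "\<omega> \<in> space M" "0 \<le> s" for s \<omega> y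
  proof (rule euler_converges[where x = "\<lambda>t. flow A t *v y + response A (path s \<omega>) t"])
    note g = path_continuous[OF that(2,1)]
    show "continuous_on {0..} (\<lambda>t. flow A t *v y + response A (path s \<omega>) t)" by (rule affine_path_solves(1)[OF g])
    show "flow A t *v y + response A (path s \<omega>) t = y + (LINT r:{0..t}|lborel. A *v (flow A r *v y + response A (path s \<omega>) r)) + path s \<omega> t"
      if "0 \<le> t" for t by (rule affine_path_solves(2)[OF g that])
  qed (use t in \<open>auto simp: path_def\<close>)
  have rm: "(\<lambda>\<omega>. response A (path s \<omega>) t) \<in> borel_measurable (F (s + t))" if s: "0 \<le> s" for s
  proof (rule borel_measurable_LIMSEQ_metric)
    fix \<omega> assume "\<omega> \<in> space (F (s + t))"
    then show "(\<lambda>n. euler A (t / real (Suc n)) (path s \<omega>) 0 (Suc n)) \<longlonglongrightarrow> response A (path s \<omega>) t"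
      using E[of \<omega> s 0] s by (simp add: space_F)
  next
    fix n
    have "s + real (Suc n) * (t / real (Suc n)) = s + t" by simp
    then show "(\<lambda>\<omega>. euler A (t / real (Suc n)) (path s \<omega>) 0 (Suc n)) \<in> borel_measurable (F (s + t))"
      using euler_adapted[OF s less_imp_le[OF h[of n]], of "\<lambda>_. 0" A "Suc n"] by simp
  qed
  show "(\<lambda>\<omega>. response A (path s \<omega>) t) \<in> borel_measurable (F (s + t))" by (rule rm[OF s])
  have E0: "(\<lambda>n. euler A (t / real (Suc n)) (\<lambda>_. 0) y (Suc n)) \<longlonglongrightarrow> flow A t *v y" for y
  proof (rule euler_converges[where x = "\<lambda>t. flow A t *v y"])
    show "continuous_on {0..} (\<lambda>t. flow A t *v y)"
      by (intro bounded_bilinear.continuous_on[OF bounded_bilinear_matrix_vector] continuous_on_const continuous_on_flow)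
    show "flow A t *v y = y + (LINT r:{0..t}|lborel. A *v (flow A r *v y)) + 0" if "0 \<le> t" for t
      using flow_integral(2)[OF that, of A y] by simp
  qed (use t in auto)
  interpret p: pair_prob_space M M ..
  define Z where "Z \<omega> = response A (path 0 \<omega>) t" for \<omega>
  have Zm: "Z \<in> borel_measurable M" unfolding Z_def[abs_def] using measurable_F[OF rm[of 0]] by simp
  have fYm: "(\<lambda>\<omega>. flow A t *v Y \<omega>) \<in> borel_measurable M" by (rule borel_measurable_matrix_vector[OF Ym])
  have em: "(\<lambda>\<omega>. euler A (t / real (Suc n)) (path 0 \<omega>) 0 (Suc n)) \<in> borel_measurable M" for n
    using measurable_F[OF euler_adapted[OF order_refl less_imp_le[OF h[of n]], of "\<lambda>_. 0" A "Suc n"]] by simp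
  have dm: "(\<lambda>\<omega>. euler A (t / real (Suc n)) (\<lambda>_. 0) (Y \<omega>) j) \<in> borel_measurable M" for n j
  proof (induction j)
    case (Suc j)
    show ?case unfolding euler_step using borel_measurable_matrix_vector[OF Suc] by simp
  qed (use Ym in simp)
  have "law M (\<lambda>\<omega>. flow A t *v Y \<omega> + response A (path s \<omega>) t) = law (M \<Otimes>\<^sub>M M) (\<lambda>p. flow A t *v Y (fst p) + Z (snd p))"
  proof (rule law_limit_unique[OF prob_space_axioms p.prob_space_axioms,
      where S = "\<lambda>n \<omega>. euler A (t / real (Suc n)) (path s \<omega>) (Y \<omega>) (Suc n)" and
        S' = "\<lambda>n p. euler A (t / real (Suc n)) (\<lambda>_. 0) (Y (fst p)) (Suc n) + euler A (t / real (Suc n)) (path 0 (snd p)) 0 (Suc n)"])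
    fix n
    show "(\<lambda>\<omega>. euler A (t / real (Suc n)) (path s \<omega>) (Y \<omega>) (Suc n)) \<in> borel_measurable M"
      by (rule measurable_F[OF euler_adapted[OF s less_imp_le[OF h[of n]] Y]])
    show "(\<lambda>p. euler A (t / real (Suc n)) (\<lambda>_. 0) (Y (fst p)) (Suc n) + euler A (t / real (Suc n)) (path 0 (snd p)) 0 (Suc n)) \<in> borel_measurable (M \<Otimes>\<^sub>M M)"
      by (intro borel_measurable_add measurable_compose[OF measurable_fst dm] measurable_compose[OF measurable_snd em])
    show "law M (\<lambda>\<omega>. euler A (t / real (Suc n)) (path s \<omega>) (Y \<omega>) (Suc n))
      = law (M \<Otimes>\<^sub>M M) (\<lambda>p. euler A (t / real (Suc n)) (\<lambda>_. 0) (Y (fst p)) (Suc n) + euler A (t / real (Suc n)) (path 0 (snd p)) 0 (Suc n))"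
      unfolding law_sum_product_space[OF prob_space_axioms prob_space_axioms dm em] by (rule euler_law[OF s h Y])
  next
    show "(\<lambda>\<omega>. flow A t *v Y \<omega> + response A (path s \<omega>) t) \<in> borel_measurable M"
      by (rule borel_measurable_add[OF fYm measurable_F[OF rm[OF s]]])
    show "(\<lambda>p. flow A t *v Y (fst p) + Z (snd p)) \<in> borel_measurable (M \<Otimes>\<^sub>M M)"
      by (intro borel_measurable_add measurable_compose[OF measurable_fst fYm] measurable_compose[OF measurable_snd Zm])
    show "AE \<omega> in M. (\<lambda>n. euler A (t / real (Suc n)) (path s \<omega>) (Y \<omega>) (Suc n)) \<longlonglongrightarrow> flow A t *v Y \<omega> + response A (path s \<omega>) t"
      by (rule AE_I2) (rule E[OF _ s])
    show "AE p in M \<Otimes>\<^sub>M M. (\<lambda>n. euler A (t / real (Suc n)) (\<lambda>_. 0) (Y (fst p)) (Suc n) + euler A (t / real (Suc n)) (path 0 (snd p)) 0 (Suc n))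
       \<longlonglongrightarrow> flow A t *v Y (fst p) + Z (snd p)"
    proof (rule AE_I2, rule tendsto_add[OF E0])
      fix p assume "p \<in> space (M \<Otimes>\<^sub>M M)"
      then have "snd p \<in> space M" by (auto simp: space_pair_measure)
      from E[OF this order_refl, of 0]
      show "(\<lambda>n. euler A (t / real (Suc n)) (path 0 (snd p)) 0 (Suc n)) \<longlonglongrightarrow> Z (snd p)" by (simp add: Z_def)
    qed
  qed
  also have "\<dots> = (law M (\<lambda>\<omega>. flow A t *v Y \<omega>) \<star> law M Z)"
    by (rule law_sum_product_space[OF prob_space_axioms prob_space_axioms fYm Zm])
  also have "law M Z = law M (ou A t)"
  proof (rule distr_cong_AE)
    show "AE \<omega> in M. Z \<omega> = ou A t \<omega>"
      using W_0
    proof eventually_elim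
      case (elim \<omega>)
      then have "path 0 \<omega> = (\<lambda>s. W s \<omega>)" by (simp add: path_def fun_eq_iff)
      then show ?case by (simp add: Z_def ou_def)
    qed
  qed (use Zm ou_measurable t in auto)
  finally show "law M (\<lambda>\<omega>. flow A t *v Y \<omega> + response A (path s \<omega>) t) = (law M (\<lambda>\<omega>. flow A t *v Y \<omega>) \<star> law M (ou A t))" .
qed

lemma set_integral_shift:
  fixes f :: "real \<Rightarrow> real^2"
  assumes st: "0 \<le> s" "0 \<le> t" and f: "continuous_on {0..} f"
  shows "(LINT r:{0..s+t}|lborel. f r) = (LINT r:{0..s}|lborel. f r) + (LINT r:{0..t}|lborel. f (s + r))"
proof -
  have c: "continuous_on {a..b} f" if "0 \<le> a" for a b using that by (intro continuous_on_subset[OF f]) auto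
  have HK: "(LINT r:{a..b}|lborel. f r) = integral {a..b} f" if "0 \<le> a" for a b
    by (intro set_borel_integral_eq_integral set_integrable_continuous_Icc c that)
  have "(LINT r:{s..s+t}|lborel. f r) = (LINT r:{0..t}|lborel. f (s + r))"
    unfolding set_lebesgue_integral_def
    by (subst lborel_integral_real_affine[where c = 1 and t = s])
      (auto intro!: Bochner_Integration.integral_cong simp: indicator_def)
  moreover have "integral {0..s+t} f = integral {0..s} f + integral {s..s+t} f"
    by (rule Henstock_Kurzweil_Integration.integral_combine[symmetric]) (use st in \<open>auto intro!: integrable_continuous_real c\<close>)
  ultimately show ?thesis using HK st by simp
qed

lemma ou_add:
  assumes s: "0 \<le> s" and t: "0 \<le> t" and \<omega>: "\<omega> \<in> space M"
  shows "ou A (s + t) \<omega> = flow A t *v ou A s \<omega> + response A (path s \<omega>) t"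
proof -
  note g = path_continuous[OF s \<omega>]
  let ?x = "\<lambda>t. flow A t *v ou A s \<omega> + response A (path s \<omega>) t"
  have cA: "continuous_on {0..} (\<lambda>r. A *v ou A r \<omega>)"
    by (intro bounded_bilinear.continuous_on[OF bounded_bilinear_matrix_vector continuous_on_const] ou_continuous[OF \<omega>])
  have cs: "continuous_on {0..} (\<lambda>t. ou A (s + t) \<omega>)"
    by (intro continuous_on_compose2[OF ou_continuous[OF \<omega>], of "{0..}" "\<lambda>t. s + t"] continuous_intros) (use s in auto)
  have "ou A (s + t) \<omega> - ?x t = 0"
  proof (rule linear_volterra_unique[where u = "\<lambda>t. ou A (s + t) \<omega> - ?x t" and A = A, OF _ _ t])
    show "continuous_on {0..} (\<lambda>t. ou A (s + t) \<omega> - ?x t)"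
      by (intro continuous_on_diff cs affine_path_solves(1)[OF g])
    fix t :: real assume t: "0 \<le> t"
    have i1: "set_integrable lborel {0..t} (\<lambda>r. A *v ou A (s + r) \<omega>)"
      by (intro set_integrable_continuous_Icc bounded_bilinear.continuous_on[OF bounded_bilinear_matrix_vector continuous_on_const]
        continuous_on_subset[OF cs]) simp
    have i2: "set_integrable lborel {0..t} (\<lambda>r. A *v ?x r)"
      by (intro set_integrable_continuous_Icc bounded_bilinear.continuous_on[OF bounded_bilinear_matrix_vector continuous_on_const]
        continuous_on_subset[OF affine_path_solves(1)[OF g]]) simp
    have "ou A (s + t) \<omega> = W (s + t) \<omega> + ((LINT r:{0..s}|lborel. A *v ou A r \<omega>) + (LINT r:{0..t}|lborel. A *v ou A (s + r) \<omega>))"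
      using ou_solves[OF \<omega>, of "s + t" A] s t by (simp add: set_integral_shift[OF s t cA])
    also have "\<dots> = ou A s \<omega> + path s \<omega> t + (LINT r:{0..t}|lborel. A *v ou A (s + r) \<omega>)"
      using ou_solves[OF \<omega> s, of A] by (simp add: path_def)
    finally have "ou A (s + t) \<omega> - ?x t = (LINT r:{0..t}|lborel. A *v ou A (s + r) \<omega>) - (LINT r:{0..t}|lborel. A *v ?x r)"
      using affine_path_solves(2)[OF g t, of A "ou A s \<omega>"] by simp
    also have "\<dots> = (LINT r:{0..t}|lborel. A *v (ou A (s + r) \<omega> - ?x r))"
      unfolding matrix_vector_mult_diff_distrib by (rule set_integral_diff(2)[OF i1 i2, symmetric])
    finally show "ou A (s + t) \<omega> - ?x t = (LINT r:{0..t}|lborel. A *v (ou A (s + r) \<omega> - ?x r))" .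
  qed
  then show ?thesis by simp
qed

text \<open>
  The law of the process started at \<open>0\<close> satisfies the semigroup relation of convolutions, from which its
  limit is computed.
\<close>

lemma ou_law_add:
  assumes s: "0 \<le> s" and t: "0 < t"
  shows "law M (ou A (s + t)) = (law M (\<lambda>\<omega>. flow A t *v ou A s \<omega>) \<star> law M (ou A t))"
proof -
  have "law M (ou A (s + t)) = law M (\<lambda>\<omega>. flow A t *v ou A s \<omega> + response A (path s \<omega>) t)"
    by (rule distr_cong) (use ou_add[OF s less_imp_le[OF t]] in simp_all)
  then show ?thesis using markov_law(2)[OF s t ou_adapted[OF s]] by simp
qed

end

section \<open>The invariant law\<close>

lemma distr_snd_product:
  assumes "prob_space N" "prob_space M"
  shows "distr (N \<Otimes>\<^sub>M M) M snd = M"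
proof (rule measure_eqI)
  interpret N: prob_space N by (rule assms(1))
  interpret M: prob_space M by (rule assms(2))
  fix A assume "A \<in> sets (distr (N \<Otimes>\<^sub>M M) M snd)"
  then have A: "A \<in> sets M" by simp
  have "snd -` A \<inter> space (N \<Otimes>\<^sub>M M) = space N \<times> A"
    using sets.sets_into_space[OF A] by (auto simp: space_pair_measure)
  then show "emeasure (distr (N \<Otimes>\<^sub>M M) M snd) A = emeasure M A"
    using A by (simp add: emeasure_distr M.emeasure_pair_measure_Times N.emeasure_space_1)
qed simp

lemma product_fst:
  fixes f :: "'a \<Rightarrow> 'c::{banach, second_countable_topology}"
  assumes "prob_space N" "prob_space M" and f: "f \<in> borel_measurable N"
  shows "integrable (N \<Otimes>\<^sub>M M) (\<lambda>q. f (fst q)) \<longleftrightarrow> integrable N f"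
    and "(\<integral>q. f (fst q) \<partial>(N \<Otimes>\<^sub>M M)) = (\<integral>x. f x \<partial>N)"
    and "distr (N \<Otimes>\<^sub>M M) borel (\<lambda>q. f (fst q)) = distr N borel f"
proof -
  have d: "distr (N \<Otimes>\<^sub>M M) N fst = N" by (rule prob_space.distr_pair_fst[OF assms(2)])
  have m: "fst \<in> measurable (N \<Otimes>\<^sub>M M) N" by simp
  show "integrable (N \<Otimes>\<^sub>M M) (\<lambda>q. f (fst q)) \<longleftrightarrow> integrable N f"
    using integrable_distr_eq[OF m f] unfolding d by simp
  show "(\<integral>q. f (fst q) \<partial>(N \<Otimes>\<^sub>M M)) = (\<integral>x. f x \<partial>N)"
    using integral_distr[OF m f] unfolding d by simp
  show "distr (N \<Otimes>\<^sub>M M) borel (\<lambda>q. f (fst q)) = distr N borel f"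
    using distr_distr[OF f m] unfolding d by (simp add: o_def)
qed

lemma product_snd:
  fixes f :: "'a \<Rightarrow> 'c::{banach, second_countable_topology}"
  assumes "prob_space N" "prob_space M" and f: "f \<in> borel_measurable M"
  shows "integrable (N \<Otimes>\<^sub>M M) (\<lambda>q. f (snd q)) \<longleftrightarrow> integrable M f"
    and "(\<integral>q. f (snd q) \<partial>(N \<Otimes>\<^sub>M M)) = (\<integral>x. f x \<partial>M)"
    and "distr (N \<Otimes>\<^sub>M M) borel (\<lambda>q. f (snd q)) = distr M borel f"
proof -
  have d: "distr (N \<Otimes>\<^sub>M M) M snd = M" by (rule distr_snd_product[OF assms(1,2)])
  have m: "snd \<in> measurable (N \<Otimes>\<^sub>M M) M" by simp
  show "integrable (N \<Otimes>\<^sub>M M) (\<lambda>q. f (snd q)) \<longleftrightarrow> integrable M f"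
    using integrable_distr_eq[OF m f] unfolding d by simp
  show "(\<integral>q. f (snd q) \<partial>(N \<Otimes>\<^sub>M M)) = (\<integral>x. f x \<partial>M)"
    using integral_distr[OF m f] unfolding d by simp
  show "distr (N \<Otimes>\<^sub>M M) borel (\<lambda>q. f (snd q)) = distr M borel f"
    using distr_distr[OF f m] unfolding d by (simp add: o_def)
qed

lemma AE_product_fst:
  assumes "prob_space N" "prob_space M" "AE x in N. P x"
  shows "AE q in N \<Otimes>\<^sub>M M. P (fst q)"
proof -
  have d: "distr (N \<Otimes>\<^sub>M M) N fst = N" by (rule prob_space.distr_pair_fst[OF assms(2)])
  have "AE x in distr (N \<Otimes>\<^sub>M M) N fst. P x" by (subst d) (rule assms(3))
  then show ?thesis by (rule AE_distrD[rotated]) simp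
qed

context brownian begin

text \<open>
  The effect at time \<open>k + 1\<close> of the noise in the interval from \<open>k\<close> to \<open>k + 1\<close>.
\<close>

definition shock :: "real^2^2 \<Rightarrow> nat \<Rightarrow> 'a \<Rightarrow> real^2" where
  "shock A k \<omega> = response A (path (real k) \<omega>) 1"

definition shock_sum :: "real^2^2 \<Rightarrow> nat \<Rightarrow> 'a \<Rightarrow> real^2" where
  "shock_sum A n \<omega> = (\<Sum>k<n. flow A (real k) *v shock A k \<omega>)"

definition ou_limit :: "real^2^2 \<Rightarrow> 'a \<Rightarrow> real^2" where
  "ou_limit A \<omega> = lim (\<lambda>n. shock_sum A n \<omega>)"

lemma shock_adapted: "shock A k \<in> borel_measurable (F (real k + 1))"
  unfolding shock_def[abs_def] by (rule markov_law(1)[where Y = "\<lambda>_. 0"]) simp_all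

lemma shock_measurable: "shock A k \<in> borel_measurable M"
  by (rule measurable_F[OF shock_adapted])

lemma shock_sum_adapted: "shock_sum A n \<in> borel_measurable (F (real n))"
  unfolding shock_sum_def[abs_def]
proof (intro borel_measurable_sum borel_measurable_matrix_vector)
  fix k assume "k \<in> {..<n}"
  then show "shock A k \<in> borel_measurable (F (real n))" by (intro measurable_F_mono[OF _ shock_adapted]) simp
qed

lemma shock_sum_measurable: "shock_sum A n \<in> borel_measurable M"
  by (rule measurable_F[OF shock_sum_adapted])

lemma ou_limit_measurable: "ou_limit A \<in> borel_measurable M"
  unfolding ou_limit_def[abs_def] by (rule borel_measurable_lim_metric[OF shock_sum_measurable])

lemma finite_law: "f \<in> borel_measurable M \<Longrightarrow> finite_measure (law M f)" for f :: "'a \<Rightarrow> real^2"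
  by (rule prob_space.finite_measure[OF prob_space_law])

lemma law_commute:
  fixes f g :: "'a \<Rightarrow> real^2"
  assumes "f \<in> borel_measurable M" "g \<in> borel_measurable M"
  shows "(law M f \<star> law M g) = (law M g \<star> law M f)"
  by (rule convolution_commutative[OF finite_law finite_law]) (use assms in simp_all)

lemma shock_law: "law M (shock A k) = law M (ou A 1)"
proof -
  have "law M (\<lambda>\<omega>. flow A 1 *v 0 + response A (path (real k) \<omega>) 1) = (law M (\<lambda>\<omega>. flow A 1 *v 0) \<star> law M (ou A 1))"
    by (rule markov_law(2)[where Y = "\<lambda>_. 0"]) simp_all
  moreover have "flow A 1 *v (0 :: real^2) = 0" by (rule bounded_bilinear.zero_right[OF bounded_bilinear_matrix_vector])
  ultimately have "law M (shock A k) = (law M (\<lambda>\<omega>. 0) \<star> law M (ou A 1))" by (simp add: shock_def[abs_def])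
  also have "\<dots> = (law M (ou A 1) \<star> law M (\<lambda>\<omega>. 0))" by (rule law_commute) (simp_all add: ou_measurable)
  also have "\<dots> = law M (ou A 1)" by (rule convolution_law_zero[OF prob_space_axioms]) (simp add: ou_measurable)
  finally show ?thesis .
qed

lemma ou_0: "ou A 0 = W 0"
  by (rule ext) (simp add: ou_def response_def set_integral_singleton bounded_bilinear.zero_right[OF bounded_bilinear_matrix_vector])

text \<open>
  Read backwards in time, the process at time \<open>n\<close> is a sum of the effects of the noise in \<open>n\<close> unit
  intervals, the most recent one being damped least. The time reversal keeps the law and makes the
  sums converge, whereas the process itself does not.
\<close>

lemma shock_sum_law: "law M (shock_sum A n) = law M (ou A (real n))"
proof (induction n)
  case 0
  show ?case
  proof (rule distr_cong_AE)
    show "AE \<omega> in M. shock_sum A 0 \<omega> = ou A (real 0) \<omega>" using W_0 by eventually_elim (simp add: shock_sum_def ou_0)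
  qed (use W_measurable in \<open>simp_all add: shock_sum_measurable ou_0\<close>)
next
  case (Suc n)
  show ?case
  proof (cases "n = 0")
    case True
    have "shock_sum A 1 = shock A 0" by (rule ext) (simp add: shock_sum_def flow_0)
    then show ?thesis using shock_law[of A 0] True by simp
  next
    case False
    let ?f = "\<lambda>v. flow A (real n) *v v"
    \<comment> \<open>The flow is invertible, so the sum of the first \<open>n\<close> shocks can be written as an evolved initial value.\<close>
    define Y where "Y \<omega> = flow A (- 1) *v (flow A (- real n) *v shock_sum A n \<omega>)" for \<omega>
    have Y: "Y \<in> borel_measurable (F (real n))"
      unfolding Y_def[abs_def] by (intro borel_measurable_matrix_vector shock_sum_adapted)
    have f1Y: "flow A 1 *v Y \<omega> = flow A (- real n) *v shock_sum A n \<omega>" for \<omega>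
      unfolding Y_def using flow_inverse(1)[of A 1] by (simp add: matrix_vector_mul_assoc[of "flow A 1" "flow A (- 1)"])
    have fn: "?f (flow A 1 *v Y \<omega>) = shock_sum A n \<omega>" for \<omega>
      unfolding f1Y by (simp add: matrix_vector_mul_assoc flow_inverse)
    have m1: "(\<lambda>\<omega>. flow A 1 *v Y \<omega>) \<in> borel_measurable M" by (rule borel_measurable_matrix_vector[OF measurable_F[OF Y]])
    have m2: "ou A 1 \<in> borel_measurable M" by (simp add: ou_measurable)
    have m3: "(\<lambda>\<omega>. flow A 1 *v Y \<omega> + shock A n \<omega>) \<in> borel_measurable M" by (rule borel_measurable_add[OF m1 shock_measurable])
    have lin: "linear ?f" by (rule linear_matrix)
    have "shock_sum A (Suc n) = (\<lambda>\<omega>. ?f (flow A 1 *v Y \<omega> + shock A n \<omega>))"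
      unfolding matrix_vector_right_distrib fn by (rule ext) (simp add: shock_sum_def)
    then have "law M (shock_sum A (Suc n)) = law (law M (\<lambda>\<omega>. flow A 1 *v Y \<omega> + shock A n \<omega>)) ?f"
      using distr_linear[OF m3 lin] by simp
    also have "law M (\<lambda>\<omega>. flow A 1 *v Y \<omega> + shock A n \<omega>) = (law M (\<lambda>\<omega>. flow A 1 *v Y \<omega>) \<star> law M (ou A 1))"
      unfolding shock_def by (rule markov_law(2)[OF _ _ Y]) simp_all
    also have "law \<dots> ?f = (law (law M (\<lambda>\<omega>. flow A 1 *v Y \<omega>)) ?f \<star> law (law M (ou A 1)) ?f)"
      by (rule law_convolution_linear[OF prob_space_law[OF m1] prob_space_law[OF m2] _ _ lin]) simp_all
    also have "\<dots> = (law M (shock_sum A n) \<star> law M (\<lambda>\<omega>. ?f (ou A 1 \<omega>)))"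
      unfolding distr_linear[OF m1 lin] distr_linear[OF m2 lin] fn ..
    also have "\<dots> = (law M (\<lambda>\<omega>. ?f (ou A 1 \<omega>)) \<star> law M (shock_sum A n))"
      by (rule law_commute[OF shock_sum_measurable borel_measurable_matrix_vector[OF m2]])
    also have "\<dots> = law M (ou A (1 + real n))"
      unfolding Suc using ou_law_add[of 1 "real n" A] False by simp
    finally show ?thesis by simp
  qed
qed

context
  fixes A :: "real^2^2" and l :: real
  assumes l: "0 < l" and diss: "\<And>x. x \<bullet> (A *v x) \<le> - l * (norm x)\<^sup>2"
begin

lemma flow_nat_decay: "norm (flow A (real k) *v x) \<le> exp (- l) ^ k * norm x"
proof -
  have "exp (- l * real k) = exp (- l) ^ k" by (simp add: exp_of_nat_mult[symmetric] mult.commute)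
  then show ?thesis using flow_decay[OF diss, of "real k" x] by simp
qed

lemma flow_tendsto_0: "((\<lambda>t. flow A t *v x) \<longlongrightarrow> 0) at_top"
proof (rule Lim_null_comparison)
  show "\<forall>\<^sub>F t in at_top. norm (flow A t *v x) \<le> exp (- l * t) * norm x"
    using eventually_ge_at_top[of 0] by eventually_elim (rule flow_decay[OF diss])
  have "filterlim (\<lambda>t. - (l * t)) at_bot at_top"
    using l filterlim_tendsto_pos_mult_at_top[OF tendsto_const l filterlim_ident] by (simp add: filterlim_uminus_at_bot)
  then have "((\<lambda>t. exp (- (l * t))) \<longlongrightarrow> 0) at_top" by (rule filterlim_compose[OF exp_at_bot])
  then show "((\<lambda>t. exp (- l * t) * norm x) \<longlongrightarrow> 0) at_top" by (intro tendsto_mult_left_zero) simp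
qed

lemma shock_moment: "integrable M (\<lambda>\<omega>. (norm (shock A k \<omega>))\<^sup>2)"
  "(\<integral>\<omega>. (norm (shock A k \<omega>))\<^sup>2 \<partial>M) = (\<integral>\<omega>. (norm (ou A 1 \<omega>))\<^sup>2 \<partial>M)"
proof -
  have m: "ou A 1 \<in> borel_measurable M" by (simp add: ou_measurable)
  have "integrable (law M (ou A 1)) (\<lambda>x. (norm x)\<^sup>2)"
    using ou_square[of 1 A] m by (subst integrable_distr_eq) auto
  then show "integrable M (\<lambda>\<omega>. (norm (shock A k \<omega>))\<^sup>2)"
    unfolding shock_law[of A k, symmetric] using shock_measurable by (subst (asm) integrable_distr_eq) auto
  have "(\<integral>\<omega>. (norm (shock A k \<omega>))\<^sup>2 \<partial>M) = (\<integral>x. (norm x)\<^sup>2 \<partial>law M (shock A k))"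
    using shock_measurable by (subst integral_distr) auto
  also have "\<dots> = (\<integral>\<omega>. (norm (ou A 1 \<omega>))\<^sup>2 \<partial>M)"
    unfolding shock_law using m by (subst integral_distr) auto
  finally show "(\<integral>\<omega>. (norm (shock A k \<omega>))\<^sup>2 \<partial>M) = (\<integral>\<omega>. (norm (ou A 1 \<omega>))\<^sup>2 \<partial>M)" .
qed

abbreviation "shock_energy k \<omega> \<equiv> exp (- l) ^ k * (norm (shock A k \<omega>))\<^sup>2"

lemma contraction_rate: "0 < exp (- l)" "exp (- l) < 1"
  using l by auto

text \<open>
  The shocks are identically distributed with finite second moment, so the geometrically weighted sum of
  their squares has finite expectation.
\<close>

lemma shock_energy_summable: "AE \<omega> in M. summable (\<lambda>k. shock_energy k \<omega>)"
  and shock_energy_integrable: "integrable M (\<lambda>\<omega>. \<Sum>k. shock_energy k \<omega>)"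
proof -
  define K where "K = (\<integral>\<omega>. (norm (ou A 1 \<omega>))\<^sup>2 \<partial>M)"
  have i: "integrable M (shock_energy k)" for k using shock_moment(1) by simp
  have e: "(\<integral>\<omega>. shock_energy k \<omega> \<partial>M) = exp (- l) ^ k * K" for k using shock_moment by (simp add: K_def)
  have sK: "summable (\<lambda>k. exp (- l) ^ k * K)" using contraction_rate by (intro summable_mult2 summable_geometric) simp
  have "(\<integral>\<^sup>+\<omega>. (\<Sum>k. ennreal (shock_energy k \<omega>)) \<partial>M) = (\<Sum>k. \<integral>\<^sup>+\<omega>. ennreal (shock_energy k \<omega>) \<partial>M)"
    using i by (intro nn_integral_suminf) (auto intro!: borel_measurable_integrable measurable_compose[OF _ measurable_ennreal])
  also have "\<dots> = (\<Sum>k. ennreal (exp (- l) ^ k * K))"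
    by (intro suminf_cong) (subst nn_integral_eq_integral[OF i], auto simp: shock_moment(2) K_def)
  also have "\<dots> \<noteq> \<infinity>"
    using sK by (subst suminf_ennreal_eq[OF _ summable_sums[OF sK]]) (auto simp: K_def)
  finally have "AE \<omega> in M. (\<Sum>k. ennreal (shock_energy k \<omega>)) \<noteq> \<infinity>"
    using i by (intro nn_integral_noteq_infinite borel_measurable_suminf_order measurable_compose[OF _ measurable_ennreal] borel_measurable_integrable) auto
  then show *: "AE \<omega> in M. summable (\<lambda>k. shock_energy k \<omega>)"
    by eventually_elim (rule summable_suminf_not_top, auto)
  show "integrable M (\<lambda>\<omega>. \<Sum>k. shock_energy k \<omega>)"
  proof (rule integrable_suminf[OF i])
    show "AE \<omega> in M. summable (\<lambda>k. norm (shock_energy k \<omega>))" using * by eventually_elim simp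
    show "summable (\<lambda>k. \<integral>\<omega>. norm (shock_energy k \<omega>) \<partial>M)" using sK e by simp
  qed
qed

text \<open>
  The flow contributes the weights \<open>exp (- l) ^ k\<close>, so the weighted Cauchy-Schwarz inequality bounds the
  square of the sum by the geometric series times the energy.
\<close>

lemma shock_sum_converges_bound:
  assumes s: "summable (\<lambda>k. shock_energy k \<omega>)"
  shows "(\<lambda>n. shock_sum A n \<omega>) \<longlonglongrightarrow> ou_limit A \<omega>"
    and "(norm (ou_limit A \<omega>))\<^sup>2 \<le> (1 / (1 - exp (- l))) * (\<Sum>k. shock_energy k \<omega>)"
proof -
  let ?c = "exp (- l)"
  have g: "summable (\<lambda>k. ?c ^ k)" using contraction_rate by (intro summable_geometric) simp
  have "summable (\<lambda>k. flow A (real k) *v shock A k \<omega>)"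
  proof (rule summable_comparison_test[OF _ summable_add[OF g s]], intro exI allI impI)
    fix k
    have "norm (shock A k \<omega>) \<le> 1 + (norm (shock A k \<omega>))\<^sup>2"
      using sum_squares_bound[of 1 "norm (shock A k \<omega>)"] norm_ge_zero[of "shock A k \<omega>"]
      unfolding power_one mult_1_right by linarith
    then have "?c ^ k * norm (shock A k \<omega>) \<le> ?c ^ k * (1 + (norm (shock A k \<omega>))\<^sup>2)" by (intro mult_left_mono) auto
    then show "norm (flow A (real k) *v shock A k \<omega>) \<le> ?c ^ k + shock_energy k \<omega>"
      using flow_nat_decay[of k "shock A k \<omega>"] by (simp add: distrib_left)
  qed
  then have "convergent (\<lambda>n. shock_sum A n \<omega>)" unfolding shock_sum_def by (simp add: summable_iff_convergent)
  then show c: "(\<lambda>n. shock_sum A n \<omega>) \<longlonglongrightarrow> ou_limit A \<omega>" unfolding ou_limit_def by (simp add: convergent_LIMSEQ_iff)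
  have "(norm (shock_sum A n \<omega>))\<^sup>2 \<le> (1 / (1 - ?c)) * (\<Sum>k. shock_energy k \<omega>)" for n
  proof -
    have "norm (shock_sum A n \<omega>) \<le> (\<Sum>k<n. ?c ^ k * norm (shock A k \<omega>))"
      unfolding shock_sum_def by (intro sum_norm_le flow_nat_decay)
    also have "\<dots> = (\<Sum>k<n. sqrt (?c ^ k) * (sqrt (?c ^ k) * norm (shock A k \<omega>)))"
      by (intro sum.cong refl) (simp add: mult.assoc[symmetric])
    finally have "(norm (shock_sum A n \<omega>))\<^sup>2 \<le> (\<Sum>k<n. sqrt (?c ^ k) * (sqrt (?c ^ k) * norm (shock A k \<omega>)))\<^sup>2"
      by (intro power_mono) auto
    also have "\<dots> \<le> (\<Sum>k<n. (sqrt (?c ^ k))\<^sup>2) * (\<Sum>k<n. (sqrt (?c ^ k) * norm (shock A k \<omega>))\<^sup>2)"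
      by (rule Cauchy_Schwarz_ineq_sum)
    also have "\<dots> = (\<Sum>k<n. ?c ^ k) * (\<Sum>k<n. shock_energy k \<omega>)" by (simp add: power_mult_distrib)
    also have "\<dots> \<le> (\<Sum>k. ?c ^ k) * (\<Sum>k. shock_energy k \<omega>)"
      by (intro mult_mono sum_le_suminf g s suminf_nonneg sum_nonneg) auto
    also have "(\<Sum>k. ?c ^ k) = 1 / (1 - ?c)" using contraction_rate by (intro suminf_geometric) simp
    finally show ?thesis .
  qed
  then show "(norm (ou_limit A \<omega>))\<^sup>2 \<le> (1 / (1 - ?c)) * (\<Sum>k. shock_energy k \<omega>)"
    by (intro LIMSEQ_le_const2[OF tendsto_power[OF tendsto_norm[OF c]]]) auto
qed

lemma shock_sum_converges: "AE \<omega> in M. (\<lambda>n. shock_sum A n \<omega>) \<longlonglongrightarrow> ou_limit A \<omega>"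
  using shock_energy_summable by eventually_elim (rule shock_sum_converges_bound(1))

lemma ou_limit_square: "integrable M (\<lambda>\<omega>. (norm (ou_limit A \<omega>))\<^sup>2)"
proof (rule Bochner_Integration.integrable_bound)
  show "integrable M (\<lambda>\<omega>. (1 / (1 - exp (- l))) * (\<Sum>k. shock_energy k \<omega>))" using shock_energy_integrable by (rule integrable_mult_right)
  show "(\<lambda>\<omega>. (norm (ou_limit A \<omega>))\<^sup>2) \<in> borel_measurable M" using ou_limit_measurable by measurable
  show "AE \<omega> in M. norm ((norm (ou_limit A \<omega>))\<^sup>2) \<le> norm ((1 / (1 - exp (- l))) * (\<Sum>k. shock_energy k \<omega>))"
    using shock_energy_summable
  proof eventually_elim
    case (elim \<omega>)
    show ?case unfolding real_norm_def by (rule order_trans[OF _ abs_ge_self]) (simp only: abs_power2 shock_sum_converges_bound(2)[OF elim] power2_abs abs_norm_cancel)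
  qed
qed

lemma ou_limit_integrable: "integrable M (ou_limit A)"
  by (rule integrable_norm_of_square(2)[OF ou_limit_measurable ou_limit_square])

text \<open>
  By commutativity of the two ways of splitting the time \<open>n + t\<close>, evolving the law at time \<open>n\<close> for a time \<open>t\<close>
  only adds the contribution \<open>flow A n *v ou A t\<close>, which vanishes as \<open>n\<close> grows.
\<close>

lemma ou_limit_invariant:
  assumes t: "0 < t"
  shows "(law M (\<lambda>\<omega>. flow A t *v ou_limit A \<omega>) \<star> law M (ou A t)) = law M (ou_limit A)"
proof -
  interpret p: pair_prob_space M M ..
  have om: "ou A t \<in> borel_measurable M" using t by (simp add: ou_measurable)
  note P = prob_space_axioms
  have fs: "(\<lambda>\<omega>. flow A t *v shock_sum A n \<omega>) \<in> borel_measurable M" for n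
    by (rule borel_measurable_matrix_vector[OF shock_sum_measurable])
  have fl: "(\<lambda>\<omega>. flow A t *v ou_limit A \<omega>) \<in> borel_measurable M"
    by (rule borel_measurable_matrix_vector[OF ou_limit_measurable])
  have fo: "(\<lambda>\<omega>. flow A (real n) *v ou A t \<omega>) \<in> borel_measurable M" for n
    by (rule borel_measurable_matrix_vector[OF om])
  have eq: "(law M (\<lambda>\<omega>. flow A t *v shock_sum A n \<omega>) \<star> law M (ou A t)) = (law M (shock_sum A n) \<star> law M (\<lambda>\<omega>. flow A (real n) *v ou A t \<omega>))"
    if n: "n > 0" for n
  proof -
    have on: "ou A (real n) \<in> borel_measurable M" by (simp add: ou_measurable)
    have "law M (\<lambda>\<omega>. flow A t *v shock_sum A n \<omega>) = law M (\<lambda>\<omega>. flow A t *v ou A (real n) \<omega>)"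
      using distr_linear[OF shock_sum_measurable linear_matrix, of A n "flow A t"] distr_linear[OF on linear_matrix, of "flow A t"]
      by (simp add: shock_sum_law)
    then have "(law M (\<lambda>\<omega>. flow A t *v shock_sum A n \<omega>) \<star> law M (ou A t)) = law M (ou A (real n + t))"
      using ou_law_add[of "real n" t A] t by simp
    also have "\<dots> = law M (ou A (t + real n))" by (simp add: add.commute)
    also have "\<dots> = (law M (\<lambda>\<omega>. flow A (real n) *v ou A t \<omega>) \<star> law M (ou A (real n)))"
      using ou_law_add[of t "real n" A] t n by simp
    also have "\<dots> = (law M (\<lambda>\<omega>. flow A (real n) *v ou A t \<omega>) \<star> law M (shock_sum A n))" by (simp only: shock_sum_law)
    also have "\<dots> = (law M (shock_sum A n) \<star> law M (\<lambda>\<omega>. flow A (real n) *v ou A t \<omega>))"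
      by (rule law_commute[OF fo shock_sum_measurable])
    finally show ?thesis .
  qed
  have "law (M \<Otimes>\<^sub>M M) (\<lambda>q. flow A t *v ou_limit A (fst q) + ou A t (snd q)) = law (M \<Otimes>\<^sub>M M) (\<lambda>q. ou_limit A (fst q))"
  proof (rule law_limit_unique[OF p.prob_space_axioms p.prob_space_axioms,
      where S = "\<lambda>n q. flow A t *v shock_sum A (Suc n) (fst q) + ou A t (snd q)"
        and S' = "\<lambda>n q. shock_sum A (Suc n) (fst q) + flow A (real (Suc n)) *v ou A t (snd q)"])
    fix n
    show "(\<lambda>q. flow A t *v shock_sum A (Suc n) (fst q) + ou A t (snd q)) \<in> borel_measurable (M \<Otimes>\<^sub>M M)"
      by (intro borel_measurable_add measurable_compose[OF measurable_fst fs] measurable_compose[OF measurable_snd om])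
    show "(\<lambda>q. shock_sum A (Suc n) (fst q) + flow A (real (Suc n)) *v ou A t (snd q)) \<in> borel_measurable (M \<Otimes>\<^sub>M M)"
      by (intro borel_measurable_add measurable_compose[OF measurable_fst shock_sum_measurable] measurable_compose[OF measurable_snd fo])
    show "law (M \<Otimes>\<^sub>M M) (\<lambda>q. flow A t *v shock_sum A (Suc n) (fst q) + ou A t (snd q))
      = law (M \<Otimes>\<^sub>M M) (\<lambda>q. shock_sum A (Suc n) (fst q) + flow A (real (Suc n)) *v ou A t (snd q))"
      unfolding law_sum_product_space[OF P P fs om] law_sum_product_space[OF P P shock_sum_measurable fo]
      by (rule eq) simp
  next
    show "(\<lambda>q. flow A t *v ou_limit A (fst q) + ou A t (snd q)) \<in> borel_measurable (M \<Otimes>\<^sub>M M)"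
      by (intro borel_measurable_add measurable_compose[OF measurable_fst fl] measurable_compose[OF measurable_snd om])
    show "(\<lambda>q. ou_limit A (fst q)) \<in> borel_measurable (M \<Otimes>\<^sub>M M)" by (rule measurable_compose[OF measurable_fst ou_limit_measurable])
    have conv: "AE q in M \<Otimes>\<^sub>M M. (\<lambda>n. shock_sum A n (fst q)) \<longlonglongrightarrow> ou_limit A (fst q)"
      by (rule AE_product_fst[OF P P shock_sum_converges])
    show "AE q in M \<Otimes>\<^sub>M M. (\<lambda>n. flow A t *v shock_sum A (Suc n) (fst q) + ou A t (snd q)) \<longlonglongrightarrow> flow A t *v ou_limit A (fst q) + ou A t (snd q)"
      using conv
    proof eventually_elim
      case (elim q)
      show ?case
        by (intro tendsto_add tendsto_const bounded_linear.tendsto[OF matrix_vector_mul_bounded_linear] LIMSEQ_Suc elim)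
    qed
    show "AE q in M \<Otimes>\<^sub>M M. (\<lambda>n. shock_sum A (Suc n) (fst q) + flow A (real (Suc n)) *v ou A t (snd q)) \<longlonglongrightarrow> ou_limit A (fst q)"
      using conv
    proof eventually_elim
      case (elim q)
      have "(\<lambda>n. flow A (real n) *v ou A t (snd q)) \<longlonglongrightarrow> 0"
        by (rule filterlim_compose[OF flow_tendsto_0 filterlim_real_sequentially])
      from tendsto_add[OF LIMSEQ_Suc[OF elim] LIMSEQ_Suc[OF this]] show ?case by simp
    qed
  qed
  then show ?thesis
    unfolding law_sum_product_space[OF P P fl om] product_fst(3)[OF P P ou_limit_measurable] .
qed

text \<open>
  The mean is fixed by the contraction \<open>flow A 1\<close>.
\<close>

lemma ou_limit_mean: "expectation (ou_limit A) = 0"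
proof -
  note P = prob_space_axioms
  have om: "ou A 1 \<in> borel_measurable M" by (simp add: ou_measurable)
  have fl: "(\<lambda>\<omega>. flow A 1 *v ou_limit A \<omega>) \<in> borel_measurable M"
    by (rule borel_measurable_matrix_vector[OF ou_limit_measurable])
  have m: "(\<lambda>q. flow A 1 *v ou_limit A (fst q) + ou A 1 (snd q)) \<in> borel_measurable (M \<Otimes>\<^sub>M M)"
    by (intro borel_measurable_add measurable_compose[OF measurable_fst fl] measurable_compose[OF measurable_snd om])
  have ifl: "integrable M (\<lambda>\<omega>. flow A 1 *v ou_limit A \<omega>)" by (rule integrable_matrix_vector(1)[OF ou_limit_integrable])
  have io: "integrable M (ou A 1)" by (simp add: ou_integrable)
  have "mean (law M (ou_limit A)) = mean (law (M \<Otimes>\<^sub>M M) (\<lambda>q. flow A 1 *v ou_limit A (fst q) + ou A 1 (snd q)))"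
    using ou_limit_invariant[of 1] law_sum_product_space[OF P P fl om] by simp
  also have "\<dots> = (\<integral>q. flow A 1 *v ou_limit A (fst q) + ou A 1 (snd q) \<partial>(M \<Otimes>\<^sub>M M))" by (rule mean_law[OF m])
  also have "\<dots> = (\<integral>q. flow A 1 *v ou_limit A (fst q) \<partial>(M \<Otimes>\<^sub>M M)) + (\<integral>q. ou A 1 (snd q) \<partial>(M \<Otimes>\<^sub>M M))"
    by (rule Bochner_Integration.integral_add)
      (use product_fst(1)[OF P P fl] product_snd(1)[OF P P om] ifl io in simp_all)
  also have "\<dots> = flow A 1 *v expectation (ou_limit A)"
    unfolding product_fst(2)[OF P P fl] product_snd(2)[OF P P om]
    using integrable_matrix_vector(2)[OF ou_limit_integrable, of "flow A 1"] ou_mean[of 1 A] by simp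
  finally have "expectation (ou_limit A) = flow A (real 1) *v expectation (ou_limit A)"
    unfolding mean_law[OF ou_limit_measurable] by simp
  then have "norm (expectation (ou_limit A)) \<le> exp (- l) * norm (expectation (ou_limit A))"
    using flow_nat_decay[of 1 "expectation (ou_limit A)"] by simp
  moreover have "0 < 1 - exp (- l)" using contraction_rate by simp
  ultimately have "norm (expectation (ou_limit A)) * (1 - exp (- l)) \<le> 0" by (simp add: algebra_simps)
  then show ?thesis using \<open>0 < 1 - exp (- l)\<close> by (simp add: mult_le_0_iff)
qed

end

end

lemma AE_product_snd:
  assumes "prob_space N" "prob_space M" "AE x in M. P x"
  shows "AE q in N \<Otimes>\<^sub>M M. P (snd q)"
proof -
  have d: "distr (N \<Otimes>\<^sub>M M) M snd = M" by (rule distr_snd_product[OF assms(1,2)])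
  have "AE x in distr (N \<Otimes>\<^sub>M M) M snd. P x" by (subst d) (rule assms(3))
  then show ?thesis by (rule AE_distrD[rotated]) simp
qed

lemma P2_law:
  fixes U :: "'a \<Rightarrow> 'b::euclidean_space"
  assumes "prob_space N" "U \<in> borel_measurable N" "integrable N (\<lambda>x. (norm (U x))\<^sup>2)"
  shows "law N U \<in> P2"
proof -
  have "integrable (law N U) (\<lambda>x. (norm x)\<^sup>2)" using assms(2,3) by (subst integrable_distr_eq) auto
  then show ?thesis using prob_space.prob_space_law[OF assms(1,2)] by (simp add: P2_def)
qed

lemma P2_D:
  assumes "\<mu> \<in> P2"
  shows "prob_space \<mu>" "sets \<mu> = sets borel" "integrable \<mu> (\<lambda>x. (norm x)\<^sup>2)" "(\<lambda>x. x) \<in> borel_measurable \<mu>"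
  using assms measurable_ident_sets[of \<mu> borel] by (auto simp: P2_def)

lemma law_translate:
  fixes g :: "'a \<Rightarrow> real^2"
  assumes "g \<in> borel_measurable M"
  shows "law (law M g) (\<lambda>v. p + v) = law M (\<lambda>\<omega>. p + g \<omega>)"
  using assms by (subst distr_distr) (auto simp: o_def)

context brownian begin

text \<open>
  The enlarged space carries the same noise, read off the second coordinate, and the enlarged
  filtration, so existence and uniqueness for the affine equation apply there as well.
\<close>

lemma product_noise:
  assumes \<mu>: "\<mu> \<in> P2"
  shows "noise (\<mu> \<Otimes>\<^sub>M M) (\<lambda>t. (borel :: (real^2) measure) \<Otimes>\<^sub>M F t) (\<lambda>t q. W t (snd q))"
proof -
  note P = P2_D[OF \<mu>]
  interpret m: prob_space \<mu> by (rule P(1))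
  interpret p: pair_prob_space \<mu> M ..
  have sp: "space \<mu> = UNIV" using sets_eq_imp_space_eq[OF P(2)] by simp
  have meas_sub: "sets A1 \<subseteq> sets A2" if "space A1 = space A2" "(\<lambda>x. x) \<in> measurable A2 A1" for A1 A2 :: "'z measure"
  proof
    fix S assume S: "S \<in> sets A1"
    from measurable_sets[OF that(2) this] show "S \<in> sets A2" using sets.sets_into_space[OF S] that(1) by (simp add: Int_absorb2)
  qed
  note snd = product_snd[OF P(1) prob_space_axioms]
  show ?thesis
  proof unfold_locales
    show "space (borel \<Otimes>\<^sub>M F t) = space (\<mu> \<Otimes>\<^sub>M M)" for t by (simp add: space_pair_measure space_F sp)
    show "sets ((borel :: (real^2) measure) \<Otimes>\<^sub>M F s) \<subseteq> sets (borel \<Otimes>\<^sub>M F t)" if "0 \<le> s" "s \<le> t" for s t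
    proof (rule meas_sub)
      have "(\<lambda>x. x) \<in> measurable (F t) (F s)" by (rule measurable_F_mono[OF that(2) measurable_ident_sets[OF refl]])
      from measurable_compose[OF measurable_snd this]
      have "snd \<in> measurable ((borel :: (real^2) measure) \<Otimes>\<^sub>M F t) (F s)" .
      then have "(\<lambda>x. (fst x, snd x)) \<in> measurable ((borel :: (real^2) measure) \<Otimes>\<^sub>M F t) (borel \<Otimes>\<^sub>M F s)"
        by (intro measurable_Pair measurable_fst)
      then show "(\<lambda>x. x) \<in> measurable ((borel :: (real^2) measure) \<Otimes>\<^sub>M F t) (borel \<Otimes>\<^sub>M F s)" by simp
    qed (simp add: space_pair_measure space_F)
    show "sets ((borel :: (real^2) measure) \<Otimes>\<^sub>M F t) \<subseteq> sets (\<mu> \<Otimes>\<^sub>M M)" for t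
    proof (rule meas_sub)
      have "(\<lambda>x. x) \<in> measurable M (F t)" by (rule measurable_F[OF measurable_ident_sets[OF refl]])
      from measurable_compose[OF measurable_snd this]
      have "snd \<in> measurable (\<mu> \<Otimes>\<^sub>M M) (F t)" .
      moreover have "fst \<in> borel_measurable (\<mu> \<Otimes>\<^sub>M M)" by (rule measurable_compose[OF measurable_fst P(4)])
      ultimately have "(\<lambda>x. (fst x, snd x)) \<in> measurable (\<mu> \<Otimes>\<^sub>M M) (borel \<Otimes>\<^sub>M F t)" by (intro measurable_Pair) 
      then show "(\<lambda>x. x) \<in> measurable (\<mu> \<Otimes>\<^sub>M M) (borel \<Otimes>\<^sub>M F t)" by simp
    qed (simp add: space_pair_measure space_F sp)
    fix t :: real assume t: "0 \<le> t"
    show "(\<lambda>q. W t (snd q)) \<in> borel_measurable ((borel :: (real^2) measure) \<Otimes>\<^sub>M F t)"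
      by (rule measurable_compose[OF measurable_snd W_adapted]) (use t in simp_all)
    have Wm: "W t \<in> borel_measurable M" by (rule W_measurable[OF t])
    have W2m: "(\<lambda>\<omega>. (norm (W t \<omega>))\<^sup>2) \<in> borel_measurable M" using Wm by measurable
    show "integrable (\<mu> \<Otimes>\<^sub>M M) (\<lambda>q. (norm (W t (snd q)))\<^sup>2)" using snd(1)[OF W2m] W_moments(1)[OF t] by simp
    show "(\<integral>q. (norm (W t (snd q)))\<^sup>2 \<partial>(\<mu> \<Otimes>\<^sub>M M)) = 2 * t" using snd(2)[OF W2m] W_moments(4)[OF t] by simp
    have Wim: "(\<lambda>\<omega>. W t \<omega> $ i) \<in> borel_measurable M" for i using Wm by measurable
    show "(\<integral>q. W t (snd q) $ i \<partial>(\<mu> \<Otimes>\<^sub>M M)) = 0" for i using snd(2)[OF Wim] W_moments(2)[OF t] by simp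
  next
    fix q assume "q \<in> space (\<mu> \<Otimes>\<^sub>M M)"
    then show "continuous_on {0..} (\<lambda>t. W t (snd q))" by (intro W_continuous) (auto simp: space_pair_measure)
  qed
qed

text \<open>
  The explicit solution started from the independent position \<open>fst q\<close> of law \<open>\<mu>\<close>.
\<close>

definition transition :: "real^2^2 \<Rightarrow> real^2^2 \<Rightarrow> real^2 \<Rightarrow> (real^2) measure \<Rightarrow> real \<Rightarrow> (real^2) \<times> 'a \<Rightarrow> real^2" where
  "transition A B p \<mu> t q = (p + flow (A + B) t *v (mean \<mu> - p)) + flow A t *v (fst q - mean \<mu>) + ou A t (snd q)"

lemma transition_measurable:
  assumes \<mu>: "\<mu> \<in> P2" and t: "0 \<le> t"
  shows "transition A B p \<mu> t \<in> borel_measurable (\<mu> \<Otimes>\<^sub>M M)"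
proof -
  have "fst \<in> borel_measurable (\<mu> \<Otimes>\<^sub>M M)" by (rule measurable_compose[OF measurable_fst P2_D(4)[OF \<mu>]])
  then have "(\<lambda>q. flow A t *v (fst q - mean \<mu>)) \<in> borel_measurable (\<mu> \<Otimes>\<^sub>M M)"
    by (intro borel_measurable_matrix_vector borel_measurable_diff) simp_all
  moreover have "(\<lambda>q. ou A t (snd q)) \<in> borel_measurable (\<mu> \<Otimes>\<^sub>M M)"
    by (rule measurable_compose[OF measurable_snd ou_measurable[OF t]])
  ultimately show ?thesis unfolding transition_def[abs_def] by (intro borel_measurable_add) simp_all
qed

text \<open>
  On the enlarged space the affine equation has exactly one solution, the explicit one, so invariance is a
  statement about its law.
\<close>

lemma invariant_law_affine_iff:
  assumes \<mu>: "\<mu> \<in> P2" and p: "(A + B) *v p + d = 0"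
  shows "invariant_law M F W (affine_feedback A B d) \<mu> \<longleftrightarrow>
    (\<forall>t\<ge>0. law (\<mu> \<Otimes>\<^sub>M M) (transition A B p \<mu> t) = \<mu>)"
proof -
  interpret N: noise "\<mu> \<Otimes>\<^sub>M M" "\<lambda>t. borel \<Otimes>\<^sub>M F t" "\<lambda>t q. W t (snd q)" by (rule product_noise[OF \<mu>])
  note P = P2_D[OF \<mu>]
  let ?sol = "sq_int_solution (\<mu> \<Otimes>\<^sub>M M) (\<lambda>t. borel \<Otimes>\<^sub>M F t) (\<lambda>t q. W t (snd q)) fst (affine_feedback A B d)"
  have fm: "fst \<in> borel_measurable ((borel :: (real^2) measure) \<Otimes>\<^sub>M F 0)" by simp
  have n2: "(\<lambda>x. (norm x)\<^sup>2) \<in> borel_measurable \<mu>" using P(4) by measurable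
  have f2: "integrable (\<mu> \<Otimes>\<^sub>M M) (\<lambda>q. (norm (fst q))\<^sup>2)"
    using product_fst(1)[OF P(1) prob_space_axioms n2] P(3) by simp
  have Ef: "N.expectation fst = mean \<mu>"
    using product_fst(2)[OF P(1) prob_space_axioms P(4)] by (simp add: mean_def)
  have sol: "?sol (N.mkv A B p fst)" by (rule N.mkv_solution[OF fm f2 p])
  have e: "N.mkv A B p fst t = transition A B p \<mu> t" for t
    by (rule ext) (simp add: N.mkv_def transition_def Ef N.ou_def ou_def)
  show ?thesis
  proof
    assume "invariant_law M F W (affine_feedback A B d) \<mu>"
    then have "\<forall>X. ?sol X \<longrightarrow> (\<forall>t\<ge>0. law (\<mu> \<Otimes>\<^sub>M M) (X t) = \<mu>)" by (simp add: invariant_law_def Let_def)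
    then have "\<forall>t\<ge>0. law (\<mu> \<Otimes>\<^sub>M M) (N.mkv A B p fst t) = \<mu>" using sol by blast
    then show "\<forall>t\<ge>0. law (\<mu> \<Otimes>\<^sub>M M) (transition A B p \<mu> t) = \<mu>" by (simp only: e)
  next
    assume T: "\<forall>t\<ge>0. law (\<mu> \<Otimes>\<^sub>M M) (transition A B p \<mu> t) = \<mu>"
    have "law (\<mu> \<Otimes>\<^sub>M M) (X t) = \<mu>" if X: "?sol X" and t: "0 \<le> t" for X t
    proof -
      have "AE q in \<mu> \<Otimes>\<^sub>M M. X t q = transition A B p \<mu> t q"
        using N.mkv_unique[OF X sol] by eventually_elim (use t in \<open>simp add: e\<close>)
      moreover have "X t \<in> borel_measurable (\<mu> \<Otimes>\<^sub>M M)"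
        by (rule N.adapted_measurable[of _ t]) (use X t in \<open>simp add: sq_int_solution_def\<close>)
      ultimately have "law (\<mu> \<Otimes>\<^sub>M M) (X t) = law (\<mu> \<Otimes>\<^sub>M M) (transition A B p \<mu> t)"
        by (intro distr_cong_AE transition_measurable[OF \<mu> t]) auto
      then show ?thesis using T t by simp
    qed
    then show "invariant_law M F W (affine_feedback A B d) \<mu>"
      unfolding invariant_law_def Let_def using \<mu> sol by blast
  qed
qed

definition stationary_law :: "real^2^2 \<Rightarrow> real^2 \<Rightarrow> (real^2) measure" where
  "stationary_law A p = law M (\<lambda>\<omega>. p + ou_limit A \<omega>)"

context
  fixes A B :: "real^2^2" and p d :: "real^2" and l l' :: real
  assumes l: "0 < l" and diss: "\<And>x. x \<bullet> (A *v x) \<le> - l * (norm x)\<^sup>2"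
    and l': "0 < l'" and diss': "\<And>x. x \<bullet> ((A + B) *v x) \<le> - l' * (norm x)\<^sup>2"
    and p: "(A + B) *v p + d = 0"
begin

lemma shifted_limit_measurable: "(\<lambda>\<omega>. p + ou_limit A \<omega>) \<in> borel_measurable M"
  using ou_limit_measurable by simp

lemma stationary_law_P2: "stationary_law A p \<in> P2"
  unfolding stationary_law_def
proof (rule P2_law[OF prob_space_axioms shifted_limit_measurable])
  show "integrable M (\<lambda>\<omega>. (norm (p + ou_limit A \<omega>))\<^sup>2)"
    by (rule integrable_square_diff(2)[OF _ ou_limit_measurable _ ou_limit_square[OF l diss]]) simp_all
qed

lemma stationary_law_mean: "mean (stationary_law A p) = p"
  unfolding stationary_law_def mean_law[OF shifted_limit_measurable]
  using ou_limit_integrable[OF l diss] ou_limit_mean[OF l diss] by (simp add: prob_space)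

text \<open>
  With mean \<open>p\<close> the mean does not move, and the fluctuation is the limit law of the linear process, which is
  invariant.
\<close>

lemma stationary_transition:
  assumes t: "0 \<le> t"
  shows "law (stationary_law A p \<Otimes>\<^sub>M M) (transition A B p (stationary_law A p) t) = stationary_law A p"
proof (cases "t = 0")
  case True
  let ?\<mu> = "stationary_law A p"
  note P = P2_D[OF stationary_law_P2]
  have "law (?\<mu> \<Otimes>\<^sub>M M) (transition A B p ?\<mu> 0) = law (?\<mu> \<Otimes>\<^sub>M M) (\<lambda>q. fst q)"
  proof (rule distr_cong_AE)
    show "AE q in ?\<mu> \<Otimes>\<^sub>M M. transition A B p ?\<mu> 0 q = fst q"
      using AE_product_snd[OF P(1) prob_space_axioms W_0]
      by eventually_elim (simp add: transition_def flow_0 ou_0 stationary_law_mean)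
    show "(\<lambda>q. fst q) \<in> borel_measurable (?\<mu> \<Otimes>\<^sub>M M)" by (rule measurable_compose[OF measurable_fst P(4)])
  qed (simp_all add: transition_measurable[OF stationary_law_P2])
  also have "\<dots> = law ?\<mu> (\<lambda>x. x)" by (rule product_fst(3)[OF P(1) prob_space_axioms P(4)])
  also have "\<dots> = ?\<mu>" using P(2) distr_id2[of borel ?\<mu>] by (simp add: id_def)
  finally show ?thesis using True by simp
next
  case False
  let ?\<mu> = "stationary_law A p"
  note P = P2_D[OF stationary_law_P2]
  have om: "ou A t \<in> borel_measurable M" by (rule ou_measurable[OF t])
  have fm': "(\<lambda>x. flow A t *v (x - p)) \<in> borel_measurable borel"
    by (intro borel_measurable_matrix_vector) simp
  have fm: "(\<lambda>x. flow A t *v (x - p)) \<in> borel_measurable ?\<mu>"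
    using fm' measurable_cong_sets[OF P(2) refl] by blast
  have gm: "(\<lambda>q. flow A t *v (fst q - p) + ou A t (snd q)) \<in> borel_measurable (?\<mu> \<Otimes>\<^sub>M M)"
    by (intro borel_measurable_add measurable_compose[OF measurable_fst fm] measurable_compose[OF measurable_snd om])
  have "law ?\<mu> (\<lambda>x. flow A t *v (x - p)) = law M (\<lambda>\<omega>. flow A t *v ou_limit A \<omega>)"
    unfolding stationary_law_def using fm' shifted_limit_measurable by (subst distr_distr) (auto simp: o_def)
  then have g: "law (?\<mu> \<Otimes>\<^sub>M M) (\<lambda>q. flow A t *v (fst q - p) + ou A t (snd q)) = law M (ou_limit A)"
    unfolding law_sum_product_space[OF P(1) prob_space_axioms fm om]
    using ou_limit_invariant[OF l diss, of t] t False by simp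
  have tr: "transition A B p ?\<mu> t = (\<lambda>q. p + (flow A t *v (fst q - p) + ou A t (snd q)))"
    by (rule ext) (simp add: transition_def stationary_law_mean add.assoc bounded_bilinear.zero_right[OF bounded_bilinear_matrix_vector])
  have "law (?\<mu> \<Otimes>\<^sub>M M) (transition A B p ?\<mu> t)
      = law (law (?\<mu> \<Otimes>\<^sub>M M) (\<lambda>q. flow A t *v (fst q - p) + ou A t (snd q))) (\<lambda>v. p + v)"
    unfolding tr by (rule law_translate[OF gm, symmetric])
  also have "\<dots> = law (law M (ou_limit A)) (\<lambda>v. p + v)" unfolding g ..
  also have "\<dots> = ?\<mu>" unfolding stationary_law_def by (rule law_translate[OF ou_limit_measurable])
  finally show ?thesis .
qed

lemma stationary_law_invariant: "invariant_law M F W (affine_feedback A B d) (stationary_law A p)"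
  using invariant_law_affine_iff[OF stationary_law_P2 p] stationary_transition by blast

text \<open>
  Synchronous coupling: two solutions started from the two invariant laws and driven by the same noise
  differ by a term without noise, which decays.
\<close>

lemma invariant_law_unique:
  assumes \<mu>: "invariant_law M F W (affine_feedback A B d) \<mu>" and \<nu>: "invariant_law M F W (affine_feedback A B d) \<nu>"
  shows "\<mu> = \<nu>"
proof -
  have \<mu>2: "\<mu> \<in> P2" and \<nu>2: "\<nu> \<in> P2" using \<mu> \<nu> by (auto simp: invariant_law_def)
  note Pm = P2_D[OF \<mu>2] and Pn = P2_D[OF \<nu>2]
  interpret m: prob_space \<mu> by (rule Pm(1))
  interpret n: prob_space \<nu> by (rule Pn(1))
  interpret mn: pair_prob_space \<mu> \<nu> ..
  interpret mnM: pair_prob_space "\<mu> \<Otimes>\<^sub>M \<nu>" M ..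
  define f where "f \<kappa> t x = (p + flow (A + B) t *v (mean \<kappa> - p)) + flow A t *v (x - mean \<kappa>)" for \<kappa> t x
  have fb: "f \<kappa> t \<in> borel_measurable borel" for \<kappa> t
    unfolding f_def[abs_def] by (intro borel_measurable_add borel_measurable_matrix_vector) simp_all
  have fm: "f \<kappa> t \<in> borel_measurable \<mu>" "f \<kappa> t \<in> borel_measurable \<nu>" for \<kappa> t
    using fb measurable_cong_sets[OF Pm(2) refl] measurable_cong_sets[OF Pn(2) refl] by blast+
  have om: "ou A (real k) \<in> borel_measurable M" for k by (simp add: ou_measurable)
  have tr: "transition A B p \<kappa> t = (\<lambda>q. f \<kappa> t (fst q) + ou A t (snd q))" for \<kappa> t
    by (rule ext) (simp add: transition_def f_def)
  define U where "U k q = f \<mu> (real k) (fst (fst q)) + ou A (real k) (snd q)" for k and q :: "((real^2) \<times> (real^2)) \<times> 'a"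
  define V where "V k q = f \<nu> (real k) (snd (fst q)) + ou A (real k) (snd q)" for k and q :: "((real^2) \<times> (real^2)) \<times> 'a"
  have m1: "(\<lambda>x. f \<kappa> t (fst x)) \<in> borel_measurable (\<mu> \<Otimes>\<^sub>M \<nu>)" "(\<lambda>x. f \<kappa> t (snd x)) \<in> borel_measurable (\<mu> \<Otimes>\<^sub>M \<nu>)" for \<kappa> t
    by (rule measurable_compose[OF measurable_fst fm(1)], rule measurable_compose[OF measurable_snd fm(2)])
  show ?thesis
  proof (rule sym, rule law_eq_of_difference_vanishing[OF mnM.prob_space_axioms, where U = V and V = U])
    fix k
    show "U k \<in> borel_measurable ((\<mu> \<Otimes>\<^sub>M \<nu>) \<Otimes>\<^sub>M M)" "V k \<in> borel_measurable ((\<mu> \<Otimes>\<^sub>M \<nu>) \<Otimes>\<^sub>M M)"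
      unfolding U_def[abs_def] V_def[abs_def]
      by (intro borel_measurable_add measurable_compose[OF measurable_fst m1(1)] measurable_compose[OF measurable_fst m1(2)]
        measurable_compose[OF measurable_snd om])+
    show "law ((\<mu> \<Otimes>\<^sub>M \<nu>) \<Otimes>\<^sub>M M) (U k) = \<mu>"
    proof -
      have "law ((\<mu> \<Otimes>\<^sub>M \<nu>) \<Otimes>\<^sub>M M) (U k) = (law (\<mu> \<Otimes>\<^sub>M \<nu>) (\<lambda>x. f \<mu> (real k) (fst x)) \<star> law M (ou A (real k)))"
        unfolding U_def[abs_def] by (rule law_sum_product_space[OF mn.prob_space_axioms prob_space_axioms m1(1) om])
      also have "\<dots> = law (\<mu> \<Otimes>\<^sub>M M) (transition A B p \<mu> (real k))"
        unfolding product_fst(3)[OF Pm(1) Pn(1) fm(1)] tr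
        by (rule law_sum_product_space[OF Pm(1) prob_space_axioms fm(1) om, symmetric])
      finally show ?thesis using \<mu> invariant_law_affine_iff[OF \<mu>2 p] by simp
    qed
    show "law ((\<mu> \<Otimes>\<^sub>M \<nu>) \<Otimes>\<^sub>M M) (V k) = \<nu>"
    proof -
      have "law ((\<mu> \<Otimes>\<^sub>M \<nu>) \<Otimes>\<^sub>M M) (V k) = (law (\<mu> \<Otimes>\<^sub>M \<nu>) (\<lambda>x. f \<nu> (real k) (snd x)) \<star> law M (ou A (real k)))"
        unfolding V_def[abs_def] by (rule law_sum_product_space[OF mn.prob_space_axioms prob_space_axioms m1(2) om])
      also have "\<dots> = law (\<nu> \<Otimes>\<^sub>M M) (transition A B p \<nu> (real k))"
        unfolding product_snd(3)[OF Pm(1) Pn(1) fm(2)] tr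
        by (rule law_sum_product_space[OF Pn(1) prob_space_axioms fm(2) om, symmetric])
      finally show ?thesis using \<nu> invariant_law_affine_iff[OF \<nu>2 p] by simp
    qed
  next
    show "AE q in (\<mu> \<Otimes>\<^sub>M \<nu>) \<Otimes>\<^sub>M M. (\<lambda>k. V k q - U k q) \<longlonglongrightarrow> 0"
    proof (rule AE_I2)
      fix q
      have "V k q - U k q = flow (A + B) (real k) *v (mean \<nu> - mean \<mu>)
          + flow A (real k) *v ((snd (fst q) - mean \<nu>) - (fst (fst q) - mean \<mu>))" for k
        unfolding U_def V_def f_def by (simp add: matrix_vector_mult_diff_distrib)
      moreover have "(\<lambda>k. flow (A + B) (real k) *v (mean \<nu> - mean \<mu>)
          + flow A (real k) *v ((snd (fst q) - mean \<nu>) - (fst (fst q) - mean \<mu>))) \<longlonglongrightarrow> 0 + 0"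
        by (intro tendsto_add filterlim_compose[OF flow_tendsto_0[OF l' diss'] filterlim_real_sequentially]
          filterlim_compose[OF flow_tendsto_0[OF l diss] filterlim_real_sequentially])
      ultimately show "(\<lambda>k. V k q - U k q) \<longlonglongrightarrow> 0" by simp
    qed
  qed
qed

text \<open>
  Synchronous coupling with a stationary solution. The distance of the means decays at the rate of \<open>A + B\<close>,
  that of the fluctuations at the rate of \<open>A\<close>.
\<close>

lemma mkv_coupling:
  assumes X0: "X0 \<in> borel_measurable (F 0)" "integrable M (\<lambda>\<omega>. (norm (X0 \<omega>))\<^sup>2)"
  defines "N \<equiv> stationary_law A p \<Otimes>\<^sub>M M" and "V \<equiv> transition A B p (stationary_law A p)"
  obtains K \<theta> where "0 < \<theta>" "\<And>t. 0 \<le> t \<Longrightarrow> integrable N (\<lambda>q. (norm (mkv A B p X0 t (snd q) - V t q))\<^sup>2)"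
    "\<And>t. 0 \<le> t \<Longrightarrow> (\<integral>q. (norm (mkv A B p X0 t (snd q) - V t q))\<^sup>2 \<partial>N) \<le> K * exp (- \<theta> * t)"
proof -
  let ?\<mu> = "stationary_law A p"
  note P = P2_D[OF stationary_law_P2]
  interpret m: prob_space ?\<mu> by (rule P(1))
  interpret pp: pair_prob_space ?\<mu> M ..
  define m0 where "m0 = expectation X0"
  define \<theta> where "\<theta> = min l l'"
  have \<theta>: "0 < \<theta>" "\<theta> \<le> l" "\<theta> \<le> l'" using l l' by (auto simp: \<theta>_def)
  define y where "y q = (X0 (snd q) - m0) - (fst q - p)" for q :: "(real^2) \<times> 'a"
  have X0m: "X0 \<in> borel_measurable M" by (rule measurable_F[OF X0(1)])
  have sX: "(\<lambda>q. X0 (snd q)) \<in> borel_measurable N" unfolding N_def by (rule measurable_compose[OF measurable_snd X0m])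
  have fX: "fst \<in> borel_measurable N" unfolding N_def by (rule measurable_compose[OF measurable_fst P(4)])
  have c2: "integrable N (\<lambda>q. (norm (c :: real^2))\<^sup>2)" for c unfolding N_def by simp
  have X02: "integrable N (\<lambda>q. (norm (X0 (snd q)))\<^sup>2)" unfolding N_def
    using product_snd(1)[OF P(1) prob_space_axioms, of "\<lambda>\<omega>. (norm (X0 \<omega>))\<^sup>2"] X0m X0(2) by simp
  have n2: "(\<lambda>x. (norm x)\<^sup>2) \<in> borel_measurable ?\<mu>" using P(4) by measurable
  have f2: "integrable N (\<lambda>q. (norm (fst q))\<^sup>2)" unfolding N_def
    using product_fst(1)[OF P(1) prob_space_axioms n2] P(3) by simp
  have ym: "y \<in> borel_measurable N" unfolding y_def[abs_def] using sX fX by (intro borel_measurable_diff) simp_all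
  have y2: "integrable N (\<lambda>q. (norm (y q))\<^sup>2)" unfolding y_def
  proof (rule integrable_square_diff(1))
    show "integrable N (\<lambda>q. (norm (X0 (snd q) - m0))\<^sup>2)" by (rule integrable_square_diff(1)[OF sX _ X02 c2]) simp
    show "integrable N (\<lambda>q. (norm (fst q - p))\<^sup>2)" by (rule integrable_square_diff(1)[OF fX _ f2 c2]) simp
  qed (use sX fX in \<open>auto intro!: borel_measurable_diff\<close>)
  define K where "K = 2 * (norm (m0 - p))\<^sup>2 + 2 * (\<integral>q. (norm (y q))\<^sup>2 \<partial>N)"
  have diff: "mkv A B p X0 t (snd q) - V t q = flow (A + B) t *v (m0 - p) + flow A t *v y q" for t q
    unfolding mkv_def V_def transition_def stationary_law_mean m0_def y_def
    by (simp add: matrix_vector_mult_diff_distrib)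
  have b: "(norm (mkv A B p X0 t (snd q) - V t q))\<^sup>2 \<le> exp (- \<theta> * t) * (2 * (norm (m0 - p))\<^sup>2 + 2 * (norm (y q))\<^sup>2)"
    if t: "0 \<le> t" for t q
  proof -
    define E where "E = exp (- \<theta> * t)"
    have E: "0 \<le> E" "E \<le> 1" "exp (- l * t) \<le> E" "exp (- l' * t) \<le> E"
      using \<theta> t by (auto simp: E_def mult_right_mono)
    have "norm (flow (A + B) t *v (m0 - p)) \<le> exp (- l' * t) * norm (m0 - p)" by (rule flow_decay[OF diss' t])
    also have "\<dots> \<le> E * norm (m0 - p)" using E by (intro mult_right_mono) auto
    finally have 1: "norm (flow (A + B) t *v (m0 - p)) \<le> E * norm (m0 - p)" .
    have "norm (flow A t *v y q) \<le> exp (- l * t) * norm (y q)" by (rule flow_decay[OF diss t])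
    also have "\<dots> \<le> E * norm (y q)" using E by (intro mult_right_mono) auto
    finally have 2: "norm (flow A t *v y q) \<le> E * norm (y q)" .
    have "norm (flow (A + B) t *v (m0 - p) + flow A t *v y q) \<le> E * (norm (m0 - p) + norm (y q))"
      using norm_triangle_ineq[of "flow (A + B) t *v (m0 - p)" "flow A t *v y q"] 1 2 by (simp add: distrib_left)
    then have "(norm (flow (A + B) t *v (m0 - p) + flow A t *v y q))\<^sup>2 \<le> (E * (norm (m0 - p) + norm (y q)))\<^sup>2"
      by (intro power_mono) auto
    also have "\<dots> = (E * E) * (norm (m0 - p) + norm (y q))\<^sup>2" by (simp add: power2_eq_square mult_ac)
    also have "\<dots> \<le> E * (2 * (norm (m0 - p))\<^sup>2 + 2 * (norm (y q))\<^sup>2)"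
    proof (rule mult_mono)
      show "E * E \<le> E" using E(1,2) by (simp add: mult_left_le)
      show "(norm (m0 - p) + norm (y q))\<^sup>2 \<le> 2 * (norm (m0 - p))\<^sup>2 + 2 * (norm (y q))\<^sup>2"
        using sum_squares_bound[of "norm (m0 - p)" "norm (y q)"] by (simp add: power2_sum)
    qed (use E in auto)
    finally show ?thesis unfolding diff E_def .
  qed
  have Vm: "V t \<in> borel_measurable N" if "0 \<le> t" for t unfolding V_def N_def by (rule transition_measurable[OF stationary_law_P2 that])
  have Um: "(\<lambda>q. mkv A B p X0 t (snd q)) \<in> borel_measurable N" if "0 \<le> t" for t
    unfolding N_def by (rule measurable_compose[OF measurable_snd measurable_F[OF mkv_adapted[OF X0(1) that]]])
  have cst: "integrable N (\<lambda>_. c :: real)" for c unfolding N_def by simp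
  have iR: "integrable N (\<lambda>q. exp (- \<theta> * t) * (2 * (norm (m0 - p))\<^sup>2 + 2 * (norm (y q))\<^sup>2))" for t
    by (intro integrable_mult_right Bochner_Integration.integrable_add cst y2)
  have int: "integrable N (\<lambda>q. (norm (mkv A B p X0 t (snd q) - V t q))\<^sup>2)" if t: "0 \<le> t" for t
  proof (rule Bochner_Integration.integrable_bound[OF iR])
    show "(\<lambda>q. (norm (mkv A B p X0 t (snd q) - V t q))\<^sup>2) \<in> borel_measurable N" using Um[OF t] Vm[OF t] by measurable
    show "AE q in N. norm ((norm (mkv A B p X0 t (snd q) - V t q))\<^sup>2) \<le> norm (exp (- \<theta> * t) * (2 * (norm (m0 - p))\<^sup>2 + 2 * (norm (y q))\<^sup>2))"
      using b[OF t] by (intro AE_I2) simp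
  qed
  have "(\<integral>q. (norm (mkv A B p X0 t (snd q) - V t q))\<^sup>2 \<partial>N) \<le> K * exp (- \<theta> * t)" if t: "0 \<le> t" for t
  proof -
    have "(\<integral>q. (norm (mkv A B p X0 t (snd q) - V t q))\<^sup>2 \<partial>N) \<le> (\<integral>q. exp (- \<theta> * t) * (2 * (norm (m0 - p))\<^sup>2 + 2 * (norm (y q))\<^sup>2) \<partial>N)"
      by (rule integral_mono[OF int[OF t] iR b[OF t]])
    also have "\<dots> = exp (- \<theta> * t) * K"
    proof -
      have "(\<integral>q. 2 * (norm (m0 - p))\<^sup>2 + 2 * (norm (y q))\<^sup>2 \<partial>N) = K"
        unfolding K_def by (subst Bochner_Integration.integral_add[OF cst integrable_mult_right[OF y2]])
          (simp add: N_def pp.prob_space)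
      then show ?thesis by simp
    qed
    finally show ?thesis by (simp add: mult.commute)
  qed
  with \<theta>(1) int show ?thesis by (rule that)
qed

text \<open>
  The pair of state and control is a Lipschitz function of the state and of its mean, and both converge by
  the synchronous coupling.
\<close>

lemma mkv_W2_converges:
  assumes X0: "X0 \<in> borel_measurable (F 0)" "integrable M (\<lambda>\<omega>. (norm (X0 \<omega>))\<^sup>2)"
  shows "W2_converges (\<lambda>t. law M (\<lambda>\<omega>. (mkv A B p X0 t \<omega>, affine_feedback A B d (law M (mkv A B p X0 t)) (mkv A B p X0 t \<omega>))))
     (law (stationary_law A p) (\<lambda>x. (x, affine_feedback A B d (stationary_law A p) x)))"
proof -
  let ?\<mu> = "stationary_law A p"
  define N where "N = ?\<mu> \<Otimes>\<^sub>M M"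
  define V where "V = transition A B p ?\<mu>"
  define U where "U t q = mkv A B p X0 t (snd q)" for t and q :: "(real^2) \<times> 'a"
  define m where "m t = mean (law M (mkv A B p X0 t))" for t
  define h where "h t x = (x, A *v x + (B *v m t + d))" for t x
  define k where "k x = (x, A *v x + (B *v p + d))" for x
  note P = P2_D[OF stationary_law_P2]
  interpret \<mu>: prob_space ?\<mu> by (rule P(1))
  interpret pp: pair_prob_space ?\<mu> M ..
  have N: "prob_space N" unfolding N_def by (rule pp.prob_space_axioms)
  interpret N: prob_space N by (rule N)
  obtain K \<theta> where K: "0 < \<theta>" "\<And>t. 0 \<le> t \<Longrightarrow> integrable N (\<lambda>q. (norm (U t q - V t q))\<^sup>2)"
    "\<And>t. 0 \<le> t \<Longrightarrow> (\<integral>q. (norm (U t q - V t q))\<^sup>2 \<partial>N) \<le> K * exp (- \<theta> * t)"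
    by (rule mkv_coupling[OF X0, folded N_def V_def U_def]) (rule that)
  have hm: "h t \<in> borel_measurable borel" and km: "k \<in> borel_measurable borel" for t
    unfolding h_def[abs_def] k_def[abs_def]
    by (intro borel_measurable_Pair borel_measurable_add borel_measurable_matrix_vector; simp)+
  have Xm: "mkv A B p X0 t \<in> borel_measurable M" if "0 \<le> t" for t by (rule measurable_F[OF mkv_adapted[OF X0(1) that]])
  have Um: "U t \<in> borel_measurable N" if "0 \<le> t" for t
    unfolding N_def U_def[abs_def] by (rule measurable_compose[OF measurable_snd Xm[OF that]])
  have Vm: "V t \<in> borel_measurable N" if "0 \<le> t" for t unfolding V_def N_def by (rule transition_measurable[OF stationary_law_P2 that])
  have lawU: "law M (\<lambda>\<omega>. h t (mkv A B p X0 t \<omega>)) = law N (\<lambda>q. h t (U t q))" if t: "0 \<le> t" for t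
    unfolding N_def U_def by (rule product_snd(3)[OF P(1) prob_space_axioms, symmetric]) (rule measurable_compose[OF Xm[OF t] hm])
  have lawV: "law ?\<mu> k = law N (\<lambda>q. k (V t q))" if t: "0 \<le> t" for t
  proof -
    have "law N (V t) = ?\<mu>" unfolding N_def V_def by (rule stationary_transition[OF t])
    then have "law ?\<mu> k = law (law N (V t)) k" by simp
    also have "\<dots> = law N (\<lambda>q. k (V t q))" using distr_distr[OF km Vm[OF t]] by (simp add: o_def)
    finally show ?thesis .
  qed
  have eh: "(\<lambda>\<omega>. (mkv A B p X0 t \<omega>, affine_feedback A B d (law M (mkv A B p X0 t)) (mkv A B p X0 t \<omega>))) = (\<lambda>\<omega>. h t (mkv A B p X0 t \<omega>))" for t
    by (simp add: affine_feedback_def h_def m_def add.assoc)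
  have ek: "(\<lambda>x. (x, affine_feedback A B d ?\<mu> x)) = k"
    by (simp add: affine_feedback_def k_def[abs_def] stationary_law_mean add.assoc)
  have sq: "integrable Q (\<lambda>x. (norm (f x, A *v f x + c))\<^sup>2)" 
    if "prob_space Q" "f \<in> borel_measurable Q" "integrable Q (\<lambda>x. (norm (f x))\<^sup>2)" for Q :: "'z measure" and f c
  proof -
    interpret Q: prob_space Q by (rule that(1))
    have "integrable Q (\<lambda>x. (norm (A *v f x))\<^sup>2)" by (rule square_matrix_vector[OF that(2,3)])
    then have "integrable Q (\<lambda>x. (norm (A *v f x + c))\<^sup>2)"
      by (intro integrable_square_diff(2) borel_measurable_matrix_vector that) simp_all
    then show ?thesis using that(3) by (simp add: norm_Pair)
  qed
  have kP2: "law ?\<mu> k \<in> P2"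
  proof (rule P2_law[OF P(1)])
    show "k \<in> borel_measurable ?\<mu>" using km measurable_cong_sets[OF P(2) refl] by blast
    show "integrable ?\<mu> (\<lambda>x. (norm (k x))\<^sup>2)" unfolding k_def by (rule sq[OF P(1,4,3)])
  qed
  have hP2: "law M (\<lambda>\<omega>. h t (mkv A B p X0 t \<omega>)) \<in> P2" if t: "0 \<le> t" for t
  proof (rule P2_law[OF prob_space_axioms measurable_compose[OF Xm[OF t] hm]])
    show "integrable M (\<lambda>\<omega>. (norm (h t (mkv A B p X0 t \<omega>)))\<^sup>2)"
      unfolding h_def by (rule sq[OF prob_space_axioms Xm[OF t] mkv_square[OF X0 t]])
  qed
  have iX0: "integrable M X0" by (rule integrable_norm_of_square(2)[OF measurable_F[OF X0(1)] X0(2)])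
  have mt: "m t - p = flow (A + B) t *v (expectation X0 - p)" if t: "0 \<le> t" for t
    unfolding m_def mean_law[OF Xm[OF t]] mkv_mean[OF iX0 t] by simp
  define L where "L = (op_norm A)\<^sup>2"
  define R where "R t = (1 + 2 * L) * (K * exp (- \<theta> * t)) + 2 * (norm (B *v (flow (A + B) t *v (expectation X0 - p))))\<^sup>2" for t
  have bound: "W2 (law M (\<lambda>\<omega>. h t (mkv A B p X0 t \<omega>))) (law ?\<mu> k) \<le> sqrt (R t)"
    "0 \<le> W2 (law M (\<lambda>\<omega>. h t (mkv A B p X0 t \<omega>))) (law ?\<mu> k)" if t: "0 \<le> t" for t
  proof -
    have mm: "(\<lambda>q. h t (U t q)) \<in> borel_measurable N" "(\<lambda>q. k (V t q)) \<in> borel_measurable N"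
      by (rule measurable_compose[OF Um[OF t] hm], rule measurable_compose[OF Vm[OF t] km])
    show "0 \<le> W2 (law M (\<lambda>\<omega>. h t (mkv A B p X0 t \<omega>))) (law ?\<mu> k)"
      unfolding lawU[OF t] lawV[OF t] by (rule W2_law_le(1)[OF N mm])
    let ?c = "2 * (norm (B *v (m t - p)))\<^sup>2"
    have d: "(dist (h t (U t q)) (k (V t q)))\<^sup>2 \<le> (1 + 2 * L) * (norm (U t q - V t q))\<^sup>2 + ?c" for q
    proof -
      have e: "A *v U t q + (B *v m t + d) - (A *v V t q + (B *v p + d)) = A *v (U t q - V t q) + B *v (m t - p)"
        by (simp add: matrix_vector_mult_diff_distrib)
      define a b where "a = norm (A *v (U t q - V t q))" and "b = norm (B *v (m t - p))"
      have "(norm (A *v (U t q - V t q) + B *v (m t - p)))\<^sup>2 \<le> (a + b)\<^sup>2"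
        unfolding a_def b_def by (intro power_mono norm_triangle_ineq) simp
      also have "\<dots> \<le> 2 * a\<^sup>2 + 2 * b\<^sup>2" using sum_squares_bound[of a b] by (simp add: power2_sum)
      also have "a\<^sup>2 \<le> L * (norm (U t q - V t q))\<^sup>2"
        unfolding a_def L_def power_mult_distrib[symmetric] by (intro power_mono onorm matrix_vector_mul_bounded_linear) simp
      finally have "(norm (A *v (U t q - V t q) + B *v (m t - p)))\<^sup>2 \<le> 2 * (L * (norm (U t q - V t q))\<^sup>2) + ?c" by (simp add: b_def)
      moreover have "(dist (h t (U t q)) (k (V t q)))\<^sup>2 = (norm (U t q - V t q))\<^sup>2 + (norm (A *v (U t q - V t q) + B *v (m t - p)))\<^sup>2"
        unfolding h_def k_def dist_Pair_Pair unfolding dist_norm e by simp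
      ultimately show ?thesis by (simp add: algebra_simps)
    qed
    have iB: "integrable N (\<lambda>q. (1 + 2 * L) * (norm (U t q - V t q))\<^sup>2 + ?c)" using K(2)[OF t] by simp
    have iD: "integrable N (\<lambda>q. (dist (h t (U t q)) (k (V t q)))\<^sup>2)"
    proof (rule Bochner_Integration.integrable_bound[OF iB])
      show "(\<lambda>q. (dist (h t (U t q)) (k (V t q)))\<^sup>2) \<in> borel_measurable N" using mm by measurable
      show "AE q in N. norm ((dist (h t (U t q)) (k (V t q)))\<^sup>2) \<le> norm ((1 + 2 * L) * (norm (U t q - V t q))\<^sup>2 + ?c)"
      proof (rule AE_I2)
        fix q
        show "norm ((dist (h t (U t q)) (k (V t q)))\<^sup>2) \<le> norm ((1 + 2 * L) * (norm (U t q - V t q))\<^sup>2 + ?c)"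
          using d[of q] by simp
      qed
    qed
    have "(\<integral>q. (dist (h t (U t q)) (k (V t q)))\<^sup>2 \<partial>N) \<le> (\<integral>q. (1 + 2 * L) * (norm (U t q - V t q))\<^sup>2 + ?c \<partial>N)"
      by (rule integral_mono[OF iD iB d])
    also have "\<dots> = (1 + 2 * L) * (\<integral>q. (norm (U t q - V t q))\<^sup>2 \<partial>N) + ?c"
      using K(2)[OF t] by (simp add: N.prob_space)
    also have "\<dots> \<le> R t"
      unfolding R_def mt[OF t, symmetric] using K(3)[OF t] by (intro add_mono mult_left_mono) (auto simp: L_def)
    finally have sR: "sqrt (\<integral>q. (dist (h t (U t q)) (k (V t q)))\<^sup>2 \<partial>N) \<le> sqrt (R t)"
      by (rule real_sqrt_le_mono)
    show "W2 (law M (\<lambda>\<omega>. h t (mkv A B p X0 t \<omega>))) (law ?\<mu> k) \<le> sqrt (R t)"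
      unfolding lawU[OF t] lawV[OF t] by (rule order_trans[OF W2_law_le(2)[OF N mm] sR])
  qed
  have R0: "((\<lambda>t. sqrt (R t)) \<longlongrightarrow> 0) at_top"
  proof -
    have "filterlim (\<lambda>t. - (\<theta> * t)) at_bot at_top"
      using filterlim_tendsto_pos_mult_at_top[OF tendsto_const K(1) filterlim_ident] by (simp add: filterlim_uminus_at_bot)
    then have "((\<lambda>t. exp (- (\<theta> * t))) \<longlongrightarrow> 0) at_top" by (rule filterlim_compose[OF exp_at_bot])
    then have e: "((\<lambda>t. exp (- \<theta> * t)) \<longlongrightarrow> 0) at_top" by simp
    have "((\<lambda>t. B *v (flow (A + B) t *v (expectation X0 - p))) \<longlongrightarrow> B *v 0) at_top"
      by (intro bounded_linear.tendsto[OF matrix_vector_mul_bounded_linear] flow_tendsto_0[OF l' diss'])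
    from tendsto_norm[OF this]
    have g: "((\<lambda>t. norm (B *v (flow (A + B) t *v (expectation X0 - p)))) \<longlongrightarrow> 0) at_top"
      by (simp add: bounded_bilinear.zero_right[OF bounded_bilinear_matrix_vector])
    have "((\<lambda>t. sqrt (R t)) \<longlongrightarrow> sqrt ((1 + 2 * L) * (K * 0) + 2 * 0\<^sup>2)) at_top"
      unfolding R_def by (intro tendsto_intros e g)
    then show ?thesis by simp
  qed
  show ?thesis
    unfolding W2_converges_def eh ek
  proof (intro conjI kP2)
    show "\<forall>\<^sub>F t in at_top. law M (\<lambda>\<omega>. h t (mkv A B p X0 t \<omega>)) \<in> P2"
      using eventually_ge_at_top[of 0] by eventually_elim (rule hP2)
    show "((\<lambda>t. W2 (law M (\<lambda>\<omega>. h t (mkv A B p X0 t \<omega>))) (law ?\<mu> k)) \<longlongrightarrow> 0) at_top"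
    proof (rule Lim_null_comparison[OF _ R0])
      show "\<forall>\<^sub>F t in at_top. norm (W2 (law M (\<lambda>\<omega>. h t (mkv A B p X0 t \<omega>))) (law ?\<mu> k)) \<le> sqrt (R t)"
        using eventually_ge_at_top[of 0]
      proof eventually_elim
        case (elim t)
        show ?case using bound[OF elim] by simp
      qed
    qed
  qed
qed

end

end

section \<open>Algebra of the Riccati system\<close>

lemma two_indices: "(1::2) \<noteq> 2" "(2::2) \<noteq> 1"
  by simp_all

lemma outer_mult_component: "((e k \<odot> e k) ** N) $ i $ j = (if i = k then N $ k $ j else 0)"
  using exhaust_2[of k] exhaust_2[of i]
  by (auto simp: outer_def e_def matrix_matrix_mult_def sum_2 axis_def)

lemma stacked_component:
  assumes "\<And>k. r k \<noteq> 0"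
  shows "(stacked r A *v x) $ i = (A i *v x) $ i / r i"
  using exhaust_2[of i]
  by (auto simp: stacked_def matrix_vector_mult_def sum_2 outer_mult_component divide_inverse algebra_simps)

definition lq_offset :: "(2 \<Rightarrow> real) \<Rightarrow> (2 \<Rightarrow> real^2) \<Rightarrow> real^2" where
  "lq_offset r q = (\<chi> i. - (q i $ i / (2 * r i)))"

lemma inner_e: "e i \<bullet> x = x $ i"
  by (simp add: e_def inner_axis')

lemma lq_feedback_component:
  "lq_feedback r Q R q \<mu> x $ i = - ((Q i *v x) $ i + (R i *v mean \<mu>) $ i + q i $ i / 2) / r i"
  by (simp add: lq_feedback_def inner_e)

lemma lq_feedback_affine:
  assumes "\<And>k. r k \<noteq> 0"
  shows "lq_feedback r Q R q = affine_feedback (- stacked r Q) (- stacked r R) (lq_offset r q)"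
proof (intro ext)
  fix \<mu> x
  have a: "(- stacked r Q *v x) $ i = - ((Q i *v x) $ i / r i)" for i
    using stacked_component[OF assms, where A = Q and x = x and i = i]
    by (simp add: bounded_bilinear.minus_left[OF bounded_bilinear_matrix_vector])
  have b: "(- stacked r R *v mean \<mu>) $ i = - ((R i *v mean \<mu>) $ i / r i)" for i
    using stacked_component[OF assms, where A = R and x = "mean \<mu>" and i = i]
    by (simp add: bounded_bilinear.minus_left[OF bounded_bilinear_matrix_vector])
  show "lq_feedback r Q R q \<mu> x = affine_feedback (- stacked r Q) (- stacked r R) (lq_offset r q) \<mu> x"
  proof (rule vec_eq_iff[THEN iffD2], rule allI)
    fix i
    show "lq_feedback r Q R q \<mu> x $ i = affine_feedback (- stacked r Q) (- stacked r R) (lq_offset r q) \<mu> x $ i"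
      unfolding lq_feedback_component affine_feedback_def vector_add_component a b lq_offset_def
      using assms[of i] by (simp add: field_simps)
  qed
qed

lemma quadratic_form_outer: "x \<bullet> ((u \<odot> w) *v y) = (x \<bullet> u) * (w \<bullet> y)"
  unfolding inner_matrix_plane by (simp add: inner_plane outer_def algebra_simps)

lemma quadratic_form_sym_outer: "x \<bullet> (sym_part (u \<odot> w) *v x) = (u \<bullet> x) * (w \<bullet> x)"
  by (simp add: sym_part_quadratic_form quadratic_form_outer inner_commute)

lemma symmetric_column:
  assumes "transpose (A :: real^2^2) = A"
  shows "(A *v e k) \<bullet> x = (A *v x) $ k"
proof -
  have "(A *v e k) \<bullet> x = e k \<bullet> (transpose A *v x)" by (simp add: dot_lmul_matrix[symmetric] inner_commute vector_transpose_matrix transpose_matrix_vector)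
  then show ?thesis using assms by (simp add: inner_e)
qed

text \<open>
  The equations of one player, with opponent \<open>j\<close>, written as identities between quadratic and linear forms.
  In this form they are the same for both players.
\<close>

definition player_riccati ::
  "(2 \<Rightarrow> real) \<Rightarrow> (2 \<Rightarrow> real^2) \<Rightarrow> (2 \<Rightarrow> real^2^2) \<Rightarrow> (2 \<Rightarrow> real^2^2) \<Rightarrow> (2 \<Rightarrow> real^2) \<Rightarrow> 2 \<Rightarrow> 2 \<Rightarrow> real \<Rightarrow> bool" where
  "player_riccati r \<eta> Q R q i j c \<longleftrightarrow> i \<noteq> j \<and> r i > 0 \<and> r j > 0 \<and>
    (\<forall>x. (norm x)\<^sup>2 = ((Q i *v x) $ i)\<^sup>2 / r i + 2 * ((Q i *v x) $ j * (Q j *v x) $ j) / r j) \<and>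
    (\<forall>m. (\<eta> i \<bullet> m)\<^sup>2 = (2 * ((Q i *v m) $ i * (R i *v m) $ i) + ((R i *v m) $ i)\<^sup>2) / r i
       + 2 * ((Q i *v m) $ j * (R j *v m) $ j + (Q j *v m) $ j * (R i *v m) $ j + (R i *v m) $ j * (R j *v m) $ j) / r j) \<and>
    (\<forall>m. q i $ i * ((Q i *v m) $ i + (R i *v m) $ i) / r i
       + (q j $ j * ((Q i *v m) $ j + (R i *v m) $ j) + q i $ j * ((Q j *v m) $ j + (R j *v m) $ j)) / r j = 0) \<and>
    c - trace (Q i) = - (q i $ i)\<^sup>2 / (4 * r i) - q i $ j * q j $ j / (2 * r j)"

lemma quadratic_form_expand:
  fixes x :: "real^2"
  shows "x \<bullet> ((A - B) *v x) = x \<bullet> (A *v x) - x \<bullet> (B *v x)" "x \<bullet> ((s *\<^sub>R A) *v x) = s * (x \<bullet> (A *v x))"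
    "x \<bullet> (mat 1 *v x) = (norm x)\<^sup>2" "x \<bullet> (0 *v x) = 0"
proof -
  show "x \<bullet> (mat 1 *v x) = (norm x)\<^sup>2" by (simp add: power2_norm_eq_inner)
qed (simp_all add: inner_matrix_plane algebra_simps)

lemma vector_matrix_outer:
  fixes N :: "real^2^2" and m v :: "real^2"
  shows "(v v* ((e k \<odot> e k) ** N)) \<bullet> m = v $ k * (N *v m) $ k"
  using exhaust_2[of k]
  by (auto simp: inner_vec_def vector_matrix_mult_def matrix_vector_mult_def sum_2 outer_mult_component algebra_simps)

lemma riccati_player:
  assumes ric: "riccati_solution r \<eta> Q R q c" and r: "r 1 > 0" "r 2 > 0"
  shows "player_riccati r \<eta> Q R q 1 2 (ergodic_const1 r Q q)"
    and "player_riccati r \<eta> Q R q 2 1 (ergodic_const2 r Q q)"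
proof -
  have sym: "transpose (Q k) = Q k" "transpose (R k) = R k" for k
    using ric unfolding riccati_solution_def by blast+
  note col = symmetric_column[OF sym(1)] symmetric_column[OF sym(2)]
  have E1: "mat 1 - inverse (r 1) *\<^sub>R ((Q 1 *v e 1) \<odot> (Q 1 *v e 1))
       - (2 * inverse (r 2)) *\<^sub>R sym_part ((Q 1 *v e 2) \<odot> (Q 2 *v e 2)) = 0"
    and E2: "mat 1 - inverse (r 2) *\<^sub>R ((Q 2 *v e 2) \<odot> (Q 2 *v e 2))
       - (2 * inverse (r 1)) *\<^sub>R sym_part ((Q 2 *v e 1) \<odot> (Q 1 *v e 1)) = 0"
    and E3: "\<eta> 1 \<odot> \<eta> 1
       - (2 * inverse (r 1)) *\<^sub>R sym_part ((Q 1 *v e 1) \<odot> (R 1 *v e 1))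
       - inverse (r 1) *\<^sub>R ((R 1 *v e 1) \<odot> (R 1 *v e 1))
       - (2 * inverse (r 2)) *\<^sub>R sym_part ((Q 1 *v e 2) \<odot> (R 2 *v e 2))
       - (2 * inverse (r 2)) *\<^sub>R sym_part ((Q 2 *v e 2) \<odot> (R 1 *v e 2))
       - (2 * inverse (r 2)) *\<^sub>R sym_part ((R 1 *v e 2) \<odot> (R 2 *v e 2)) = 0"
    and E4: "\<eta> 2 \<odot> \<eta> 2
       - (2 * inverse (r 2)) *\<^sub>R sym_part ((Q 2 *v e 2) \<odot> (R 2 *v e 2))
       - inverse (r 2) *\<^sub>R ((R 2 *v e 2) \<odot> (R 2 *v e 2))
       - (2 * inverse (r 1)) *\<^sub>R sym_part ((Q 2 *v e 1) \<odot> (R 1 *v e 1))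
       - (2 * inverse (r 1)) *\<^sub>R sym_part ((Q 1 *v e 1) \<odot> (R 2 *v e 1))
       - (2 * inverse (r 1)) *\<^sub>R sym_part ((R 1 *v e 1) \<odot> (R 2 *v e 1)) = 0"
    and E5: "- (inverse (r 1) *\<^sub>R (q 1 v* ((e 1 \<odot> e 1) ** (Q 1 + R 1))))
       - inverse (r 2) *\<^sub>R (q 2 v* ((e 2 \<odot> e 2) ** (Q 1 + R 1)))
       - inverse (r 2) *\<^sub>R (q 1 v* ((e 2 \<odot> e 2) ** (Q 2 + R 2))) = 0"
    and E6: "- (inverse (r 2) *\<^sub>R (q 2 v* ((e 2 \<odot> e 2) ** (Q 2 + R 2))))
       - inverse (r 1) *\<^sub>R (q 1 v* ((e 1 \<odot> e 1) ** (Q 2 + R 2)))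
       - inverse (r 1) *\<^sub>R (q 2 v* ((e 1 \<odot> e 1) ** (Q 1 + R 1))) = 0"
    using ric unfolding riccati_solution_def by blast+
  have quad: "x \<bullet> ((u \<odot> u) *v x) = (u \<bullet> x)\<^sup>2" for u x :: "real^2"
    by (simp add: quadratic_form_outer power2_eq_square inner_commute)
  note ex = quadratic_form_expand quad quadratic_form_sym_outer col
  have Q1: "(norm x)\<^sup>2 - inverse (r 1) * ((Q 1 *v x) $ 1)\<^sup>2 - 2 * inverse (r 2) * ((Q 1 *v x) $ 2 * (Q 2 *v x) $ 2) = 0" for x
    using arg_cong[OF E1, of "\<lambda>N. x \<bullet> (N *v x)"] by (simp only: ex)
  have Q2: "(norm x)\<^sup>2 - inverse (r 2) * ((Q 2 *v x) $ 2)\<^sup>2 - 2 * inverse (r 1) * ((Q 2 *v x) $ 1 * (Q 1 *v x) $ 1) = 0" for x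
    using arg_cong[OF E2, of "\<lambda>N. x \<bullet> (N *v x)"] by (simp only: ex)
  have Q3: "(\<eta> 1 \<bullet> m)\<^sup>2 - 2 * inverse (r 1) * ((Q 1 *v m) $ 1 * (R 1 *v m) $ 1) - inverse (r 1) * ((R 1 *v m) $ 1)\<^sup>2
     - 2 * inverse (r 2) * ((Q 1 *v m) $ 2 * (R 2 *v m) $ 2) - 2 * inverse (r 2) * ((Q 2 *v m) $ 2 * (R 1 *v m) $ 2)
     - 2 * inverse (r 2) * ((R 1 *v m) $ 2 * (R 2 *v m) $ 2) = 0" for m
    using arg_cong[OF E3, of "\<lambda>N. m \<bullet> (N *v m)"] by (simp only: ex)
  have Q4: "(\<eta> 2 \<bullet> m)\<^sup>2 - 2 * inverse (r 2) * ((Q 2 *v m) $ 2 * (R 2 *v m) $ 2) - inverse (r 2) * ((R 2 *v m) $ 2)\<^sup>2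
     - 2 * inverse (r 1) * ((Q 2 *v m) $ 1 * (R 1 *v m) $ 1) - 2 * inverse (r 1) * ((Q 1 *v m) $ 1 * (R 2 *v m) $ 1)
     - 2 * inverse (r 1) * ((R 1 *v m) $ 1 * (R 2 *v m) $ 1) = 0" for m
    using arg_cong[OF E4, of "\<lambda>N. m \<bullet> (N *v m)"] by (simp only: ex)
  have Q5: "- (inverse (r 1) * (q 1 $ 1 * ((Q 1 + R 1) *v m) $ 1)) - inverse (r 2) * (q 2 $ 2 * ((Q 1 + R 1) *v m) $ 2)
     - inverse (r 2) * (q 1 $ 2 * ((Q 2 + R 2) *v m) $ 2) = 0" for m
    using arg_cong[OF E5, of "\<lambda>v. v \<bullet> m"]
    by (simp only: inner_diff_left inner_minus_left inner_scaleR_left vector_matrix_outer inner_zero_left)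
  have Q6: "- (inverse (r 2) * (q 2 $ 2 * ((Q 2 + R 2) *v m) $ 2)) - inverse (r 1) * (q 1 $ 1 * ((Q 2 + R 2) *v m) $ 1)
     - inverse (r 1) * (q 2 $ 1 * ((Q 1 + R 1) *v m) $ 1) = 0" for m
    using arg_cong[OF E6, of "\<lambda>v. v \<bullet> m"]
    by (simp only: inner_diff_left inner_minus_left inner_scaleR_left vector_matrix_outer inner_zero_left)
  have add: "((Q k + R k) *v m) $ i = (Q k *v m) $ i + (R k *v m) $ i" for k m i
    by (simp add: matrix_vector_mult_add_rdistrib)
  have oc: "q a \<bullet> ((e k \<odot> e k) *v q b) = q a $ k * q b $ k" for a b k
    by (simp add: quadratic_form_outer inner_commute[of "q a"] inner_e)
  show "player_riccati r \<eta> Q R q 1 2 (ergodic_const1 r Q q)"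
    unfolding player_riccati_def
  proof (intro conjI allI)
    fix m :: "real^2"
    show "(norm m)\<^sup>2 = ((Q 1 *v m) $ 1)\<^sup>2 / r 1 + 2 * ((Q 1 *v m) $ 2 * (Q 2 *v m) $ 2) / r 2"
      using Q1[of m] by (simp add: divide_inverse algebra_simps)
    show "(\<eta> 1 \<bullet> m)\<^sup>2 = (2 * ((Q 1 *v m) $ 1 * (R 1 *v m) $ 1) + ((R 1 *v m) $ 1)\<^sup>2) / r 1
       + 2 * ((Q 1 *v m) $ 2 * (R 2 *v m) $ 2 + (Q 2 *v m) $ 2 * (R 1 *v m) $ 2 + (R 1 *v m) $ 2 * (R 2 *v m) $ 2) / r 2"
      using Q3[of m] by (simp add: divide_inverse algebra_simps)
    show "q 1 $ 1 * ((Q 1 *v m) $ 1 + (R 1 *v m) $ 1) / r 1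
       + (q 2 $ 2 * ((Q 1 *v m) $ 2 + (R 1 *v m) $ 2) + q 1 $ 2 * ((Q 2 *v m) $ 2 + (R 2 *v m) $ 2)) / r 2 = 0"
      using Q5[of m] unfolding add by (simp add: divide_inverse algebra_simps)
    show "ergodic_const1 r Q q - trace (Q 1) = - (q 1 $ 1)\<^sup>2 / (4 * r 1) - q 1 $ 2 * q 2 $ 2 / (2 * r 2)"
      unfolding ergodic_const1_def oc inner_e power2_abs using r by (simp add: field_simps)
  qed (use r two_indices in auto)
  show "player_riccati r \<eta> Q R q 2 1 (ergodic_const2 r Q q)"
    unfolding player_riccati_def
  proof (intro conjI allI)
    fix m :: "real^2"
    show "(norm m)\<^sup>2 = ((Q 2 *v m) $ 2)\<^sup>2 / r 2 + 2 * ((Q 2 *v m) $ 1 * (Q 1 *v m) $ 1) / r 1"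
      using Q2[of m] by (simp add: divide_inverse algebra_simps)
    show "(\<eta> 2 \<bullet> m)\<^sup>2 = (2 * ((Q 2 *v m) $ 2 * (R 2 *v m) $ 2) + ((R 2 *v m) $ 2)\<^sup>2) / r 2
       + 2 * ((Q 2 *v m) $ 1 * (R 1 *v m) $ 1 + (Q 1 *v m) $ 1 * (R 2 *v m) $ 1 + (R 2 *v m) $ 1 * (R 1 *v m) $ 1) / r 1"
      using Q4[of m] by (simp add: divide_inverse algebra_simps)
    show "q 2 $ 2 * ((Q 2 *v m) $ 2 + (R 2 *v m) $ 2) / r 2
       + (q 1 $ 1 * ((Q 2 *v m) $ 1 + (R 2 *v m) $ 1) + q 2 $ 1 * ((Q 1 *v m) $ 1 + (R 1 *v m) $ 1)) / r 1 = 0"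
      using Q6[of m] unfolding add by (simp add: divide_inverse algebra_simps)
    show "ergodic_const2 r Q q - trace (Q 2) = - (q 2 $ 2)\<^sup>2 / (4 * r 2) - q 2 $ 1 * q 1 $ 1 / (2 * r 1)"
      unfolding ergodic_const2_def oc inner_e power2_abs using r by (simp add: field_simps)
  qed (use r two_indices in auto)
qed

lemma inner_players: "i \<noteq> j \<Longrightarrow> x \<bullet> y = x $ i * y $ i + x $ j * y $ j" for x y :: "real^2" and i j :: 2
  using exhaust_2[of i] exhaust_2[of j] by (auto simp: inner_plane)

text \<open>
  The Hamiltonian of player \<open>i\<close>, when the opponent plays the candidate feedback \<open>s\<close>: it is the square of the
  distance to \<open>s\<close>, a constant, and a term linear in \<open>x - m\<close>. The last term disappears in expectation
  when \<open>m\<close> is the mean of \<open>x\<close>.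
\<close>

lemma completion_of_squares:
  assumes P: "player_riccati r \<eta> Q R q i j c"
  shows "\<exists>w. \<forall>x \<alpha> s. (\<forall>k. s $ k = - ((Q k *v x) $ k + (R k *v m) $ k + q k $ k / 2) / r k) \<longrightarrow> \<alpha> $ j = s $ j \<longrightarrow>
    (norm x)\<^sup>2 + r i * (\<alpha> $ i)\<^sup>2 + (\<eta> i \<bullet> m)\<^sup>2 + \<alpha> \<bullet> (2 *\<^sub>R (Q i *v x) + 2 *\<^sub>R (R i *v m) + q i)
      = r i * (\<alpha> $ i - s $ i)\<^sup>2 + (c - trace (Q i)) + w \<bullet> (x - m)"
proof -
  have ij: "i \<noteq> j" and r: "r i > 0" "r j > 0"
    and H1: "\<And>x. (norm x)\<^sup>2 = ((Q i *v x) $ i)\<^sup>2 / r i + 2 * ((Q i *v x) $ j * (Q j *v x) $ j) / r j"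
    and H2: "(\<eta> i \<bullet> m)\<^sup>2 = (2 * ((Q i *v m) $ i * (R i *v m) $ i) + ((R i *v m) $ i)\<^sup>2) / r i
       + 2 * ((Q i *v m) $ j * (R j *v m) $ j + (Q j *v m) $ j * (R i *v m) $ j + (R i *v m) $ j * (R j *v m) $ j) / r j"
    and H3: "q i $ i * ((Q i *v m) $ i + (R i *v m) $ i) / r i
       + (q j $ j * ((Q i *v m) $ j + (R i *v m) $ j) + q i $ j * ((Q j *v m) $ j + (R j *v m) $ j)) / r j = 0"
    and H4: "c - trace (Q i) = - (q i $ i)\<^sup>2 / (4 * r i) - q i $ j * q j $ j / (2 * r j)"
    using P unfolding player_riccati_def by blast+
  define S where "S = (R i *v m) $ i + q i $ i / 2"
  define S' where "S' = (R i *v m) $ j + q i $ j / 2"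
  define T where "T = (R j *v m) $ j + q j $ j / 2"
  define w where "w = (- 2 * S / r i) *\<^sub>R row i (Q i) + (- 2 * S' / r j) *\<^sub>R row j (Q j) + (- 2 * T / r j) *\<^sub>R row j (Q i)"
  have row: "row k N \<bullet> v = (N *v v) $ k" for k and N :: "real^2^2" and v
    by (simp add: row_def inner_plane matrix_vector_mult_def sum_2)
  have w: "w \<bullet> v = - 2 * S / r i * (Q i *v v) $ i - 2 * S' / r j * (Q j *v v) $ j - 2 * T / r j * (Q i *v v) $ j" for v
    unfolding w_def inner_add_left inner_scaleR_left row by simp
  have wd: "w \<bullet> (x - m) = w \<bullet> x - w \<bullet> m" for x by (simp add: inner_diff_right)
  have det: "(\<eta> i \<bullet> m)\<^sup>2 - S\<^sup>2 / r i - 2 * T * S' / r j + w \<bullet> m = c - trace (Q i)"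
  proof -
    define u u' v s s' t a b e where "u = (Q i *v m) $ i" and "u' = (Q i *v m) $ j" and "v = (Q j *v m) $ j"
      and "s = (R i *v m) $ i" and "s' = (R i *v m) $ j" and "t = (R j *v m) $ j"
      and "a = q i $ i" and "b = q i $ j" and "e = q j $ j"
    define x y where "x = inverse (r i)" and "y = inverse (r j)"
    have h2: "(\<eta> i \<bullet> m)\<^sup>2 = (2 * (u * s) + s\<^sup>2) * x + 2 * (u' * t + v * s' + s' * t) * y"
      using H2 by (simp add: u_def u'_def v_def s_def s'_def t_def x_def y_def divide_inverse)
    have h3: "a * (u + s) * x + (e * (u' + s') + b * (v + t)) * y = 0"
      using H3 by (simp add: u_def u'_def v_def s_def s'_def t_def a_def b_def e_def x_def y_def divide_inverse)
    have h4: "c - trace (Q i) = - a\<^sup>2 * x / 4 - b * e * y / 2"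
      unfolding H4 a_def b_def e_def x_def y_def using r by (simp add: field_simps)
    have wm: "w \<bullet> m = - 2 * S * x * u - 2 * S' * y * v - 2 * T * y * u'"
      unfolding w by (simp add: u_def u'_def v_def x_def y_def divide_inverse)
    have S: "S = s + a / 2" "S' = s' + b / 2" "T = t + e / 2"
      by (simp_all add: S_def S'_def T_def s_def s'_def t_def a_def b_def e_def)
    have "(\<eta> i \<bullet> m)\<^sup>2 - S\<^sup>2 / r i - 2 * T * S' / r j + w \<bullet> m
        = (\<eta> i \<bullet> m)\<^sup>2 - S\<^sup>2 * x - 2 * T * S' * y + w \<bullet> m" by (simp add: x_def y_def divide_inverse)
    also have "\<dots> = (- a\<^sup>2 * x / 4 - b * e * y / 2) - (a * (u + s) * x + (e * (u' + s') + b * (v + t)) * y)"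
      unfolding h2 wm S by (simp add: power2_eq_square field_simps)
    finally show ?thesis unfolding h3 h4 by simp
  qed
  show ?thesis
  proof (intro exI[of _ w] allI impI)
    fix x \<alpha> s :: "real^2"
    assume s: "\<forall>k. s $ k = - ((Q k *v x) $ k + (R k *v m) $ k + q k $ k / 2) / r k" and \<alpha>: "\<alpha> $ j = s $ j"
    define u u' v where "u = (Q i *v x) $ i" and "u' = (Q i *v x) $ j" and "v = (Q j *v x) $ j"
    define X Y where "X = inverse (r i)" and "Y = inverse (r j)"
    have rX: "r i * X = 1" using r by (simp add: X_def)
    have si: "s $ i = - (u + S) * X" and sj: "s $ j = - (v + T) * Y"
      unfolding s[rule_format, of i] s[rule_format, of j] u_def v_def S_def T_def X_def Y_def
      using r by (simp_all add: field_simps)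
    have h1: "(norm x)\<^sup>2 = u\<^sup>2 * X + 2 * (u' * v) * Y"
      using H1[of x] by (simp add: u_def u'_def v_def X_def Y_def divide_inverse)
    have wx: "w \<bullet> x = - 2 * S * X * u - 2 * S' * Y * v - 2 * T * Y * u'"
      unfolding w by (simp add: u_def u'_def v_def X_def Y_def divide_inverse)
    have c: "\<alpha> \<bullet> (2 *\<^sub>R (Q i *v x) + 2 *\<^sub>R (R i *v m) + q i) = \<alpha> $ i * (2 * (u + S)) + s $ j * (2 * (u' + S'))"
      unfolding inner_players[OF ij] \<alpha> by (simp add: u_def u'_def S_def S'_def add.assoc)
    have sq: "r i * (\<alpha> $ i)\<^sup>2 + \<alpha> $ i * (2 * (u + S)) = r i * (\<alpha> $ i - s $ i)\<^sup>2 - (u + S)\<^sup>2 * X"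
    proof -
      define y where "y = \<alpha> $ i"
      have "r i * (y - (- (u + S) * X))\<^sup>2 - (u + S)\<^sup>2 * X = r i * y\<^sup>2 + 2 * (r i * X) * y * (u + S) + (r i * X) * X * (u + S)\<^sup>2 - (u + S)\<^sup>2 * X"
        by (simp add: power2_eq_square algebra_simps)
      then show ?thesis unfolding si y_def[symmetric] rX by (simp add: algebra_simps)
    qed
    have "(norm x)\<^sup>2 + r i * (\<alpha> $ i)\<^sup>2 + (\<eta> i \<bullet> m)\<^sup>2 + \<alpha> \<bullet> (2 *\<^sub>R (Q i *v x) + 2 *\<^sub>R (R i *v m) + q i)
      = (r i * (\<alpha> $ i)\<^sup>2 + \<alpha> $ i * (2 * (u + S))) + ((norm x)\<^sup>2 + (\<eta> i \<bullet> m)\<^sup>2 + s $ j * (2 * (u' + S')))"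
      unfolding c by simp
    also have "\<dots> = r i * (\<alpha> $ i - s $ i)\<^sup>2 + ((\<eta> i \<bullet> m)\<^sup>2 - S\<^sup>2 * X - 2 * T * S' * Y + w \<bullet> x)"
      unfolding sq h1 wx sj by (simp add: power2_eq_square algebra_simps)
    also have "(\<eta> i \<bullet> m)\<^sup>2 - S\<^sup>2 * X - 2 * T * S' * Y + w \<bullet> x = (c - trace (Q i)) + w \<bullet> (x - m)"
      using det unfolding wd by (simp add: X_def Y_def divide_inverse)
    finally show "(norm x)\<^sup>2 + r i * (\<alpha> $ i)\<^sup>2 + (\<eta> i \<bullet> m)\<^sup>2 + \<alpha> \<bullet> (2 *\<^sub>R (Q i *v x) + 2 *\<^sub>R (R i *v m) + q i)
      = r i * (\<alpha> $ i - s $ i)\<^sup>2 + (c - trace (Q i)) + w \<bullet> (x - m)" by simp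
  qed
qed

section \<open>Costs of a unilateral deviation\<close>

abbreviation law_space :: "(real^2) measure measure" where
  "law_space \<equiv> restrict_space (prob_algebra borel) P2"

lemma affine_feedback_measurable:
  "(\<lambda>(\<mu>, x). affine_feedback A B d \<mu> x) \<in> borel_measurable (law_space \<Otimes>\<^sub>M borel)"
proof -
  have i: "(\<lambda>\<mu>. \<mu>) \<in> measurable law_space (prob_algebra (borel :: (real^2) measure))"
    by (rule measurable_restrict_space1) (rule measurable_ident_sets[OF refl])
  have "(\<lambda>\<mu>. \<integral>x. x \<partial>\<mu>) \<in> borel_measurable (subprob_algebra (borel :: (real^2) measure))"
    by (rule integral_measurable_subprob_algebra) simp
  from measurable_compose[OF measurable_prob_algebraD[OF i] this]
  have "mean \<in> borel_measurable law_space" by (simp add: mean_def[abs_def])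
  then have m: "(\<lambda>q. mean (fst q)) \<in> borel_measurable (law_space \<Otimes>\<^sub>M (borel :: (real^2) measure))"
    by (rule measurable_compose[OF measurable_fst])
  have s: "(\<lambda>q. snd q) \<in> borel_measurable (law_space \<Otimes>\<^sub>M (borel :: (real^2) measure))" by (rule measurable_snd)
  show ?thesis unfolding affine_feedback_def split_beta'
    by (intro borel_measurable_add borel_measurable_matrix_vector m s) simp
qed

lemma feedback_section:
  assumes b: "(\<lambda>(\<mu>, x). b \<mu> x) \<in> borel_measurable (law_space \<Otimes>\<^sub>M borel)" and \<mu>: "\<mu> \<in> P2"
  shows "b \<mu> \<in> borel_measurable borel"
proof -
  have "\<mu> \<in> space law_space" using \<mu> by (auto simp: space_restrict_space space_prob_algebra P2_def)
  from measurable_compose[OF measurable_Pair1'[OF this] b] show ?thesis by simp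
qed

text \<open>
  The curve of laws \<open>t \<mapsto> law M (Z t)\<close> is measurable by Fubini, so feedback controls along a measurable
  process are jointly measurable.
\<close>

lemma (in prob_space) feedback_joint:
  assumes b: "(\<lambda>(\<mu>, x). b \<mu> x) \<in> borel_measurable (law_space \<Otimes>\<^sub>M borel)"
    and Z: "(\<lambda>p. Z (fst p) (snd p)) \<in> borel_measurable ((borel :: real measure) \<Otimes>\<^sub>M M)"
    and P2: "\<And>t. law M (Z t) \<in> P2"
  shows "(\<lambda>p. b (law M (Z (fst p))) (Z (fst p) (snd p))) \<in> borel_measurable (borel \<Otimes>\<^sub>M M)"
proof -
  have "M \<in> space (subprob_algebra M)" by (simp add: space_subprob_algebra subprob_space_axioms)
  then have c: "(\<lambda>_::real. M) \<in> measurable borel (subprob_algebra M)" by simp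
  have Z': "case_prod Z \<in> borel_measurable ((borel :: real measure) \<Otimes>\<^sub>M M)" using Z by (simp add: split_beta')
  have "(\<lambda>t. law M (Z t)) \<in> measurable borel (subprob_algebra borel)"
    using measurable_distr2[OF Z' c] by simp
  then have "(\<lambda>t. law M (Z t)) \<in> measurable borel (prob_algebra borel)"
    by (rule measurable_prob_algebraI[rotated]) (use P2 in \<open>auto simp: P2_def\<close>)
  then have "(\<lambda>t. law M (Z t)) \<in> measurable borel law_space"
    by (rule measurable_restrict_space2[rotated]) (use P2 in auto)
  from measurable_compose[OF measurable_fst this] Z
  have "(\<lambda>p. (law M (Z (fst p)), Z (fst p) (snd p))) \<in> measurable (borel \<Otimes>\<^sub>M M) (law_space \<Otimes>\<^sub>M borel)"
    by (rule measurable_Pair)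
  from measurable_compose[OF this b] show ?thesis by simp
qed

text \<open>
  Player \<open>i\<close> plays the feedback \<open>b\<close> while \<open>j\<close> keeps to the candidate. Both players are treated at once: \<open>i\<close> and
  \<open>j\<close> are parameters. The candidate is affine with coefficients \<open>A\<close>, \<open>B\<close>, \<open>d\<close>, and \<open>p\<close> is its equilibrium mean.
\<close>

locale deviation = brownian M F W
  for M :: "'a measure" and F and W :: "real \<Rightarrow> 'a \<Rightarrow> real^2" +
  fixes X0 :: "'a \<Rightarrow> real^2" and A B :: "real^2^2" and d p :: "real^2" and l l' :: real
    and r :: "2 \<Rightarrow> real" and \<eta> :: "2 \<Rightarrow> real^2" and Q R :: "2 \<Rightarrow> real^2^2" and q :: "2 \<Rightarrow> real^2"
    and i j :: 2 and c :: real and b :: feedback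
  assumes X0F: "X0 \<in> borel_measurable (F 0)" and X02: "integrable M (\<lambda>\<omega>. (norm (X0 \<omega>))\<^sup>2)"
    and l: "0 < l" and diss: "\<And>x. x \<bullet> (A *v x) \<le> - l * (norm x)\<^sup>2"
    and l': "0 < l'" and diss': "\<And>x. x \<bullet> ((A + B) *v x) \<le> - l' * (norm x)\<^sup>2"
    and p: "(A + B) *v p + d = 0"
    and star: "lq_feedback r Q R q = affine_feedback A B d"
    and ric: "player_riccati r \<eta> Q R q i j c"
    and symQ: "transpose (Q i) = Q i" and symR: "transpose (R i) = R i"
    and b: "b \<in> admissible M F W X0"
    and agree: "\<And>\<mu> x. \<mu> \<in> P2 \<Longrightarrow> b \<mu> x $ j = lq_feedback r Q R q \<mu> x $ j"
begin

text \<open>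
  Negative times are mapped to \<open>0\<close>, so that the process is continuous and measurable on the whole line.
\<close>

definition X :: "real \<Rightarrow> 'a \<Rightarrow> real^2" where "X t = state M F W X0 b (max 0 t)"
definition \<alpha> :: "real \<Rightarrow> 'a \<Rightarrow> real^2" where "\<alpha> t \<omega> = b (law M (X t)) (X t \<omega>)"
definition s :: "real \<Rightarrow> 'a \<Rightarrow> real^2" where "s t \<omega> = affine_feedback A B d (law M (X t)) (X t \<omega>)"
definition m :: "real \<Rightarrow> real^2" where "m t = expectation (X t)"

lemma players: "i \<noteq> j" "0 < r i" "0 < r j" using ric by (auto simp: player_riccati_def)

lemma b_markov: "markov_control M F W X0 b" using b by (simp add: admissible_def)

lemma b_measurable: "(\<lambda>(\<mu>, x). b \<mu> x) \<in> borel_measurable (law_space \<Otimes>\<^sub>M borel)"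
  using b_markov by (simp add: markov_control_def)

lemma solution: "sq_int_solution M F W X0 b (state M F W X0 b)"
proof -
  have "\<exists>Y. sq_int_solution M F W X0 b Y" using b_markov by (simp add: markov_control_def)
  then show ?thesis unfolding state_def by (rule someI_ex)
qed

lemma X_state: "0 \<le> t \<Longrightarrow> X t = state M F W X0 b t" by (simp add: X_def max_def)

lemma X_adapted: "0 \<le> t \<Longrightarrow> X t \<in> borel_measurable (F t)"
  using solution by (simp add: X_state sq_int_solution_def)

lemma X_square: "integrable M (\<lambda>\<omega>. (norm (X t \<omega>))\<^sup>2)"
  using solution by (simp add: X_def sq_int_solution_def)

lemma X_joint: "(\<lambda>p. X (fst p) (snd p)) \<in> borel_measurable (borel \<Otimes>\<^sub>M M)"
  unfolding X_def
proof (rule joint_of_continuous)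
  show "state M F W X0 b t \<in> borel_measurable M" if "0 \<le> t" for t
    using measurable_F[OF X_adapted[OF that]] X_state[OF that] by simp
  show "continuous_on {0..} (\<lambda>t. state M F W X0 b t \<omega>)" if "\<omega> \<in> space M" for \<omega>
    using solution that by (simp add: sq_int_solution_def)
qed

lemma X_meas: "X t \<in> borel_measurable M"
  using measurable_compose[OF measurable_Pair1' X_joint, of t] by simp

lemma law_X_P2: "law M (X t) \<in> P2" by (rule P2_law[OF prob_space_axioms X_meas X_square])

lemma \<alpha>_joint: "(\<lambda>p. \<alpha> (fst p) (snd p)) \<in> borel_measurable (borel \<Otimes>\<^sub>M M)"
  unfolding \<alpha>_def by (rule feedback_joint[OF b_measurable X_joint law_X_P2])

lemma s_joint: "(\<lambda>p. s (fst p) (snd p)) \<in> borel_measurable (borel \<Otimes>\<^sub>M M)"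
  unfolding s_def by (rule feedback_joint[OF affine_feedback_measurable X_joint law_X_P2])

lemma \<alpha>_adapted: "0 \<le> t \<Longrightarrow> \<alpha> t \<in> borel_measurable (F t)"
  unfolding \<alpha>_def[abs_def] by (rule measurable_compose[OF X_adapted feedback_section[OF b_measurable law_X_P2]])

lemma X_eq: "AE \<omega> in M. \<forall>t\<ge>0. set_integrable lborel {0..t} (\<lambda>s. \<alpha> s \<omega>) \<and>
        X t \<omega> = X0 \<omega> + (LINT s:{0..t}|lborel. \<alpha> s \<omega>) + W t \<omega>"
proof -
  have a: "AE \<omega> in M. \<forall>t\<ge>0. set_integrable lborel {0..t} (\<lambda>s. b (law M (state M F W X0 b s)) (state M F W X0 b s \<omega>)) \<and>
        state M F W X0 b t \<omega> = X0 \<omega> + (LINT s:{0..t}|lborel. b (law M (state M F W X0 b s)) (state M F W X0 b s \<omega>)) + W t \<omega>"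
    using solution by (simp add: sq_int_solution_def)
  have e: "indicator {0..t} s *\<^sub>R \<alpha> s \<omega> = indicator {0..t} s *\<^sub>R b (law M (state M F W X0 b s)) (state M F W X0 b s \<omega>)" for t s \<omega>
    by (auto simp: indicator_def \<alpha>_def X_state)
  show ?thesis
  proof (rule eventually_mono[OF a])
    fix \<omega>
    assume "\<forall>t\<ge>0. set_integrable lborel {0..t} (\<lambda>s. b (law M (state M F W X0 b s)) (state M F W X0 b s \<omega>)) \<and>
        state M F W X0 b t \<omega> = X0 \<omega> + (LINT s:{0..t}|lborel. b (law M (state M F W X0 b s)) (state M F W X0 b s \<omega>)) + W t \<omega>"
    then show "\<forall>t\<ge>0. set_integrable lborel {0..t} (\<lambda>s. \<alpha> s \<omega>) \<and>
        X t \<omega> = X0 \<omega> + (LINT s:{0..t}|lborel. \<alpha> s \<omega>) + W t \<omega>"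
      unfolding set_integrable_def set_lebesgue_integral_def e by (simp add: X_state)
  qed
qed

lemma s_component: "s t \<omega> $ k = - ((Q k *v X t \<omega>) $ k + (R k *v m t) $ k + q k $ k / 2) / r k"
  unfolding s_def star[symmetric] lq_feedback_component m_def mean_law[OF X_meas] ..

lemma \<alpha>_other: "\<alpha> t \<omega> $ j = s t \<omega> $ j"
  unfolding \<alpha>_def s_def agree[OF law_X_P2] star ..

lemma norm_players: "(norm x)\<^sup>2 = (x $ i)\<^sup>2 + (x $ j)\<^sup>2" for x :: "real^2"
  using inner_players[OF players(1), of x x] by (simp add: power2_norm_eq_inner power2_eq_square[of "_ $ _"])

definition running :: "real \<Rightarrow> 'a \<Rightarrow> real" where
  "running t \<omega> = (norm (X t \<omega>))\<^sup>2 + r i * (\<alpha> t \<omega> $ i)\<^sup>2 + (\<eta> i \<bullet> m t)\<^sup>2"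

lemma running_nonneg: "0 \<le> running t \<omega>" using players by (simp add: running_def)

lemma X_int: "integrable M (X t)" by (rule integrable_norm_of_square(2)[OF X_meas X_square])

lemma m_measurable: "m \<in> borel_measurable borel"
proof -
  have "(\<lambda>t. \<integral>\<omega>. X t \<omega> \<partial>M) \<in> borel_measurable borel"
    using borel_measurable_lebesgue_integral[of "\<lambda>t \<omega>. X t \<omega>" borel] X_joint by (simp add: split_beta')
  then show ?thesis by (simp add: m_def[abs_def])
qed

lemma running_joint: "(\<lambda>p. running (fst p) (snd p)) \<in> borel_measurable (borel \<Otimes>\<^sub>M M)"
proof -
  have "(\<lambda>p. m (fst p)) \<in> borel_measurable ((borel :: real measure) \<Otimes>\<^sub>M M)" by (rule measurable_compose[OF measurable_fst m_measurable])
  then show ?thesis unfolding running_def using X_joint \<alpha>_joint by measurable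
qed

lemma expected_cost_eq:
  assumes T: "0 \<le> T"
  shows "expected_cost M F W X0 r \<eta> i b T = enn2ereal (\<integral>\<^sup>+z. ennreal (running (fst z) (snd z)) \<partial>(time T \<Otimes>\<^sub>M M))"
proof -
  interpret tp: pair_sigma_finite "time T" M by (rule pair_time)
  have f: "(\<lambda>z. ennreal (running (fst z) (snd z))) \<in> borel_measurable (time T \<Otimes>\<^sub>M M)"
    using measurable_time[OF running_joint] by measurable
  have inner: "(\<integral>\<^sup>+t\<in>{0..T}. ennreal
         ((norm (state M F W X0 b t \<omega>))\<^sup>2
          + r i * (control_process M F W X0 b t \<omega> $ i)\<^sup>2
          + (\<integral>\<omega>'. \<eta> i \<bullet> state M F W X0 b t \<omega>' \<partial>M)\<^sup>2) \<partial>lborel)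
      = (\<integral>\<^sup>+t. ennreal (running t \<omega>) \<partial>time T)" for \<omega>
    unfolding nn_integral_restrict_space[of "{0..T}" lborel, simplified]
  proof (rule nn_integral_cong)
    fix t :: real
    show "ennreal
         ((norm (state M F W X0 b t \<omega>))\<^sup>2
          + r i * (control_process M F W X0 b t \<omega> $ i)\<^sup>2
          + (\<integral>\<omega>'. \<eta> i \<bullet> state M F W X0 b t \<omega>' \<partial>M)\<^sup>2) * indicator {0..T} t
       = ennreal (running t \<omega>) * indicator {0..T} t"
    proof (cases "t \<in> {0..T}")
      case True
      then have t: "0 \<le> t" by simp
      have "(\<integral>\<omega>'. \<eta> i \<bullet> X t \<omega>' \<partial>M) = \<eta> i \<bullet> m t" unfolding m_def using X_int by (rule integral_inner_right)
      then show ?thesis by (simp add: running_def control_process_def \<alpha>_def X_state[OF t])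
    qed simp
  qed
  have "(\<integral>\<^sup>+\<omega>. \<integral>\<^sup>+t. ennreal (running t \<omega>) \<partial>time T \<partial>M) = (\<integral>\<^sup>+z. ennreal (running (fst z) (snd z)) \<partial>(time T \<Otimes>\<^sub>M M))"
    using tp.nn_integral_snd[OF f] by simp
  then show ?thesis unfolding expected_cost_def inner by simp
qed

text \<open>
  Carries an infinite cost over to all later horizons.
\<close>

lemma expected_cost_mono:
  assumes "S \<le> T"
  shows "expected_cost M F W X0 r \<eta> i b S \<le> expected_cost M F W X0 r \<eta> i b T"
  unfolding expected_cost_def less_eq_ennreal.rep_eq[symmetric]
  by (intro nn_integral_mono mult_left_mono) (use assms in \<open>auto simp: indicator_def\<close>)

lemma norm_m_le: "(norm (m t))\<^sup>2 \<le> (\<integral>\<omega>. (norm (X t \<omega>))\<^sup>2 \<partial>M)"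
proof -
  have "0 \<le> (\<integral>\<omega>. (norm (X t \<omega> - m t))\<^sup>2 \<partial>M)" by simp
  also have "\<dots> = (\<integral>\<omega>. (norm (X t \<omega>))\<^sup>2 - 2 * (m t \<bullet> X t \<omega>) + (norm (m t))\<^sup>2 \<partial>M)"
    by (intro Bochner_Integration.integral_cong refl) (simp add: power2_norm_eq_inner inner_diff_left inner_diff_right inner_commute)
  also have "\<dots> = (\<integral>\<omega>. (norm (X t \<omega>))\<^sup>2 \<partial>M) - 2 * (m t \<bullet> m t) + (norm (m t))\<^sup>2"
    using X_square[of t] X_int[of t] by (simp add: m_def prob_space)
  finally show ?thesis by (simp add: power2_norm_eq_inner)
qed

lemma m_square_joint:
  assumes T: "0 \<le> T" and X: "integrable (time T \<Otimes>\<^sub>M M) (\<lambda>z. (norm (X (fst z) (snd z)))\<^sup>2)"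
  shows "integrable (time T \<Otimes>\<^sub>M M) (\<lambda>z. (norm (m (fst z)))\<^sup>2)"
proof (rule integrable_time_pairI[where f = "\<lambda>t _. (norm (m t))\<^sup>2"])
  have "(\<lambda>t. (norm (m t))\<^sup>2) \<in> borel_measurable borel" using m_measurable by measurable
  then show "(\<lambda>p. (norm (m (fst p)))\<^sup>2) \<in> borel_measurable (borel \<Otimes>\<^sub>M M)" by (rule measurable_compose[OF measurable_fst])
  have "set_integrable lborel {0..T} (\<lambda>t. \<integral>\<omega>. (norm (X t \<omega>))\<^sup>2 \<partial>M)"
    using expectation_set_integral(2)[where f = "\<lambda>t \<omega>. (norm (X t \<omega>))\<^sup>2", OF X] .
  then have i: "integrable (time T) (\<lambda>t. \<integral>\<omega>. (norm (X t \<omega>))\<^sup>2 \<partial>M)" by (simp only: integrable_time)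
  have "integrable (time T) (\<lambda>t. (norm (m t))\<^sup>2)"
  proof (rule Bochner_Integration.integrable_bound[OF i])
    show "(\<lambda>t. (norm (m t))\<^sup>2) \<in> borel_measurable (time T)"
      by (rule measurable_restrict_space1) (use m_measurable in measurable)
    show "AE t in time T. norm ((norm (m t))\<^sup>2) \<le> norm (\<integral>\<omega>. (norm (X t \<omega>))\<^sup>2 \<partial>M)"
      using norm_m_le by (intro AE_I2) simp
  qed
  then show "set_integrable lborel {0..T} (\<lambda>t. \<integral>\<omega>. (norm (m t))\<^sup>2 \<partial>M)" by (simp add: integrable_time prob_space)
qed simp_all

lemma s_eq: "s t \<omega> = A *v X t \<omega> + (B *v m t + d)"
  by (simp add: s_def affine_feedback_def m_def mean_law[OF X_meas] add.assoc)

lemma s_square_joint: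
  assumes T: "0 \<le> T" and X: "integrable (time T \<Otimes>\<^sub>M M) (\<lambda>z. (norm (X (fst z) (snd z)))\<^sup>2)"
  shows "integrable (time T \<Otimes>\<^sub>M M) (\<lambda>z. (norm (s (fst z) (snd z)))\<^sup>2)"
proof -
  note Xm = measurable_time[OF X_joint, of T]
  have mm: "(\<lambda>z. m (fst z)) \<in> borel_measurable (time T \<Otimes>\<^sub>M M)"
    by (rule measurable_time) (rule measurable_compose[OF measurable_fst m_measurable])
  have a: "integrable (time T \<Otimes>\<^sub>M M) (\<lambda>z. (norm (A *v X (fst z) (snd z)))\<^sup>2)" by (rule square_matrix_vector[OF Xm X])
  have bm: "integrable (time T \<Otimes>\<^sub>M M) (\<lambda>z. (norm (B *v m (fst z)))\<^sup>2)" by (rule square_matrix_vector[OF mm m_square_joint[OF T X]])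
  have dc: "integrable (time T \<Otimes>\<^sub>M M) (\<lambda>z. (norm d)\<^sup>2)"
    by (rule integrable_time_pairI[where f = "\<lambda>_ _. (norm d)\<^sup>2"]) (auto intro!: set_integrable_continuous_Icc continuous_intros)
  have mB: "(\<lambda>z. B *v m (fst z)) \<in> borel_measurable (time T \<Otimes>\<^sub>M M)" by (rule borel_measurable_matrix_vector[OF mm])
  have mA: "(\<lambda>z. A *v X (fst z) (snd z)) \<in> borel_measurable (time T \<Otimes>\<^sub>M M)" by (rule borel_measurable_matrix_vector[OF Xm])
  have "integrable (time T \<Otimes>\<^sub>M M) (\<lambda>z. (norm (B *v m (fst z) + d))\<^sup>2)"
    by (rule integrable_square_diff(2)[OF mB _ bm dc]) simp
  from integrable_square_diff(2)[OF mA borel_measurable_add[OF mB borel_measurable_const] a this]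
  show ?thesis by (simp only: s_eq)
qed

text \<open>
  The gap: how far, in mean square, the deviating player stays from the candidate feedback \<open>s\<close>.
\<close>

definition \<Delta> :: "real \<Rightarrow> real" where
  "\<Delta> t = (\<integral>\<omega>. (\<alpha> t \<omega> $ i - s t \<omega> $ i)\<^sup>2 \<partial>M)"

definition v :: "(real^2) measure \<Rightarrow> real" where "v = lq_value Q R q i"

end

text \<open>
  Deviations of finite cost. A finite cost makes state and control square integrable in time, which is what
  the evolution of moments asks for.
\<close>

locale finite_deviation = deviation +
  assumes finite_cost: "\<And>T. 0 \<le> T \<Longrightarrow> expected_cost M F W X0 r \<eta> i b T < \<infinity>"
begin

lemma running_integrable:
  assumes T: "0 \<le> T"
  shows "integrable (time T \<Otimes>\<^sub>M M) (\<lambda>z. running (fst z) (snd z))"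
proof (rule integrableI_bounded)
  show "(\<lambda>z. running (fst z) (snd z)) \<in> borel_measurable (time T \<Otimes>\<^sub>M M)" by (rule measurable_time[OF running_joint])
  have "enn2ereal (\<integral>\<^sup>+z. ennreal (running (fst z) (snd z)) \<partial>(time T \<Otimes>\<^sub>M M)) < enn2ereal \<infinity>"
    using finite_cost[OF T] unfolding expected_cost_eq[OF T] by simp
  then show "(\<integral>\<^sup>+z. ennreal (norm (running (fst z) (snd z))) \<partial>(time T \<Otimes>\<^sub>M M)) < \<infinity>"
    by (simp add: running_nonneg less_ennreal.rep_eq)
qed

lemma X_square_joint:
  assumes T: "0 \<le> T"
  shows "integrable (time T \<Otimes>\<^sub>M M) (\<lambda>z. (norm (X (fst z) (snd z)))\<^sup>2)"
proof (rule Bochner_Integration.integrable_bound[OF running_integrable[OF T]])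
  show "(\<lambda>z. (norm (X (fst z) (snd z)))\<^sup>2) \<in> borel_measurable (time T \<Otimes>\<^sub>M M)"
    using measurable_time[OF X_joint] by measurable
  show "AE z in time T \<Otimes>\<^sub>M M. norm ((norm (X (fst z) (snd z)))\<^sup>2) \<le> norm (running (fst z) (snd z))"
  proof (rule AE_I2)
    fix z
    have "0 \<le> r i * (\<alpha> (fst z) (snd z) $ i)\<^sup>2" using players by simp
    then show "norm ((norm (X (fst z) (snd z)))\<^sup>2) \<le> norm (running (fst z) (snd z))"
      using running_nonneg[of "fst z" "snd z"] by (simp add: running_def)
  qed
qed

lemma \<alpha>i_square_joint:
  assumes T: "0 \<le> T"
  shows "integrable (time T \<Otimes>\<^sub>M M) (\<lambda>z. (\<alpha> (fst z) (snd z) $ i)\<^sup>2)"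
proof (rule Bochner_Integration.integrable_bound[OF integrable_mult_right[OF running_integrable[OF T], of "1 / r i"]])
  show "(\<lambda>z. (\<alpha> (fst z) (snd z) $ i)\<^sup>2) \<in> borel_measurable (time T \<Otimes>\<^sub>M M)"
    using measurable_time[OF \<alpha>_joint] by measurable
  show "AE z in time T \<Otimes>\<^sub>M M. norm ((\<alpha> (fst z) (snd z) $ i)\<^sup>2) \<le> norm (1 / r i * running (fst z) (snd z))"
  proof (rule AE_I2)
    fix z
    have "r i * (\<alpha> (fst z) (snd z) $ i)\<^sup>2 \<le> running (fst z) (snd z)" by (simp add: running_def)
    then have "(\<alpha> (fst z) (snd z) $ i)\<^sup>2 \<le> 1 / r i * running (fst z) (snd z)" using players by (simp add: field_simps)
    then show "norm ((\<alpha> (fst z) (snd z) $ i)\<^sup>2) \<le> norm (1 / r i * running (fst z) (snd z))"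
      using players(2) by (simp add: running_nonneg abs_of_pos)
  qed
qed

lemma \<alpha>_square_joint:
  assumes T: "0 \<le> T"
  shows "integrable (time T \<Otimes>\<^sub>M M) (\<lambda>z. (norm (\<alpha> (fst z) (snd z)))\<^sup>2)"
  unfolding norm_players \<alpha>_other
  by (rule Bochner_Integration.integrable_add[OF \<alpha>i_square_joint[OF T]
      integrable_square_component[OF measurable_time[OF s_joint] s_square_joint[OF T X_square_joint[OF T]]]])

sublocale drift_process M F W X \<alpha> X0
  by unfold_locales (fact \<alpha>_joint X_joint X0F X_eq \<alpha>_adapted \<alpha>_square_joint X_square_joint | rule X_square X02)+

lemma gap_joint:
  assumes T: "0 \<le> T"
  shows "integrable (time T \<Otimes>\<^sub>M M) (\<lambda>z. (\<alpha> (fst z) (snd z) $ i - s (fst z) (snd z) $ i)\<^sup>2)"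
proof -
  have "integrable (time T \<Otimes>\<^sub>M M) (\<lambda>z. (norm (\<alpha> (fst z) (snd z) - s (fst z) (snd z)))\<^sup>2)"
    by (rule integrable_square_diff(1)[OF measurable_time[OF \<alpha>_joint] measurable_time[OF s_joint] \<alpha>_square_joint[OF T] s_square_joint[OF T X_square_joint[OF T]]])
  from integrable_square_component[OF _ this, of i] show ?thesis
    using measurable_time[OF \<alpha>_joint, of T] measurable_time[OF s_joint, of T] by simp
qed

lemma \<Delta>_integrable: "set_integrable lborel {0..T} \<Delta>"
proof (cases "0 \<le> T")
  case True
  show ?thesis unfolding \<Delta>_def[abs_def]
    using expectation_set_integral(2)[where f = "\<lambda>t \<omega>. (\<alpha> t \<omega> $ i - s t \<omega> $ i)\<^sup>2", OF gap_joint[OF True]] .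
qed (simp add: set_integrable_def)

lemma \<Delta>_nonneg: "0 \<le> \<Delta> t" by (simp add: \<Delta>_def)

text \<open>
  The verification identity, on which both equilibrium statements rest: integrate the completed square and
  replace the integral of the generator by the increment of the value function.
\<close>

lemma cost_identity:
  assumes T: "0 \<le> T"
  shows "expected_cost M F W X0 r \<eta> i b T = ereal (v (law M X0) - v (law M (X T)) + c * T + r i * (LINT t:{0..T}|lborel. \<Delta> t))"
proof -
  define g where "g t = (\<integral>\<omega>. \<alpha> t \<omega> \<bullet> (2 *\<^sub>R (Q i *v X t \<omega>) + 2 *\<^sub>R (R i *v (\<integral>\<omega>. X t \<omega> \<partial>M)) + q i) \<partial>M)" for t
  note V = value_evolution[where A = Q and B = R and b = q and k = i, OF T symQ symR, folded g_def]
  note fE = expectation_set_integral[where f = running, OF running_integrable[OF T]]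
  have "AE t in time T. (\<integral>\<omega>. running t \<omega> \<partial>M) = (c - trace (Q i)) + r i * \<Delta> t - g t"
    using AE_square_integrable[OF T] fE(4) expectation_set_integral(4)[where f = "\<lambda>t \<omega>. (\<alpha> t \<omega> $ i - s t \<omega> $ i)\<^sup>2", OF gap_joint[OF T]]
  proof eventually_elim
    case (elim t)
    obtain w where w: "\<And>x a s. (\<forall>k. s $ k = - ((Q k *v x) $ k + (R k *v m t) $ k + q k $ k / 2) / r k) \<Longrightarrow> a $ j = s $ j \<Longrightarrow>
      (norm x)\<^sup>2 + r i * (a $ i)\<^sup>2 + (\<eta> i \<bullet> m t)\<^sup>2 + a \<bullet> (2 *\<^sub>R (Q i *v x) + 2 *\<^sub>R (R i *v m t) + q i)
      = r i * (a $ i - s $ i)\<^sup>2 + (c - trace (Q i)) + w \<bullet> (x - m t)"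
      using completion_of_squares[OF ric, of "m t"] by blast
    let ?h = "\<lambda>\<omega>. \<alpha> t \<omega> \<bullet> (2 *\<^sub>R (Q i *v X t \<omega>) + 2 *\<^sub>R (R i *v m t) + q i)"
    have e: "?h \<omega> = (c - trace (Q i)) + r i * (\<alpha> t \<omega> $ i - s t \<omega> $ i)\<^sup>2 + w \<bullet> (X t \<omega> - m t) - running t \<omega>" for \<omega>
      using w[of "s t \<omega>" "X t \<omega>" "\<alpha> t \<omega>"] s_component \<alpha>_other unfolding running_def by simp
    have "g t = (\<integral>\<omega>. ?h \<omega> \<partial>M)" by (simp add: g_def m_def)
    also have "\<dots> = (\<integral>\<omega>. (c - trace (Q i)) + r i * (\<alpha> t \<omega> $ i - s t \<omega> $ i)\<^sup>2 + w \<bullet> (X t \<omega> - m t) - running t \<omega> \<partial>M)"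
      unfolding e ..
    also have "\<dots> = (c - trace (Q i)) + r i * \<Delta> t + w \<bullet> (expectation (X t) - m t) - (\<integral>\<omega>. running t \<omega> \<partial>M)"
      using elim(2,3) X_int[of t] by (simp add: \<Delta>_def prob_space)
    finally show ?case by (simp add: m_def)
  qed
  moreover have cI: "set_integrable lborel {0..T} (\<lambda>_. c - trace (Q i))"
    by (rule set_integrable_continuous_Icc) (intro continuous_intros)
  moreover have hI: "set_integrable lborel {0..T} (\<lambda>t. (c - trace (Q i)) + r i * \<Delta> t - g t)"
    by (intro set_integral_diff(1) set_integral_add(1) cI set_integrable_mult_right \<Delta>_integrable V(1))
  ultimately have "(LINT t:{0..T}|lborel. \<integral>\<omega>. running t \<omega> \<partial>M) = (LINT t:{0..T}|lborel. (c - trace (Q i)) + r i * \<Delta> t - g t)"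
    by (intro set_integral_cong_AE_time fE(2))
  also have "\<dots> = (LINT t:{0..T}|lborel. c - trace (Q i)) + r i * (LINT t:{0..T}|lborel. \<Delta> t) - (LINT t:{0..T}|lborel. g t)"
    by (simp only: set_integral_diff set_integral_add cI set_integrable_mult_right \<Delta>_integrable V(1) set_integral_mult_right)
  also have "(LINT t:{0..T}|lborel. c - trace (Q i)) = (c - trace (Q i)) * T"
    using T by (simp add: set_integral_const)
  finally have L: "(LINT t:{0..T}|lborel. \<integral>\<omega>. running t \<omega> \<partial>M)
      = v (law M X0) - v (law M (X T)) + c * T + r i * (LINT t:{0..T}|lborel. \<Delta> t)"
    using V(2) by (simp add: v_def algebra_simps)
  interpret tp: pair_sigma_finite "time T" M by (rule pair_time)
  have "(\<integral>\<^sup>+z. ennreal (running (fst z) (snd z)) \<partial>(time T \<Otimes>\<^sub>M M)) = ennreal (\<integral>z. running (fst z) (snd z) \<partial>(time T \<Otimes>\<^sub>M M))"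
    by (rule nn_integral_eq_integral[OF running_integrable[OF T]]) (simp add: running_nonneg)
  also have "(\<integral>z. running (fst z) (snd z) \<partial>(time T \<Otimes>\<^sub>M M)) = (LINT t:{0..T}|lborel. \<integral>\<omega>. running t \<omega> \<partial>M)"
    using tp.integral_fst'[OF running_integrable[OF T]] by (simp add: integral_time)
  finally have "expected_cost M F W X0 r \<eta> i b T = enn2ereal (ennreal (LINT t:{0..T}|lborel. \<integral>\<omega>. running t \<omega> \<partial>M))"
    unfolding expected_cost_eq[OF T] by simp
  also have "\<dots> = ereal (LINT t:{0..T}|lborel. \<integral>\<omega>. running t \<omega> \<partial>M)"
    unfolding set_lebesgue_integral_def
    by (rule enn2ereal_ennreal) (auto intro!: Bochner_Integration.integral_nonneg mult_nonneg_nonneg simp: running_nonneg)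
  finally show ?thesis unfolding L .
qed

end

section \<open>Long-time limits along a deviation\<close>

lemma integrable_square_bounded_linear:
  fixes f :: "'b::euclidean_space \<Rightarrow> real"
  assumes f: "bounded_linear f" and U: "U \<in> borel_measurable N" "integrable N (\<lambda>x. (norm (U x))\<^sup>2)"
  shows "integrable N (\<lambda>x. (f (U x))\<^sup>2)" and "(\<lambda>x. f (U x)) \<in> borel_measurable N"
proof -
  have "f \<in> borel_measurable borel" by (rule borel_measurable_continuous_onI) (rule linear_continuous_on[OF f])
  from measurable_compose[OF U(1) this] show m: "(\<lambda>x. f (U x)) \<in> borel_measurable N" .
  obtain K where K: "\<And>x. norm (f x) \<le> norm x * K" using bounded_linear.bounded[OF f] by blast
  show "integrable N (\<lambda>x. (f (U x))\<^sup>2)"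
  proof (rule Bochner_Integration.integrable_bound[OF integrable_mult_right[OF U(2), of "K\<^sup>2"]])
    show "(\<lambda>x. (f (U x))\<^sup>2) \<in> borel_measurable N" using m by measurable
    have "(f (U x))\<^sup>2 \<le> K\<^sup>2 * (norm (U x))\<^sup>2" for x
      using power_mono[OF K[of "U x"], of 2] by (simp add: power_mult_distrib mult.commute)
    then show "AE x in N. norm ((f (U x))\<^sup>2) \<le> norm (K\<^sup>2 * (norm (U x))\<^sup>2)" by (intro AE_I2) simp
  qed
qed

lemma W2_converges_cong:
  assumes "\<And>t. 0 \<le> t \<Longrightarrow> \<mu> t = \<mu>' t" "W2_converges \<mu> \<nu>"
  shows "W2_converges \<mu>' \<nu>"
proof -
  have ev: "\<forall>\<^sub>F t in at_top. \<mu> t = \<mu>' t" using eventually_ge_at_top[of 0] by eventually_elim (rule assms(1))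
  have c: "\<nu> \<in> P2" "\<forall>\<^sub>F t in at_top. \<mu> t \<in> P2" "((\<lambda>t. W2 (\<mu> t) \<nu>) \<longlongrightarrow> 0) at_top"
    using assms(2) by (auto simp: W2_converges_def)
  have "\<forall>\<^sub>F t in at_top. \<mu>' t \<in> P2" using ev c(2) by eventually_elim simp
  moreover have "\<forall>\<^sub>F t in at_top. W2 (\<mu> t) \<nu> = W2 (\<mu>' t) \<nu>" using ev by eventually_elim simp
  then have "((\<lambda>t. W2 (\<mu>' t) \<nu>) \<longlongrightarrow> 0) at_top" using c(3) by (rule Lim_transform_eventually[rotated])
  ultimately show ?thesis using c(1) by (simp add: W2_converges_def)
qed

text \<open>
  The closed form, for matrices of the plane, of the solution \<open>S\<close> of \<open>A\<^sup>T S + S A = Q\<close>.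
\<close>

definition lyapunov_solution :: "real^2^2 \<Rightarrow> real^2^2 \<Rightarrow> real^2^2" where
  "lyapunov_solution A Q = (1 / (2 * trace A * det A)) *\<^sub>R
     (det A *\<^sub>R Q + transpose (A - trace A *\<^sub>R mat 1) ** Q ** (A - trace A *\<^sub>R mat 1))"

lemma matrix_plane:
  fixes A B :: "real^2^2"
  shows "(A ** B) $ a $ b = A $ a $ 1 * B $ 1 $ b + A $ a $ 2 * B $ 2 $ b"
    and "transpose A $ a $ b = A $ b $ a" and "trace A = A $ 1 $ 1 + A $ 2 $ 2" and "(mat 1 :: real^2^2) $ a $ b = (if a = b then 1 else 0)"
    and "det A = A $ 1 $ 1 * A $ 2 $ 2 - A $ 1 $ 2 * A $ 2 $ 1"
  by (simp_all add: matrix_matrix_mult_def sum_2 transpose_def trace_def mat_def det_2)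

lemma plane_matrix_vector: "(A *v x) $ a = A $ a $ 1 * x $ 1 + A $ a $ 2 * x $ 2" for A :: "real^2^2"
  by (simp add: matrix_vector_mult_def sum_2)

text \<open>
  Dissipativity makes the trace negative and the determinant nonzero, so the closed form is defined; the
  identity itself is a computation with entries.
\<close>

lemma lyapunov_solution:
  fixes A Q :: "real^2^2"
  assumes diss: "\<And>x. x \<bullet> (A *v x) \<le> - l * (norm x)\<^sup>2" and l: "0 < l" and Q: "transpose Q = Q"
  shows "transpose (lyapunov_solution A Q) = lyapunov_solution A Q"
    and "(A *v x) \<bullet> (2 *\<^sub>R (lyapunov_solution A Q *v x)) = x \<bullet> (Q *v x)"
proof -
  have q: "Q $ 2 $ 1 = Q $ 1 $ 2" using Q by (metis matrix_plane(2))
  have tr: "trace A < 0"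
    using diss[of "axis 1 1"] diss[of "axis 2 1"] l by (simp add: inner_matrix_plane axis_def norm_axis_1[unfolded axis_def] matrix_plane(3))
  have "x = 0" if "A *v x = 0" for x using diss[of x] l that by (auto simp: mult_le_0_iff)
  then have "inj ((*v) A)" by (simp add: linear_injective_0[OF matrix_vector_mul_linear])
  then have dt: "det A \<noteq> 0" using invertible_det_nz[of A] matrix_left_invertible_injective[of A] invertible_left_inverse[of A] by blast
  define N where "N = det A *\<^sub>R Q + transpose (A - trace A *\<^sub>R mat 1) ** Q ** (A - trace A *\<^sub>R mat 1)"
  have S: "lyapunov_solution A Q = (1 / (2 * trace A * det A)) *\<^sub>R N" by (simp add: lyapunov_solution_def N_def)
  have N: "N $ 1 $ 1 = det A * Q$1$1 + A$2$2 * A$2$2 * Q$1$1 - 2 * A$2$2 * A$2$1 * Q$1$2 + A$2$1 * A$2$1 * Q$2$2"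
    "N $ 1 $ 2 = det A * Q$1$2 - A$1$2 * (- A$2$2 * Q$1$1 + A$2$1 * Q$1$2) * (-1) * (-1) - A$1$1 * (- A$2$2 * Q$1$2 + A$2$1 * Q$2$2) + 2 * A$1$2 * (- A$2$2 * Q$1$1 + A$2$1 * Q$1$2)"
    "N $ 2 $ 1 = N $ 1 $ 2"
    "N $ 2 $ 2 = det A * Q$2$2 + A$1$2 * A$1$2 * Q$1$1 - 2 * A$1$1 * A$1$2 * Q$1$2 + A$1$1 * A$1$1 * Q$2$2"
    unfolding N_def by (simp_all add: matrix_plane(1-4) q) (simp_all add: algebra_simps)
  have "transpose N = N" by (simp add: vec_eq_iff forall_2 matrix_plane(2) N(3))
  then show "transpose (lyapunov_solution A Q) = lyapunov_solution A Q" unfolding S by (simp add: vec_eq_iff matrix_plane(2))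
  have "(A *v x) \<bullet> (N *v x) = trace A * det A * (x \<bullet> (Q *v x))"
    unfolding inner_plane plane_matrix_vector N q unfolding matrix_plane(3,5) by (simp add: algebra_simps power2_eq_square)
  then show "(A *v x) \<bullet> (2 *\<^sub>R (lyapunov_solution A Q *v x)) = x \<bullet> (Q *v x)"
    unfolding S using tr dt by (simp add: scaleR_matrix_vector_assoc[symmetric])
qed

text \<open>
  The value of \<open>lq_value\<close> at every law of mean \<open>p\<close> under which the affine drift balances the noise: the first
  two terms are the integral of \<open>x \<bullet> (Q i *v x)\<close>, computed from the Lyapunov equation.
\<close>

definition stationary_lq_value ::
  "real^2^2 \<Rightarrow> real^2^2 \<Rightarrow> real^2 \<Rightarrow> real^2 \<Rightarrow> (2 \<Rightarrow> real^2^2) \<Rightarrow> (2 \<Rightarrow> real^2^2) \<Rightarrow> (2 \<Rightarrow> real^2) \<Rightarrow> 2 \<Rightarrow> real" where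
  "stationary_lq_value A B d p Q R q i =
     - trace (lyapunov_solution A (Q i)) - (B *v p + d) \<bullet> (2 *\<^sub>R (lyapunov_solution A (Q i) *v p))
     + q i \<bullet> p + p \<bullet> (R i *v p)"

text \<open>
  The measure \<open>\<nu>\<close> is the limiting joint law of state and control that admissibility provides.
\<close>

locale convergent_deviation = finite_deviation +
  fixes \<nu>
  assumes conv: "W2_converges (\<lambda>t. law M (\<lambda>\<omega>. (X t \<omega>, \<alpha> t \<omega>))) \<nu>"
begin

lemma pair_measurable: "(\<lambda>\<omega>. (X t \<omega>, \<alpha> t \<omega>)) \<in> borel_measurable M"
  by (rule borel_measurable_Pair[OF X_measurable \<alpha>_measurable])

lemma \<nu>: "prob_space \<nu>" "sets \<nu> = sets borel" "integrable \<nu> (\<lambda>z. (norm z)\<^sup>2)" "(\<lambda>z. z) \<in> borel_measurable \<nu>"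
  using P2_D[of \<nu>] conv by (auto simp: W2_converges_def)

lemma eventually_pair_square: "\<forall>\<^sub>F t in at_top. integrable M (\<lambda>\<omega>. (norm (X t \<omega>, \<alpha> t \<omega>))\<^sup>2)"
proof -
  have "\<forall>\<^sub>F t in at_top. law M (\<lambda>\<omega>. (X t \<omega>, \<alpha> t \<omega>)) \<in> P2" using conv by (simp add: W2_converges_def)
  then show ?thesis
  proof eventually_elim
    case (elim t)
    have "integrable (law M (\<lambda>\<omega>. (X t \<omega>, \<alpha> t \<omega>))) (\<lambda>z. (norm z)\<^sup>2)" using elim by (simp add: P2_def)
    moreover have "(\<lambda>z :: (real^2) \<times> (real^2). (norm z)\<^sup>2) \<in> borel_measurable borel"
      by (intro borel_measurable_power borel_measurable_norm measurable_ident_sets[OF refl])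
    ultimately show ?case by (simp only: integrable_distr_eq[OF pair_measurable])
  qed
qed

lemma moment_limit:
  fixes f g :: "(real^2) \<times> (real^2) \<Rightarrow> real"
  assumes f: "bounded_linear f" and g: "bounded_linear g"
  shows "((\<lambda>t. \<integral>\<omega>. (f (X t \<omega>, \<alpha> t \<omega>) + a) * (g (X t \<omega>, \<alpha> t \<omega>) + a') \<partial>M) \<longlongrightarrow> (\<integral>z. (f z + a) * (g z + a') \<partial>\<nu>)) at_top"
proof -
  obtain K where K: "quadratic_variation_bound K (\<lambda>z. (f z + a) * (g z + a'))"
    using quadratic_variation_bound_product[OF f g] by blast
  have q: "(\<lambda>z. (f z + a) * (g z + a')) \<in> borel_measurable borel" using K by (simp add: quadratic_variation_bound_def)
  from W2_converges_quadratic[OF conv K] show ?thesis by (simp only: integral_distr[OF pair_measurable q])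
qed

lemma linear_limit:
  fixes f :: "(real^2) \<times> (real^2) \<Rightarrow> real"
  assumes f: "bounded_linear f"
  shows "((\<lambda>t. \<integral>\<omega>. f (X t \<omega>, \<alpha> t \<omega>) \<partial>M) \<longlongrightarrow> (\<integral>z. f z \<partial>\<nu>)) at_top"
  using moment_limit[OF f bounded_linear_zero, of 0 1] by simp

lemma product_limit:
  fixes f g :: "(real^2) \<times> (real^2) \<Rightarrow> real"
  assumes f: "bounded_linear f" and g: "bounded_linear g"
  shows "((\<lambda>t. \<integral>\<omega>. f (X t \<omega>, \<alpha> t \<omega>) * g (X t \<omega>, \<alpha> t \<omega>) \<partial>M) \<longlongrightarrow> (\<integral>z. f z * g z \<partial>\<nu>)) at_top"
  using moment_limit[OF f g, of 0 0] by simp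

lemma bounded_linear_nth: "bounded_linear f \<Longrightarrow> bounded_linear (\<lambda>z. f z $ k)" for f :: "'b::real_normed_vector \<Rightarrow> real^2"
  by (rule bounded_linear_compose[OF bounded_linear_vec_nth])

lemma inner_limit:
  fixes f g :: "(real^2) \<times> (real^2) \<Rightarrow> real^2"
  assumes f: "bounded_linear f" and g: "bounded_linear g"
  shows "((\<lambda>t. \<integral>\<omega>. f (X t \<omega>, \<alpha> t \<omega>) \<bullet> g (X t \<omega>, \<alpha> t \<omega>) \<partial>M) \<longlongrightarrow> (\<integral>z. f z \<bullet> g z \<partial>\<nu>)) at_top"
proof -
  note fk = bounded_linear_nth[OF f] and gk = bounded_linear_nth[OF g]
  have i: "integrable N (\<lambda>x. f (U x) $ k * g (U x) $ k)" if "U \<in> borel_measurable N" "integrable N (\<lambda>x. (norm (U x))\<^sup>2)" for N and U :: "'c \<Rightarrow> _" and k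
    by (rule integral_Cauchy_Schwarz(1)[OF integrable_square_bounded_linear(2)[OF fk[of k] that] integrable_square_bounded_linear(2)[OF gk[of k] that]
        integrable_square_bounded_linear(1)[OF fk[of k] that] integrable_square_bounded_linear(1)[OF gk[of k] that]])
  have e: "(\<integral>x. f (U x) \<bullet> g (U x) \<partial>N) = (\<integral>x. f (U x) $ 1 * g (U x) $ 1 \<partial>N) + (\<integral>x. f (U x) $ 2 * g (U x) $ 2 \<partial>N)"
    if "U \<in> borel_measurable N" "integrable N (\<lambda>x. (norm (U x))\<^sup>2)" for N and U :: "'c \<Rightarrow> _"
    unfolding inner_plane by (rule Bochner_Integration.integral_add) (rule i[OF that])+
  have "\<forall>\<^sub>F t in at_top. (\<integral>\<omega>. f (X t \<omega>, \<alpha> t \<omega>) $ 1 * g (X t \<omega>, \<alpha> t \<omega>) $ 1 \<partial>M) + (\<integral>\<omega>. f (X t \<omega>, \<alpha> t \<omega>) $ 2 * g (X t \<omega>, \<alpha> t \<omega>) $ 2 \<partial>M)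
      = (\<integral>\<omega>. f (X t \<omega>, \<alpha> t \<omega>) \<bullet> g (X t \<omega>, \<alpha> t \<omega>) \<partial>M)"
    using eventually_pair_square by eventually_elim (rule e[OF pair_measurable, symmetric])
  from Lim_transform_eventually[OF tendsto_add[OF product_limit[OF fk gk] product_limit[OF fk gk]] this]
  show ?thesis unfolding e[OF \<nu>(4,3)] .
qed

lemmas linear_pair = bounded_linear_fst bounded_linear_snd
  bounded_linear_compose[OF matrix_vector_mul_bounded_linear bounded_linear_fst]
  bounded_linear_compose[OF matrix_vector_mul_bounded_linear bounded_linear_snd]

lemma value_limit:
  "((\<lambda>t. v (law M (X t))) \<longlongrightarrow> (\<integral>z. fst z \<bullet> (Q i *v fst z) \<partial>\<nu>) + q i \<bullet> (\<chi> k. \<integral>z. fst z $ k \<partial>\<nu>)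
      + (\<chi> k. \<integral>z. fst z $ k \<partial>\<nu>) \<bullet> (R i *v (\<chi> k. \<integral>z. fst z $ k \<partial>\<nu>))) at_top"
  and mean_limit: "(m \<longlongrightarrow> (\<chi> k. \<integral>z. fst z $ k \<partial>\<nu>)) at_top"
proof -
  have mk: "m t $ k = (\<integral>\<omega>. X t \<omega> $ k \<partial>M)" for t k
    unfolding m_def by (rule integral_bounded_linear[OF bounded_linear_vec_nth X_int, symmetric])
  show ml: "(m \<longlongrightarrow> (\<chi> k. \<integral>z. fst z $ k \<partial>\<nu>)) at_top"
    by (rule vec_tendstoI) (use linear_limit[OF bounded_linear_nth[OF bounded_linear_fst]] in \<open>simp add: mk\<close>)
  have lq: "v (law M (X t)) = (\<integral>\<omega>. X t \<omega> \<bullet> (Q i *v X t \<omega>) \<partial>M) + q i \<bullet> m t + m t \<bullet> (R i *v m t)" for t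
  proof -
    have "(\<lambda>x. x \<bullet> (Q i *v x)) \<in> borel_measurable borel"
      by (intro borel_measurable_inner borel_measurable_matrix_vector measurable_ident_sets[OF refl])
    then show ?thesis by (simp add: v_def lq_value_def mean_law[OF X_meas] m_def integral_distr[OF X_meas])
  qed
  show "((\<lambda>t. v (law M (X t))) \<longlongrightarrow> (\<integral>z. fst z \<bullet> (Q i *v fst z) \<partial>\<nu>) + q i \<bullet> (\<chi> k. \<integral>z. fst z $ k \<partial>\<nu>)
      + (\<chi> k. \<integral>z. fst z $ k \<partial>\<nu>) \<bullet> (R i *v (\<chi> k. \<integral>z. fst z $ k \<partial>\<nu>))) at_top"
    unfolding lq using inner_limit[OF linear_pair(1,3), of "Q i"]
    by (intro tendsto_add tendsto_inner tendsto_const ml bounded_linear.tendsto[OF matrix_vector_mul_bounded_linear]) simp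
qed

definition minf :: "real^2" where "minf = (\<chi> k. \<integral>z. fst z $ k \<partial>\<nu>)"

text \<open>
  Under the limit law \<open>\<nu>\<close>, the mean squared distance of player \<open>k\<close>'s control from the affine feedback.
\<close>

definition gap_limit :: "2 \<Rightarrow> real" where
  "gap_limit k = (\<integral>z. (snd z $ k - (A *v fst z) $ k - (B *v minf + d) $ k)\<^sup>2 \<partial>\<nu>)"

text \<open>
  The gap is a quadratic function of state and control whose coefficients depend on the mean, and all of
  these converge.
\<close>

lemma gap_converges: "((\<lambda>t. \<integral>\<omega>. (\<alpha> t \<omega> $ k - s t \<omega> $ k)\<^sup>2 \<partial>M) \<longlongrightarrow> gap_limit k) at_top"
proof -
  define h where "h z = (snd z - A *v fst z) $ k" for z :: "(real^2) \<times> (real^2)"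
  define u where "u t = (B *v m t + d) $ k" for t
  define u' where "u' = (B *v minf + d) $ k"
  have h: "bounded_linear h" unfolding h_def[abs_def]
    by (intro bounded_linear_nth bounded_linear_sub linear_pair)
  have u: "(u \<longlongrightarrow> u') at_top" unfolding u_def[abs_def] u'_def
    by (intro tendsto_vec_nth tendsto_add tendsto_const bounded_linear.tendsto[OF matrix_vector_mul_bounded_linear] mean_limit[folded minf_def])
  have expand: "(\<integral>x. (h (U x) - a)\<^sup>2 \<partial>N) = (\<integral>x. h (U x) * h (U x) \<partial>N) - 2 * a * (\<integral>x. h (U x) \<partial>N) + a\<^sup>2"
    if N: "prob_space N" and U: "U \<in> borel_measurable N" "integrable N (\<lambda>x. (norm (U x))\<^sup>2)" for N and U :: "'c \<Rightarrow> _" and a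
  proof -
    interpret N: prob_space N by (rule N)
    note sq = integrable_square_bounded_linear[OF h U]
    have i: "integrable N (\<lambda>x. h (U x) * h (U x))" using sq(1) by (simp add: power2_eq_square)
    have j: "integrable N (\<lambda>x. h (U x))" using N.integrable_norm_of_square(2)[OF sq(2)] sq(1) by simp
    have "(h (U x) - a)\<^sup>2 = h (U x) * h (U x) - 2 * a * h (U x) + a\<^sup>2" for x by (simp add: power2_eq_square algebra_simps)
    then show ?thesis using i j by (simp add: N.prob_space)
  qed
  have "\<forall>\<^sub>F t in at_top. (\<integral>\<omega>. h (X t \<omega>, \<alpha> t \<omega>) * h (X t \<omega>, \<alpha> t \<omega>) \<partial>M) - 2 * u t * (\<integral>\<omega>. h (X t \<omega>, \<alpha> t \<omega>) \<partial>M) + (u t)\<^sup>2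
      = (\<integral>\<omega>. (\<alpha> t \<omega> $ k - s t \<omega> $ k)\<^sup>2 \<partial>M)"
    using eventually_pair_square
  proof eventually_elim
    case (elim t)
    have "\<alpha> t \<omega> $ k - s t \<omega> $ k = h (X t \<omega>, \<alpha> t \<omega>) - u t" for \<omega> by (simp add: s_eq h_def u_def)
    then show ?case using expand[OF prob_space_axioms pair_measurable elim, of "u t"] by simp
  qed
  moreover have "((\<lambda>t. (\<integral>\<omega>. h (X t \<omega>, \<alpha> t \<omega>) * h (X t \<omega>, \<alpha> t \<omega>) \<partial>M) - 2 * u t * (\<integral>\<omega>. h (X t \<omega>, \<alpha> t \<omega>) \<partial>M) + (u t)\<^sup>2)
      \<longlongrightarrow> (\<integral>z. h z * h z \<partial>\<nu>) - 2 * u' * (\<integral>z. h z \<partial>\<nu>) + u'\<^sup>2) at_top"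
    by (intro tendsto_add tendsto_diff tendsto_mult tendsto_power tendsto_const product_limit[OF h h] linear_limit[OF h] u)
  ultimately have "((\<lambda>t. \<integral>\<omega>. (\<alpha> t \<omega> $ k - s t \<omega> $ k)\<^sup>2 \<partial>M) \<longlongrightarrow> (\<integral>z. h z * h z \<partial>\<nu>) - 2 * u' * (\<integral>z. h z \<partial>\<nu>) + u'\<^sup>2) at_top"
    by (rule Lim_transform_eventually[rotated])
  then show ?thesis using expand[OF \<nu>(1,4,3), of u'] by (simp add: gap_limit_def h_def u'_def)
qed

lemma \<Delta>_limit: "(\<Delta> \<longlongrightarrow> gap_limit i) at_top"
  using gap_converges[of i] by (simp add: \<Delta>_def[abs_def])

lemma gap_limit_other: "gap_limit j = 0"
proof -
  have "((\<lambda>t::real. 0) \<longlongrightarrow> gap_limit j) at_top" using gap_converges[of j] by (simp add: \<alpha>_other)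
  from tendsto_unique[OF trivial_limit_at_top_linorder this tendsto_const] show ?thesis .
qed

text \<open>
  The mean converges, so the time average of its derivative tends to \<open>0\<close>.
\<close>

lemma limit_drift_vanishes: "(\<integral>z. snd z $ k \<partial>\<nu>) = 0"
proof -
  have g: "set_integrable lborel {0..T} (\<lambda>t. \<integral>\<omega>. \<alpha> t \<omega> $ k \<partial>M)" for T
    using mean_evolution(1)[of T k] by (cases "0 \<le> T") (auto simp: set_integrable_def)
  have X: "((\<lambda>T. \<integral>\<omega>. X T \<omega> $ k \<partial>M) \<longlongrightarrow> (\<integral>z. fst z $ k \<partial>\<nu>)) at_top"
    using linear_limit[OF bounded_linear_nth[OF bounded_linear_fst], of k] by simp
  have "((\<lambda>T. (LINT t:{0..T}|lborel. \<integral>\<omega>. \<alpha> t \<omega> $ k \<partial>M) / T) \<longlongrightarrow> (\<integral>z. snd z $ k \<partial>\<nu>)) at_top"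
    by (rule cesaro_integral[OF g]) (use linear_limit[OF bounded_linear_nth[OF bounded_linear_snd], of k] in simp)
  moreover have "((\<lambda>T. (LINT t:{0..T}|lborel. \<integral>\<omega>. \<alpha> t \<omega> $ k \<partial>M) / T) \<longlongrightarrow> 0) at_top"
  proof (rule Lim_transform_eventually)
    show "((\<lambda>T. ((\<integral>\<omega>. X T \<omega> $ k \<partial>M) - (\<integral>\<omega>. X0 \<omega> $ k \<partial>M)) / T) \<longlongrightarrow> 0) at_top"
      by (rule tendsto_divide_0[OF tendsto_diff[OF X tendsto_const]]) (rule filterlim_at_top_imp_at_infinity[OF filterlim_ident])
    show "\<forall>\<^sub>F T in at_top. ((\<integral>\<omega>. X T \<omega> $ k \<partial>M) - (\<integral>\<omega>. X0 \<omega> $ k \<partial>M)) / T = (LINT t:{0..T}|lborel. \<integral>\<omega>. \<alpha> t \<omega> $ k \<partial>M) / T"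
      using eventually_ge_at_top[of 0] by eventually_elim (simp add: mean_evolution(2))
  qed
  ultimately show ?thesis by (rule tendsto_unique[rotated]) simp
qed

text \<open>
  The second moment \<open>E[X \<bullet> S X]\<close> converges, so the time average of its derivative tends to \<open>0\<close>; the derivative
  consists of the drift term and the trace of \<open>S\<close>.
\<close>

lemma limit_energy_balance:
  assumes S: "transpose S = S"
  shows "(\<integral>z. snd z \<bullet> (2 *\<^sub>R (S *v fst z)) \<partial>\<nu>) = - trace S"
proof -
  define g where "g t = (\<integral>\<omega>. \<alpha> t \<omega> \<bullet> (2 *\<^sub>R (S *v X t \<omega>)) \<partial>M)" for t
  have Z: "transpose (0 :: real^2^2) = 0" by (simp add: vec_eq_iff transpose_def)
  note V = value_evolution[where A = "\<lambda>_. S" and B = "\<lambda>_. 0" and b = "\<lambda>_. 0" and k = i, OF _ S Z]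
  have g: "set_integrable lborel {0..T} g" for T
    using V(1)[of T] by (cases "0 \<le> T") (auto simp: set_integrable_def g_def[abs_def])
  have L: "lq_value (\<lambda>_. S) (\<lambda>_. 0) (\<lambda>_. 0) i (law M (X t)) = (\<integral>\<omega>. X t \<omega> \<bullet> (S *v X t \<omega>) \<partial>M)" for t
  proof -
    have "(\<lambda>x. x \<bullet> (S *v x)) \<in> borel_measurable borel"
      by (intro borel_measurable_inner borel_measurable_matrix_vector measurable_ident_sets[OF refl])
    then show ?thesis by (simp add: lq_value_def integral_distr[OF X_meas])
  qed
  define w0 where "w0 = lq_value (\<lambda>_. S) (\<lambda>_. 0) (\<lambda>_. 0) i (law M X0)"
  have X: "((\<lambda>T. \<integral>\<omega>. X T \<omega> \<bullet> (S *v X T \<omega>) \<partial>M) \<longlongrightarrow> (\<integral>z. fst z \<bullet> (S *v fst z) \<partial>\<nu>)) at_top"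
    using inner_limit[OF linear_pair(1,3), of S] by simp
  have "((\<lambda>T. (LINT t:{0..T}|lborel. g t) / T) \<longlongrightarrow> (\<integral>z. snd z \<bullet> (2 *\<^sub>R (S *v fst z)) \<partial>\<nu>)) at_top"
    by (rule cesaro_integral[OF g])
      (use inner_limit[OF linear_pair(2) bounded_linear_const_scaleR[OF linear_pair(3)], of 2 S] in \<open>simp add: g_def[abs_def]\<close>)
  moreover have "((\<lambda>T. (LINT t:{0..T}|lborel. g t) / T) \<longlongrightarrow> 0 - trace S) at_top"
  proof (rule Lim_transform_eventually)
    show "((\<lambda>T. ((\<integral>\<omega>. X T \<omega> \<bullet> (S *v X T \<omega>) \<partial>M) - w0) / T - trace S) \<longlongrightarrow> 0 - trace S) at_top"
      by (rule tendsto_diff[OF tendsto_divide_0[OF tendsto_diff[OF X tendsto_const]] tendsto_const])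
        (rule filterlim_at_top_imp_at_infinity[OF filterlim_ident])
    show "\<forall>\<^sub>F T in at_top. ((\<integral>\<omega>. X T \<omega> \<bullet> (S *v X T \<omega>) \<partial>M) - w0) / T - trace S = (LINT t:{0..T}|lborel. g t) / T"
      using eventually_gt_at_top[of 0]
    proof eventually_elim
      case (elim T)
      have "(\<integral>\<omega>. X T \<omega> \<bullet> (S *v X T \<omega>) \<partial>M) = w0 + (LINT t:{0..T}|lborel. g t) + T * trace S"
        using V(2)[of T] elim by (simp add: L w0_def g_def)
      then show ?case using elim by (simp add: field_simps)
    qed
  qed
  ultimately show ?thesis using tendsto_unique[of "at_top :: real filter"] by simp
qed

abbreviation vinf :: real where
  "vinf \<equiv> stationary_lq_value A B d p Q R q i"

text \<open>
  If the gap vanishes in the limit, then under the limit law the control is almost surely the affine function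
  of the state. The mean balance then identifies the mean as \<open>p\<close>. The energy balance, with \<open>S\<close> solving the
  Lyapunov equation for \<open>Q i\<close>, identifies the quadratic moment. So the limit of the value does not
  depend on the deviation.
\<close>

lemma optimal_limit:
  assumes 0: "gap_limit i = 0"
  shows "minf = p" and "((\<lambda>t. v (law M (X t))) \<longlongrightarrow> vinf) at_top"
proof -
  interpret N: prob_space \<nu> by (rule \<nu>(1))
  define S where "S = lyapunov_solution A (Q i)"
  note S = lyapunov_solution[OF diss l symQ, folded S_def]
  let ?u = "B *v minf + d"
  have sq: "integrable \<nu> (\<lambda>z. (f z)\<^sup>2)" "f \<in> borel_measurable \<nu>" "integrable \<nu> f" if "bounded_linear f" for f :: "_ \<Rightarrow> real"
  proof -
    note a = integrable_square_bounded_linear[OF that \<nu>(4,3)]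
    show f: "integrable \<nu> (\<lambda>z. (f z)\<^sup>2)" "f \<in> borel_measurable \<nu>" by (fact a)+
    from f(1) have "integrable \<nu> (\<lambda>z. (norm (f z))\<^sup>2)" by (simp only: real_norm_def power2_abs)
    then show "integrable \<nu> f" by (rule N.integrable_norm_of_square(2)[OF f(2)])
  qed
  \<comment> \<open>Both gaps vanish: that of \<open>i\<close> by assumption, that of \<open>j\<close> because \<open>j\<close> plays the candidate.\<close>
  have ae: "AE z in \<nu>. snd z $ k = (A *v fst z + ?u) $ k" for k
  proof -
    have "k = i \<or> k = j" using exhaust_2[of k] exhaust_2[of i] exhaust_2[of j] players(1) by auto
    then have "gap_limit k = 0" using 0 gap_limit_other by auto
    define h where "h z = (snd z - A *v fst z) $ k" for z :: "(real^2) \<times> (real^2)"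
    have h: "bounded_linear h" unfolding h_def[abs_def]
      by (intro bounded_linear_nth bounded_linear_sub linear_pair)
    have "integrable \<nu> (\<lambda>z. (h z)\<^sup>2 + (?u $ k)\<^sup>2 - 2 * h z * ?u $ k)"
      by (intro Bochner_Integration.integrable_diff Bochner_Integration.integrable_add integrable_mult_left integrable_mult_right sq[OF h]) simp
    then have "integrable \<nu> (\<lambda>z. (h z - ?u $ k)\<^sup>2)" by (simp only: power2_diff)
    moreover have "(\<integral>z. (h z - ?u $ k)\<^sup>2 \<partial>\<nu>) = 0" using \<open>gap_limit k = 0\<close> by (simp add: gap_limit_def h_def)
    ultimately have "AE z in \<nu>. (h z - ?u $ k)\<^sup>2 = 0"
      by (subst (asm) integral_nonneg_eq_0_iff_AE) simp_all
    then show ?thesis by eventually_elim (simp add: h_def)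
  qed
  have ae2: "AE z in \<nu>. snd z = A *v fst z + ?u" using ae[of 1] ae[of 2] by eventually_elim (simp add: vec_eq_iff forall_2)
  note i1 = sq(3)[OF bounded_linear_nth[OF bounded_linear_fst]]
  have m1: "minf $ k = (\<integral>z. fst z $ k \<partial>\<nu>)" for k by (simp add: minf_def)
  have drift: "((A + B) *v minf + d) $ k = 0" for k
  proof -
    have "0 = (\<integral>z. snd z $ k \<partial>\<nu>)" by (simp add: limit_drift_vanishes)
    also have "\<dots> = (\<integral>z. A $ k $ 1 * fst z $ 1 + A $ k $ 2 * fst z $ 2 + ?u $ k \<partial>\<nu>)"
    proof (rule integral_cong_AE)
      show "AE z in \<nu>. snd z $ k = A $ k $ 1 * fst z $ 1 + A $ k $ 2 * fst z $ 2 + ?u $ k"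
        using ae[of k] by eventually_elim (simp add: plane_matrix_vector)
    qed (use sq(2)[OF bounded_linear_nth[OF bounded_linear_snd]] sq(2)[OF bounded_linear_nth[OF bounded_linear_fst]] in measurable)
    also have "\<dots> = A $ k $ 1 * minf $ 1 + A $ k $ 2 * minf $ 2 + ?u $ k"
      using i1[of 1] i1[of 2] by (simp add: m1 N.prob_space)
    finally show ?thesis by (simp add: plane_matrix_vector algebra_simps)
  qed
  then have "(A + B) *v minf + d = 0" by (simp add: vec_eq_iff)
  with p have "(A + B) *v minf + d = (A + B) *v p + d" by (simp only:)
  then have "(A + B) *v (minf - p) = 0" unfolding matrix_vector_mult_diff_distrib by (simp only: add_right_cancel diff_self)
  then have "(norm (minf - p))\<^sup>2 \<le> 0" using diss'[of "minf - p"] l' by (simp add: mult_le_0_iff)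
  then show mp: "minf = p" by simp
  have "- trace S = (\<integral>z. snd z \<bullet> (2 *\<^sub>R (S *v fst z)) \<partial>\<nu>)" by (rule limit_energy_balance[OF S(1), symmetric])
  also have "\<dots> = (\<integral>z. fst z \<bullet> (Q i *v fst z) + (2 * (S *v ?u)$1 * fst z $ 1 + 2 * (S *v ?u)$2 * fst z $ 2) \<partial>\<nu>)"
  proof (rule integral_cong_AE)
    have m2: "(\<lambda>z. fst z) \<in> borel_measurable \<nu>" "(\<lambda>z. snd z) \<in> borel_measurable \<nu>"
      using \<nu>(2) by (simp_all add: measurable_cong_sets[OF \<nu>(2) refl] borel_prod[symmetric])
    show "(\<lambda>z. snd z \<bullet> (2 *\<^sub>R (S *v fst z))) \<in> borel_measurable \<nu>"
      by (intro borel_measurable_inner borel_measurable_scaleR borel_measurable_const borel_measurable_matrix_vector m2)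
    have m3: "(\<lambda>z. fst z $ k) \<in> borel_measurable \<nu>" for k by (rule sq(2)[OF bounded_linear_nth[OF bounded_linear_fst]])
    show "(\<lambda>z. fst z \<bullet> (Q i *v fst z) + (2 * (S *v ?u)$1 * fst z $ 1 + 2 * (S *v ?u)$2 * fst z $ 2)) \<in> borel_measurable \<nu>"
      by (intro borel_measurable_inner borel_measurable_add borel_measurable_times borel_measurable_const borel_measurable_matrix_vector m2 m3)
    have S21: "S $ 2 $ 1 = S $ 1 $ 2" using S(1) by (metis matrix_plane(2))
    show "AE z in \<nu>. snd z \<bullet> (2 *\<^sub>R (S *v fst z)) = fst z \<bullet> (Q i *v fst z) + (2 * (S *v ?u)$1 * fst z $ 1 + 2 * (S *v ?u)$2 * fst z $ 2)"
      using ae2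
    proof eventually_elim
      case (elim z)
      have "snd z \<bullet> (2 *\<^sub>R (S *v fst z)) = fst z \<bullet> (Q i *v fst z) + ?u \<bullet> (2 *\<^sub>R (S *v fst z))"
        unfolding elim inner_add_left[of "A *v fst z" ?u] S(2) ..
      also have "?u \<bullet> (2 *\<^sub>R (S *v fst z)) = 2 * (S *v ?u)$1 * fst z $ 1 + 2 * (S *v ?u)$2 * fst z $ 2"
        unfolding inner_plane[of ?u] vector_scaleR_component plane_matrix_vector[of S] S21 by (simp add: algebra_simps)
      finally show ?case .
    qed
  qed
  also have "\<dots> = (\<integral>z. fst z \<bullet> (Q i *v fst z) \<partial>\<nu>) + (2 * (S *v ?u)$1 * minf $ 1 + 2 * (S *v ?u)$2 * minf $ 2)"
  proof -
    have b: "bounded_linear (\<lambda>z :: (real^2) \<times> (real^2). fst z $ k)" "bounded_linear (\<lambda>z :: (real^2) \<times> (real^2). (Q i *v fst z) $ k)" for k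
      by (rule bounded_linear_nth[OF linear_pair(1)] bounded_linear_nth[OF linear_pair(3)])+
    have "integrable \<nu> (\<lambda>z. fst z $ k * (Q i *v fst z) $ k)" for k
      by (rule integral_Cauchy_Schwarz(1)[OF sq(2)[OF b(1)[of k]] sq(2)[OF b(2)[of k]] sq(1)[OF b(1)[of k]] sq(1)[OF b(2)[of k]]])
    then have "integrable \<nu> (\<lambda>z. fst z \<bullet> (Q i *v fst z))" unfolding inner_plane
      by (intro Bochner_Integration.integrable_add)
    then show ?thesis using i1[of 1] i1[of 2] by (simp add: m1)
  qed
  also have "2 * (S *v ?u)$1 * minf $ 1 + 2 * (S *v ?u)$2 * minf $ 2 = ?u \<bullet> (2 *\<^sub>R (S *v minf))"
  proof -
    have S21: "S $ 2 $ 1 = S $ 1 $ 2" using S(1) by (metis matrix_plane(2))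
    show ?thesis unfolding inner_plane[of ?u] vector_scaleR_component plane_matrix_vector[of S] S21 by (simp add: algebra_simps)
  qed
  finally have "(\<integral>z. fst z \<bullet> (Q i *v fst z) \<partial>\<nu>) = - trace S - (B *v p + d) \<bullet> (2 *\<^sub>R (S *v p))" unfolding mp by simp
  then show "((\<lambda>t. v (law M (X t))) \<longlongrightarrow> vinf) at_top"
    using value_limit unfolding minf_def[symmetric] mp stationary_lq_value_def S_def by simp
qed

end

section \<open>Limits of the costs\<close>

context deviation
begin

lemma deviation_limit:
  obtains \<nu> where "W2_converges (\<lambda>t. law M (\<lambda>\<omega>. (X t \<omega>, \<alpha> t \<omega>))) \<nu>"
proof -
  obtain \<nu> where \<nu>: "W2_converges (\<lambda>t. law M (\<lambda>\<omega>. (state M F W X0 b t \<omega>, control_process M F W X0 b t \<omega>))) \<nu>"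
    using b by (auto simp: admissible_def)
  show ?thesis
    by (rule that, rule W2_converges_cong[OF _ \<nu>]) (simp add: X_state \<alpha>_def[abs_def] control_process_def[abs_def])
qed

lemma costs_of_infinite_deviation:
  assumes T0: "0 \<le> T0" "expected_cost M F W X0 r \<eta> i b T0 = \<infinity>" and chat: "chat i = ereal c"
  shows "(average_cost M F W X0 r \<eta> i b \<longlongrightarrow> \<infinity>) at_top"
    and "(compensated_cost M F W X0 r \<eta> chat i b \<longlongrightarrow> \<infinity>) at_top"
proof -
  have inf: "expected_cost M F W X0 r \<eta> i b T = \<infinity>" if "T0 \<le> T" for T
    using expected_cost_mono[OF that] T0(2) by simp
  have "\<forall>\<^sub>F T in at_top. \<infinity> = average_cost M F W X0 r \<eta> i b T"
    using eventually_gt_at_top[of T0]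
  proof eventually_elim
    case (elim T)
    then show ?case using T0(1) by (simp add: average_cost_def inf)
  qed
  then show "(average_cost M F W X0 r \<eta> i b \<longlongrightarrow> \<infinity>) at_top" by (rule Lim_transform_eventually[OF tendsto_const])
  have "\<forall>\<^sub>F T in at_top. \<infinity> = compensated_cost M F W X0 r \<eta> chat i b T"
    using eventually_gt_at_top[of T0]
  proof eventually_elim
    case (elim T)
    then show ?case by (simp add: compensated_cost_def inf chat)
  qed
  then show "(compensated_cost M F W X0 r \<eta> chat i b \<longlongrightarrow> \<infinity>) at_top" by (rule Lim_transform_eventually[OF tendsto_const])
qed

end

context convergent_deviation
begin

lemma value_bounded_average: "((\<lambda>T. (v (law M X0) - v (law M (X T))) / T) \<longlongrightarrow> 0) at_top"
  by (rule tendsto_divide_0[OF tendsto_diff[OF tendsto_const value_limit]]) (rule filterlim_at_top_imp_at_infinity[OF filterlim_ident])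

lemma gap_limit_nonneg: "0 \<le> gap_limit i"
  by (simp add: gap_limit_def)

text \<open>
  The value converges and is thus negligible on the scale of \<open>T\<close>.
\<close>

lemma average_cost_limit: "(average_cost M F W X0 r \<eta> i b \<longlongrightarrow> ereal (c + r i * gap_limit i)) at_top"
proof (rule Lim_transform_eventually)
  show "((\<lambda>T. ereal ((v (law M X0) - v (law M (X T))) / T + c + r i * ((LINT t:{0..T}|lborel. \<Delta> t) / T)))
      \<longlongrightarrow> ereal (c + r i * gap_limit i)) at_top"
  proof -
    have "((\<lambda>T. (v (law M X0) - v (law M (X T))) / T + c + r i * ((LINT t:{0..T}|lborel. \<Delta> t) / T)) \<longlongrightarrow> 0 + c + r i * gap_limit i) at_top"
      by (intro tendsto_add tendsto_mult tendsto_const value_bounded_average cesaro_integral \<Delta>_integrable \<Delta>_limit)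
    then show ?thesis by simp
  qed
  show "\<forall>\<^sub>F T in at_top. ereal ((v (law M X0) - v (law M (X T))) / T + c + r i * ((LINT t:{0..T}|lborel. \<Delta> t) / T)) = average_cost M F W X0 r \<eta> i b T"
    using eventually_gt_at_top[of 0]
  proof eventually_elim
    case (elim T)
    then show ?case unfolding average_cost_def cost_identity[OF less_imp_le[OF elim]] by (simp add: field_simps)
  qed
qed

lemma compensated_cost_eq:
  assumes "chat i = ereal c" "0 \<le> T"
  shows "compensated_cost M F W X0 r \<eta> chat i b T = ereal (v (law M X0) - v (law M (X T)) + r i * (LINT t:{0..T}|lborel. \<Delta> t))"
  unfolding compensated_cost_def cost_identity[OF assms(2)] assms(1) by simp

lemma gap_integral_mono: "mono (\<lambda>T. LINT t:{0..T}|lborel. \<Delta> t)"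
proof (rule monoI)
  fix S T :: real
  assume "S \<le> T"
  then show "(LINT t:{0..S}|lborel. \<Delta> t) \<le> (LINT t:{0..T}|lborel. \<Delta> t)"
    unfolding set_lebesgue_integral_def
    by (intro integral_mono \<Delta>_integrable[unfolded set_integrable_def]) (auto simp: indicator_def \<Delta>_nonneg)
qed

text \<open>
  If the accumulated gap is unbounded, the cost is infinite. Otherwise the gap, which converges, has limit
  \<open>0\<close>, and the value has the same limit as at the equilibrium.
\<close>

lemma compensated_cost_limit:
  assumes chat: "chat i = ereal c"
  obtains L where "(compensated_cost M F W X0 r \<eta> chat i b \<longlongrightarrow> L) at_top"
    "ereal (v (law M X0) - vinf) \<le> L"
proof -
  define I where "I T = (LINT t:{0..T}|lborel. \<Delta> t)" for T
  have eq: "\<forall>\<^sub>F T in at_top. ereal (v (law M X0) - v (law M (X T)) + r i * I T) = compensated_cost M F W X0 r \<eta> chat i b T"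
    using eventually_ge_at_top[of 0] by eventually_elim (simp add: compensated_cost_eq[where chat = chat, OF chat] I_def)
  have mono: "mono I" using gap_integral_mono by (simp add: I_def[abs_def])
  show ?thesis
  proof (cases "\<exists>C. \<forall>T. I T \<le> C")
    case True
    then obtain C where C: "I T \<le> C" for T by blast
    then have bdd: "bdd_above (range I)" by (intro bdd_aboveI) blast
    define L where "L = (SUP T. I T)"
    have I0: "0 \<le> I T" for T unfolding I_def set_lebesgue_integral_def by (rule Bochner_Integration.integral_nonneg) (simp add: \<Delta>_nonneg)
    have L: "(I \<longlongrightarrow> L) at_top"
    proof (rule increasing_tendsto)
      show "\<forall>\<^sub>F T in at_top. I T \<le> L" unfolding L_def using bdd by (intro always_eventually allI cSUP_upper) auto
      fix x assume "x < L"
      then obtain S where "x < I S" unfolding L_def using less_cSUP_iff[OF _ bdd] by auto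
      show "\<forall>\<^sub>F T in at_top. x < I T" using eventually_ge_at_top[of S]
      proof eventually_elim
        case (elim T)
        then show ?case using \<open>x < I S\<close> monoD[OF mono elim] by simp
      qed
    qed
    have L0: "0 \<le> L" by (rule tendsto_lowerbound[OF L]) (simp_all add: I0)
    have "((\<lambda>T. I T / T) \<longlongrightarrow> 0) at_top"
      by (rule tendsto_divide_0[OF L]) (rule filterlim_at_top_imp_at_infinity[OF filterlim_ident])
    moreover have "((\<lambda>T. I T / T) \<longlongrightarrow> gap_limit i) at_top"
      unfolding I_def by (rule cesaro_integral[OF \<Delta>_integrable \<Delta>_limit])
    ultimately have "gap_limit i = 0" using tendsto_unique[OF trivial_limit_at_top_linorder] by blast
    note vl = optimal_limit(2)[OF this]
    have "((\<lambda>T. ereal (v (law M X0) - v (law M (X T)) + r i * I T)) \<longlongrightarrow> ereal (v (law M X0) - vinf + r i * L)) at_top"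
      by (intro tendsto_ereal tendsto_add tendsto_diff tendsto_mult tendsto_const vl L)
    from Lim_transform_eventually[OF this eq] show ?thesis
      by (rule that) (use L0 players in simp)
  next
    case False
    have I: "filterlim I at_top at_top" unfolding filterlim_at_top
    proof
      fix Z
      obtain S where S: "Z < I S" using False not_le by blast
      show "\<forall>\<^sub>F T in at_top. Z \<le> I T" using eventually_ge_at_top[of S]
      proof eventually_elim
        case (elim T)
        then show ?case using S monoD[OF mono elim] by simp
      qed
    qed
    have "filterlim (\<lambda>T. r i * I T) at_top at_top"
      by (rule filterlim_tendsto_pos_mult_at_top[OF tendsto_const _ I]) (use players in simp)
    from filterlim_tendsto_add_at_top[OF tendsto_diff[OF tendsto_const value_limit] this]
    have "filterlim (\<lambda>T. v (law M X0) - v (law M (X T)) + r i * I T) at_top at_top" .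
    then have "((\<lambda>T. ereal (v (law M X0) - v (law M (X T)) + r i * I T)) \<longlongrightarrow> \<infinity>) at_top"
      unfolding tendsto_PInfty_eq_at_top by simp
    from Lim_transform_eventually[OF this eq] show ?thesis by (rule that) (rule ereal_less_eq(1))
  qed
qed

lemma equilibrium_costs:
  assumes "\<And>t. \<Delta> t = 0"
  shows "(average_cost M F W X0 r \<eta> i b \<longlongrightarrow> ereal c) at_top"
    and "chat i = ereal c \<Longrightarrow> (compensated_cost M F W X0 r \<eta> chat i b \<longlongrightarrow> ereal (v (law M X0) - vinf)) at_top"
    and "gap_limit i = 0"
proof -
  have "\<Delta> = (\<lambda>_. 0)" using assms by blast
  with \<Delta>_limit have "((\<lambda>_::real. 0) \<longlongrightarrow> gap_limit i) at_top" by simp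
  from tendsto_unique[OF trivial_limit_at_top_linorder this tendsto_const] show g: "gap_limit i = 0" .
  show "(average_cost M F W X0 r \<eta> i b \<longlongrightarrow> ereal c) at_top" using average_cost_limit g by simp
  assume chat: "chat i = ereal c"
  show "(compensated_cost M F W X0 r \<eta> chat i b \<longlongrightarrow> ereal (v (law M X0) - vinf)) at_top"
  proof (rule Lim_transform_eventually)
    show "((\<lambda>T. ereal (v (law M X0) - v (law M (X T)))) \<longlongrightarrow> ereal (v (law M X0) - vinf)) at_top"
      by (intro tendsto_ereal tendsto_diff tendsto_const optimal_limit(2)[OF g])
    show "\<forall>\<^sub>F T in at_top. ereal (v (law M X0) - v (law M (X T))) = compensated_cost M F W X0 r \<eta> chat i b T"
      using eventually_ge_at_top[of 0] by eventually_elim (simp add: compensated_cost_eq[where chat = chat, OF chat] assms)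
  qed
qed

end

lemma (in deviation) deviation_costs:
  obtains L where "(average_cost M F W X0 r \<eta> i b \<longlongrightarrow> L) at_top" "ereal c \<le> L"
proof (cases "\<exists>T\<ge>0. expected_cost M F W X0 r \<eta> i b T = \<infinity>")
  case True
  then obtain T0 where "0 \<le> T0" "expected_cost M F W X0 r \<eta> i b T0 = \<infinity>" by blast
  note limit = costs_of_infinite_deviation(1)[where chat = "\<lambda>_. ereal c", OF this refl]
  show ?thesis by (rule that[OF limit]) (rule ereal_less_eq(1))
next
  case False
  obtain \<nu> where \<nu>: "W2_converges (\<lambda>t. law M (\<lambda>\<omega>. (X t \<omega>, \<alpha> t \<omega>))) \<nu>" by (rule deviation_limit)
  interpret convergent_deviation M F W X0 A B d p l l' r \<eta> Q R q i j c b \<nu>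
    by unfold_locales (use False \<nu> in \<open>simp_all add: less_top\<close>)
  show ?thesis
    by (rule that[OF average_cost_limit]) (use players gap_limit_nonneg in simp)
qed

lemma (in deviation) deviation_compensated_costs:
  assumes chat: "chat i = ereal c"
  obtains L where "(compensated_cost M F W X0 r \<eta> chat i b \<longlongrightarrow> L) at_top"
    "ereal (v (law M X0) - stationary_lq_value A B d p Q R q i) \<le> L"
proof (cases "\<exists>T\<ge>0. expected_cost M F W X0 r \<eta> i b T = \<infinity>")
  case True
  then obtain T0 where "0 \<le> T0" "expected_cost M F W X0 r \<eta> i b T0 = \<infinity>" by blast
  note limit = costs_of_infinite_deviation(2)[where chat = chat, OF this chat]
  show ?thesis by (rule that[OF limit]) (rule ereal_less_eq(1))
next
  case False
  obtain \<nu> where \<nu>: "W2_converges (\<lambda>t. law M (\<lambda>\<omega>. (X t \<omega>, \<alpha> t \<omega>))) \<nu>" by (rule deviation_limit)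
  interpret convergent_deviation M F W X0 A B d p l l' r \<eta> Q R q i j c b \<nu>
    by unfold_locales (use False \<nu> in \<open>simp_all add: less_top\<close>)
  show ?thesis
    by (rule compensated_cost_limit[where chat = chat, OF chat]) (rule that)
qed

section \<open>The affine feedback is admissible\<close>

context brownian
begin

context
  fixes A B :: "real^2^2" and p d :: "real^2" and l l' :: real and X0 :: "'a \<Rightarrow> real^2"
  assumes l: "0 < l" and diss: "\<And>x. x \<bullet> (A *v x) \<le> - l * (norm x)\<^sup>2"
    and l': "0 < l'" and diss': "\<And>x. x \<bullet> ((A + B) *v x) \<le> - l' * (norm x)\<^sup>2"
    and p: "(A + B) *v p + d = 0"
    and X0: "X0 \<in> borel_measurable (F 0)" "integrable M (\<lambda>\<omega>. (norm (X0 \<omega>))\<^sup>2)"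
begin

lemma affine_feedback_markov: "markov_control M F W X0 (affine_feedback A B d)"
  unfolding markov_control_def
proof (intro conjI allI impI)
  show "\<exists>X. sq_int_solution M F W X0 (affine_feedback A B d) X" using mkv_solution[OF X0 p] by blast
qed (rule affine_feedback_measurable mkv_unique; assumption)+

lemma affine_feedback_state: "AE \<omega> in M. \<forall>t\<ge>0. state M F W X0 (affine_feedback A B d) t \<omega> = mkv A B p X0 t \<omega>"
proof -
  have "sq_int_solution M F W X0 (affine_feedback A B d) (state M F W X0 (affine_feedback A B d))"
    unfolding state_def by (rule someI[of "sq_int_solution M F W X0 (affine_feedback A B d)", OF mkv_solution[OF X0 p]])
  from mkv_unique[OF this mkv_solution[OF X0 p]] show ?thesis .
qed

text \<open>
  The state is chosen among indistinguishable solutions, so it may be replaced by the explicit one.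
\<close>

lemma affine_feedback_converges:
  "W2_converges (\<lambda>t. law M (\<lambda>\<omega>. (state M F W X0 (affine_feedback A B d) t \<omega>, control_process M F W X0 (affine_feedback A B d) t \<omega>)))
     (law (stationary_law A p) (\<lambda>x. (x, affine_feedback A B d (stationary_law A p) x)))"
proof (rule W2_converges_cong[OF _ mkv_W2_converges[OF l diss l' diss' p X0]])
  fix t :: real
  assume t: "0 \<le> t"
  let ?a = "affine_feedback A B d"
  have "sq_int_solution M F W X0 ?a (state M F W X0 ?a)"
    unfolding state_def by (rule someI[of "sq_int_solution M F W X0 (affine_feedback A B d)", OF mkv_solution[OF X0 p]])
  then have "state M F W X0 ?a t \<in> borel_measurable (F t)" using t by (simp add: sq_int_solution_def)
  then have Xm: "state M F W X0 ?a t \<in> borel_measurable M" by (rule measurable_F)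
  have Ym: "mkv A B p X0 t \<in> borel_measurable M" by (rule measurable_F[OF mkv_adapted[OF X0(1) t]])
  have ae: "AE \<omega> in M. state M F W X0 ?a t \<omega> = mkv A B p X0 t \<omega>" using affine_feedback_state by eventually_elim (use t in blast)
  have law: "law M (state M F W X0 ?a t) = law M (mkv A B p X0 t)" by (rule distr_cong_AE[OF refl refl ae Xm Ym])
  have fm: "(\<lambda>\<omega>. (Z \<omega>, ?a \<mu> (Z \<omega>))) \<in> borel_measurable M" if "Z \<in> borel_measurable M" for Z \<mu>
    unfolding affine_feedback_def
    by (intro borel_measurable_Pair borel_measurable_add borel_measurable_const borel_measurable_matrix_vector that)
  show "law M (\<lambda>\<omega>. (mkv A B p X0 t \<omega>, ?a (law M (mkv A B p X0 t)) (mkv A B p X0 t \<omega>)))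
      = law M (\<lambda>\<omega>. (state M F W X0 ?a t \<omega>, control_process M F W X0 ?a t \<omega>))"
    unfolding control_process_def law
  proof (rule distr_cong_AE[OF refl refl _ fm[OF Ym] fm[OF Xm]])
    show "AE \<omega> in M. (mkv A B p X0 t \<omega>, ?a (law M (mkv A B p X0 t)) (mkv A B p X0 t \<omega>))
        = (state M F W X0 ?a t \<omega>, ?a (law M (mkv A B p X0 t)) (state M F W X0 ?a t \<omega>))"
      using ae by eventually_elim simp
  qed
qed

lemma affine_feedback_admissible: "affine_feedback A B d \<in> admissible M F W X0"
  unfolding admissible_def using affine_feedback_markov affine_feedback_converges by blast

end

end

section \<open>The equilibrium\<close>

text \<open>
  The candidate as a deviation from itself.
\<close>

locale equilibrium = deviation +
  assumes b_star: "b = lq_feedback r Q R q"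
begin

lemma b_affine: "b = affine_feedback A B d" using b_star star by simp

lemma optimal_control: "\<alpha> = s"
proof (intro ext)
  show "\<alpha> t \<omega> = s t \<omega>" for t \<omega>
    unfolding \<alpha>_def s_def by (rule arg_cong[of _ _ "\<lambda>f. f (law M (X t)) (X t \<omega>)", OF b_affine])
qed

lemma X_mkv: "AE \<omega> in M. \<forall>t\<ge>0. X t \<omega> = mkv A B p X0 t \<omega>"
  using affine_feedback_state[OF l diss l' diss' p X0F X02, folded b_affine] by eventually_elim (simp add: X_state)

lemma X_square_joint':
  assumes T: "0 \<le> T"
  shows "integrable (time T \<Otimes>\<^sub>M M) (\<lambda>z. (norm (X (fst z) (snd z)))\<^sup>2)"
proof (rule integrable_time_pairI[where f = "\<lambda>t \<omega>. (norm (X t \<omega>))\<^sup>2"])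
  show "(\<lambda>z. (norm (X (fst z) (snd z)))\<^sup>2) \<in> borel_measurable (borel \<Otimes>\<^sub>M M)" using X_joint by measurable
  have "set_integrable lborel {0..T} (\<lambda>t. \<integral>\<omega>. (norm (mkv A B p X0 (max 0 t) \<omega>))\<^sup>2 \<partial>M)"
    using expectation_set_integral(2)[where f = "\<lambda>t \<omega>. (norm (mkv A B p X0 (max 0 t) \<omega>))\<^sup>2", OF mkv_square_joint[OF X0F X02 T]] .
  moreover have "(\<integral>\<omega>. (norm (X t \<omega>))\<^sup>2 \<partial>M) = (\<integral>\<omega>. (norm (mkv A B p X0 (max 0 t) \<omega>))\<^sup>2 \<partial>M)" if t: "0 \<le> t" for t
  proof (rule integral_cong_AE)
    have "mkv A B p X0 t \<in> borel_measurable M" by (rule measurable_F[OF mkv_adapted[OF X0F t]])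
    then show "(\<lambda>\<omega>. (norm (mkv A B p X0 (max 0 t) \<omega>))\<^sup>2) \<in> borel_measurable M" using t by (simp add: max_def)
    show "(\<lambda>\<omega>. (norm (X t \<omega>))\<^sup>2) \<in> borel_measurable M" using X_meas[of t] by measurable
    show "AE \<omega> in M. (norm (X t \<omega>))\<^sup>2 = (norm (mkv A B p X0 (max 0 t) \<omega>))\<^sup>2"
      using X_mkv by eventually_elim (use t in \<open>simp add: max_def\<close>)
  qed
  ultimately show "set_integrable lborel {0..T} (\<lambda>t. \<integral>\<omega>. (norm (X t \<omega>))\<^sup>2 \<partial>M)"
    by (subst set_integrable_cong[OF refl refl]) auto
qed (simp_all add: X_square)

sublocale finite_deviation
proof
  fix T :: real
  assume T: "0 \<le> T"
  note X2 = X_square_joint'[OF T]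
  have m2: "integrable (time T \<Otimes>\<^sub>M M) (\<lambda>z. (\<eta> i \<bullet> m (fst z))\<^sup>2)"
  proof (rule Bochner_Integration.integrable_bound[OF integrable_mult_right[OF m_square_joint[OF T X2], of "(norm (\<eta> i))\<^sup>2"]])
    show "(\<lambda>z. (\<eta> i \<bullet> m (fst z))\<^sup>2) \<in> borel_measurable (time T \<Otimes>\<^sub>M M)"
      by (intro borel_measurable_power borel_measurable_inner borel_measurable_const measurable_time[where f = "\<lambda>z. m (fst z)"]
          measurable_compose[OF measurable_fst m_measurable])
    have "(\<eta> i \<bullet> m t)\<^sup>2 \<le> (norm (\<eta> i))\<^sup>2 * (norm (m t))\<^sup>2" for t
      using power_mono[OF Cauchy_Schwarz_ineq2[of "\<eta> i" "m t"] abs_ge_zero, of 2] by (simp add: power_mult_distrib)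
    then show "AE z in time T \<Otimes>\<^sub>M M. norm ((\<eta> i \<bullet> m (fst z))\<^sup>2) \<le> norm ((norm (\<eta> i))\<^sup>2 * (norm (m (fst z)))\<^sup>2)"
      by (intro AE_I2) simp
  qed
  have "integrable (time T \<Otimes>\<^sub>M M) (\<lambda>z. running (fst z) (snd z))" unfolding running_def optimal_control
    by (rule Bochner_Integration.integrable_add[OF Bochner_Integration.integrable_add[OF X2
        integrable_mult_right[OF integrable_square_component[OF measurable_time[OF s_joint] s_square_joint[OF T X2]]]] m2])
  from nn_integral_eq_integral[OF this] running_nonneg
  have "(\<integral>\<^sup>+z. ennreal (running (fst z) (snd z)) \<partial>(time T \<Otimes>\<^sub>M M)) = ennreal (\<integral>z. running (fst z) (snd z) \<partial>(time T \<Otimes>\<^sub>M M))"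
    by simp
  moreover have "0 \<le> (\<integral>z. running (fst z) (snd z) \<partial>(time T \<Otimes>\<^sub>M M))"
    by (rule Bochner_Integration.integral_nonneg) (rule running_nonneg)
  ultimately show "expected_cost M F W X0 r \<eta> i b T < \<infinity>"
    unfolding expected_cost_eq[OF T] by (simp add: enn2ereal_ennreal)
qed

lemma \<Delta>_zero: "\<Delta> t = 0" by (simp add: \<Delta>_def optimal_control)

sublocale convergent_deviation M F W X0 A B d p l l' r \<eta> Q R q i j c b
    "law (stationary_law A p) (\<lambda>x. (x, affine_feedback A B d (stationary_law A p) x))"
proof
  show "W2_converges (\<lambda>t. law M (\<lambda>\<omega>. (X t \<omega>, \<alpha> t \<omega>))) (law (stationary_law A p) (\<lambda>x. (x, affine_feedback A B d (stationary_law A p) x)))"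
    by (rule W2_converges_cong[OF _ affine_feedback_converges[OF l diss l' diss' p X0F X02]])
      (simp add: b_affine[symmetric] X_state \<alpha>_def[abs_def] control_process_def[abs_def])
qed

text \<open>
  The value along the equilibrium converges both to its integral for the invariant law and to the constant
  computed from the limiting balances.
\<close>

lemma stationary_value: "v (stationary_law A p) = vinf"
proof -
  let ?\<sigma> = "stationary_law A p"
  note \<sigma> = P2_D[OF stationary_law_P2[OF l diss l' diss' p]]
  have id: "(\<lambda>x. x) \<in> borel_measurable ?\<sigma>" by (rule \<sigma>(4))
  have f: "(\<lambda>x. (x, affine_feedback A B d ?\<sigma> x)) \<in> borel_measurable ?\<sigma>" unfolding affine_feedback_def
    by (intro borel_measurable_Pair borel_measurable_add borel_measurable_const borel_measurable_matrix_vector id)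
  have m1: "minf = p" by (rule optimal_limit(1)[OF equilibrium_costs(3)[OF \<Delta>_zero]])
  have fst: "(\<lambda>z. fst z) \<in> borel_measurable (borel :: ((real^2) \<times> (real^2)) measure)"
    unfolding borel_prod[symmetric] by (rule measurable_fst)
  have "(\<lambda>z. fst z \<bullet> (Q i *v fst z)) \<in> borel_measurable (borel :: ((real^2) \<times> (real^2)) measure)"
    by (intro borel_measurable_inner borel_measurable_matrix_vector fst)
  from integral_distr[OF f this]
  have "((\<lambda>t. v (law M (X t))) \<longlongrightarrow> v ?\<sigma>) at_top"
    using value_limit unfolding minf_def[symmetric] m1 by (simp add: v_def lq_value_def stationary_law_mean[OF l diss l' diss' p])
  from tendsto_unique[OF trivial_limit_at_top_linorder this optimal_limit(2)[OF equilibrium_costs(3)[OF \<Delta>_zero]]]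
  show ?thesis .
qed

end

section \<open>The linear-quadratic game\<close>

theorem proposition3:
  fixes M :: "'a measure" and F :: "real \<Rightarrow> 'a measure"
    and W :: "real \<Rightarrow> 'a \<Rightarrow> real^2" and X0 :: "'a \<Rightarrow> real^2" and \<mu>0 :: "(real^2) measure"
    and r :: "2 \<Rightarrow> real" and \<eta> :: "2 \<Rightarrow> real^2"
    and Q R :: "2 \<Rightarrow> real^2^2" and q :: "2 \<Rightarrow> real^2" and c :: "2 \<Rightarrow> real"
  assumes "filtered_prob_space M F" and "usual_conditions M F"
    and "brownian_motion M F W"
    and "X0 \<in> borel_measurable (F 0)" and "law M X0 = \<mu>0" and "\<mu>0 \<in> P2"
    and "r 1 > 0" and "r 2 > 0"
    and "riccati_solution r \<eta> Q R q c"
    and "\<exists>\<epsilon>>0. min_eigenvalue (sym_part (stacked r Q)) - \<epsilon> / 2 > (op_norm (stacked r R))\<^sup>2 / \<epsilon>"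
  defines "astar \<equiv> lq_feedback r Q R q"
  defines "chat \<equiv> \<lambda>i. ergodic_cost M F W X0 r \<eta> i astar"
  shows "ergodic_nash_equilibrium M F W X0 r \<eta> astar
    \<and> (chat 1 = ereal (ergodic_const1 r Q q) \<and> chat 2 = ereal (ergodic_const2 r Q q))
    \<and> auxiliary_nash_equilibrium M F W X0 r \<eta> chat astar
    \<and> (\<exists>\<mu>inf. invariant_law M F W astar \<mu>inf
          \<and> (\<forall>\<nu>. invariant_law M F W astar \<nu> \<longrightarrow> \<nu> = \<mu>inf)
          \<and> (\<forall>i. auxiliary_cost M F W X0 r \<eta> chat i astar
                   = ereal (lq_value Q R q i \<mu>0 - lq_value Q R q i \<mu>inf)))"
proof -
  interpret brownian M F W using assms(1,3) by unfold_locales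
  have r0: "r k \<noteq> 0" for k using exhaust_2[of k] assms(7,8) by auto
  define A where "A = - stacked r Q"
  define B where "B = - stacked r R"
  define d where "d = lq_offset r q"
  have star: "lq_feedback r Q R q = affine_feedback A B d"
    unfolding A_def B_def d_def by (rule lq_feedback_affine[OF r0])
  obtain \<rho> l where \<rho>: "0 \<le> \<rho>" "\<rho> < l" and coercive: "\<And>x. l * (norm x)\<^sup>2 \<le> x \<bullet> (stacked r Q *v x)"
    and small: "\<And>x. norm (stacked r R *v x) \<le> \<rho> * norm x"
    proof -
    have "\<exists>\<rho> l. 0 \<le> \<rho> \<and> \<rho> < l \<and> (\<forall>x. l * (norm x)\<^sup>2 \<le> x \<bullet> (stacked r Q *v x))
        \<and> (\<forall>x. norm (stacked r R *v x) \<le> \<rho> * norm x)"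
      by (rule eigenvalue_gap_dissipative[OF assms(10)]) blast
    then show ?thesis using that by blast
  qed
  have minus: "(- N) *v x = - (N *v x)" for N :: "real^2^2" and x by (simp add: matrix_vector_mult_def vec_eq_iff sum_negf)
  have l: "0 < l" using \<rho> by simp
  have diss: "x \<bullet> (A *v x) \<le> - l * (norm x)\<^sup>2" for x
    using coercive[of x] unfolding A_def minus by simp
  \<comment> \<open>The mean evolves with \<open>A + B\<close>, so it loses \<open>\<rho>\<close> from the rate \<open>l\<close> of the fluctuations.\<close>
  define l' where "l' = l - \<rho>"
  have l': "0 < l'" using \<rho> by (simp add: l'_def)
  have diss': "x \<bullet> ((A + B) *v x) \<le> - l' * (norm x)\<^sup>2" for x
  proof -
    have "- (x \<bullet> (stacked r R *v x)) \<le> norm x * norm (stacked r R *v x)"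
      using Cauchy_Schwarz_ineq2[of x "stacked r R *v x"] by linarith
    also have "\<dots> \<le> norm x * (\<rho> * norm x)" by (rule mult_left_mono[OF small norm_ge_zero])
    finally show ?thesis using diss[of x]
      unfolding matrix_vector_mult_add_rdistrib B_def minus l'_def inner_add_right inner_minus_right
      by (simp add: algebra_simps power2_eq_square)
  qed
  have "inj ((*v) (A + B))"
  proof (subst linear_injective_0[OF matrix_vector_mul_linear], intro allI impI)
    fix x assume "(A + B) *v x = 0"
    then have "(norm x)\<^sup>2 \<le> 0" using diss'[of x] l' by (simp add: mult_le_0_iff)
    then show "x = 0" by simp
  qed
  then have "surj ((*v) (A + B))" using linear_injective_imp_surjective[OF matrix_vector_mul_linear] by blast
  then obtain p where "- d = (A + B) *v p" by (rule surjE)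
  then have p: "(A + B) *v p + d = 0" by (metis add.left_inverse)
  have X0m: "X0 \<in> borel_measurable M" by (rule measurable_F[OF assms(4)])
  have "(\<lambda>x :: real^2. (norm x)\<^sup>2) \<in> borel_measurable borel"
    by (intro borel_measurable_power borel_measurable_norm measurable_ident_sets[OF refl])
  from integrable_distr_eq[OF X0m this] have X02: "integrable M (\<lambda>\<omega>. (norm (X0 \<omega>))\<^sup>2)"
    using assms(5,6) by (simp add: P2_def)
  have adm: "astar \<in> admissible M F W X0"
    unfolding astar_def star by (rule affine_feedback_admissible[OF l diss l' diss' p assms(4) X02])
  have self: "astar = lq_feedback r Q R q" by (simp add: astar_def)
  then have agree: "astar \<mu> x $ k = lq_feedback r Q R q \<mu> x $ k" if "\<mu> \<in> P2" for \<mu> x k by simp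
  have sym: "transpose (Q k) = Q k" "transpose (R k) = R k" for k
    using assms(9) by (simp_all add: riccati_solution_def)
  define const where "const i = (if i = 1 then ergodic_const1 r Q q else ergodic_const2 r Q q)" for i :: 2
  have opponent: "\<exists>j. (\<forall>k. k \<noteq> i \<longleftrightarrow> k = j) \<and> player_riccati r \<eta> Q R q i j (const i)" for i
  proof -
    consider "i = 1" | "i = 2" using exhaust_2[of i] by blast
    then show ?thesis
    proof cases
      case 1
      have "(\<forall>k. k \<noteq> i \<longleftrightarrow> k = 2) \<and> player_riccati r \<eta> Q R q i 2 (const i)"
        using riccati_player(1)[OF assms(9,7,8)] 1 by (auto simp: const_def forall_2 two_indices)
      then show ?thesis by blast
    next
      case 2
      have "(\<forall>k. k \<noteq> i \<longleftrightarrow> k = 1) \<and> player_riccati r \<eta> Q R q i 1 (const i)"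
        using riccati_player(2)[OF assms(9,7,8)] 2 by (auto simp: const_def forall_2 two_indices)
      then show ?thesis by blast
    qed
  qed
  let ?\<sigma> = "stationary_law A p"
  let ?value = "\<lambda>i. lq_value Q R q i \<mu>0 - lq_value Q R q i ?\<sigma>"
  have avg: "(average_cost M F W X0 r \<eta> i astar \<longlongrightarrow> ereal (const i)) at_top"
    and vinf: "stationary_lq_value A B d p Q R q i = lq_value Q R q i ?\<sigma>"
    and comp: "ch i = ereal (const i) \<Longrightarrow> (compensated_cost M F W X0 r \<eta> ch i astar \<longlongrightarrow> ereal (?value i)) at_top" for i ch
  proof -
    obtain j where j: "\<forall>k. k \<noteq> i \<longleftrightarrow> k = j" and ric: "player_riccati r \<eta> Q R q i j (const i)" using opponent by blast
    interpret E: equilibrium M F W X0 A B d p l l' r \<eta> Q R q i j "const i" astar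
      by unfold_locales (fact assms(4) X02 l diss l' diss' p star ric sym adm self agree)+
    show "(average_cost M F W X0 r \<eta> i astar \<longlongrightarrow> ereal (const i)) at_top"
      by (rule E.equilibrium_costs(1)[OF E.\<Delta>_zero])
    show vi: "stationary_lq_value A B d p Q R q i = lq_value Q R q i ?\<sigma>"
      using E.stationary_value unfolding E.v_def ..
    show "(compensated_cost M F W X0 r \<eta> ch i astar \<longlongrightarrow> ereal (?value i)) at_top" if "ch i = ereal (const i)"
      using E.equilibrium_costs(2)[OF E.\<Delta>_zero, of ch, OF that] unfolding E.v_def vi assms(5) .
  qed
  have chat: "chat i = ereal (const i)" for i
    unfolding chat_def ergodic_cost_def by (rule tendsto_Lim[OF trivial_limit_at_top_linorder avg])
  have aux: "auxiliary_cost M F W X0 r \<eta> chat i astar = ereal (?value i)" for i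
    unfolding auxiliary_cost_def by (rule tendsto_Lim[OF trivial_limit_at_top_linorder]) (rule comp, rule chat)
  have dev: "(\<exists>L. (average_cost M F W X0 r \<eta> i b \<longlongrightarrow> L) at_top) \<and> ereal (const i) \<le> ergodic_cost M F W X0 r \<eta> i b"
    "(\<exists>L. (compensated_cost M F W X0 r \<eta> chat i b \<longlongrightarrow> L) at_top) \<and> ereal (?value i) \<le> auxiliary_cost M F W X0 r \<eta> chat i b"
    if b: "b \<in> deviations M F W X0 i astar" for i b
  proof -
    obtain j where j: "\<forall>k. k \<noteq> i \<longleftrightarrow> k = j" and ric: "player_riccati r \<eta> Q R q i j (const i)" using opponent by blast
    have "b \<in> admissible M F W X0" and agree: "\<And>\<mu> x. \<mu> \<in> P2 \<Longrightarrow> b \<mu> x $ j = lq_feedback r Q R q \<mu> x $ j"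
      using b j by (auto simp: deviations_def astar_def)
    interpret D: deviation M F W X0 A B d p l l' r \<eta> Q R q i j "const i" b
      by unfold_locales (fact assms(4) X02 l diss l' diss' p star ric sym \<open>b \<in> admissible M F W X0\<close> agree)+
    obtain L where L: "(average_cost M F W X0 r \<eta> i b \<longlongrightarrow> L) at_top" "ereal (const i) \<le> L"
      by (rule D.deviation_costs)
    have "ergodic_cost M F W X0 r \<eta> i b = L" unfolding ergodic_cost_def by (rule tendsto_Lim[OF trivial_limit_at_top_linorder L(1)])
    then show "(\<exists>L. (average_cost M F W X0 r \<eta> i b \<longlongrightarrow> L) at_top) \<and> ereal (const i) \<le> ergodic_cost M F W X0 r \<eta> i b"
      using L by blast
    obtain K where K: "(compensated_cost M F W X0 r \<eta> chat i b \<longlongrightarrow> K) at_top" "ereal (D.v (law M X0) - lq_value Q R q i ?\<sigma>) \<le> K"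
      using D.deviation_compensated_costs[of chat, OF chat, unfolded vinf] by blast
    have "auxiliary_cost M F W X0 r \<eta> chat i b = K" unfolding auxiliary_cost_def by (rule tendsto_Lim[OF trivial_limit_at_top_linorder K(1)])
    then show "(\<exists>L. (compensated_cost M F W X0 r \<eta> chat i b \<longlongrightarrow> L) at_top) \<and> ereal (?value i) \<le> auxiliary_cost M F W X0 r \<eta> chat i b"
      using K unfolding D.v_def assms(5) by blast
  qed
  have "ergodic_nash_equilibrium M F W X0 r \<eta> astar"
    unfolding ergodic_nash_equilibrium_def using adm dev(1) chat by (simp add: chat_def)
  moreover have "auxiliary_nash_equilibrium M F W X0 r \<eta> chat astar"
    unfolding auxiliary_nash_equilibrium_def using adm dev(2) aux by simp
  moreover have "chat 1 = ereal (ergodic_const1 r Q q)" "chat 2 = ereal (ergodic_const2 r Q q)"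
    unfolding chat const_def by simp_all
  moreover have "invariant_law M F W astar ?\<sigma>"
    unfolding astar_def star by (rule stationary_law_invariant[OF l diss l' diss' p])
  moreover have "\<forall>\<nu>. invariant_law M F W astar \<nu> \<longrightarrow> \<nu> = ?\<sigma>"
    using invariant_law_unique[OF l diss l' diss' p] calculation(5) unfolding astar_def star by blast
  ultimately show ?thesis using aux by blast
qed

end
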